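(* Let $1<p<\infty$ and let $u$ be a uniformly continuous viscosity solution to $$(p-1)u^{p-2}\partial_t u-\Delta_p u=0\quad\text{in }B_4\times(-4,0).$$ Suppose that $0<m\le u\le M$ for some constants $m,M$. Then there is $C_H>0$ such that $$|u(x_0,t_0)-u(x_0,s_0)|\le C_H|t_0-s_0|^{1/2}\quad\text{for all }(x_0,t_0),(x_0,s_0)\in Q_1 .$$ The constant $C_H$ depends only on $N$, $p$, $m$, $M$ and the optimal modulus of continuity of $u$ in space in $B_4\times(-4,0)$.
   Context: Points are written $(x,t)$, $x\in\mathbb{R}^N$, $t\in\mathbb{R}$; $D$ is the gradient in $x$; $\Delta_p u=\operatorname{div}(|Du|^{p-2}Du)$; $B_r=B_r(0)\subset\mathbb{R}^N$ is the open ball; $Q_r:=B_r(0)\times(-r,0]$. The function $u$ is regarded as continuously extended to the top $t=0$ of the cylinder. The optimal modulus of continuity of $u$ in a set $\Xi\subset\mathbb{R}^{N+1}$ in the space variable is $\omega(s):=\sup\{|u(x,t)-u(y,t)|:(x,t),(y,t)\in\Xi,\ |x-y|\le s\}$. Viscosity solutions in an open set $\Xi$: a continuous $u:\Xi\to(0,\infty)$ is a viscosity supersolution to $(p-1)u^{p-2}\partial_t u-\Delta_p u=0$ if, whenever $\phi\in C^2(\Xi)$ touches $u$ from below at $(x,t)\in\Xi$ (i.e. $\phi(x,t)=u(x,t)$ and $\phi\le u$ near $(x,t)$) and $D\phi(y,s)\ne0$ for $y\neq x$ (for $(y,s)$ near $(x,t)$), we have $$\limsup_{(y,s)\to(x,t),\,y\ne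 x}\Big(\partial_t\big(|\phi(y,s)|^{p-2}\phi(y,s)\big)-\Delta_p\phi(y,s)\Big)\ge 0 .$$ It is a viscosity subsolution if, whenever $\varphi\in C^2(\Xi)$ touches $u$ from above at $(x,t)$ and $D\varphi(y,s)\neq0$ for $y\ne x$ (near $(x,t)$), then $$\liminf_{(y,s)\to(x,t),\,y\ne x}\Big(\partial_t\big(|\varphi(y,s)|^{p-2}\varphi(y,s)\big)-\Delta_p\varphi(y,s)\Big)\le 0 .$$ A viscosity solution is both. *)

theory Defs
  imports "HOL-Analysis.Analysis"
begin

text \<open>Points \<open>(x, t)\<close> of space-time have type \<open>(real ^ 'n) \<times> real\<close>, so the space dimension is
  \<open>N = CARD('n)\<close>.\<close>

definition C2_on :: "'b::real_normed_vector set \<Rightarrow> ('b \<Rightarrow> real) \<Rightarrow> bool" where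
  "C2_on S f \<longleftrightarrow> (\<exists>(f' :: 'b \<Rightarrow> 'b \<Rightarrow>\<^sub>L real) (f'' :: 'b \<Rightarrow> 'b \<Rightarrow>\<^sub>L 'b \<Rightarrow>\<^sub>L real).
     (\<forall>z\<in>S. (f has_derivative blinfun_apply (f' z)) (at z)) \<and>
     (\<forall>z\<in>S. (f' has_derivative blinfun_apply (f'' z)) (at z)) \<and>
     continuous_on S f'')"

definition gradient :: "(real ^ 'n \<Rightarrow> real) \<Rightarrow> real ^ 'n \<Rightarrow> real ^ 'n" where
  "gradient f x = (\<chi> i. frechet_derivative f (at x) (axis i 1))"

definition divergence :: "(real ^ 'n \<Rightarrow> real ^ 'n) \<Rightarrow> real ^ 'n \<Rightarrow> real" where
  "divergence F x = trace (jacobian F (at x))"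

text \<open>Below, \<open>p_laplacian\<close> is evaluated only where the gradient does not vanish; the convention
  \<open>0 powr a = 0\<close> is therefore harmless.\<close>

definition p_laplacian :: "real \<Rightarrow> (real ^ 'n \<Rightarrow> real) \<Rightarrow> real ^ 'n \<Rightarrow> real" where
  "p_laplacian p f = divergence (\<lambda>y. norm (gradient f y) powr (p - 2) *\<^sub>R gradient f y)"

definition space_gradient :: "((real ^ 'n) \<times> real \<Rightarrow> real) \<Rightarrow> (real ^ 'n) \<times> real \<Rightarrow> real ^ 'n" where
  "space_gradient \<phi> z = gradient (\<lambda>y. \<phi> (y, snd z)) (fst z)"

definition trudinger_op :: "real \<Rightarrow> ((real ^ 'n) \<times> real \<Rightarrow> real) \<Rightarrow> (real ^ 'n) \<times> real \<Rightarrow> real" where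
  "trudinger_op p \<phi> z =
     deriv (\<lambda>s. \<bar>\<phi> (fst z, s)\<bar> powr (p - 2) * \<phi> (fst z, s)) (snd z)
     - p_laplacian p (\<lambda>y. \<phi> (y, snd z)) (fst z)"

text \<open>The filter of the limits \<open>(y, s) \<rightarrow> (x, t)\<close> with \<open>y \<noteq> x\<close>; the time \<open>s\<close> may equal \<open>t\<close>.\<close>

definition at_off_axis :: "(real ^ 'n) \<times> real \<Rightarrow> ((real ^ 'n) \<times> real) filter" where
  "at_off_axis z = at z within {w. fst w \<noteq> fst z}"

definition touches_below ::
    "((real ^ 'n) \<times> real \<Rightarrow> real) \<Rightarrow> ((real ^ 'n) \<times> real \<Rightarrow> real) \<Rightarrow> (real ^ 'n) \<times> real \<Rightarrow> bool" where
  "touches_below \<phi> u z \<longleftrightarrow> \<phi> z = u z \<and> (\<forall>\<^sub>F w in nhds z. \<phi> w \<le> u w)"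

definition touches_above ::
    "((real ^ 'n) \<times> real \<Rightarrow> real) \<Rightarrow> ((real ^ 'n) \<times> real \<Rightarrow> real) \<Rightarrow> (real ^ 'n) \<times> real \<Rightarrow> bool" where
  "touches_above \<phi> u z \<longleftrightarrow> \<phi> z = u z \<and> (\<forall>\<^sub>F w in nhds z. u w \<le> \<phi> w)"

text \<open>Sub- and supersolutions of \<open>(p - 1) u^(p - 2) \<partial>\<^sub>t u - \<Delta>\<^sub>p u = 0\<close> in an open set \<open>\<Xi>\<close>. The limits
  superior and inferior may be infinite, hence are taken in the extended reals.\<close>

definition viscosity_supersolution ::
    "real \<Rightarrow> ((real ^ 'n) \<times> real) set \<Rightarrow> ((real ^ 'n) \<times> real \<Rightarrow> real) \<Rightarrow> bool" where
  "viscosity_supersolution p \<Xi> u \<longleftrightarrow>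
     continuous_on \<Xi> u \<and> (\<forall>z\<in>\<Xi>. 0 < u z) \<and>
     (\<forall>\<phi>. \<forall>z\<in>\<Xi>. C2_on \<Xi> \<phi> \<longrightarrow> touches_below \<phi> u z \<longrightarrow>
        (\<forall>\<^sub>F w in at_off_axis z. space_gradient \<phi> w \<noteq> 0) \<longrightarrow>
        Limsup (at_off_axis z) (\<lambda>w. ereal (trudinger_op p \<phi> w)) \<ge> 0)"

definition viscosity_subsolution ::
    "real \<Rightarrow> ((real ^ 'n) \<times> real) set \<Rightarrow> ((real ^ 'n) \<times> real \<Rightarrow> real) \<Rightarrow> bool" where
  "viscosity_subsolution p \<Xi> u \<longleftrightarrow>
     continuous_on \<Xi> u \<and> (\<forall>z\<in>\<Xi>. 0 < u z) \<and>
     (\<forall>\<phi>. \<forall>z\<in>\<Xi>. C2_on \<Xi> \<phi> \<longrightarrow> touches_above \<phi> u z \<longrightarrow>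
        (\<forall>\<^sub>F w in at_off_axis z. space_gradient \<phi> w \<noteq> 0) \<longrightarrow>
        Liminf (at_off_axis z) (\<lambda>w. ereal (trudinger_op p \<phi> w)) \<le> 0)"

definition viscosity_solution ::
    "real \<Rightarrow> ((real ^ 'n) \<times> real) set \<Rightarrow> ((real ^ 'n) \<times> real \<Rightarrow> real) \<Rightarrow> bool" where
  "viscosity_solution p \<Xi> u \<longleftrightarrow> viscosity_supersolution p \<Xi> u \<and> viscosity_subsolution p \<Xi> u"

text \<open>The supremum is meaningful for \<open>s \<ge> 0\<close>, nonempty \<open>\<Xi>\<close> and bounded \<open>u\<close>; for \<open>s < 0\<close> it is
  taken over the empty set.\<close>

definition optimal_space_modulus ::
    "((real ^ 'n) \<times> real) set \<Rightarrow> ((real ^ 'n) \<times> real \<Rightarrow> real) \<Rightarrow> real \<Rightarrow> real" where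
  "optimal_space_modulus \<Xi> u s =
     Sup {\<bar>u (x, t) - u (y, t)\<bar> | x y t. (x, t) \<in> \<Xi> \<and> (y, t) \<in> \<Xi> \<and> norm (x - y) \<le> s}"

definition Q_cyl :: "real \<Rightarrow> ((real ^ 'n) \<times> real) set" where
  "Q_cyl r = ball 0 r \<times> {-r<..0}"

end

theory Submission
  imports Defs
begin

text \<open>The logarithm \<open>v = ln u\<close> solves \<open>(p - 1) \<partial>\<^sub>t v = \<Delta>\<^sub>p v + (p - 1) |Dv|^p\<close>, an equation without
  dependence on \<open>v\<close> itself. By the Ishii--Lions method \<open>v\<close> is Lipschitz in space: one doubles the variables with
  the concave penalisation \<open>L (2 r - r powr (3/2))\<close>, \<open>r = |x - y|\<close>, localised by a weight. The theorem on sums is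
  avoided. Sup-convolution makes the functions semiconvex, so that the coefficients can be frozen at the
  gradient; the jets are then subsolutions of an equation with constant coefficients, hence stay below the heat
  flow of any function above them, and the heat flow of \<open>f x + g y\<close> is the sum of the two flows.

  A Lipschitz bound in space gives the exponent 1/2 in time. With \<open>\<eta> = sqrt (t - s)\<close>, the barrier
  \<open>(\<eta>^(2 k) + (L |x - x0|)^(2 k))^(1/(2 k)) + B (t - s)\<close> is a strict supersolution once \<open>B\<close> exceeds a multiple of
  \<open>1 / \<eta>\<close>; it is smooth, and flat of order \<open>2 k\<close> where its gradient vanishes. Evaluated at the centre it
  bounds the increment by a multiple of \<open>\<eta>\<close>, and \<open>- v\<close> is treated in the same way.\<close>

section \<open>Quadratic expansions\<close>

text \<open>Jets are therefore used with nonzero gradient only; in the doubling a large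
  \<open>L\<close> keeps both gradients comparable with \<open>L / \<zeta> ^ 4\<close>. Once frozen,
  the operator is a sum of \<open>Q (\<sigma> j)\<close> over the columns of a square root of the
  coefficient matrix. Doubling pairs the columns of two roots, and roots are not unique: opposite
  signs along the gradient make the difference of paired columns nearly parallel to the gradient,
  the one direction in which the penalisation is concave. In probability this is the coupling by
  reflection. The weight multiplies the modulus instead of being added to it. At a maximum
  \<open>L * r / \<zeta> ^ 4\<close> is then bounded by the oscillation, so the weight disturbs the
  gradient only by a small relative amount, even near the boundary. This controls the gradient term
  of degree \<open>p\<close>, although its degree exceeds that of the diffusion.\<close>

definition quadform :: "('a::euclidean_space \<Rightarrow> real) \<Rightarrow> bool" where
  "quadform Q \<longleftrightarrow> (\<exists>A. linear A \<and> Q = (\<lambda>h. h \<bullet> A h))"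

lemma linear_real_inner:
  fixes l :: "'a::euclidean_space \<Rightarrow> real"
  assumes "linear l"
  obtains a where "l = (\<lambda>h. a \<bullet> h)"
proof -
  have "l h = (adjoint l 1) \<bullet> h" for h
    using adjoint_works[OF assms, of h 1] by (simp add: inner_commute)
  then show ?thesis using that by blast
qed

lemma quadform_add: "quadform Q \<Longrightarrow> quadform R \<Longrightarrow> quadform (\<lambda>h. Q h + R h)"
proof -
  assume "quadform Q" "quadform R"
  then obtain A B where "linear A" "Q = (\<lambda>h. h \<bullet> A h)" "linear B" "R = (\<lambda>h. h \<bullet> B h)"
    unfolding quadform_def by blast
  then show ?thesis unfolding quadform_def
    by (intro exI[of _ "\<lambda>h. A h + B h"]) (simp add: inner_add_right linear_compose_add)
qed

lemma quadform_cmult: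
  assumes "quadform Q" shows "quadform (\<lambda>h. c * Q h)"
proof -
  obtain A where A: "linear A" "Q = (\<lambda>h. h \<bullet> A h)" using assms by (auto simp: quadform_def)
  show ?thesis unfolding quadform_def
    by (rule exI[of _ "\<lambda>h. c *\<^sub>R A h"]) (use A in \<open>auto intro: linear_compose_scale_right\<close>)
qed

lemma quadform_diff: "quadform Q \<Longrightarrow> quadform R \<Longrightarrow> quadform (\<lambda>h. Q h - R h)"
  using quadform_add[of Q "\<lambda>h. (-1) * R h"] quadform_cmult[of R "-1"] by simp

lemma quadform_mult:
  assumes "linear l" "linear m" shows "quadform (\<lambda>h. l h * m h :: real)"
proof -
  obtain a where a: "l = (\<lambda>h. a \<bullet> h)" using linear_real_inner[OF assms(1)] .
  have "linear (\<lambda>h. m h *\<^sub>R a)"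
    using assms(2) by (intro linearI) (auto simp: linear_add linear_scale scaleR_add_left)
  then show ?thesis unfolding quadform_def a
    by (intro exI[of _ "\<lambda>h. m h *\<^sub>R a"]) (auto simp: inner_commute)
qed

lemma quadform_linear_sq: "linear l \<Longrightarrow> quadform (\<lambda>h. (l h :: real)\<^sup>2)"
  using quadform_mult[of l l] by (simp add: power2_eq_square)

lemma quadform_comp:
  assumes "quadform Q" "linear T" shows "quadform (\<lambda>h. Q (T h))"
proof -
  obtain A where A: "linear A" "Q = (\<lambda>h. h \<bullet> A h)" using assms by (auto simp: quadform_def)
  have "linear (adjoint T \<circ> (A \<circ> T))"
    by (intro linear_compose assms A adjoint_linear)
  moreover have "Q (T h) = h \<bullet> (adjoint T \<circ> (A \<circ> T)) h" for h
    using adjoint_works[OF assms(2)] by (simp add: A)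
  ultimately show ?thesis unfolding quadform_def by blast
qed

lemma quadform_norm: "quadform (\<lambda>h::'a::euclidean_space. (norm h)\<^sup>2)"
  unfolding quadform_def by (intro exI[of _ "\<lambda>h. h"]) (auto simp: power2_norm_eq_inner linear_ident)

lemma quadform_zero: "quadform (\<lambda>h. 0)"
  using quadform_cmult[OF quadform_norm, of 0] by simp

lemma quadform_norm_comp:
  fixes T :: "'a::euclidean_space \<Rightarrow> 'b::euclidean_space"
  shows "linear T \<Longrightarrow> quadform (\<lambda>h. (norm (T h))\<^sup>2)"
  by (rule quadform_comp[OF quadform_norm])

lemmas quadform_intros = quadform_add quadform_cmult quadform_diff quadform_mult quadform_linear_sq
  quadform_norm quadform_zero quadform_norm_comp

lemma quadform_scaleR: "quadform Q \<Longrightarrow> Q (c *\<^sub>R h) = c\<^sup>2 * Q h"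
  unfolding quadform_def by (auto simp: linear_scale power2_eq_square)

lemma quadform_0: "quadform Q \<Longrightarrow> Q 0 = 0"
  using quadform_scaleR[of Q 0 0] by simp

lemma quadform_minus: "quadform Q \<Longrightarrow> Q (- h) = Q h"
  using quadform_scaleR[of Q "-1" h] by simp

lemma quadform_bound:
  assumes "quadform Q"
  obtains C where "C > 0" "\<And>h. \<bar>Q h\<bar> \<le> C * (norm h)\<^sup>2"
proof -
  obtain A where A: "linear A" "Q = (\<lambda>h. h \<bullet> A h)" using assms by (auto simp: quadform_def)
  obtain B where B: "B > 0" "\<And>h. norm (A h) \<le> B * norm h"
    using linear_bounded_pos[OF A(1)] by blast
  have "\<bar>Q h\<bar> \<le> B * (norm h)\<^sup>2" for h
  proof -
    have "\<bar>Q h\<bar> \<le> norm h * norm (A h)" unfolding A by (rule Cauchy_Schwarz_ineq2)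
    also have "\<dots> \<le> norm h * (B * norm h)" by (intro mult_left_mono B) auto
    finally show ?thesis by (simp add: power2_eq_square mult_ac)
  qed
  with B(1) that show ?thesis by blast
qed

lemma abs_triangle3: "\<bar>a + b + c\<bar> \<le> \<bar>a\<bar> + \<bar>b\<bar> + \<bar>c :: real\<bar>"
  by linarith

lemma eventually_nhds_0_norm:
  fixes P :: "'a::real_normed_vector \<Rightarrow> bool"
  shows "(\<forall>\<^sub>F h in nhds 0. P h) \<longleftrightarrow> (\<exists>d>0. \<forall>h. norm h < d \<longrightarrow> P h)"
  by (auto simp: eventually_nhds_metric dist_norm)

text \<open>Evaluating at \<open>t *\<^sub>R h\<close> and dividing by \<open>t\<close> leaves
  \<open>l h + t * Q h\<close>. Letting \<open>t\<close> tend to 0 for both \<open>h\<close> and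
  \<open>- h\<close> kills \<open>l\<close>; one small multiple of \<open>h\<close> then settles
  \<open>Q\<close>. This is the derivative test at a minimum for functions known only through
  expansions.\<close>

lemma nonneg_quadratic_imp:
  assumes "linear l" "quadform Q"
    and "\<forall>\<^sub>F h in nhds 0. 0 \<le> l h + Q (h::'a::euclidean_space)"
  shows "l h = (0::real)" "0 \<le> Q h"
proof -
  obtain d where d: "d > 0" "\<And>h. norm h < d \<Longrightarrow> 0 \<le> l h + Q h"
    using assms(3) unfolding eventually_nhds_0_norm by blast
  have *: "0 \<le> l h + t * Q h" if "0 < t" "t * norm h < d" for t h
  proof -
    have "0 \<le> l (t *\<^sub>R h) + Q (t *\<^sub>R h)" using that by (intro d) auto
    also have "\<dots> = t * (l h + t * Q h)"
      using assms by (simp add: linear_scale quadform_scaleR power2_eq_square algebra_simps)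
    finally show ?thesis using that by (simp add: zero_le_mult_iff)
  qed
  have ge: "0 \<le> l h" for h
  proof -
    have "\<forall>\<^sub>F t in at_right 0. 0 \<le> l h + t * Q h"
    proof -
      have "((\<lambda>t. t * norm h) \<longlongrightarrow> 0 * norm h) (at_right 0)" by (intro tendsto_intros)
      then have "\<forall>\<^sub>F t in at_right 0. t * norm h < d"
        using d(1) by (intro order_tendstoD) auto
      then show ?thesis using eventually_at_right_less[of "0::real"]
        by eventually_elim (rule *)
    qed
    moreover have "((\<lambda>t. l h + t * Q h) \<longlongrightarrow> l h + 0 * Q h) (at_right 0)"
      by (intro tendsto_intros)
    ultimately show ?thesis by (intro tendsto_lowerbound[where F="at_right 0"]) auto
  qed
  show l0: "l h = 0" for h using ge[of h] ge[of "-h"] linear_neg[OF assms(1), of h] by simp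
  have "0 < 1 + norm h" using norm_ge_zero[of h] by linarith
  then have "d / (1 + norm h) * norm h < d"
    using d(1) by (simp add: field_simps)
  then show "0 \<le> Q h" using *[of "d / (1 + norm h)" h] d(1) l0 \<open>0 < 1 + norm h\<close>
    by (simp add: zero_le_divide_iff zero_le_mult_iff)
qed

text \<open>Peano expansion at a single point; \<open>Q\<close> is half the Hessian form, the source
  of the factors 1/2 below. Its calculus of sums, products and compositions takes the place of
  differentiating the penalisation and the barriers.\<close>

definition second_order ::
    "('a::euclidean_space \<Rightarrow> real) \<Rightarrow> 'a \<Rightarrow> ('a \<Rightarrow> real) \<Rightarrow> ('a \<Rightarrow> real) \<Rightarrow> bool" where
  "second_order f z l Q \<longleftrightarrow> linear l \<and> quadform Q \<and>
     (\<forall>e>0. \<forall>\<^sub>F h in nhds 0. \<bar>f (z + h) - f z - l h - Q h\<bar> \<le> e * (norm h)\<^sup>2)"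

lemma second_orderD:
  assumes "second_order f z l Q"
  shows "linear l" "quadform Q"
    "e > 0 \<Longrightarrow> \<forall>\<^sub>F h in nhds 0. \<bar>f (z + h) - f z - l h - Q h\<bar> \<le> e * (norm h)\<^sup>2"
  using assms by (auto simp: second_order_def)

lemma second_order_exact:
  assumes "linear l" "quadform Q" "\<And>h. f (z + h) = f z + l h + Q h"
  shows "second_order f z l Q"
  using assms by (auto simp: second_order_def)

lemma second_order_const: "second_order (\<lambda>_. c) z (\<lambda>_. 0) (\<lambda>_. 0)"
  by (intro second_order_exact) (auto simp: linear_zero quadform_zero)

lemma second_order_linear: "linear l \<Longrightarrow> second_order l z l (\<lambda>_. 0)"
  by (intro second_order_exact) (auto simp: linear_add quadform_zero)

lemma second_order_add:
  assumes "second_order f z l Q" "second_order g z m R"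
  shows "second_order (\<lambda>w. f w + g w) z (\<lambda>h. l h + m h) (\<lambda>h. Q h + R h)"
  unfolding second_order_def
proof (intro conjI allI impI)
  show "linear (\<lambda>h. l h + m h)" using assms by (auto simp: second_order_def intro: linear_compose_add)
  show "quadform (\<lambda>h. Q h + R h)" using assms by (auto simp: second_order_def intro: quadform_add)
  fix e :: real assume "e > 0"
  then have "e/2 > 0" by simp
  from second_orderD(3)[OF assms(1) this] second_orderD(3)[OF assms(2) this]
  show "\<forall>\<^sub>F h in nhds 0. \<bar>f (z + h) + g (z + h) - (f z + g z) - (l h + m h) - (Q h + R h)\<bar>
          \<le> e * (norm h)\<^sup>2"
  proof eventually_elim
    case (elim h)
    have "e * (norm h)\<^sup>2 = e/2 * (norm h)\<^sup>2 + e/2 * (norm h)\<^sup>2" by simp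
    with elim show ?case by linarith
  qed
qed

lemma second_order_cmult:
  assumes "second_order f z l Q"
  shows "second_order (\<lambda>w. c * f w) z (\<lambda>h. c * l h) (\<lambda>h. c * Q h)"
  unfolding second_order_def
proof (intro conjI allI impI)
  show "linear (\<lambda>h. c * l h)"
    using linear_compose_scale_right[OF second_orderD(1)[OF assms], of c] by simp
  show "quadform (\<lambda>h. c * Q h)" using assms by (auto simp: second_order_def intro: quadform_cmult)
  fix e :: real assume "e > 0"
  then have "e / (\<bar>c\<bar> + 1) > 0" by simp
  from second_orderD(3)[OF assms this]
  show "\<forall>\<^sub>F h in nhds 0. \<bar>c * f (z + h) - c * f z - c * l h - c * Q h\<bar> \<le> e * (norm h)\<^sup>2"
  proof eventually_elim
    case (elim h)
    have "\<bar>c * f (z + h) - c * f z - c * l h - c * Q h\<bar> = \<bar>c\<bar> * \<bar>f (z + h) - f z - l h - Q h\<bar>"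
      by (simp add: abs_mult[symmetric] algebra_simps)
    also have "\<dots> \<le> (\<bar>c\<bar> + 1) * (e / (\<bar>c\<bar> + 1) * (norm h)\<^sup>2)"
      using elim by (intro mult_mono) auto
    finally show ?case by (simp add: add_nonneg_eq_0_iff)
  qed
qed

lemma second_order_diff:
  assumes "second_order f z l Q" "second_order g z m R"
  shows "second_order (\<lambda>w. f w - g w) z (\<lambda>h. l h - m h) (\<lambda>h. Q h - R h)"
  using second_order_add[OF assms(1) second_order_cmult[OF assms(2), of "-1"]] by simp

lemma linear_bound_real:
  assumes "linear (l :: 'a::euclidean_space \<Rightarrow> real)"
  obtains C where "C > 0" "\<And>h. \<bar>l h\<bar> \<le> C * norm h"
  using linear_bounded_pos[OF assms] by auto

lemma linear_mult_const: "linear l \<Longrightarrow> linear (\<lambda>h. c * (l h :: real))"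
  using linear_compose_scale_right[of l c] by simp

lemma second_order_le_quadratic:
  assumes "second_order f z l Q"
  obtains C where "C > 0" "\<forall>\<^sub>F h in nhds 0. \<bar>f (z + h) - f z\<bar> \<le> C * norm h"
    "\<forall>\<^sub>F h in nhds 0. \<bar>f (z + h) - f z - l h\<bar> \<le> C * (norm h)\<^sup>2"
proof -
  obtain A where A: "A > 0" "\<And>h. \<bar>l h\<bar> \<le> A * norm h"
    using linear_bound_real[OF second_orderD(1)[OF assms]] by blast
  obtain B where B: "B > 0" "\<And>h. \<bar>Q h\<bar> \<le> B * (norm h)\<^sup>2"
    using quadform_bound[OF second_orderD(2)[OF assms]] by blast
  have small: "\<forall>\<^sub>F h in nhds (0::'a). norm h < 1"
    unfolding eventually_nhds_0_norm by (auto intro: exI[of _ 1])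
  have quad: "\<forall>\<^sub>F h in nhds 0. \<bar>f (z + h) - f z - l h\<bar> \<le> (B + 1) * (norm h)\<^sup>2"
    using second_orderD(3)[OF assms, of 1, simplified]
  proof eventually_elim
    case (elim h) then show ?case using B(2)[of h] by (auto simp: abs_le_iff algebra_simps)
  qed
  have "\<forall>\<^sub>F h in nhds 0. \<bar>f (z + h) - f z\<bar> \<le> (A + B + 1) * norm h"
    using quad small
  proof eventually_elim
    case (elim h)
    have "(B + 1) * (norm h)\<^sup>2 \<le> (B + 1) * norm h"
      using elim B(1) by (intro mult_left_mono) (auto simp: power2_eq_square intro: mult_left_le)
    with elim A(2)[of h] show ?case by (auto simp: abs_le_iff algebra_simps)
  qed
  moreover have "\<forall>\<^sub>F h in nhds 0. \<bar>f (z + h) - f z - l h\<bar> \<le> (A + B + 1) * (norm h)\<^sup>2"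
    using quad
  proof eventually_elim
    case (elim h)
    have "(B + 1) * (norm h)\<^sup>2 \<le> (A + B + 1) * (norm h)\<^sup>2" using A(1) by (intro mult_right_mono) auto
    with elim show ?case by linarith
  qed
  ultimately show ?thesis using A(1) B(1) by (intro that[of "A + B + 1"]) auto
qed

lemma eventually_norm_le: "r > 0 \<Longrightarrow> \<forall>\<^sub>F h in nhds (0::'a::real_normed_vector). norm h \<le> r"
  unfolding eventually_nhds_0_norm by (auto intro: exI[of _ r])

lemma second_order_mult:
  assumes f: "second_order f z l Q" and g: "second_order g z m R"
  shows "second_order (\<lambda>w. f w * g w) z (\<lambda>h. f z * m h + g z * l h)
     (\<lambda>h. f z * R h + g z * Q h + l h * m h)"
  unfolding second_order_def
proof (intro conjI allI impI)
  note lf = second_orderD(1)[OF f] and lg = second_orderD(1)[OF g]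
  show "linear (\<lambda>h. f z * m h + g z * l h)"
    by (intro linear_compose_add linear_mult_const lf lg)
  show "quadform (\<lambda>h. f z * R h + g z * Q h + l h * m h)"
    using second_orderD(2)[OF f] second_orderD(2)[OF g] lf lg by (intro quadform_intros)
  fix e :: real assume e: "e > 0"
  obtain A where A: "A > 0" "\<forall>\<^sub>F h in nhds 0. \<bar>f (z + h) - f z\<bar> \<le> A * norm h"
    "\<forall>\<^sub>F h in nhds 0. \<bar>f (z + h) - f z - l h\<bar> \<le> A * (norm h)\<^sup>2"
    using second_order_le_quadratic[OF f] by blast
  obtain B where B: "B > 0" "\<forall>\<^sub>F h in nhds 0. \<bar>g (z + h) - g z\<bar> \<le> B * norm h"
    "\<forall>\<^sub>F h in nhds 0. \<bar>g (z + h) - g z - m h\<bar> \<le> B * (norm h)\<^sup>2"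
    using second_order_le_quadratic[OF g] by blast
  obtain C where C: "C > 0" "\<And>h. \<bar>m h\<bar> \<le> C * norm h" using linear_bound_real[OF lg] by blast
  \<comment> \<open>The error splits into two Peano remainders, each kept below a third of
    \<open>e\<close> by \<open>k\<close>, and mixed products, which are cubic in
    \<open>norm h\<close> and hence below the last third for \<open>norm h \<le> r\<close>.\<close>
  define k where "k = e / (3 * (\<bar>f z\<bar> + \<bar>g z\<bar> + 1))"
  have k: "k > 0" using e by (simp add: k_def)
  have fk: "\<bar>f z\<bar> * k \<le> e/3" "\<bar>g z\<bar> * k \<le> e/3"
    using e unfolding k_def by (auto simp: field_simps)
  define r where "r = e / (3 * (A * B + A * C))"
  have r: "r > 0" using e A(1) B(1) C(1) by (simp add: r_def add_pos_pos)
  have rr: "(A * B + A * C) * r = e/3"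
  proof -
    have "A * B + A * C > 0" using A(1) B(1) C(1) by (simp add: add_pos_pos)
    then show ?thesis unfolding r_def by (metis divide_divide_eq_left less_irrefl nonzero_mult_div_cancel_left times_divide_eq_right)
  qed
  show "\<forall>\<^sub>F h in nhds 0. \<bar>f (z + h) * g (z + h) - f z * g z - (f z * m h + g z * l h)
      - (f z * R h + g z * Q h + l h * m h)\<bar> \<le> e * (norm h)\<^sup>2"
    using second_orderD(3)[OF f k] second_orderD(3)[OF g k] A(2,3) B(2,3) eventually_norm_le[OF r]
  proof eventually_elim
    case (elim h)
    let ?n = "norm h" and ?df = "f (z + h) - f z" and ?dg = "g (z + h) - g z"
    have eq: "f (z + h) * g (z + h) - f z * g z - (f z * m h + g z * l h)
      - (f z * R h + g z * Q h + l h * m h)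
      = f z * (?dg - m h - R h) + g z * (?df - l h - Q h) + (?df * (?dg - m h) + (?df - l h) * m h)"
      by (simp add: algebra_simps)
    have "\<bar>?df * (?dg - m h) + (?df - l h) * m h\<bar> \<le> \<bar>?df\<bar> * \<bar>?dg - m h\<bar> + \<bar>?df - l h\<bar> * \<bar>m h\<bar>"
      unfolding abs_mult[symmetric] by (rule abs_triangle_ineq)
    also have "\<dots> \<le> (A * ?n) * (B * ?n\<^sup>2) + (A * ?n\<^sup>2) * (C * ?n)"
      using elim A(1) B(1) C by (intro add_mono mult_mono) auto
    finally have 3: "\<bar>?df * (?dg - m h) + (?df - l h) * m h\<bar> \<le> (A * ?n) * (B * ?n\<^sup>2) + (A * ?n\<^sup>2) * (C * ?n)" .
    have 1: "\<bar>f z * (?dg - m h - R h)\<bar> \<le> \<bar>f z\<bar> * (k * ?n\<^sup>2)"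
      unfolding abs_mult using elim by (intro mult_left_mono) auto
    have 2: "\<bar>g z * (?df - l h - Q h)\<bar> \<le> \<bar>g z\<bar> * (k * ?n\<^sup>2)"
      unfolding abs_mult using elim by (intro mult_left_mono) auto
    have "\<bar>f (z + h) * g (z + h) - f z * g z - (f z * m h + g z * l h)
      - (f z * R h + g z * Q h + l h * m h)\<bar> \<le> \<bar>f z\<bar> * (k * ?n\<^sup>2) + \<bar>g z\<bar> * (k * ?n\<^sup>2)
        + ((A * ?n) * (B * ?n\<^sup>2) + (A * ?n\<^sup>2) * (C * ?n))"
      unfolding eq by (rule order_trans[OF abs_triangle3 add_mono[OF add_mono[OF 1 2] 3]])
    also have "\<dots> = (\<bar>f z\<bar> * k) * ?n\<^sup>2 + (\<bar>g z\<bar> * k) * ?n\<^sup>2 + (A * B + A * C) * ?n * ?n\<^sup>2"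
      by (simp add: algebra_simps power2_eq_square)
    also have "\<dots> \<le> (e/3) * ?n\<^sup>2 + (e/3) * ?n\<^sup>2 + ((A * B + A * C) * r) * ?n\<^sup>2"
      using elim A(1) B(1) C(1) fk by (intro add_mono mult_right_mono mult_left_mono) auto
    also have "\<dots> = e * ?n\<^sup>2" unfolding rr by simp
    finally show ?case .
  qed
qed

text \<open>Taylor's formula follows from differentiability of \<open>F'\<close> at the single point
  \<open>f z\<close>: the remainder has derivative \<open>F' (f z + y) - F' (f z) - F'' * y\<close>,
  which is \<open>o(y)\<close>, and the mean value inequality integrates this. The term with
  \<open>(l h)\<^sup>2\<close> later carries the concavity of the modulus.\<close>

lemma second_order_real_comp:
  fixes F :: "real \<Rightarrow> real"
  assumes f: "second_order f z l Q" and F: "\<forall>\<^sub>F y in nhds (f z). (F has_real_derivative F' y) (at y)"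
    and F': "(F' has_real_derivative F'') (at (f z))"
  shows "second_order (\<lambda>w. F (f w)) z (\<lambda>h. F' (f z) * l h)
     (\<lambda>h. F' (f z) * Q h + F'' / 2 * (l h)\<^sup>2)"
proof -
  have taylor: "\<forall>\<^sub>F u in nhds 0. \<bar>F (f z + u) - F (f z) - F' (f z) * u - F'' / 2 * u\<^sup>2\<bar> \<le> e * u\<^sup>2"
    if "e > 0" for e
  proof -
    obtain d1 where d1: "d1 > 0" "\<And>u. \<bar>u\<bar> < d1 \<Longrightarrow> (F has_real_derivative F' (f z + u)) (at (f z + u))"
      using F unfolding eventually_nhds_metric dist_real_def
      by (metis add_diff_cancel_left' )
    have "((\<lambda>u. (F' (f z + u) - F' (f z)) / u) \<longlongrightarrow> F'') (at 0)"
      using F' by (simp add: DERIV_def)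
    then have "\<forall>\<^sub>F u in at 0. dist ((F' (f z + u) - F' (f z)) / u) F'' < e"
      using that by (rule tendstoD)
    then obtain d2 where d2: "d2 > 0"
      "\<And>u. u \<noteq> 0 \<Longrightarrow> \<bar>u\<bar> < d2 \<Longrightarrow> dist ((F' (f z + u) - F' (f z)) / u) F'' < e"
      unfolding eventually_at by (auto simp: dist_real_def)
    have d2': "\<bar>F' (f z + u) - F' (f z) - F'' * u\<bar> \<le> e * \<bar>u\<bar>" if "\<bar>u\<bar> < d2" for u
    proof (cases "u = 0")
      case False
      have "\<bar>F' (f z + u) - F' (f z) - F'' * u\<bar> = \<bar>(F' (f z + u) - F' (f z)) / u - F''\<bar> * \<bar>u\<bar>"
        using False by (simp add: abs_mult[symmetric] field_simps)
      also have "\<dots> \<le> e * \<bar>u\<bar>"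
        using d2(2)[OF False that] by (intro mult_right_mono) (auto simp: dist_real_def)
      finally show ?thesis .
    qed auto
    have "\<bar>F (f z + u) - F (f z) - F' (f z) * u - F'' / 2 * u\<^sup>2\<bar> \<le> e * u\<^sup>2"
      if u: "\<bar>u\<bar> < min d1 d2" for u
    proof -
      let ?G = "\<lambda>y. F (f z + y) - F' (f z) * y - F'' / 2 * y\<^sup>2"
      have der: "(?G has_real_derivative F' (f z + y) - F' (f z) - F'' * y) (at y)"
        if "\<bar>y\<bar> < d1" for y
        using DERIV_shift[THEN iffD1, of F "F' (f z + y)" y "f z"] d1(2)[OF that]
        by (auto intro!: derivative_eq_intros simp: add.commute)
      have "\<bar>?G u - ?G 0\<bar> \<le> (e * \<bar>u\<bar>) * \<bar>u - 0\<bar>"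
      proof (rule field_differentiable_bound[where S="{-\<bar>u\<bar>..\<bar>u\<bar>}", unfolded real_norm_def])
        fix y assume y: "y \<in> {-\<bar>u\<bar>..\<bar>u\<bar>}"
        then show "(?G has_real_derivative F' (f z + y) - F' (f z) - F'' * y) (at y within {-\<bar>u\<bar>..\<bar>u\<bar>})"
          using u by (intro DERIV_subset[OF der]) auto
        have "\<bar>F' (f z + y) - F' (f z) - F'' * y\<bar> \<le> e * \<bar>y\<bar>" using y u by (intro d2') auto
        also have "\<dots> \<le> e * \<bar>u\<bar>" using y \<open>e > 0\<close> by (intro mult_left_mono) auto
        finally show "\<bar>F' (f z + y) - F' (f z) - F'' * y\<bar> \<le> e * \<bar>u\<bar>" .
      qed auto
      then show ?thesis by (simp add: power2_eq_square algebra_simps)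
    qed
    then show ?thesis unfolding eventually_nhds_0_norm using d1(1) d2(1)
      by (intro exI[of _ "min d1 d2"]) auto
  qed
  note lf = second_orderD(1)[OF f]
  show ?thesis unfolding second_order_def
  proof (intro conjI allI impI)
    show "linear (\<lambda>h. F' (f z) * l h)" by (intro linear_mult_const lf)
    show "quadform (\<lambda>h. F' (f z) * Q h + F'' / 2 * (l h)\<^sup>2)"
      by (intro quadform_intros lf second_orderD(2)[OF f])
    fix e :: real assume e: "e > 0"
    obtain A where A: "A > 0" "\<forall>\<^sub>F h in nhds 0. \<bar>f (z + h) - f z\<bar> \<le> A * norm h"
      "\<forall>\<^sub>F h in nhds 0. \<bar>f (z + h) - f z - l h\<bar> \<le> A * (norm h)\<^sup>2"
      using second_order_le_quadratic[OF f] by blast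
    obtain C where C: "C > 0" "\<And>h. \<bar>l h\<bar> \<le> C * norm h" using linear_bound_real[OF lf] by blast
    define k where "k = e / (3 * (\<bar>F' (f z)\<bar> + 1))"
    have k: "k > 0" "\<bar>F' (f z)\<bar> * k \<le> e/3" using e by (auto simp: k_def field_simps)
    define j where "j = e / (3 * A\<^sup>2)"
    have j: "j > 0" "j * A\<^sup>2 = e/3" using e A(1) by (auto simp: j_def)
    define r where "r = e / (3 * (\<bar>F''\<bar> * A * (A + C) + 1))"
    have pos: "\<bar>F''\<bar> * A * (A + C) \<ge> 0" using A(1) C(1) by auto
    have r: "r > 0" "\<bar>F''\<bar> * A * (A + C) * r \<le> e/3"
      using e pos by (auto simp: r_def field_simps add_nonneg_pos)
    obtain d where d: "d > 0" "\<And>u. \<bar>u\<bar> < d \<Longrightarrow>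
        \<bar>F (f z + u) - F (f z) - F' (f z) * u - F'' / 2 * u\<^sup>2\<bar> \<le> j * u\<^sup>2"
      using taylor[OF j(1)] unfolding eventually_nhds_0_norm by auto
    have "d / (2 * A) > 0" using d(1) A(1) by simp
    from second_orderD(3)[OF f k(1)] A(2,3) eventually_norm_le[OF r(1)] eventually_norm_le[OF this]
    show "\<forall>\<^sub>F h in nhds 0. \<bar>F (f (z + h)) - F (f z) - F' (f z) * l h
          - (F' (f z) * Q h + F'' / 2 * (l h)\<^sup>2)\<bar> \<le> e * (norm h)\<^sup>2"
    proof eventually_elim
      case (elim h)
      let ?n = "norm h"
      define u where "u = f (z + h) - f z"
      have u: "\<bar>u\<bar> \<le> A * ?n" using elim by (simp add: u_def)
      also have "A * ?n \<le> A * (d / (2 * A))" using elim A(1) by (intro mult_left_mono) auto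
      also have "\<dots> < d" using A(1) d(1) by simp
      finally have T: "\<bar>F (f z + u) - F (f z) - F' (f z) * u - F'' / 2 * u\<^sup>2\<bar> \<le> j * u\<^sup>2" by (rule d(2))
      have u2: "u\<^sup>2 \<le> A\<^sup>2 * ?n\<^sup>2" using power_mono[OF u, of 2] by (simp add: power_mult_distrib)
      have eq: "F (f (z + h)) - F (f z) - F' (f z) * l h - (F' (f z) * Q h + F'' / 2 * (l h)\<^sup>2)
        = (F (f z + u) - F (f z) - F' (f z) * u - F'' / 2 * u\<^sup>2) + F' (f z) * (u - l h - Q h)
          + F'' / 2 * ((u - l h) * (u + l h))"
        by (simp add: u_def algebra_simps power2_eq_square)
      have 1: "\<bar>F (f z + u) - F (f z) - F' (f z) * u - F'' / 2 * u\<^sup>2\<bar> \<le> j * (A\<^sup>2 * ?n\<^sup>2)"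
        by (rule order_trans[OF T mult_left_mono[OF u2]]) (use j(1) in simp)
      have "\<bar>u - l h - Q h\<bar> \<le> k * ?n\<^sup>2" using elim(1) by (simp only: u_def)
      then have 2: "\<bar>F' (f z) * (u - l h - Q h)\<bar> \<le> \<bar>F' (f z)\<bar> * (k * ?n\<^sup>2)"
        unfolding abs_mult by (rule mult_left_mono) simp
      have "\<bar>u - l h\<bar> \<le> A * ?n\<^sup>2" using elim(3) by (simp only: u_def)
      moreover have "\<bar>u + l h\<bar> \<le> A * ?n + C * ?n"
        by (rule order_trans[OF abs_triangle_ineq add_mono[OF u C(2)]])
      ultimately have "\<bar>(u - l h) * (u + l h)\<bar> \<le> (A * ?n\<^sup>2) * (A * ?n + C * ?n)"
        unfolding abs_mult by (rule mult_mono) (use A(1) in auto)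
      then have "\<bar>F'' / 2\<bar> * \<bar>(u - l h) * (u + l h)\<bar>
            \<le> \<bar>F'' / 2\<bar> * ((A * ?n\<^sup>2) * (A * ?n + C * ?n))"
        by (rule mult_left_mono) simp
      then have 3: "\<bar>F'' / 2 * ((u - l h) * (u + l h))\<bar> \<le> \<bar>F''\<bar> / 2 * ((A * ?n\<^sup>2) * (A * ?n + C * ?n))"
        unfolding abs_mult by simp
      have "\<bar>F (f (z + h)) - F (f z) - F' (f z) * l h - (F' (f z) * Q h + F'' / 2 * (l h)\<^sup>2)\<bar>
         \<le> j * (A\<^sup>2 * ?n\<^sup>2) + \<bar>F' (f z)\<bar> * (k * ?n\<^sup>2)
          + \<bar>F''\<bar> / 2 * ((A * ?n\<^sup>2) * (A * ?n + C * ?n))"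
        unfolding eq by (rule order_trans[OF abs_triangle3 add_mono[OF add_mono[OF 1 2] 3]])
      also have "\<dots> = (j * A\<^sup>2) * ?n\<^sup>2 + (\<bar>F' (f z)\<bar> * k) * ?n\<^sup>2
          + (\<bar>F''\<bar> * A * (A + C) * ?n) / 2 * ?n\<^sup>2"
        by (simp add: algebra_simps)
      also have "\<dots> \<le> (e/3) * ?n\<^sup>2 + (e/3) * ?n\<^sup>2 + (e/3) * ?n\<^sup>2"
      proof (intro add_mono mult_right_mono)
        have "\<bar>F''\<bar> * A * (A + C) * ?n \<le> \<bar>F''\<bar> * A * (A + C) * r"
          using elim pos by (intro mult_left_mono) auto
        moreover have "0 \<le> \<bar>F''\<bar> * A * (A + C) * ?n" using pos by simp
        ultimately show "\<bar>F''\<bar> * A * (A + C) * ?n / 2 \<le> e/3" using r(2) by linarith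
      qed (use j k in auto)
      also have "\<dots> = e * ?n\<^sup>2" by simp
      finally show ?case .
    qed
  qed
qed

section \<open>The heat flow comparison of separate sums\<close>

text \<open>Trigonometric polynomials evolving by the possibly degenerate heat equation whose
  generator is half the sum of the second derivatives along the vectors \<open>\<sigma> j\<close>.
  Each wave merely decays, so the flow is explicit.\<close>

inductive_set trigflow :: "('k \<Rightarrow> 'a::euclidean_space) \<Rightarrow> 'k set \<Rightarrow> ('a \<Rightarrow> real \<Rightarrow> real) set"
  for \<sigma> :: "'k \<Rightarrow> 'a" and I :: "'k set" where
  wave: "(\<lambda>z \<tau>. exp (- (\<Sum>j\<in>I. (k \<bullet> \<sigma> j)\<^sup>2) / 2 * \<tau>) * cos (k \<bullet> z + a)) \<in> trigflow \<sigma> I"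
| add: "h \<in> trigflow \<sigma> I \<Longrightarrow> g \<in> trigflow \<sigma> I \<Longrightarrow> (\<lambda>z \<tau>. h z \<tau> + g z \<tau>) \<in> trigflow \<sigma> I"
| cmult: "h \<in> trigflow \<sigma> I \<Longrightarrow> (\<lambda>z \<tau>. c * h z \<tau>) \<in> trigflow \<sigma> I"

lemma trigflow_continuous:
  assumes "h \<in> trigflow \<sigma> I" shows "continuous_on A (\<lambda>p. h (fst p) (snd p))"
  using assms by induction (auto intro!: continuous_intros)

lemma trigflow_bounded:
  assumes "h \<in> trigflow \<sigma> I" shows "\<exists>K. \<forall>z \<tau>. 0 \<le> \<tau> \<longrightarrow> \<bar>h z \<tau>\<bar> \<le> K"
  using assms
proof induction
  case (wave k a)
  have "\<bar>exp (- (\<Sum>j\<in>I. (k \<bullet> \<sigma> j)\<^sup>2) / 2 * \<tau>) * cos (k \<bullet> z + a)\<bar> \<le> 1" if "0 \<le> \<tau>" for z \<tau>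
  proof -
    have "exp (- (\<Sum>j\<in>I. (k \<bullet> \<sigma> j)\<^sup>2) / 2 * \<tau>) \<le> 1"
      using that by (auto intro!: mult_nonneg_nonneg sum_nonneg simp: mult_nonpos_nonneg)
    then show ?thesis unfolding abs_mult by (intro mult_le_one) auto
  qed
  then show ?case by blast
next
  case (add h g)
  then obtain K L where "\<forall>z \<tau>. 0 \<le> \<tau> \<longrightarrow> \<bar>h z \<tau>\<bar> \<le> K" "\<forall>z \<tau>. 0 \<le> \<tau> \<longrightarrow> \<bar>g z \<tau>\<bar> \<le> L" by blast
  then have "\<forall>z \<tau>. 0 \<le> \<tau> \<longrightarrow> \<bar>h z \<tau> + g z \<tau>\<bar> \<le> K + L"
    by (meson abs_triangle_ineq add_mono order_trans)
  then show ?case by blast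
next
  case (cmult h c)
  then obtain K where "\<forall>z \<tau>. 0 \<le> \<tau> \<longrightarrow> \<bar>h z \<tau>\<bar> \<le> K" by blast
  then have "\<forall>z \<tau>. 0 \<le> \<tau> \<longrightarrow> \<bar>c * h z \<tau>\<bar> \<le> \<bar>c\<bar> * K"
    by (auto simp: abs_mult intro!: mult_left_mono)
  then show ?case by blast
qed

lemma second_order_cos:
  "second_order (\<lambda>z. cos (k \<bullet> z + a)) z (\<lambda>h. - sin (k \<bullet> z + a) * (k \<bullet> h))
     (\<lambda>h. - cos (k \<bullet> z + a) / 2 * (k \<bullet> h)\<^sup>2)"
proof -
  have "second_order (\<lambda>z. k \<bullet> z + a) z (\<lambda>h. k \<bullet> h) (\<lambda>_. 0)"
    by (intro second_order_exact) (auto simp: inner_add_right quadform_zero bounded_linear.linear bounded_linear_inner_right)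
  moreover have "((\<lambda>y. - sin y) has_real_derivative - cos (k \<bullet> z + a)) (at (k \<bullet> z + a))"
    by (auto intro!: derivative_eq_intros)
  ultimately show ?thesis
    using second_order_real_comp[of "\<lambda>z. k \<bullet> z + a" z "\<lambda>h. k \<bullet> h" "\<lambda>_. 0" cos "\<lambda>y. - sin y"
        "- cos (k \<bullet> z + a)"]
    by (simp add: DERIV_cos)
qed

lemma trigflow_heat:
  assumes "h \<in> trigflow \<sigma> I"
  shows "\<exists>l Q. second_order (\<lambda>z. h z \<tau>) z l Q \<and> (h z has_real_derivative (\<Sum>j\<in>I. Q (\<sigma> j))) (at \<tau>)"
  using assms
proof induction
  case (wave k a)
  let ?s = "\<Sum>j\<in>I. (k \<bullet> \<sigma> j)\<^sup>2"
  let ?Q = "\<lambda>h. exp (- ?s / 2 * \<tau>) * (- cos (k \<bullet> z + a) / 2 * (k \<bullet> h)\<^sup>2)"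
  have "(\<Sum>j\<in>I. ?Q (\<sigma> j)) = exp (- ?s / 2 * \<tau>) * (- cos (k \<bullet> z + a) / 2) * ?s"
    by (simp only: sum_distrib_left mult.assoc)
  then have "((\<lambda>\<tau>. exp (- ?s / 2 * \<tau>) * cos (k \<bullet> z + a)) has_real_derivative (\<Sum>j\<in>I. ?Q (\<sigma> j))) (at \<tau>)"
    by (auto intro!: derivative_eq_intros)
  with second_order_cmult[OF second_order_cos] show ?case by blast
next
  case (add h g)
  then obtain l Q m R where
    "second_order (\<lambda>z. h z \<tau>) z l Q" "(h z has_real_derivative (\<Sum>j\<in>I. Q (\<sigma> j))) (at \<tau>)"
    "second_order (\<lambda>z. g z \<tau>) z m R" "(g z has_real_derivative (\<Sum>j\<in>I. R (\<sigma> j))) (at \<tau>)" by blast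
  then show ?case
    by (intro exI[of _ "\<lambda>h. l h + m h"] exI[of _ "\<lambda>h. Q h + R h"] conjI second_order_add)
      (auto intro!: DERIV_add simp: sum.distrib)
next
  case (cmult h c)
  then obtain l Q where
    "second_order (\<lambda>z. h z \<tau>) z l Q" "(h z has_real_derivative (\<Sum>j\<in>I. Q (\<sigma> j))) (at \<tau>)" by blast
  then show ?case
    by (intro exI[of _ "\<lambda>h. c * l h"] exI[of _ "\<lambda>h. c * Q h"] conjI second_order_cmult)
      (auto intro!: DERIV_cmult simp: sum_distrib_left[symmetric])
qed

text \<open>The product of two flows is in general not a flow, but its initial values are those of
  one: a product of cosines is half the sum of the cosines of the difference and the sum of the
  phases. This gives the algebra needed for the Stone-Weierstrass theorem.\<close>

lemma trigflow_mult_0: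
  assumes "h \<in> trigflow \<sigma> I" "g \<in> trigflow \<sigma> I"
  shows "\<exists>r\<in>trigflow \<sigma> I. \<forall>z. r z 0 = h z 0 * g z 0"
  using assms(1)
proof induction
  case (wave k a)
  from assms(2) show ?case
  proof induction
    case (wave j b)
    let ?w = "\<lambda>k a z \<tau>. exp (- (\<Sum>j\<in>I. (k \<bullet> \<sigma> j)\<^sup>2) / 2 * \<tau>) * cos (k \<bullet> z + a)"
    let ?r = "\<lambda>z \<tau>. 1/2 * (?w (k - j) (a - b) z \<tau> + ?w (k + j) (a + b) z \<tau>)"
    have 1: "?r \<in> trigflow \<sigma> I"
      by (intro trigflow.cmult trigflow.add trigflow.wave)
    have 2: "?r z 0 = ?w k a z 0 * ?w j b z 0" for z
    proof -
      have "cos ((k - j) \<bullet> z + (a - b)) + cos ((k + j) \<bullet> z + (a + b))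
        = cos ((k \<bullet> z + a) - (j \<bullet> z + b)) + cos ((k \<bullet> z + a) + (j \<bullet> z + b))"
        by (simp add: algebra_simps)
      then show ?thesis by (simp only: cos_diff cos_add) simp
    qed
    show ?case by (rule bexI[of _ ?r]) (rule allI, rule 2, rule 1)
  next
    case (add g1 g2)
    then obtain r1 r2 where "r1 \<in> trigflow \<sigma> I" "r2 \<in> trigflow \<sigma> I"
      "\<forall>z. r1 z 0 = exp (- (\<Sum>j\<in>I. (k \<bullet> \<sigma> j)\<^sup>2) / 2 * 0) * cos (k \<bullet> z + a) * g1 z 0"
      "\<forall>z. r2 z 0 = exp (- (\<Sum>j\<in>I. (k \<bullet> \<sigma> j)\<^sup>2) / 2 * 0) * cos (k \<bullet> z + a) * g2 z 0" by blast
    then show ?case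
      by (intro bexI[of _ "\<lambda>z \<tau>. r1 z \<tau> + r2 z \<tau>"]) (auto simp: distrib_left intro: trigflow.add)
  next
    case (cmult g1 c)
    then obtain r1 where "r1 \<in> trigflow \<sigma> I"
      "\<forall>z. r1 z 0 = exp (- (\<Sum>j\<in>I. (k \<bullet> \<sigma> j)\<^sup>2) / 2 * 0) * cos (k \<bullet> z + a) * g1 z 0" by blast
    then show ?case
      by (intro bexI[of _ "\<lambda>z \<tau>. c * r1 z \<tau>"]) (auto intro: trigflow.cmult)
  qed
next
  case (add h1 h2)
  then obtain r1 r2 where "r1 \<in> trigflow \<sigma> I" "r2 \<in> trigflow \<sigma> I"
    "\<forall>z. r1 z 0 = h1 z 0 * g z 0" "\<forall>z. r2 z 0 = h2 z 0 * g z 0" by blast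
  then show ?case
    by (intro bexI[of _ "\<lambda>z \<tau>. r1 z \<tau> + r2 z \<tau>"]) (auto simp: distrib_right intro: trigflow.add)
next
  case (cmult h1 c)
  then obtain r1 where "r1 \<in> trigflow \<sigma> I" "\<forall>z. r1 z 0 = h1 z 0 * g z 0" by blast
  then show ?case
    by (intro bexI[of _ "\<lambda>z \<tau>. c * r1 z \<tau>"]) (auto intro: trigflow.cmult)
qed

text \<open>The wave vector \<open>(k, 0)\<close> has the same inner product with
  \<open>(\<sigma> j, \<sigma>' j)\<close> as \<open>k\<close> with \<open>\<sigma> j\<close>, so a
  function of one variable evolves in the product space at its own rate, whatever the other
  components are.\<close>

lemma trigflow_pair_fst:
  "h \<in> trigflow \<sigma> I \<Longrightarrow> (\<lambda>Z \<tau>. h (fst Z) \<tau>) \<in> trigflow (\<lambda>j. (\<sigma> j, \<sigma>' j)) I"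
proof (induction rule: trigflow.induct)
  case (wave k a)
  then show ?case using trigflow.wave[where k="(k, 0)" and \<sigma>="\<lambda>j. (\<sigma> j, \<sigma>' j)" and I=I and a=a] by (simp add: inner_prod_def)
qed (auto intro: trigflow.add trigflow.cmult)

lemma trigflow_pair_snd:
  "h \<in> trigflow \<sigma>' I \<Longrightarrow> (\<lambda>Z \<tau>. h (snd Z) \<tau>) \<in> trigflow (\<lambda>j. (\<sigma> j, \<sigma>' j)) I"
proof (induction rule: trigflow.induct)
  case (wave k a)
  then show ?case using trigflow.wave[where k="(0, k)" and \<sigma>="\<lambda>j. (\<sigma> j, \<sigma>' j)" and I=I and a=a] by (simp add: inner_prod_def)
qed (auto intro: trigflow.add trigflow.cmult)

section \<open>Trigonometric approximation on a cube\<close>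

definition cfold :: "'a::euclidean_space \<Rightarrow> 'a" where
  "cfold z = (\<Sum>i\<in>Basis. arcsin (sin (z \<bullet> i)) *\<^sub>R i)"

definition cube :: "'a::euclidean_space set" where
  "cube = {z. \<forall>i\<in>Basis. \<bar>z \<bullet> i\<bar> \<le> pi/2}"

lemma cfold_inner: "i \<in> Basis \<Longrightarrow> cfold z \<bullet> i = arcsin (sin (z \<bullet> i))"
  by (simp add: cfold_def)

lemma cfold_in_cube: "cfold z \<in> cube"
proof -
  have "\<bar>arcsin (sin t)\<bar> \<le> pi/2" for t
    using arcsin_bounded[of "sin t"] by (simp only: abs_le_iff) auto
  then show ?thesis unfolding cube_def by (auto simp only: cfold_inner mem_Collect_eq)
qed

lemma cfold_cube:
  assumes "z \<in> cube" shows "cfold z = z"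
proof (rule euclidean_eqI)
  fix i :: 'a assume i: "i \<in> Basis"
  with assms have "-(pi/2) \<le> z \<bullet> i" "z \<bullet> i \<le> pi/2" by (auto simp: cube_def abs_le_iff)
  then show "cfold z \<bullet> i = z \<bullet> i" using i by (simp add: cfold_inner arcsin_sin)
qed

lemma compact_cube: "compact (cube :: 'a::euclidean_space set)"
proof -
  have "cube = cbox (-(pi/2) *\<^sub>R One) ((pi/2) *\<^sub>R One :: 'a)"
  proof (intro set_eqI)
    fix x :: 'a
    have "\<bar>x \<bullet> i\<bar> \<le> pi/2 \<longleftrightarrow> (-(pi/2) *\<^sub>R One) \<bullet> i \<le> x \<bullet> i \<and> x \<bullet> i \<le> ((pi/2) *\<^sub>R One) \<bullet> i"
      if "i \<in> Basis" for i
    proof -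
      have "One \<bullet> i = (1::real)" using that by simp
      then show ?thesis by (simp only: inner_scaleR_left) linarith
    qed
    then show "x \<in> cube \<longleftrightarrow> x \<in> cbox (-(pi/2) *\<^sub>R One) ((pi/2) *\<^sub>R One)"
      unfolding cube_def mem_box mem_Collect_eq by (intro ball_cong) auto
  qed
  then show ?thesis by (metis compact_cbox)
qed

lemma bounded_on_cube:
  fixes F :: "'a::euclidean_space \<Rightarrow> real"
  assumes "continuous_on UNIV F" shows "\<exists>K. \<forall>z\<in>cube. \<bar>F z\<bar> \<le> K"
proof -
  have "compact (F ` cube)"
    using assms by (intro compact_continuous_image compact_cube) (auto intro: continuous_on_subset)
  then show ?thesis using compact_imp_bounded[of "F ` cube"] unfolding bounded_iff by fastforce
qed

lemma norm_imp_cube: "norm z \<le> pi/2 \<Longrightarrow> z \<in> cube"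
  unfolding cube_def using Basis_le_norm order_trans by (intro CollectI ballI) blast

text \<open>The sines of the coordinates separate the points of the cube and do not change when a
  coordinate \<open>t\<close> is replaced by \<open>arcsin (sin t)\<close>. The approximant can
  therefore be chosen invariant under folding, which makes it comparable with
  \<open>f (cfold z)\<close> everywhere: bounds on the cube become bounds on the whole
  space.\<close>

lemma trig_approx:
  fixes f :: "'a::euclidean_space \<Rightarrow> real" and \<sigma> :: "'k \<Rightarrow> 'a"
  assumes f: "continuous_on UNIV f" and e: "e > 0"
  obtains h where "h \<in> trigflow \<sigma> I" "\<And>z. z \<in> cube \<Longrightarrow> \<bar>f z - h z 0\<bar> < e" "\<And>z. h (cfold z) 0 = h z 0"
proof -
  define R where "R = {q. (\<exists>h\<in>trigflow \<sigma> I. q = (\<lambda>z. h z 0)) \<and> (\<forall>z. q (cfold z) = q z)}"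
  have const: "(\<lambda>_. c) \<in> R" for c
  proof -
    have "(\<lambda>z \<tau>. c * (exp (- (\<Sum>j\<in>I. ((0::'a) \<bullet> \<sigma> j)\<^sup>2) / 2 * \<tau>) * cos (0 \<bullet> z + 0))) \<in> trigflow \<sigma> I"
      by (intro trigflow.cmult trigflow.wave)
    then have "(\<lambda>z \<tau>. c) \<in> trigflow \<sigma> I" by simp
    then show ?thesis unfolding R_def by auto
  qed
  interpret function_ring_on R cube
  proof
    show "compact (cube :: 'a set)" by (rule compact_cube)
    show "(\<lambda>_. c) \<in> R" for c by (rule const)
    show "continuous_on cube q" if q: "q \<in> R" for q
    proof -
      obtain h where h: "h \<in> trigflow \<sigma> I" "q = (\<lambda>z. h z 0)" using q unfolding R_def by blast
      have "continuous_on cube ((\<lambda>p. h (fst p) (snd p)) \<circ> (\<lambda>z. (z, 0)))"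
        by (rule continuous_on_compose) (auto intro!: continuous_intros trigflow_continuous[OF h(1)])
      then show ?thesis by (simp add: h(2) comp_def)
    qed
    show "(\<lambda>x. q x + r x) \<in> R" if "q \<in> R" "r \<in> R" for q r
      using that unfolding R_def by (fastforce intro: trigflow.add)
    show "(\<lambda>x. q x * r x) \<in> R" if qr: "q \<in> R" "r \<in> R" for q r
    proof -
      obtain h g where hg: "h \<in> trigflow \<sigma> I" "q = (\<lambda>z. h z 0)" "g \<in> trigflow \<sigma> I" "r = (\<lambda>z. g z 0)"
        using qr unfolding R_def by blast
      obtain s where s: "s \<in> trigflow \<sigma> I" "\<forall>z. s z 0 = h z 0 * g z 0"
        using trigflow_mult_0[OF hg(1,3)] by blast
      then have eq: "(\<lambda>x. q x * r x) = (\<lambda>z. s z 0)" by (simp add: hg)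
      have "q (cfold z) = q z" "r (cfold z) = r z" for z using qr unfolding R_def by blast+
      then have "s (cfold z) 0 = s z 0" for z using s(2) by (simp add: hg)
      then show ?thesis using s(1) unfolding R_def eq by blast
    qed
    show "\<exists>q\<in>R. q x \<noteq> q y" if xy: "x \<in> cube" "y \<in> cube" "x \<noteq> y" for x y
    proof -
      obtain i where i: "i \<in> Basis" "x \<bullet> i \<noteq> y \<bullet> i" using xy(3) euclidean_eqI by blast
      \<comment> \<open>The phase \<open>- (pi/2)\<close> turns the cosine into a sine, which is
        injective between \<open>- (pi/2)\<close> and \<open>pi/2\<close>.\<close>
      define w where "w = (\<lambda>z \<tau>. exp (- (\<Sum>j\<in>I. (i \<bullet> \<sigma> j)\<^sup>2) / 2 * \<tau>) * cos (i \<bullet> z + (- (pi/2))))"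
      have w: "w \<in> trigflow \<sigma> I" unfolding w_def by (rule trigflow.wave)
      have "w z 0 = sin (z \<bullet> i)" for z
        unfolding w_def by (simp add: inner_commute cos_diff)
      then have "(\<lambda>z. sin (z \<bullet> i)) = (\<lambda>z. w z 0)" by simp
      with w have "\<exists>h\<in>trigflow \<sigma> I. (\<lambda>z. sin (z \<bullet> i)) = (\<lambda>z. h z 0)" by blast
      then have sinR: "(\<lambda>z. sin (z \<bullet> i)) \<in> R"
        unfolding R_def using i(1) by (simp add: cfold_inner)
      have "sin (x \<bullet> i) \<noteq> sin (y \<bullet> i)"
      proof
        assume "sin (x \<bullet> i) = sin (y \<bullet> i)"
        then have "cfold x \<bullet> i = cfold y \<bullet> i" using i(1) by (simp add: cfold_inner)
        then show False using i(2) by (simp add: cfold_cube xy)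
      qed
      then show ?thesis by (rule bexI[where x="\<lambda>z. sin (z \<bullet> i)", OF _ sinR])
    qed
  qed
  obtain q where q: "q \<in> R" "\<forall>x\<in>cube. \<bar>f x - q x\<bar> < e"
    using Stone_Weierstrass_basic[OF continuous_on_subset[OF f] e] by auto
  then show ?thesis using that unfolding R_def by blast
qed

text \<open>Supersolutions of the heat equation of \<open>trigflow\<close> with source
  \<open>- c\<close>. Here \<open>c\<close> is the lower bound satisfied by the jets of a stationary
  subsolution, so the function above it may decrease at rate \<open>c\<close>.\<close>

definition supercal :: "('k \<Rightarrow> 'a::euclidean_space) \<Rightarrow> 'k set \<Rightarrow> real \<Rightarrow> ('a \<Rightarrow> real \<Rightarrow> real) \<Rightarrow> bool" where
  "supercal \<sigma> I c H \<longleftrightarrow> continuous_on UNIV (\<lambda>p. H (fst p) (snd p)) \<and>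
     (\<forall>z \<tau>. 0 \<le> \<tau> \<longrightarrow> (\<exists>l Q D. second_order (\<lambda>z. H z \<tau>) z l Q \<and>
        (H z has_real_derivative D) (at \<tau>) \<and> (\<Sum>j\<in>I. Q (\<sigma> j)) \<le> D + c))"

lemma supercal_add:
  assumes "supercal \<sigma> I c H" "supercal \<sigma> I d G"
  shows "supercal \<sigma> I (c + d) (\<lambda>z \<tau>. H z \<tau> + G z \<tau>)"
  unfolding supercal_def
proof (intro conjI allI impI)
  show "continuous_on UNIV (\<lambda>p. H (fst p) (snd p) + G (fst p) (snd p))"
    using assms by (auto simp: supercal_def intro: continuous_on_add)
  fix z and \<tau> :: real assume "0 \<le> \<tau>"
  then obtain l Q D m R E where
    "second_order (\<lambda>z. H z \<tau>) z l Q" "(H z has_real_derivative D) (at \<tau>)" "(\<Sum>j\<in>I. Q (\<sigma> j)) \<le> D + c"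
    "second_order (\<lambda>z. G z \<tau>) z m R" "(G z has_real_derivative E) (at \<tau>)" "(\<Sum>j\<in>I. R (\<sigma> j)) \<le> E + d"
    using assms unfolding supercal_def by meson
  then show "\<exists>l Q D. second_order (\<lambda>z. H z \<tau> + G z \<tau>) z l Q \<and>
     ((\<lambda>\<tau>. H z \<tau> + G z \<tau>) has_real_derivative D) (at \<tau>) \<and> (\<Sum>j\<in>I. Q (\<sigma> j)) \<le> D + (c + d)"
    by (intro exI[of _ "\<lambda>h. l h + m h"] exI[of _ "\<lambda>h. Q h + R h"] exI[of _ "D + E"] conjI second_order_add)
      (auto intro!: DERIV_add simp: sum.distrib)
qed

lemma supercal_trigflow: "h \<in> trigflow \<sigma> I \<Longrightarrow> supercal \<sigma> I 0 h"
  unfolding supercal_def using trigflow_continuous trigflow_heat by fastforce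

lemma supercal_affine: "supercal \<sigma> I c (\<lambda>z \<tau>. a - c * \<tau>)"
  unfolding supercal_def
proof (intro conjI allI impI)
  fix z and \<tau> :: real
  show "\<exists>l Q D. second_order (\<lambda>z. a - c * \<tau>) z l Q \<and> ((\<lambda>\<tau>. a - c * \<tau>) has_real_derivative D) (at \<tau>)
     \<and> (\<Sum>j\<in>I. Q (\<sigma> j)) \<le> D + c"
    by (intro exI[of _ "\<lambda>_. 0"] exI[of _ "-c"] conjI second_order_const) (auto intro!: derivative_eq_intros)
qed (auto intro!: continuous_intros)

lemma supercal_quadratic:
  assumes "linear l" "quadform Q"
  shows "supercal \<sigma> I 0 (\<lambda>z \<tau>. l z + Q z + \<tau> * (\<Sum>j\<in>I. Q (\<sigma> j)))"
  unfolding supercal_def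
proof (intro conjI allI impI)
  obtain A where A: "linear A" "Q = (\<lambda>h. h \<bullet> A h)" using assms by (auto simp: quadform_def)
  have "continuous_on UNIV l" "continuous_on UNIV A"
    using assms(1) A(1) by (auto intro: linear_continuous_on simp: linear_linear)
  then show "continuous_on UNIV (\<lambda>p. l (fst p) + Q (fst p) + snd p * (\<Sum>j\<in>I. Q (\<sigma> j)))"
    unfolding A by (auto intro!: continuous_intros intro: continuous_on_compose2)
  fix z and \<tau> :: real
  let ?l = "\<lambda>h. l h + (z \<bullet> A h + h \<bullet> A z)"
  have lin: "linear ?l"
    using assms(1) A(1) by (intro linearI) (auto simp: linear_add linear_scale algebra_simps inner_add_right)
  have "second_order (\<lambda>z. l z + Q z + \<tau> * (\<Sum>j\<in>I. Q (\<sigma> j))) z ?l Q"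
  proof (rule second_order_exact[OF lin assms(2)])
    fix h show "l (z + h) + Q (z + h) + \<tau> * (\<Sum>j\<in>I. Q (\<sigma> j))
       = l z + Q z + \<tau> * (\<Sum>j\<in>I. Q (\<sigma> j)) + ?l h + Q h"
      by (simp add: A linear_add[OF assms(1)] linear_add[OF A(1)] algebra_simps)
  qed
  moreover have "((\<lambda>\<tau>. l z + Q z + \<tau> * (\<Sum>j\<in>I. Q (\<sigma> j))) has_real_derivative (\<Sum>j\<in>I. Q (\<sigma> j))) (at \<tau>)"
    by (auto intro!: derivative_eq_intros)
  ultimately show "\<exists>l' Q' D. second_order (\<lambda>z. l z + Q z + \<tau> * (\<Sum>j\<in>I. Q (\<sigma> j))) z l' Q' \<and>
     ((\<lambda>\<tau>. l z + Q z + \<tau> * (\<Sum>j\<in>I. Q (\<sigma> j))) has_real_derivative D) (at \<tau>) \<and> (\<Sum>j\<in>I. Q' (\<sigma> j)) \<le> D + 0"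
    by fastforce
qed

text \<open>Cauchy-Schwarz bounds each summand by
  \<open>6 * K * R * (norm (\<sigma> j))\<^sup>2\<close>, and the factor 3 in \<open>C\<close> makes
  the time derivative match. The fourth power is deliberate: the barrier is large away from the
  origin, yet at the origin it has grown only to order \<open>\<tau>\<^sup>2\<close>, which
  disappears after division by \<open>\<tau>\<close>.\<close>

lemma supercal_quartic:
  fixes \<sigma> :: "'k \<Rightarrow> 'a::euclidean_space"
  assumes "K \<ge> 0" "C = 3 * (\<Sum>j\<in>I. (norm (\<sigma> j))\<^sup>2)"
  shows "supercal \<sigma> I 0 (\<lambda>z \<tau>. K * ((norm z)\<^sup>2 + C * \<tau>)\<^sup>2)"
  unfolding supercal_def
proof (intro conjI allI impI)
  show "continuous_on UNIV (\<lambda>p::'a\<times>real. K * ((norm (fst p))\<^sup>2 + C * snd p)\<^sup>2)"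
    by (intro continuous_intros)
  fix z :: 'a and \<tau> :: real assume \<tau>: "0 \<le> \<tau>"
  define R where "R = (norm z)\<^sup>2 + C * \<tau>"
  define s where "s = (\<Sum>j\<in>I. (norm (\<sigma> j))\<^sup>2)"
  have s: "s \<ge> 0" "C = 3 * s" using assms(2) by (auto simp: s_def intro: sum_nonneg)
  have "linear (\<lambda>h. 2 * (z \<bullet> h))" by (intro linear_mult_const bounded_linear.linear bounded_linear_inner_right)
  moreover have "(norm (z + h))\<^sup>2 + C * \<tau> = (norm z)\<^sup>2 + C * \<tau> + 2 * (z \<bullet> h) + (norm h)\<^sup>2" for h
    by (simp add: power2_norm_eq_inner algebra_simps inner_commute)
  ultimately have "second_order (\<lambda>z. (norm z)\<^sup>2 + C * \<tau>) z (\<lambda>h. 2 * (z \<bullet> h)) (\<lambda>h. (norm h)\<^sup>2)"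
    using quadform_norm by (intro second_order_exact)
  note so2 = this
  have d1: "((\<lambda>y. K * y\<^sup>2) has_real_derivative 2 * K * y) (at y)" for y
    by (auto intro!: derivative_eq_intros)
  have "((\<lambda>y. 2 * K * y) has_real_derivative 2 * K) (at ((norm z)\<^sup>2 + C * \<tau>))"
    by (auto intro!: derivative_eq_intros)
  note second_order_real_comp[OF so2 always_eventually[OF allI[OF d1]] this]
  then
  have so: "second_order (\<lambda>z. K * ((norm z)\<^sup>2 + C * \<tau>)\<^sup>2) z (\<lambda>h. 2 * K * R * (2 * (z \<bullet> h)))
     (\<lambda>h. 2 * K * R * (norm h)\<^sup>2 + 2 * K / 2 * (2 * (z \<bullet> h))\<^sup>2)" (is "second_order _ _ ?l ?Q")
    unfolding R_def .
  have der: "((\<lambda>\<tau>. K * ((norm z)\<^sup>2 + C * \<tau>)\<^sup>2) has_real_derivative 2 * K * R * C) (at \<tau>)"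
    unfolding R_def by (auto intro!: derivative_eq_intros simp: mult_ac)
  have "(\<Sum>j\<in>I. ?Q (\<sigma> j)) \<le> (\<Sum>j\<in>I. 6 * K * R * (norm (\<sigma> j))\<^sup>2)"
  proof (rule sum_mono)
    fix j
    have "(z \<bullet> \<sigma> j)\<^sup>2 \<le> (norm z)\<^sup>2 * (norm (\<sigma> j))\<^sup>2"
      using Cauchy_Schwarz_ineq[of z "\<sigma> j"] by (simp add: power2_norm_eq_inner)
    also have "\<dots> \<le> R * (norm (\<sigma> j))\<^sup>2" unfolding R_def using s \<tau> by (intro mult_right_mono) auto
    finally have "4 * K * (z \<bullet> \<sigma> j)\<^sup>2 \<le> 4 * K * (R * (norm (\<sigma> j))\<^sup>2)"
      using assms(1) by (intro mult_left_mono) auto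
    then show "?Q (\<sigma> j) \<le> 6 * K * R * (norm (\<sigma> j))\<^sup>2" by (simp add: power_mult_distrib)
  qed
  also have "\<dots> = 2 * K * R * C + 0" by (simp add: s s_def sum_distrib_left mult_ac)
  finally show "\<exists>l Q D. second_order (\<lambda>z. K * ((norm z)\<^sup>2 + C * \<tau>)\<^sup>2) z l Q \<and>
     ((\<lambda>\<tau>. K * ((norm z)\<^sup>2 + C * \<tau>)\<^sup>2) has_real_derivative D) (at \<tau>) \<and> (\<Sum>j\<in>I. Q (\<sigma> j)) \<le> D + 0"
    using so der by blast
qed

text \<open>After subtracting a small multiple of time a positive value is left, so the maximum over
  the cylinder lies off the bottom and the lateral boundary. There the tilted function has negative
  time derivative, although earlier times must not give larger values. Only earlier times are
  compared, so the maximum may sit at the final time.\<close>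

lemma parabolic_max:
  fixes g :: "'a::euclidean_space \<Rightarrow> real \<Rightarrow> real"
  assumes cont: "continuous_on (cball 0 \<rho> \<times> {0..T}) (\<lambda>p. g (fst p) (snd p))"
    and init: "\<And>z. norm z \<le> \<rho> \<Longrightarrow> g z 0 \<le> 0"
    and lat: "\<And>z \<tau>. norm z = \<rho> \<Longrightarrow> 0 \<le> \<tau> \<Longrightarrow> \<tau> \<le> T \<Longrightarrow> g z \<tau> \<le> 0"
    and int: "\<And>z \<tau>. norm z < \<rho> \<Longrightarrow> 0 < \<tau> \<Longrightarrow> \<tau> \<le> T \<Longrightarrow> \<forall>\<^sub>F h in nhds 0. g (z + h) \<tau> \<le> g z \<tau>
      \<Longrightarrow> \<exists>D\<le>0. (g z has_real_derivative D) (at \<tau>)"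
    and z: "norm z \<le> \<rho>" "0 \<le> \<tau>" "\<tau> \<le> T"
  shows "g z \<tau> \<le> 0"
proof (rule ccontr)
  assume "\<not> g z \<tau> \<le> 0"
  then have pos: "g z \<tau> > 0" by simp
  define e where "e = g z \<tau> / (2 * (T + 1))"
  have T: "T \<ge> 0" using z by simp
  have e: "e > 0" "e * T < g z \<tau>"
  proof -
    show "e > 0" using pos T by (simp add: e_def)
    have "e * T \<le> e * (2 * (T + 1)) / 2" using T \<open>e > 0\<close> by (simp add: algebra_simps)
    also have "\<dots> = g z \<tau> / 2" using T by (simp add: e_def)
    finally show "e * T < g z \<tau>" using pos by simp
  qed
  let ?G = "\<lambda>p. g (fst p) (snd p) - e * snd p" and ?S = "cball 0 \<rho> \<times> {0..T} :: ('a \<times> real) set"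
  have "continuous_on ?S ?G" by (intro continuous_intros cont)
  moreover have "compact ?S" by (intro compact_Times) auto
  moreover have zS: "(z, \<tau>) \<in> ?S" using z by auto
  ultimately obtain p where p: "p \<in> ?S" "\<And>q. q \<in> ?S \<Longrightarrow> ?G q \<le> ?G p"
    using continuous_attains_sup[of ?S ?G] by blast
  obtain z1 t1 where p1: "p = (z1, t1)" by (cases p)
  have in1: "norm z1 \<le> \<rho>" "0 \<le> t1" "t1 \<le> T" using p(1) by (auto simp: p1)
  have "e * \<tau> \<le> e * T" using e(1) z by simp
  then have "0 < g z \<tau> - e * \<tau>" using e(2) by linarith
  then have "0 < ?G (z, \<tau>)" by simp
  also have "\<dots> \<le> ?G p" by (rule p(2)[OF zS])
  finally have "0 < g z1 t1 - e * t1" by (simp add: p1)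
  moreover have "e * t1 \<ge> 0" using e(1) in1 by simp
  ultimately have g1: "g z1 t1 > 0" by linarith
  have n1: "norm z1 < \<rho>" using lat[of z1 t1] in1 g1 by force
  have t1: "t1 > 0" using init[of z1] in1 g1 by (cases "t1 = 0") auto
  have "\<forall>\<^sub>F h in nhds 0. g (z1 + h) t1 \<le> g z1 t1"
    unfolding eventually_nhds_0_norm
  proof (intro exI[of _ "\<rho> - norm z1"] conjI allI impI)
    fix h :: 'a assume "norm h < \<rho> - norm z1"
    then have "norm (z1 + h) \<le> \<rho>" using norm_triangle_ineq[of z1 h] by linarith
    then show "g (z1 + h) t1 \<le> g z1 t1" using p(2)[of "(z1 + h, t1)"] in1 by (auto simp: p1)
  qed (use n1 in simp)
  then obtain D where D: "D \<le> 0" "(g z1 has_real_derivative D) (at t1)"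
    using int[OF n1 t1 in1(3)] by blast
  have "((\<lambda>t. g z1 t - e * t) has_real_derivative D - e) (at t1)"
    using D(2) by (auto intro!: derivative_eq_intros)
  moreover have "D - e < 0" using D e by simp
  ultimately obtain d where d: "d > 0" "\<forall>h>0. h < d \<longrightarrow> g z1 t1 - e * t1 < g z1 (t1 - h) - e * (t1 - h)"
    using DERIV_neg_dec_left by blast
  define h where "h = min t1 (d/2)"
  have h: "h > 0" "h < d" "h \<le> t1" using t1 d(1) by (auto simp: h_def)
  then have "g z1 (t1 - h) - e * (t1 - h) \<le> g z1 t1 - e * t1"
    using p(2)[of "(z1, t1 - h)"] in1 by (auto simp: p1)
  with d(2) h show False by fastforce
qed

text \<open>A superjet without remainder: the usual \<open>o\<close> term is absorbed by adding a
  small multiple of \<open>(norm h)\<^sup>2\<close> to \<open>Q\<close>.\<close>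

definition jet_above :: "('a::euclidean_space \<Rightarrow> real) \<Rightarrow> 'a \<Rightarrow> 'a \<Rightarrow> ('a \<Rightarrow> real) \<Rightarrow> bool" where
  "jet_above f z B Q \<longleftrightarrow> (\<forall>\<^sub>F h in nhds 0. f (z + h) \<le> f z + B \<bullet> h + Q h)"

lemma jet_above_second_order:
  assumes so: "second_order \<phi> z l Q" and le: "\<forall>\<^sub>F h in nhds 0. f (z + h) - f z \<le> \<phi> (z + h) - \<phi> z"
    and e: "e > 0" and l: "l = (\<lambda>h. B \<bullet> h)"
  shows "jet_above f z B (\<lambda>h. Q h + e * (norm h)\<^sup>2)"
  using second_orderD(3)[OF so e] le unfolding jet_above_def
proof eventually_elim
  case (elim h) then show ?case unfolding l by linarith
qed

lemma le_of_forall_eps_mult: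
  assumes "\<And>e. e > 0 \<Longrightarrow> a \<le> b + e * (s::real)" shows "a \<le> b"
proof (rule tendsto_lowerbound)
  show "((\<lambda>e. b + e * s) \<longlongrightarrow> b) (at_right 0)" by (auto intro!: tendsto_eq_intros)
  show "\<forall>\<^sub>F e in at_right 0. a \<le> b + e * s"
    using eventually_at_right_less[of "0::real"] by eventually_elim (rule assms)
qed simp

text \<open>Here \<open>f\<close> is regarded as constant in time. At an interior maximum of the
  difference the expansion of \<open>H\<close> yields a jet of \<open>f\<close>, so \<open>c\<close>
  is at most the sum of the \<open>Q (\<sigma> j)\<close>; the supersolution inequality then gives
  the sign of the time derivative that \<open>parabolic_max\<close> asks for.\<close>

lemma jets_le_supercal:
  fixes f :: "'a::euclidean_space \<Rightarrow> real"
  assumes f: "continuous_on UNIV f"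
    and jets: "\<And>z B Q. norm z < \<rho> \<Longrightarrow> quadform Q \<Longrightarrow> jet_above f z B Q \<Longrightarrow> c \<le> (\<Sum>j\<in>I. Q (\<sigma> j))"
    and H: "supercal \<sigma> I c H"
    and init: "\<And>z. norm z \<le> \<rho> \<Longrightarrow> f z \<le> H z 0"
    and lat: "\<And>z \<tau>. norm z = \<rho> \<Longrightarrow> 0 \<le> \<tau> \<Longrightarrow> \<tau> \<le> T \<Longrightarrow> f z \<le> H z \<tau>"
    and z: "norm z \<le> \<rho>" "0 \<le> \<tau>" "\<tau> \<le> T"
  shows "f z \<le> H z \<tau>"
proof -
  have "f z - H z \<tau> \<le> 0"
  proof (rule parabolic_max[where \<rho>=\<rho> and T=T and g="\<lambda>z \<tau>. f z - H z \<tau>"])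
    have "continuous_on (cball 0 \<rho> \<times> {0..T}) (\<lambda>p. H (fst p) (snd p))"
      using H continuous_on_subset unfolding supercal_def by blast
    then show "continuous_on (cball 0 \<rho> \<times> {0..T}) (\<lambda>p. f (fst p) - H (fst p) (snd p))"
      by (intro continuous_intros continuous_on_compose2[OF f]) auto
    fix z1 and t1 :: real
    assume 1: "norm z1 < \<rho>" "0 < t1" "t1 \<le> T"
      and max: "\<forall>\<^sub>F h in nhds 0. f (z1 + h) - H (z1 + h) t1 \<le> f z1 - H z1 t1"
    obtain l Q D where so: "second_order (\<lambda>z. H z t1) z1 l Q" "(H z1 has_real_derivative D) (at t1)"
      "(\<Sum>j\<in>I. Q (\<sigma> j)) \<le> D + c"
      using H 1 unfolding supercal_def by (meson less_imp_le)
    obtain B where B: "l = (\<lambda>h. B \<bullet> h)" using linear_real_inner[OF second_orderD(1)[OF so(1)]] .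
    have max': "\<forall>\<^sub>F h in nhds 0. f (z1 + h) - f z1 \<le> H (z1 + h) t1 - H z1 t1"
      using max by eventually_elim simp
    have "c \<le> (\<Sum>j\<in>I. Q (\<sigma> j)) + e * (\<Sum>j\<in>I. (norm (\<sigma> j))\<^sup>2)" if e: "e > 0" for e
    proof -
      have "quadform (\<lambda>h. Q h + e * (norm h)\<^sup>2)"
        by (intro quadform_intros second_orderD(2)[OF so(1)])
      from jets[OF 1(1) this jet_above_second_order[OF so(1) max' e B]]
      show ?thesis by (simp add: sum.distrib sum_distrib_left)
    qed
    then have "c \<le> (\<Sum>j\<in>I. Q (\<sigma> j))" by (rule le_of_forall_eps_mult)
    then have "- D \<le> 0" using so(3) by simp
    moreover have "((\<lambda>\<tau>. f z1 - H z1 \<tau>) has_real_derivative - D) (at t1)"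
      using so(2) by (auto intro!: derivative_eq_intros)
    ultimately show "\<exists>D\<le>0. ((\<lambda>\<tau>. f z1 - H z1 \<tau>) has_real_derivative D) (at t1)" by blast
  qed (use init lat z in auto)
  then show ?thesis by simp
qed

text \<open>A flow is bounded while \<open>H\<close> grows, which supplies the lateral inequality on
  a large ball and so a comparison on the whole space. At a maximum the two quadratic forms are
  ordered, hence also their values along the \<open>\<sigma> j\<close>.\<close>

lemma trigflow_le_supercal:
  fixes h :: "'a::euclidean_space \<Rightarrow> real \<Rightarrow> real"
  assumes h: "h \<in> trigflow \<sigma> I" and H: "supercal \<sigma> I 0 H"
    and init: "\<And>z. h z 0 \<le> H z 0"
    and growth: "\<And>K. \<exists>\<rho>0. \<forall>z \<tau>. norm z \<ge> \<rho>0 \<longrightarrow> 0 \<le> \<tau> \<longrightarrow> \<tau> \<le> T \<longrightarrow> K \<le> H z \<tau>"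
    and \<tau>: "0 \<le> \<tau>" "\<tau> \<le> T"
  shows "h z \<tau> \<le> H z \<tau>"
proof -
  obtain K where K: "\<And>z \<tau>. 0 \<le> \<tau> \<Longrightarrow> \<bar>h z \<tau>\<bar> \<le> K" using trigflow_bounded[OF h] by blast
  obtain \<rho>0 where \<rho>0: "\<And>z \<tau>. norm z \<ge> \<rho>0 \<Longrightarrow> 0 \<le> \<tau> \<Longrightarrow> \<tau> \<le> T \<Longrightarrow> K \<le> H z \<tau>"
    using growth[of K] by blast
  define \<rho> where "\<rho> = max \<rho>0 (norm z)"
  have "h z \<tau> - H z \<tau> \<le> 0"
  proof (rule parabolic_max[where \<rho>=\<rho> and T=T and g="\<lambda>z \<tau>. h z \<tau> - H z \<tau>"])
    show "continuous_on (cball 0 \<rho> \<times> {0..T}) (\<lambda>p. h (fst p) (snd p) - H (fst p) (snd p))"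
      by (intro continuous_on_diff trigflow_continuous[OF h])
        (use H in \<open>auto simp: supercal_def intro: continuous_on_subset\<close>)
    show "h z \<tau> - H z \<tau> \<le> 0" if "norm z = \<rho>" "0 \<le> \<tau>" "\<tau> \<le> T" for z \<tau>
      using \<rho>0[of z \<tau>] K[of \<tau> z] that by (simp add: \<rho>_def abs_le_iff)
    fix z1 and t1 :: real
    assume 1: "0 < t1" and max: "\<forall>\<^sub>F k in nhds 0. h (z1 + k) t1 - H (z1 + k) t1 \<le> h z1 t1 - H z1 t1"
    obtain l Q D where so: "second_order (\<lambda>z. H z t1) z1 l Q" "(H z1 has_real_derivative D) (at t1)"
      "(\<Sum>j\<in>I. Q (\<sigma> j)) \<le> D + 0"
      using H 1 unfolding supercal_def by (meson less_imp_le)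
    obtain m R where so': "second_order (\<lambda>z. h z t1) z1 m R"
        "(h z1 has_real_derivative (\<Sum>j\<in>I. R (\<sigma> j))) (at t1)"
      using trigflow_heat[OF h] by blast
    have so2: "second_order (\<lambda>z. H z t1 - h z t1) z1 (\<lambda>k. l k - m k) (\<lambda>k. Q k - R k)"
      by (rule second_order_diff[OF so(1) so'(1)])
    have RQ: "R k \<le> Q k" for k
    proof -
      have "R k - Q k \<le> 0 + e * (norm k)\<^sup>2" if "e > 0" for e
      proof -
        have "\<forall>\<^sub>F k in nhds 0. 0 \<le> (l k - m k) + (Q k - R k + e * (norm k)\<^sup>2)"
          using second_orderD(3)[OF so2 that] max by eventually_elim linarith
        then have "0 \<le> Q k - R k + e * (norm k)\<^sup>2"
          by (rule nonneg_quadratic_imp(2)[rotated 2])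
            (use second_orderD(1,2)[OF so2] in \<open>auto intro!: quadform_intros\<close>)
        then show ?thesis by simp
      qed
      then show ?thesis using le_of_forall_eps_mult[of "R k - Q k" 0 "(norm k)\<^sup>2"] by simp
    qed
    have "(\<Sum>j\<in>I. R (\<sigma> j)) \<le> (\<Sum>j\<in>I. Q (\<sigma> j))" by (intro sum_mono RQ)
    then show "\<exists>D\<le>0. ((\<lambda>\<tau>. h z1 \<tau> - H z1 \<tau>) has_real_derivative D) (at t1)"
      using so so' by (intro exI[of _ "(\<Sum>j\<in>I. R (\<sigma> j)) - D"]) (auto intro!: DERIV_diff)
  qed (use init \<tau> in \<open>auto simp: \<rho>_def\<close>)
  then show ?thesis by simp
qed

text \<open>Used to make an inequality that holds near the origin global: a fourth power does not
  affect the expansion of second order at the origin.\<close>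

lemma local_le_quartic:
  fixes l Q :: "'c::euclidean_space \<Rightarrow> real"
  assumes l: "linear l" and Q: "quadform Q" and d: "d > 0" and K: "K \<ge> 0"
  obtains M where "M > 0" "\<And>H. norm H \<ge> d \<Longrightarrow> K \<le> l H + Q H + M * (norm H) ^ 4"
proof -
  obtain A where A: "A > 0" "\<And>h. \<bar>l h\<bar> \<le> A * norm h" using linear_bound_real[OF l] by blast
  obtain B where B: "B > 0" "\<And>h. \<bar>Q h\<bar> \<le> B * (norm h)\<^sup>2" using quadform_bound[OF Q] by blast
  define M where "M = K / d ^ 4 + A / d ^ 3 + B / d\<^sup>2"
  have "K \<le> l H + Q H + M * (norm H) ^ 4" if H: "norm H \<ge> d" for H
  proof -
    let ?n = "norm H"
    have n: "?n / d \<ge> 1" "?n > 0" using H d by auto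
    have "K * 1 \<le> K * (?n / d) ^ 4" using K n by (intro mult_left_mono one_le_power) auto
    moreover have "A * ?n * 1 \<le> A * ?n * (?n / d) ^ 3"
      using A n by (intro mult_left_mono one_le_power) auto
    moreover have "B * ?n\<^sup>2 * 1 \<le> B * ?n\<^sup>2 * (?n / d)\<^sup>2"
      using B n by (intro mult_left_mono one_le_power) auto
    moreover have "M * ?n ^ 4 = K * (?n / d) ^ 4 + A * ?n * (?n / d) ^ 3 + B * ?n\<^sup>2 * (?n / d)\<^sup>2"
      unfolding M_def by (simp add: power_divide field_simps eval_nat_numeral)
    ultimately show ?thesis using A(2)[of H] B(2)[of H] by (simp add: abs_le_iff)
  qed
  moreover have "M > 0" using A B K d by (auto simp: M_def intro!: add_nonneg_pos)
  ultimately show ?thesis using that by blast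
qed

text \<open>The flow lives on the whole space, but the jets of \<open>f\<close> are controlled only
  in the ball of radius \<open>\<rho>\<close>. The quartic barrier closes the gap on the sphere at a
  cost of order \<open>\<tau>\<^sup>2\<close> at the origin.\<close>

lemma jets_le_trigflow:
  fixes f :: "'a::euclidean_space \<Rightarrow> real"
  assumes f: "continuous_on UNIV f"
    and jets: "\<And>z B Q. norm z < \<rho> \<Longrightarrow> quadform Q \<Longrightarrow> jet_above f z B Q \<Longrightarrow> c \<le> (\<Sum>j\<in>I. Q (\<sigma> j))"
    and \<rho>: "0 < \<rho>" "\<rho> \<le> pi/2" and K0: "\<And>z. z \<in> cube \<Longrightarrow> \<bar>f z\<bar> \<le> K0"
    and C: "C = 3 * (\<Sum>j\<in>I. (norm (\<sigma> j))\<^sup>2)"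
    and h: "h \<in> trigflow \<sigma> I" "\<And>z. z \<in> cube \<Longrightarrow> \<bar>f z - h z 0\<bar> < e" "\<And>z. h (cfold z) 0 = h z 0"
    and e: "0 < e" "e < 1" and \<tau>: "0 \<le> \<tau>" "\<tau> \<le> 1"
  shows "f 0 \<le> h 0 \<tau> + e - c * \<tau> + (2 * K0 + 1 + \<bar>c\<bar>) / \<rho> ^ 4 * (C * \<tau>)\<^sup>2"
proof -
  \<comment> \<open>On the sphere the barrier has to cover the bound \<open>K0\<close> of
    \<open>f\<close>, the lower bound \<open>- (K0 + 1)\<close> of the flow and the drift, at most
    \<open>\<bar>c\<bar>\<close> up to time 1.\<close>
  define K2 where "K2 = (2 * K0 + 1 + \<bar>c\<bar>) / \<rho> ^ 4"
  have C0: "C \<ge> 0" unfolding C by (intro mult_nonneg_nonneg sum_nonneg) auto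
  have "\<bar>f 0\<bar> \<le> K0" by (rule K0) (simp add: cube_def)
  then have K0': "K0 \<ge> 0" by simp
  have K2: "K2 \<ge> 0" "K2 * \<rho> ^ 4 = 2 * K0 + 1 + \<bar>c\<bar>" using K0' \<rho> by (auto simp: K2_def)
  \<comment> \<open>Invariance under folding gives the bound at time 0 in the whole space. A quartic
    with a small coefficient provides the growth for the comparison and is then removed.\<close>
  have lower: "- (K0 + 1) \<le> h z \<tau>" if t0: "0 \<le> \<tau>" for z \<tau>
  proof -
    have "- h z \<tau> \<le> K0 + 1 + \<delta> * ((norm z)\<^sup>2 + C * \<tau>)\<^sup>2" if \<delta>: "\<delta> > 0" for \<delta>
    proof -
      have "-1 * h z \<tau> \<le> (K0 + 1 - 0 * \<tau>) + \<delta> * ((norm z)\<^sup>2 + C * \<tau>)\<^sup>2"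
      proof (rule trigflow_le_supercal[where \<sigma>=\<sigma> and I=I and T=\<tau> and h="\<lambda>z \<tau>. -1 * h z \<tau>"
            and H="\<lambda>z \<tau>. (K0 + 1 - 0 * \<tau>) + \<delta> * ((norm z)\<^sup>2 + C * \<tau>)\<^sup>2"])
        show "(\<lambda>z \<tau>. -1 * h z \<tau>) \<in> trigflow \<sigma> I" by (rule trigflow.cmult[OF h(1)])
        show "supercal \<sigma> I 0 (\<lambda>z \<tau>. (K0 + 1 - 0 * \<tau>) + \<delta> * ((norm z)\<^sup>2 + C * \<tau>)\<^sup>2)"
          using supercal_add[OF supercal_affine[of \<sigma> I 0 "K0 + 1"] supercal_quartic[OF less_imp_le[OF \<delta>] C]]
          by simp
        show "-1 * h z 0 \<le> (K0 + 1 - 0 * 0) + \<delta> * ((norm z)\<^sup>2 + C * 0)\<^sup>2" for z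
        proof -
          have "\<bar>f (cfold z) - h z 0\<bar> < e" using h(2)[OF cfold_in_cube, of z] h(3) by simp
          moreover have "0 \<le> \<delta> * ((norm z)\<^sup>2 + C * 0)\<^sup>2" using \<delta> by simp
          ultimately show ?thesis using K0[OF cfold_in_cube, of z] e by linarith
        qed
        show "\<exists>\<rho>0. \<forall>(z::'a) s. \<rho>0 \<le> norm z \<longrightarrow> 0 \<le> s \<longrightarrow> s \<le> \<tau> \<longrightarrow>
             K \<le> (K0 + 1 - 0 * s) + \<delta> * ((norm z)\<^sup>2 + C * s)\<^sup>2" for K
        proof (intro exI[of _ "1 + \<bar>K\<bar> / \<delta>"] allI impI)
          fix z :: 'a and s :: real assume z: "1 + \<bar>K\<bar> / \<delta> \<le> norm z" and s: "0 \<le> s"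
          have "\<bar>K\<bar> / \<delta> \<ge> 0" using \<delta> by simp
          then have n: "norm z \<ge> 1" "\<bar>K\<bar> / \<delta> \<le> norm z" using z by linarith+
          have "norm z \<le> (norm z)\<^sup>2" using n(1) by (simp add: self_le_power)
          also have "\<dots> \<le> (norm z)\<^sup>2 + C * s" using C0 s by simp
          also have "\<dots> \<le> ((norm z)\<^sup>2 + C * s)\<^sup>2"
            using n(1) calculation by (intro self_le_power) auto
          finally have "\<bar>K\<bar> / \<delta> \<le> ((norm z)\<^sup>2 + C * s)\<^sup>2" using n(2) by linarith
          then have "\<delta> * (\<bar>K\<bar> / \<delta>) \<le> \<delta> * ((norm z)\<^sup>2 + C * s)\<^sup>2"
            using \<delta> by (intro mult_left_mono) auto
          then show "K \<le> (K0 + 1 - 0 * s) + \<delta> * ((norm z)\<^sup>2 + C * s)\<^sup>2"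
            using \<delta> K0' by simp
        qed
      qed (use t0 in auto)
      then show ?thesis by simp
    qed
    then have "- h z \<tau> \<le> K0 + 1" by (rule le_of_forall_eps_mult)
    then show ?thesis by simp
  qed
  have "f 0 \<le> h 0 \<tau> + (e - c * \<tau>) + K2 * ((norm (0::'a))\<^sup>2 + C * \<tau>)\<^sup>2"
  proof (rule jets_le_supercal[OF f jets, where T=1
        and H="\<lambda>z \<tau>. h z \<tau> + (e - c * \<tau>) + K2 * ((norm z)\<^sup>2 + C * \<tau>)\<^sup>2"])
    show "supercal \<sigma> I c (\<lambda>z \<tau>. h z \<tau> + (e - c * \<tau>) + K2 * ((norm z)\<^sup>2 + C * \<tau>)\<^sup>2)"
      using supercal_add[OF supercal_add[OF supercal_trigflow[OF h(1)] supercal_affine[of \<sigma> I c e]]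
          supercal_quartic[OF K2(1) C]] by simp
    show "f z \<le> h z 0 + (e - c * 0) + K2 * ((norm z)\<^sup>2 + C * 0)\<^sup>2" if "norm z \<le> \<rho>" for z
    proof -
      have "\<bar>f z - h z 0\<bar> < e" using that \<rho> by (intro h(2) norm_imp_cube) auto
      moreover have "0 \<le> K2 * ((norm z)\<^sup>2 + C * 0)\<^sup>2" using K2 by simp
      ultimately show ?thesis by linarith
    qed
    show "f z \<le> h z \<tau> + (e - c * \<tau>) + K2 * ((norm z)\<^sup>2 + C * \<tau>)\<^sup>2"
      if z: "norm z = \<rho>" and \<tau>: "0 \<le> \<tau>" "\<tau> \<le> 1" for z \<tau>
    proof -
      have "\<bar>f z\<bar> \<le> K0" using z \<rho> by (intro K0 norm_imp_cube) auto
      moreover have "K2 * \<rho> ^ 4 \<le> K2 * ((norm z)\<^sup>2 + C * \<tau>)\<^sup>2"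
      proof (rule mult_left_mono[OF _ K2(1)])
        have "\<rho> ^ 4 = (\<rho>\<^sup>2)\<^sup>2" by simp
        also have "\<dots> \<le> ((norm z)\<^sup>2 + C * \<tau>)\<^sup>2" using z C0 \<tau> by (intro power_mono) auto
        finally show "\<rho> ^ 4 \<le> ((norm z)\<^sup>2 + C * \<tau>)\<^sup>2" .
      qed
      moreover have "c * \<tau> \<le> \<bar>c\<bar>"
      proof -
        have "c * \<tau> \<le> \<bar>c\<bar> * 1" using \<tau> by (intro mult_mono) auto
        then show ?thesis by simp
      qed
      ultimately show ?thesis using lower[OF \<tau>(1), of z] K2(2) e by linarith
    qed
  qed (use \<tau> \<rho> in auto)
  then show ?thesis by (simp add: K2_def)
qed

text \<open>A quadratic function evolves exactly, at the rate given by its values on the pairs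
  \<open>(\<sigma> j, \<sigma>' j)\<close>. With the quartic term it is a supersolution in the
  product space that starts above the sum of the initial values.\<close>

lemma trigflow_sum_le:
  fixes f :: "'a::euclidean_space \<Rightarrow> real" and g :: "'b::euclidean_space \<Rightarrow> real"
  assumes h1: "h1 \<in> trigflow \<sigma> I" "\<And>z. z \<in> cube \<Longrightarrow> \<bar>f z - h1 z 0\<bar> < e" "\<And>z. h1 (cfold z) 0 = h1 z 0"
    and h2: "h2 \<in> trigflow \<sigma>' I" "\<And>z. z \<in> cube \<Longrightarrow> \<bar>g z - h2 z 0\<bar> < e" "\<And>z. h2 (cfold z) 0 = h2 z 0"
    and l: "linear l" and Q: "quadform Q" and M: "M > 0"
    and le: "\<And>z z'. f (cfold z) + g (cfold z') \<le> a + l (z, z') + Q (z, z') + M * (norm (z, z')) ^ 4"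
    and C: "C = 3 * (\<Sum>j\<in>I. (norm (\<sigma> j, \<sigma>' j))\<^sup>2)" and \<tau>: "0 \<le> \<tau>"
  shows "h1 0 \<tau> + h2 0 \<tau> \<le> a + 2 * e + \<tau> * (\<Sum>j\<in>I. Q (\<sigma> j, \<sigma>' j)) + M * (C * \<tau>)\<^sup>2"
proof -
  let ?S = "\<Sum>j\<in>I. Q (\<sigma> j, \<sigma>' j)"
  let ?H = "\<lambda>Z \<tau>. (l Z + Q Z + \<tau> * ?S) + ((a + 2 * e - 0 * \<tau>) + M * ((norm Z)\<^sup>2 + C * \<tau>)\<^sup>2)"
  have C0: "C \<ge> 0" unfolding C by (intro mult_nonneg_nonneg sum_nonneg) auto
  have "h1 (fst (0::'a\<times>'b)) \<tau> + h2 (snd (0::'a\<times>'b)) \<tau> \<le> ?H 0 \<tau>"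
  proof (rule trigflow_le_supercal[where \<sigma>="\<lambda>j. (\<sigma> j, \<sigma>' j)" and I=I and T=\<tau>
        and h="\<lambda>Z \<tau>. h1 (fst Z) \<tau> + h2 (snd Z) \<tau>" and H="?H"])
    show "(\<lambda>Z \<tau>. h1 (fst Z) \<tau> + h2 (snd Z) \<tau>) \<in> trigflow (\<lambda>j. (\<sigma> j, \<sigma>' j)) I"
      by (intro trigflow.add trigflow_pair_fst trigflow_pair_snd h1 h2)
    show "supercal (\<lambda>j. (\<sigma> j, \<sigma>' j)) I 0 ?H"
      using supercal_add[OF supercal_quadratic[OF l Q] supercal_add[OF supercal_affine[of _ I 0 "a + 2 * e"]
          supercal_quartic[OF less_imp_le[OF M] C]]] by simp
    show "h1 (fst Z) 0 + h2 (snd Z) 0 \<le> ?H Z 0" for Z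
    proof -
      obtain z z' where Z: "Z = (z, z')" by (cases Z)
      have "\<bar>f (cfold z) - h1 z 0\<bar> < e" "\<bar>g (cfold z') - h2 z' 0\<bar> < e"
        using h1(2)[OF cfold_in_cube, of z] h2(2)[OF cfold_in_cube, of z'] h1(3) h2(3) by simp_all
      moreover have "((norm Z)\<^sup>2 + C * 0)\<^sup>2 = norm (z, z') ^ 4" by (simp add: Z)
      ultimately show ?thesis using le[of z z'] by (simp add: Z)
    qed
    show "\<exists>\<rho>0. \<forall>Z s. \<rho>0 \<le> norm Z \<longrightarrow> 0 \<le> s \<longrightarrow> s \<le> \<tau> \<longrightarrow> K \<le> ?H Z s" for K
    proof -
      define K' where "K' = \<bar>K\<bar> + \<bar>\<tau> * ?S\<bar> + \<bar>a + 2 * e\<bar>"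
      obtain A where A: "A > 0" "\<And>h. \<bar>l h\<bar> \<le> A * norm h" using linear_bound_real[OF l] by blast
      obtain B where B: "B > 0" "\<And>h. \<bar>Q h\<bar> \<le> B * (norm h)\<^sup>2" using quadform_bound[OF Q] by blast
      have K': "K' \<ge> 0" by (simp add: K'_def)
      show ?thesis
      proof (intro exI[of _ "1 + (K' + A + B) / M"] allI impI)
        fix Z :: "'a \<times> 'b" and s :: real
        assume Z: "1 + (K' + A + B) / M \<le> norm Z" and s: "0 \<le> s" "s \<le> \<tau>"
        let ?n = "norm Z"
        have "(K' + A + B) / M \<ge> 0" using A B K' M by simp
        then have n: "?n \<ge> 1" "(K' + A + B) / M \<le> ?n" using Z by linarith+
        have n2: "?n \<le> ?n\<^sup>2" "1 \<le> ?n\<^sup>2" using n(1) by (auto simp: self_le_power)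
        have "K' + A + B \<le> M * ?n\<^sup>2"
        proof -
          have "M * ((K' + A + B) / M) \<le> M * ?n\<^sup>2" using n n2 M by (intro mult_left_mono) auto
          then show ?thesis using M by simp
        qed
        then have "(K' + A + B) * ?n\<^sup>2 \<le> M * ?n\<^sup>2 * ?n\<^sup>2" by (rule mult_right_mono) simp
        also have "\<dots> = M * (?n\<^sup>2)\<^sup>2" by (simp add: power2_eq_square)
        also have "\<dots> \<le> M * (?n\<^sup>2 + C * s)\<^sup>2"
          using M C0 s by (intro mult_left_mono power_mono) auto
        finally have 1: "K' * ?n\<^sup>2 + A * ?n\<^sup>2 + B * ?n\<^sup>2 \<le> M * (?n\<^sup>2 + C * s)\<^sup>2"
          by (simp add: algebra_simps)
        have "K' * 1 \<le> K' * ?n\<^sup>2" "A * ?n \<le> A * ?n\<^sup>2"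
          using K' A n2 by (intro mult_left_mono; simp)+
        moreover have "\<bar>s * ?S\<bar> \<le> \<bar>\<tau> * ?S\<bar>" unfolding abs_mult using s by (intro mult_right_mono) auto
        moreover have "K + \<bar>\<tau> * ?S\<bar> + \<bar>a + 2 * e\<bar> \<le> K'" by (simp add: K'_def)
        ultimately show "K \<le> ?H Z s" using 1 A(2)[of Z] B(2)[of Z] by linarith
      qed
    qed
  qed (use \<tau> in auto)
  then show ?thesis by (simp add: linear_0[OF l] quadform_0[OF Q])
qed

text \<open>This replaces the theorem on sums for operators with constant coefficients: cross terms are free,
  because the heat flow of a sum of functions of separate variables does not see them.\<close>

lemma jets_of_sum:
  fixes f :: "'a::euclidean_space \<Rightarrow> real" and g :: "'b::euclidean_space \<Rightarrow> real"
  assumes f: "continuous_on UNIV f" and g: "continuous_on UNIV g" and \<rho>: "0 < \<rho>"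
    and jf: "\<And>z B Q. norm z < \<rho> \<Longrightarrow> quadform Q \<Longrightarrow> jet_above f z B Q \<Longrightarrow> c \<le> (\<Sum>j\<in>I. Q (\<sigma> j))"
    and jg: "\<And>z B Q. norm z < \<rho> \<Longrightarrow> quadform Q \<Longrightarrow> jet_above g z B Q \<Longrightarrow> c' \<le> (\<Sum>j\<in>I. Q (\<sigma>' j))"
    and l: "linear l" and Q: "quadform Q"
    and max: "\<forall>\<^sub>F H in nhds 0. f (fst H) + g (snd H) \<le> f 0 + g 0 + l H + Q H"
  shows "c + c' \<le> (\<Sum>j\<in>I. Q (\<sigma> j, \<sigma>' j))"
proof -
  let ?S = "\<Sum>j\<in>I. Q (\<sigma> j, \<sigma>' j)"
  obtain Kf where Kf: "\<And>z. z \<in> cube \<Longrightarrow> \<bar>f z\<bar> \<le> Kf" using bounded_on_cube[OF f] by blast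
  obtain Kg where Kg: "\<And>z. z \<in> cube \<Longrightarrow> \<bar>g z\<bar> \<le> Kg" using bounded_on_cube[OF g] by blast
  have c0: "0 \<in> cube" by (simp add: cube_def)
  have K0: "Kf \<ge> 0" "Kg \<ge> 0" using Kf[OF c0] Kg[OF c0] by linarith+
  obtain d0 where d0: "d0 > 0" "\<And>H. norm H < d0 \<Longrightarrow> f (fst H) + g (snd H) \<le> f 0 + g 0 + l H + Q H"
    using max unfolding eventually_nhds_0_norm by blast
  define d where "d = min d0 (pi/2)"
  have d: "d > 0" "d \<le> d0" "d \<le> pi/2" using d0 by (auto simp: d_def)
  obtain M where M: "M > 0" "\<And>H. norm H \<ge> d \<Longrightarrow> 2 * (Kf + Kg) \<le> l H + Q H + M * (norm H) ^ 4"
    using local_le_quartic[OF l Q d(1), of "2 * (Kf + Kg)"] K0 by auto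
  \<comment> \<open>Near the origin folding is the identity and the local maximum applies; farther
    away the quartic term compensates twice the sum of the two bounds.\<close>
  have le: "f (cfold z) + g (cfold z') \<le> (f 0 + g 0) + l (z, z') + Q (z, z') + M * (norm (z, z')) ^ 4" for z z'
  proof (cases "norm (z, z') < d")
    case True
    have "norm z \<le> norm (z, z')" "norm z' \<le> norm (z, z')" by (auto simp: norm_Pair)
    then have "z \<in> cube" "z' \<in> cube" using True d by (auto intro!: norm_imp_cube)
    then have "f (cfold z) + g (cfold z') \<le> f 0 + g 0 + l (z, z') + Q (z, z')"
      using d0(2)[of "(z, z')"] True d by (simp add: cfold_cube)
    moreover have "0 \<le> M * (norm (z, z')) ^ 4" using M by simp
    ultimately show ?thesis by linarith
  next
    case False
    then have "d \<le> norm (z, z')" by simp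
    have "f (cfold z) \<le> Kf" "g (cfold z') \<le> Kg" "- Kf \<le> f 0" "- Kg \<le> g 0"
      using Kf[OF cfold_in_cube, of z] Kg[OF cfold_in_cube, of z'] Kf[OF c0] Kg[OF c0]
      unfolding abs_le_iff by linarith+
    note a1 = add_mono[OF this(1,2)] and a2 = add_mono[OF this(3,4)]
    have "Kf + Kg = (- Kf + - Kg) + 2 * (Kf + Kg)" by simp
    also have "\<dots> \<le> (f 0 + g 0) + (l (z, z') + Q (z, z') + M * (norm (z, z')) ^ 4)"
      by (rule add_mono[OF a2 M(2)[OF \<open>d \<le> norm (z, z')\<close>]])
    finally show ?thesis using a1 by (simp only: add.assoc)
  qed
  define r where "r = min \<rho> (pi/2)"
  have r: "0 < r" "r \<le> \<rho>" "r \<le> pi/2" using \<rho> by (auto simp: r_def)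
  define C1 where "C1 = 3 * (\<Sum>j\<in>I. (norm (\<sigma> j))\<^sup>2)"
  define C2 where "C2 = 3 * (\<Sum>j\<in>I. (norm (\<sigma>' j))\<^sup>2)"
  define C3 where "C3 = 3 * (\<Sum>j\<in>I. (norm (\<sigma> j, \<sigma>' j))\<^sup>2)"
  define X where "X = (2 * Kf + 1 + \<bar>c\<bar>) / r ^ 4 * C1\<^sup>2 + (2 * Kg + 1 + \<bar>c'\<bar>) / r ^ 4 * C2\<^sup>2 + M * C3\<^sup>2"
  \<comment> \<open>The values of \<open>f\<close> and \<open>g\<close> at the origin lie below
    their flows, and the sum of the flows lies below the evolved quadratic. As \<open>X\<close> does
    not involve the approximants, \<open>e\<close> may tend to 0 at fixed \<open>\<tau>\<close>;
    division by \<open>\<tau>\<close> and the limit of small times then finish the proof.\<close>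
  have main: "(c + c') * \<tau> \<le> \<tau> * ?S + X * \<tau>\<^sup>2 + 4 * e"
    if e: "0 < e" "e < 1" and \<tau>: "0 \<le> \<tau>" "\<tau> \<le> 1" for e \<tau>
  proof -
    obtain h1 where h1: "h1 \<in> trigflow \<sigma> I" "\<And>z. z \<in> cube \<Longrightarrow> \<bar>f z - h1 z 0\<bar> < e" "\<And>z. h1 (cfold z) 0 = h1 z 0"
      using trig_approx[OF f e(1)] by blast
    obtain h2 where h2: "h2 \<in> trigflow \<sigma>' I" "\<And>z. z \<in> cube \<Longrightarrow> \<bar>g z - h2 z 0\<bar> < e" "\<And>z. h2 (cfold z) 0 = h2 z 0"
      using trig_approx[OF g e(1)] by blast
    have 1: "f 0 \<le> h1 0 \<tau> + e - c * \<tau> + (2 * Kf + 1 + \<bar>c\<bar>) / r ^ 4 * (C1 * \<tau>)\<^sup>2"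
      by (rule jets_le_trigflow[OF f jf r(1,3) Kf C1_def h1 e \<tau>]) (use r in auto)
    have 2: "g 0 \<le> h2 0 \<tau> + e - c' * \<tau> + (2 * Kg + 1 + \<bar>c'\<bar>) / r ^ 4 * (C2 * \<tau>)\<^sup>2"
      by (rule jets_le_trigflow[OF g jg r(1,3) Kg C2_def h2 e \<tau>]) (use r in auto)
    have 3: "h1 0 \<tau> + h2 0 \<tau> \<le> (f 0 + g 0) + 2 * e + \<tau> * ?S + M * (C3 * \<tau>)\<^sup>2"
      by (rule trigflow_sum_le[OF h1 h2 l Q M(1) le C3_def \<tau>(1)])
    have "X * \<tau>\<^sup>2 = (2 * Kf + 1 + \<bar>c\<bar>) / r ^ 4 * (C1 * \<tau>)\<^sup>2 + (2 * Kg + 1 + \<bar>c'\<bar>) / r ^ 4 * (C2 * \<tau>)\<^sup>2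
        + M * (C3 * \<tau>)\<^sup>2"
      unfolding X_def power_mult_distrib by (simp add: distrib_right mult.assoc)
    then show ?thesis using 1 2 3 by (simp add: distrib_right)
  qed
  have "c + c' \<le> ?S + \<tau> * X" if \<tau>: "0 < \<tau>" "\<tau> < 1" for \<tau>
  proof -
    have "(c + c') * \<tau> \<le> \<tau> * ?S + X * \<tau>\<^sup>2 + e * 4" if "e > 0" for e
    proof -
      have "(c + c') * \<tau> \<le> \<tau> * ?S + X * \<tau>\<^sup>2 + 4 * min e (1/2)" using that \<tau> by (intro main) auto
      then show ?thesis by linarith
    qed
    then have "(c + c') * \<tau> \<le> \<tau> * ?S + X * \<tau>\<^sup>2" by (rule le_of_forall_eps_mult)
    then have "\<tau> * (c + c') \<le> \<tau> * (?S + \<tau> * X)" by (simp add: algebra_simps power2_eq_square)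
    then show ?thesis using \<tau> by simp
  qed
  moreover have "((\<lambda>\<tau>. ?S + \<tau> * X) \<longlongrightarrow> ?S) (at_right 0)" by (auto intro!: tendsto_eq_intros)
  moreover have "\<forall>\<^sub>F \<tau> in at_right 0. 0 < \<tau> \<and> \<tau> < (1::real)"
    by (intro eventually_conj eventually_at_right_less) (auto intro: order_tendstoD tendsto_ident_at)
  ultimately show ?thesis
    by (intro tendsto_lowerbound[where F="at_right 0" and f="\<lambda>\<tau>. ?S + \<tau> * X"]) (auto elim: eventually_mono)
qed

section \<open>Viscosity solutions and second order jets\<close>

lemma gradient_eq:
  fixes f :: "real ^ 'n \<Rightarrow> real"
  assumes "(f has_derivative (\<lambda>h. g \<bullet> h)) (at x)" shows "gradient f x = g"
  unfolding gradient_def frechet_derivative_at[OF assms, symmetric]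
  by (simp add: vec_eq_iff inner_axis)

lemma p_laplacian_eq:
  fixes f :: "real ^ 'n \<Rightarrow> real"
  assumes f: "\<And>y. (f has_derivative (\<lambda>h. g y \<bullet> h)) (at y)" and g: "(g has_derivative H) (at x)"
    and nz: "g x \<noteq> 0"
  shows "p_laplacian p f x = norm (g x) powr (p - 2) * ((\<Sum>i\<in>UNIV. axis i 1 \<bullet> H (axis i 1))
     + (p - 2) * ((g x /\<^sub>R norm (g x)) \<bullet> H (g x /\<^sub>R norm (g x))))"
proof -
  let ?N = "norm (g x)"
  have N: "?N > 0" using nz by simp
  have grad: "gradient f = g" using gradient_eq[OF f] by blast
  have lin: "linear H" using g by (rule has_derivative_linear)
  have "((\<lambda>y. norm (g y)) has_derivative (\<lambda>h. H h \<bullet> sgn (g x))) (at x)"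
    using has_derivative_compose[OF g has_derivative_norm[OF nz]] by simp
  then have "((\<lambda>y. norm (g y) powr (p - 2)) has_derivative
      (\<lambda>h. (H h \<bullet> sgn (g x)) * ((p - 2) * ?N powr (p - 2 - 1)))) (at x)"
    by (rule DERIV_compose_FDERIV[rotated]) (use N in \<open>auto intro!: DERIV_powr[THEN DERIV_cong] derivative_eq_intros\<close>)
  then have der: "((\<lambda>y. norm (g y) powr (p - 2) *\<^sub>R g y) has_derivative
      (\<lambda>h. ?N powr (p - 2) *\<^sub>R H h + ((H h \<bullet> sgn (g x)) * ((p - 2) * ?N powr (p - 2 - 1))) *\<^sub>R g x)) (at x)"
    using g by (rule has_derivative_scaleR)
  have "p_laplacian p f x = (\<Sum>i\<in>UNIV. ?N powr (p - 2) * (H (axis i 1) $ i)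
      + (H (axis i 1) \<bullet> sgn (g x)) * ((p - 2) * ?N powr (p - 2 - 1)) * (g x $ i))"
    unfolding p_laplacian_def divergence_def trace_def jacobian_def grad
      frechet_derivative_at[OF der, symmetric] matrix_def by simp
  also have "\<dots> = ?N powr (p - 2) * (\<Sum>i\<in>UNIV. axis i 1 \<bullet> H (axis i 1))
     + (p - 2) * ?N powr (p - 2 - 1) * (\<Sum>i\<in>UNIV. (H (axis i 1) \<bullet> sgn (g x)) * (g x $ i))"
    by (simp add: sum.distrib sum_distrib_left sum_distrib_right inner_axis' mult_ac)
  also have "(\<Sum>i\<in>UNIV. (H (axis i 1) \<bullet> sgn (g x)) * (g x $ i)) = H (g x) \<bullet> sgn (g x)"
  proof -
    have "H (g x) = H (\<Sum>i\<in>UNIV. (g x $ i) *\<^sub>R axis i 1)"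
      by (rule arg_cong[of _ _ H]) (simp add: vec_eq_iff axis_def if_distrib cong: if_cong)
    also have "\<dots> = (\<Sum>i\<in>UNIV. (g x $ i) *\<^sub>R H (axis i 1))"
      by (simp add: linear_sum[OF lin] linear_scale[OF lin])
    finally show ?thesis by (simp add: inner_sum_left mult.commute)
  qed
  also have "H (g x) \<bullet> sgn (g x) = ?N * ((g x /\<^sub>R ?N) \<bullet> H (g x /\<^sub>R ?N))"
    using N by (simp add: linear_scale[OF lin] sgn_div_norm inner_commute)
  also have "?N powr (p - 2 - 1) = ?N powr (p - 2) / ?N" using N by (simp only: powr_diff[of _ "p - 2" 1]) simp
  finally have eq: "p_laplacian p f x = ?N powr (p - 2) * (\<Sum>i\<in>UNIV. axis i 1 \<bullet> H (axis i 1))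
     + (p - 2) * (?N powr (p - 2) / ?N) * (?N * ((g x /\<^sub>R ?N) \<bullet> H (g x /\<^sub>R ?N)))" .
  have "(p - 2) * (v / ?N) * (?N * q) = v * ((p - 2) * q)" for v q :: real using N by simp
  then show ?thesis unfolding eq by (simp only: distrib_left)
qed

text \<open>The p-Laplacian written out at the gradient \<open>\<xi>\<close>, applied to the space
  part of \<open>Q\<close>. If \<open>Q\<close> is half the Hessian form, this is half the
  p-Laplacian.\<close>

definition Vq :: "real \<Rightarrow> real ^ 'n \<Rightarrow> ((real ^ 'n) \<times> real \<Rightarrow> real) \<Rightarrow> real" where
  "Vq p \<xi> Q = norm \<xi> powr (p - 2) *
     ((\<Sum>i\<in>UNIV. Q (axis i 1, 0)) + (p - 2) * Q (\<xi> /\<^sub>R norm \<xi>, 0))"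

lemma Vq_add: "Vq p \<xi> (\<lambda>h. Q h + R h) = Vq p \<xi> Q + Vq p \<xi> R"
  by (simp add: Vq_def sum.distrib algebra_simps)

lemma Vq_cmult: "Vq p \<xi> (\<lambda>h. c * Q h) = c * Vq p \<xi> Q"
  by (simp add: Vq_def sum_distrib_left[symmetric] algebra_simps)

section \<open>Exponential test functions\<close>

lemma C2_onI:
  fixes \<phi> :: "'b::euclidean_space \<Rightarrow> real"
  assumes "\<And>w. (\<phi> has_derivative (\<lambda>h. g w \<bullet> h)) (at w)" "\<And>w. (g has_derivative H w) (at w)"
    and "\<And>h. continuous_on UNIV (\<lambda>w. H w h)"
  shows "C2_on S \<phi>"
proof -
  have bl: "bounded_linear (H w)" for w using assms(2) by (rule has_derivative_bounded_linear)
  define H' where "H' w = Blinfun (H w)" for w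
  have H': "blinfun_apply (H' w) = H w" for w
    unfolding H'_def by (rule bounded_linear_Blinfun_apply[OF bl])
  define J where "J = Blinfun (blinfun_inner_right :: 'b \<Rightarrow> 'b \<Rightarrow>\<^sub>L real)"
  have J: "blinfun_apply J = blinfun_inner_right"
    unfolding J_def by (rule bounded_linear_Blinfun_apply[OF bounded_linear_blinfun_inner_right])
  show ?thesis unfolding C2_on_def
  proof (intro exI[of _ "\<lambda>w. blinfun_inner_right (g w)"] exI[of _ "\<lambda>w. J o\<^sub>L H' w"] conjI ballI)
    fix w
    show "(\<phi> has_derivative blinfun_apply (blinfun_inner_right (g w))) (at w)"
      using assms(1)[of w] by simp
    have "((\<lambda>w. blinfun_inner_right (g w)) has_derivative (\<lambda>k. blinfun_inner_right (H w k))) (at w)"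
      by (rule bounded_linear.has_derivative[OF bounded_linear_blinfun_inner_right assms(2)])
    moreover have "blinfun_apply (J o\<^sub>L H' w) = (\<lambda>k. blinfun_inner_right (H w k))"
      by (auto simp: J H')
    ultimately show "((\<lambda>w. blinfun_inner_right (g w)) has_derivative blinfun_apply (J o\<^sub>L H' w)) (at w)"
      by simp
  next
    have "continuous_on S H'"
      by (rule continuous_on_blinfun_componentwise)
        (use assms(3) in \<open>auto simp: H' intro: continuous_on_subset\<close>)
    then show "continuous_on S (\<lambda>w. J o\<^sub>L H' w)"
      by (intro bounded_bilinear.continuous_on[OF bounded_bilinear_blinfun_compose] continuous_intros)
  qed
qed

text \<open>Only along a nontrivial filter does a limit determine the \<open>Liminf\<close> and
  \<open>Limsup\<close> of the definitions; moving along a basis vector leaves the axis.\<close>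

lemma at_off_axis_neq_bot:
  fixes z :: "(real ^ 'n) \<times> real"
  shows "at_off_axis z \<noteq> bot"
proof -
  obtain x t where z: "z = (x :: real ^ 'n, t)" by (cases z)
  obtain b :: "real ^ 'n" where b: "b \<in> Basis" using nonempty_Basis by blast
  have "z islimpt {w. fst w \<noteq> fst z}"
    unfolding islimpt_approachable
  proof (intro allI impI)
    fix e :: real assume e: "e > 0"
    let ?w = "(x + (e/2) *\<^sub>R b, t)"
    have "b \<noteq> 0" using b by (rule nonzero_Basis)
    then have "fst ?w \<noteq> fst z" "?w \<noteq> z" using e by (auto simp: z)
    moreover have "dist ?w z < e" using e b by (simp add: z dist_Pair_Pair dist_norm)
    ultimately show "\<exists>w\<in>{w. fst w \<noteq> fst z}. w \<noteq> z \<and> dist w z < e" by blast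
  qed
  then show ?thesis unfolding at_off_axis_def by (simp add: trivial_limit_within)
qed

text \<open>The transformation \<open>\<phi> = exp (s * \<psi>)\<close> with \<open>s = 1\<close> or \<open>s = -1\<close> turns Trudinger's operator into an
  operator independent of the values of \<open>\<psi>\<close>, and treats sub- and supersolutions simultaneously.\<close>

lemma trudinger_op_exp:
  fixes \<psi> :: "(real ^ 'n) \<times> real \<Rightarrow> real"
  assumes \<psi>: "\<And>w. (\<psi> has_derivative (\<lambda>h. G w \<bullet> h)) (at w)" and G: "\<And>w. (G has_derivative H w) (at w)"
    and s: "s * s = 1" and nz: "fst (G w) \<noteq> 0"
  shows "trudinger_op p (\<lambda>w. exp (s * \<psi> w)) w = s * exp ((p - 1) * (s * \<psi> w)) *
     ((p - 1) * (snd (G w) - s * norm (fst (G w)) powr p) - Vq p (fst (G w)) (\<lambda>h. h \<bullet> H w h))"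
proof -
  obtain x t where w: "w = (x, t)" by (cases w)
  define \<xi> where "\<xi> = fst (G w)"
  define e where "e = exp (s * \<psi> w)"
  have e: "e > 0" by (simp add: e_def)
  have as: "\<bar>s\<bar> = 1" using s by (metis abs_mult_self_eq abs_one mult.right_neutral power2_eq_1_iff power2_eq_square abs_minus_cancel)
  have time: "deriv (\<lambda>r. \<bar>exp (s * \<psi> (x, r))\<bar> powr (p - 2) * exp (s * \<psi> (x, r))) t
      = (p - 1) * s * snd (G w) * exp ((p - 1) * (s * \<psi> w))"
  proof -
    have "((\<lambda>r. \<psi> (x, r)) has_derivative (\<lambda>h. G (x, t) \<bullet> (0, h))) (at t)"
      by (rule has_derivative_compose[where f="\<lambda>r. (x, r)", OF _ \<psi>]) (auto intro!: derivative_eq_intros)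
    then have "((\<lambda>r. \<psi> (x, r)) has_real_derivative snd (G w)) (at t)"
      by (simp add: has_field_derivative_def w inner_prod_def mult.commute[of _ "snd (G (x, t))"])
    then have "((\<lambda>r. exp ((p - 1) * (s * \<psi> (x, r)))) has_real_derivative
        (p - 1) * s * snd (G w) * exp ((p - 1) * (s * \<psi> w))) (at t)"
      by (auto intro!: derivative_eq_intros simp: w)
    moreover have "(\<lambda>r. \<bar>exp (s * \<psi> (x, r))\<bar> powr (p - 2) * exp (s * \<psi> (x, r)))
      = (\<lambda>r. exp ((p - 1) * (s * \<psi> (x, r))))"
      by (auto simp: powr_def exp_add[symmetric] algebra_simps)
    ultimately show ?thesis by (simp add: DERIV_imp_deriv)
  qed
  let ?f = "\<lambda>y. exp (s * \<psi> (y, t))" and ?g = "\<lambda>y. (s * exp (s * \<psi> (y, t))) *\<^sub>R fst (G (y, t))"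
  let ?H = "\<lambda>k. (s * e) *\<^sub>R fst (H w (k, 0)) + (e * (\<xi> \<bullet> k)) *\<^sub>R \<xi>"
  have \<psi>x: "((\<lambda>y. \<psi> (y, t)) has_derivative (\<lambda>h. fst (G (y, t)) \<bullet> h)) (at y)" for y
  proof -
    have "((\<lambda>y. \<psi> (y, t)) has_derivative (\<lambda>h. G (y, t) \<bullet> (h, 0))) (at y)"
      by (rule has_derivative_compose[where f="\<lambda>y. (y, t)", OF _ \<psi>]) (auto intro!: derivative_eq_intros)
    then show ?thesis by (simp add: inner_prod_def)
  qed
  have fx: "(?f has_derivative (\<lambda>h. ?g y \<bullet> h)) (at y)" for y
    using \<psi>x[of y] by (auto intro!: derivative_eq_intros simp: mult_ac)
  have Gx: "((\<lambda>y. fst (G (y, t))) has_derivative (\<lambda>k. fst (H w (k, 0)))) (at x)"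
  proof -
    have "((\<lambda>y. G (y, t)) has_derivative (\<lambda>k. H (x, t) (k, 0))) (at x)"
      by (rule has_derivative_compose[where f="\<lambda>y. (y, t)", OF _ G]) (auto intro!: derivative_eq_intros)
    then show ?thesis unfolding w by (rule has_derivative_fst)
  qed
  have sx: "((\<lambda>y. s * exp (s * \<psi> (y, t))) has_derivative (\<lambda>k. e * (\<xi> \<bullet> k))) (at x)"
  proof -
    have "((\<lambda>y. s * exp (s * \<psi> (y, t))) has_derivative (\<lambda>k. (s * s) * (e * (\<xi> \<bullet> k)))) (at x)"
      using \<psi>x[of x] by (auto intro!: derivative_eq_intros simp: e_def \<xi>_def w mult_ac)
    then show ?thesis by (simp add: s)
  qed
  have gx: "(?g has_derivative ?H) (at x)"
    using has_derivative_scaleR[OF sx Gx] by (simp add: e_def \<xi>_def w)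
  have gw: "?g x = (s * e) *\<^sub>R \<xi>" by (simp add: e_def \<xi>_def w)
  have \<xi>: "\<xi> \<noteq> 0" using nz by (simp add: \<xi>_def)
  have nz': "?g x \<noteq> 0" using \<xi> e as by (simp add: gw)
  have ngx: "norm (?g x) = e * norm \<xi>" using e by (simp add: gw abs_mult as)
  have hat: "?g x /\<^sub>R norm (?g x) = s *\<^sub>R (\<xi> /\<^sub>R norm \<xi>)" (is "_ = s *\<^sub>R ?h")
    unfolding ngx unfolding gw using e by (simp add: mult.commute)
  have linH: "linear (H w)" using G by (rule has_derivative_linear)
  have hH: "(s *\<^sub>R ?h) \<bullet> ?H (s *\<^sub>R ?h) = s * e * (?h \<bullet> fst (H w (?h, 0))) + e * (norm \<xi>)\<^sup>2"
  proof -
    have "H w (s *\<^sub>R ?h, 0) = s *\<^sub>R H w (?h, 0)"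
      using linear_scale[OF linH, of s "(?h, 0)"] by simp
    then have "(s *\<^sub>R ?h) \<bullet> ?H (s *\<^sub>R ?h)
      = (s * s) * (s * e * (?h \<bullet> fst (H w (?h, 0))) + e * (\<xi> \<bullet> ?h) * (\<xi> \<bullet> ?h))"
      by (simp add: inner_add_right inner_commute algebra_simps)
    moreover have "\<xi> \<bullet> ?h = norm \<xi>" using \<xi> by (simp add: norm_eq_sqrt_inner field_simps)
    ultimately show ?thesis by (simp add: s power2_eq_square mult.assoc)
  qed
  have tr: "(\<Sum>i\<in>UNIV. axis i 1 \<bullet> ?H (axis i 1))
     = s * e * (\<Sum>i\<in>UNIV. axis i 1 \<bullet> fst (H w (axis i 1, 0))) + e * (norm \<xi>)\<^sup>2"
  proof -
    have "(\<Sum>i\<in>UNIV. axis i 1 \<bullet> ?H (axis i 1))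
       = (\<Sum>i\<in>UNIV. s * e * (axis i 1 \<bullet> fst (H w (axis i 1, 0))) + e * (\<xi> $ i * \<xi> $ i))"
      by (intro sum.cong) (auto simp: inner_add_right inner_axis inner_axis' algebra_simps)
    also have "\<dots> = s * e * (\<Sum>i\<in>UNIV. axis i 1 \<bullet> fst (H w (axis i 1, 0))) + e * (\<xi> \<bullet> \<xi>)"
      by (simp add: sum.distrib sum_distrib_left inner_vec_def)
    finally show ?thesis by (simp add: power2_norm_eq_inner)
  qed
  have V: "Vq p \<xi> (\<lambda>h. h \<bullet> H w h) = norm \<xi> powr (p - 2) *
      ((\<Sum>i\<in>UNIV. axis i 1 \<bullet> fst (H w (axis i 1, 0))) + (p - 2) * (?h \<bullet> fst (H w (?h, 0))))"
    by (simp add: Vq_def inner_prod_def)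
  have n2: "norm \<xi> powr (p - 2) * (norm \<xi>)\<^sup>2 = norm \<xi> powr p"
    using \<xi> by (simp add: powr_diff)
  have ep: "e powr (p - 2) * e = exp ((p - 1) * (s * \<psi> w))"
    by (simp add: e_def powr_def exp_add[symmetric] algebra_simps)
  have "p_laplacian p ?f x = (e * norm \<xi>) powr (p - 2) *
      (s * e * (\<Sum>i\<in>UNIV. axis i 1 \<bullet> fst (H w (axis i 1, 0))) + e * (norm \<xi>)\<^sup>2
       + (p - 2) * (s * e * (?h \<bullet> fst (H w (?h, 0))) + e * (norm \<xi>)\<^sup>2))"
    unfolding p_laplacian_eq[OF fx gx nz'] unfolding hat unfolding ngx hH tr ..
  also have "\<dots> = (e powr (p - 2) * e) * (s * Vq p \<xi> (\<lambda>h. h \<bullet> H w h)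
      + (p - 1) * (norm \<xi> powr (p - 2) * (norm \<xi>)\<^sup>2))"
    using e by (simp add: V powr_mult algebra_simps)
  finally have pl: "p_laplacian p ?f x = exp ((p - 1) * (s * \<psi> w)) *
      (s * Vq p \<xi> (\<lambda>h. h \<bullet> H w h) + (p - 1) * norm \<xi> powr p)"
    unfolding n2 ep .
  \<comment> \<open>Writing 1 as \<open>s * s\<close> in front of the gradient term lets the common
    factor \<open>s\<close> come out. The sign left inside is all that distinguishes the equation of
    \<open>ln u\<close> from that of \<open>- ln u\<close>.\<close>
  have "trudinger_op p (\<lambda>w. exp (s * \<psi> w)) w = (p - 1) * s * snd (G w) * exp ((p - 1) * (s * \<psi> w))
     - exp ((p - 1) * (s * \<psi> w)) * (s * Vq p \<xi> (\<lambda>h. h \<bullet> H w h) + (p - 1) * ((s * s) * norm \<xi> powr p))"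
    unfolding trudinger_op_def s using time pl by (simp add: w)
  also have "\<dots> = s * exp ((p - 1) * (s * \<psi> w)) *
     ((p - 1) * (snd (G w) - s * norm \<xi> powr p) - Vq p \<xi> (\<lambda>h. h \<bullet> H w h))"
    by (simp add: algebra_simps)
  finally show ?thesis by (simp add: \<xi>_def)
qed

lemma space_gradient_exp:
  fixes \<psi> :: "(real ^ 'n) \<times> real \<Rightarrow> real"
  assumes \<psi>: "\<And>w. (\<psi> has_derivative (\<lambda>h. G w \<bullet> h)) (at w)"
  shows "space_gradient (\<lambda>w. exp (s * \<psi> w)) w = (s * exp (s * \<psi> w)) *\<^sub>R fst (G w)"
proof -
  obtain x t where w: "w = (x, t)" by (cases w)
  have "((\<lambda>y. \<psi> (y, t)) has_derivative (\<lambda>h. G (x, t) \<bullet> (h, 0))) (at x)"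
    by (rule has_derivative_compose[where f="\<lambda>y. (y, t)", OF _ \<psi>]) (auto intro!: derivative_eq_intros)
  then have "((\<lambda>y. exp (s * \<psi> (y, t))) has_derivative (\<lambda>h. ((s * exp (s * \<psi> w)) *\<^sub>R fst (G w)) \<bullet> h)) (at x)"
    by (auto intro!: derivative_eq_intros simp: inner_prod_def w mult_ac)
  then show ?thesis unfolding space_gradient_def by (simp add: w gradient_eq)
qed

text \<open>For \<open>s = 1\<close> the exponential touches \<open>u\<close> from above and the
  limit inferior is at most 0; for \<open>s = -1\<close> it touches from below and the limit
  superior is at least 0. The factor \<open>s\<close> in front of the transformed operator turns
  both into one sign condition, and the existence of the limit removes the difference between the
  two.\<close>

lemma viscosity_test_exp:
  fixes u \<psi> :: "(real ^ 'n) \<times> real \<Rightarrow> real"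
  assumes u: "viscosity_solution p \<Omega> u" and \<Omega>: "open \<Omega>" "z \<in> \<Omega>" and s: "s = 1 \<or> s = -1"
    and \<psi>: "\<And>w. (\<psi> has_derivative (\<lambda>h. G w \<bullet> h)) (at w)" and G: "\<And>w. (G has_derivative H w) (at w)"
    and H: "\<And>h. continuous_on UNIV (\<lambda>w. H w h)"
    and touch: "\<forall>\<^sub>F w in nhds z. s * ln (u w) \<le> \<psi> w" "\<psi> z = s * ln (u z)"
    and nz: "\<forall>\<^sub>F w in at_off_axis z. fst (G w) \<noteq> 0"
    and lim: "((\<lambda>w. (p - 1) * (snd (G w) - s * norm (fst (G w)) powr p)
        - Vq p (fst (G w)) (\<lambda>h. h \<bullet> H w h)) \<longlongrightarrow> e0) (at_off_axis z)"
  shows "e0 \<le> 0"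
proof -
  let ?\<phi> = "\<lambda>w. exp (s * \<psi> w)"
  have s2: "s * s = 1" using s by auto
  have pos: "\<forall>w\<in>\<Omega>. 0 < u w" using u by (auto simp: viscosity_solution_def viscosity_subsolution_def)
  have ev: "\<forall>\<^sub>F w in nhds z. w \<in> \<Omega>" using \<Omega> by (rule eventually_nhds_in_open)
  have C2: "C2_on \<Omega> ?\<phi>"
  proof (rule C2_onI)
    show "(?\<phi> has_derivative (\<lambda>h. ((s * exp (s * \<psi> w)) *\<^sub>R G w) \<bullet> h)) (at w)" for w
      using \<psi>[of w] by (auto intro!: derivative_eq_intros simp: mult_ac)
    have "((\<lambda>w. s * exp (s * \<psi> w)) has_derivative (\<lambda>k. s * (exp (s * \<psi> w) * (s * (G w \<bullet> k))))) (at w)" for w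
      using \<psi>[of w] by (auto intro!: derivative_eq_intros simp: mult_ac)
    then show "((\<lambda>w. (s * exp (s * \<psi> w)) *\<^sub>R G w) has_derivative
        (\<lambda>k. (s * exp (s * \<psi> w)) *\<^sub>R H w k + (s * (exp (s * \<psi> w) * (s * (G w \<bullet> k)))) *\<^sub>R G w)) (at w)" for w
      by (intro has_derivative_scaleR G)
    have "continuous_on UNIV \<psi>" "continuous_on UNIV G"
      using \<psi> G by (auto intro!: has_derivative_continuous_on intro: has_derivative_at_withinI)
    then show "continuous_on UNIV (\<lambda>w. (s * exp (s * \<psi> w)) *\<^sub>R H w h
        + (s * (exp (s * \<psi> w) * (s * (G w \<bullet> h)))) *\<^sub>R G w)" for h
      by (intro continuous_intros H)
  qed
  have nz': "\<forall>\<^sub>F w in at_off_axis z. space_gradient ?\<phi> w \<noteq> 0"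
    using nz by eventually_elim (use s in \<open>auto simp: space_gradient_exp[OF \<psi>]\<close>)
  define c where "c = exp ((p - 1) * (s * \<psi> z))"
  have "isCont \<psi> z" using \<psi> by (rule has_derivative_continuous)
  then have "(\<psi> \<longlongrightarrow> \<psi> z) (at_off_axis z)"
    unfolding at_off_axis_def isCont_def by (rule tendsto_within_subset[of _ _ _ UNIV, simplified])
  then have "((\<lambda>w. s * exp ((p - 1) * (s * \<psi> w)) * ((p - 1) * (snd (G w) - s * norm (fst (G w)) powr p)
        - Vq p (fst (G w)) (\<lambda>h. h \<bullet> H w h))) \<longlongrightarrow> s * c * e0) (at_off_axis z)"
    unfolding c_def by (intro tendsto_intros lim)
  then have "((\<lambda>w. trudinger_op p ?\<phi> w) \<longlongrightarrow> s * c * e0) (at_off_axis z)"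
    by (rule Lim_transform_eventually)
      (use nz in \<open>eventually_elim, simp add: trudinger_op_exp[OF \<psi> G s2]\<close>)
  then have lim': "((\<lambda>w. ereal (trudinger_op p ?\<phi> w)) \<longlongrightarrow> ereal (s * c * e0)) (at_off_axis z)"
    by simp
  have c: "c > 0" by (simp add: c_def)
  show ?thesis
  proof (cases "s = 1")
    case True
    have "touches_above ?\<phi> u z" unfolding touches_above_def
    proof
      show "?\<phi> z = u z" using touch(2) pos \<Omega>(2) True by simp
      show "\<forall>\<^sub>F w in nhds z. u w \<le> ?\<phi> w"
        using touch(1) ev
      proof eventually_elim
        case (elim w)
        then have "exp (ln (u w)) \<le> exp (\<psi> w)" using True by simp
        then show ?case using pos elim True by simp
      qed
    qed
    then have "Liminf (at_off_axis z) (\<lambda>w. ereal (trudinger_op p ?\<phi> w)) \<le> 0"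
      using u C2 nz' \<Omega>(2) unfolding viscosity_solution_def viscosity_subsolution_def by blast
    then have "ereal (s * c * e0) \<le> 0" using lim_imp_Liminf[OF at_off_axis_neq_bot lim'] by simp
    then show ?thesis using True c by (simp add: mult_le_0_iff)
  next
    case False
    then have s1: "s = -1" using s by simp
    have "touches_below ?\<phi> u z" unfolding touches_below_def
    proof
      show "?\<phi> z = u z" using touch(2) pos \<Omega>(2) s1 by simp
      show "\<forall>\<^sub>F w in nhds z. ?\<phi> w \<le> u w"
        using touch(1) ev
      proof eventually_elim
        case (elim w)
        then have "- \<psi> w \<le> ln (u w)" using s1 by simp
        then have "exp (- \<psi> w) \<le> exp (ln (u w))" by simp
        then show ?case using pos elim s1 by simp
      qed
    qed
    then have "0 \<le> Limsup (at_off_axis z) (\<lambda>w. ereal (trudinger_op p ?\<phi> w))"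
      using u C2 nz' \<Omega>(2) unfolding viscosity_solution_def viscosity_supersolution_def by blast
    then have "0 \<le> ereal (s * c * e0)" using lim_imp_Limsup[OF at_off_axis_neq_bot lim'] by simp
    then show ?thesis using s1 c by (simp add: mult_le_0_iff)
  qed
qed

section \<open>Jets with nonvanishing gradient\<close>

lemma quadform_tendsto:
  assumes "quadform Q" "(X \<longlongrightarrow> x) F" shows "((\<lambda>w. Q (X w)) \<longlongrightarrow> Q x) F"
proof -
  obtain A where A: "linear A" "Q = (\<lambda>h. h \<bullet> A h)" using assms by (auto simp: quadform_def)
  have "bounded_linear A" using A(1) by (simp add: linear_linear)
  from bounded_linear.tendsto[OF this assms(2)] show ?thesis
    unfolding A by (rule tendsto_inner[OF assms(2)])
qed

lemma Vq_tendsto: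
  assumes "quadform Q" "(X \<longlongrightarrow> \<xi>) F" "\<xi> \<noteq> 0"
  shows "((\<lambda>w. Vq p (X w) Q) \<longlongrightarrow> Vq p \<xi> Q) F"
  unfolding Vq_def using assms
  by (intro tendsto_intros quadform_tendsto[OF assms(1)] tendsto_Pair) auto

text \<open>Subsolutions of the logarithmic equation in terms of jets: \<open>ln u\<close> with
  \<open>s = 1\<close>, and \<open>- ln u\<close> with \<open>s = -1\<close>, where the gradient
  term changes sign. A jet with \<open>b = 0\<close> gives no condition, as the coefficients may be
  singular there. The factor 1/2 is due to \<open>Q\<close> being half the Hessian form.\<close>

definition jet_sub :: "real \<Rightarrow> real \<Rightarrow> ((real ^ 'n) \<times> real) set \<Rightarrow> ((real ^ 'n) \<times> real \<Rightarrow> real) \<Rightarrow> bool" where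
  "jet_sub p s \<Omega> v \<longleftrightarrow> (\<forall>z\<in>\<Omega>. \<forall>b q Q. quadform Q \<longrightarrow> b \<noteq> 0 \<longrightarrow> jet_above v z (b, q) Q \<longrightarrow>
     (p - 1) / 2 * (q - s * norm b powr p) \<le> Vq p b Q)"

lemma eventually_nhds_shift:
  fixes z :: "'a::real_normed_vector"
  assumes "\<forall>\<^sub>F h in nhds 0. P (z + h)" shows "\<forall>\<^sub>F w in nhds z. P w"
proof -
  obtain d where "d > 0" "\<And>h. norm h < d \<Longrightarrow> P (z + h)"
    using assms unfolding eventually_nhds_0_norm by blast
  note d = this
  have "P w" if "dist w z < d" for w using d(2)[of "w - z"] that by (simp add: dist_norm)
  then show ?thesis unfolding eventually_nhds_metric using d(1) by blast
qed

lemma tendsto_at_off_axis: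
  assumes "isCont f z" shows "(f \<longlongrightarrow> f z) (at_off_axis z)"
  using assms unfolding at_off_axis_def isCont_def
  by (rule tendsto_within_subset[of _ _ _ UNIV, simplified])

lemma viscosity_imp_jet_sub:
  fixes u :: "(real ^ 'n) \<times> real \<Rightarrow> real"
  assumes u: "viscosity_solution p \<Omega> u" and \<Omega>: "open \<Omega>" and s: "s = 1 \<or> s = -1"
  shows "jet_sub p s \<Omega> (\<lambda>w. s * ln (u w))"
  unfolding jet_sub_def
proof (intro ballI allI impI)
  fix z :: "(real ^ 'n) \<times> real" and b q Q
  assume z: "z \<in> \<Omega>" and Q: "quadform Q" and b: "b \<noteq> 0" and jet: "jet_above (\<lambda>w. s * ln (u w)) z (b, q) Q"
  obtain A where A: "linear A" "Q = (\<lambda>h. h \<bullet> A h)" using Q by (auto simp: quadform_def)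
  \<comment> \<open>\<open>A\<close> need not be symmetric, so the derivative of its form involves
    \<open>A\<close> plus the adjoint, and the Hessian form is \<open>2 * Q\<close>.\<close>
  define A' where "A' h = A h + adjoint A h" for h
  have blA: "bounded_linear A" "bounded_linear (adjoint A)"
    using A(1) adjoint_linear[OF A(1)] by (simp_all add: linear_linear)
  then have blA': "bounded_linear A'" unfolding A'_def by (rule bounded_linear_add)
  have adj: "x \<bullet> A y = adjoint A x \<bullet> y" for x y using adjoint_works[OF A(1), of y x] by (simp add: inner_commute)
  define \<psi> where "\<psi> w = s * ln (u z) + (b, q) \<bullet> (w - z) + (w - z) \<bullet> A (w - z)" for w
  define G where "G w = (b, q) + A' (w - z)" for w
  have \<psi>: "(\<psi> has_derivative (\<lambda>h. G w \<bullet> h)) (at w)" for w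
  proof -
    have "(\<psi> has_derivative (\<lambda>h. (b, q) \<bullet> h + ((w - z) \<bullet> A h + h \<bullet> A (w - z)))) (at w)"
      unfolding \<psi>_def
      by (auto intro!: derivative_eq_intros bounded_linear.has_derivative[OF blA(1)])
    moreover have "(b, q) \<bullet> h + ((w - z) \<bullet> A h + h \<bullet> A (w - z)) = G w \<bullet> h" for h
      by (simp add: G_def A'_def inner_add_left adj[of "w - z" h] inner_commute[of h "A (w - z)"])
    ultimately show ?thesis by simp
  qed
  have G: "(G has_derivative A') (at w)" for w
    unfolding G_def by (auto intro!: derivative_eq_intros bounded_linear.has_derivative[OF blA'])
  have QA': "(\<lambda>h. h \<bullet> A' h) = (\<lambda>h. 2 * Q h)"
    by (auto simp: A'_def A inner_add_right adj inner_commute)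
  have Gz: "G z = (b, q)" using blA' by (simp add: G_def linear_0 bounded_linear.linear)
  have "isCont G z" using G by (rule has_derivative_continuous)
  then have Gt: "(G \<longlongrightarrow> (b, q)) (at_off_axis z)" using tendsto_at_off_axis[where f=G and z=z] by (simp add: Gz)
  have f1: "((\<lambda>w. fst (G w)) \<longlongrightarrow> b) (at_off_axis z)" and f2: "((\<lambda>w. snd (G w)) \<longlongrightarrow> q) (at_off_axis z)"
    using tendsto_fst[OF Gt] tendsto_snd[OF Gt] by simp_all
  have "(p - 1) * (q - s * norm b powr p) - Vq p b (\<lambda>h. 2 * Q h) \<le> 0"
  proof (rule viscosity_test_exp[OF u \<Omega> z s \<psi> G])
    show "continuous_on UNIV (\<lambda>w. A' h)" for h by simp
    show "\<forall>\<^sub>F w in nhds z. s * ln (u w) \<le> \<psi> w"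
      by (rule eventually_nhds_shift) (use jet in \<open>simp add: jet_above_def \<psi>_def A\<close>)
    show "\<psi> z = s * ln (u z)" using A(1) by (simp add: \<psi>_def)
    show "\<forall>\<^sub>F w in at_off_axis z. fst (G w) \<noteq> 0" using f1 b by (rule tendsto_imp_eventually_ne)
    show "((\<lambda>w. (p - 1) * (snd (G w) - s * norm (fst (G w)) powr p) - Vq p (fst (G w)) (\<lambda>h. h \<bullet> A' h))
      \<longlongrightarrow> (p - 1) * (q - s * norm b powr p) - Vq p b (\<lambda>h. 2 * Q h)) (at_off_axis z)"
      unfolding QA' using b by (intro tendsto_intros Vq_tendsto quadform_cmult Q f1 f2) auto
  qed
  then show "(p - 1) / 2 * (q - s * norm b powr p) \<le> Vq p b Q" by (simp add: Vq_cmult)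
qed

text \<open>The exponent makes the \<open>p\<close>-Laplacian of \<open>C |x|^(2k)\<close> vanish at the origin, also in the singular range.\<close>

lemma viscosity_zero_gradient:
  fixes u :: "(real ^ 'n) \<times> real \<Rightarrow> real"
  assumes u: "viscosity_solution p \<Omega> u" and \<Omega>: "open \<Omega>" "z \<in> \<Omega>" and s: "s = 1 \<or> s = -1" and p: "1 < p"
    and k: "1 \<le> k" "(2 * real k - 1) * (p - 1) > 1" and C: "C > 0"
    and touch: "\<forall>\<^sub>F h in nhds 0. s * ln (u (z + h))
       \<le> s * ln (u z) + q * snd h + C * (fst h \<bullet> fst h) ^ k + C' * (snd h)\<^sup>2"
  shows "q \<le> 0"
proof -
  define S where "S w = fst (w - z) \<bullet> fst (w - z)" for w :: "(real ^ 'n) \<times> real"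
  define \<psi> where "\<psi> w = s * ln (u z) + q * snd (w - z) + C * S w ^ k + C' * (snd (w - z))\<^sup>2" for w
  define G where "G w = ((2 * k * C * S w ^ (k - 1)) *\<^sub>R fst (w - z), q + 2 * C' * snd (w - z))" for w
  define H where "H w h = ((2 * k * C * S w ^ (k - 1)) *\<^sub>R fst h
      + (2 * k * C * (real (k - 1) * S w ^ (k - 1 - 1) * (2 * (fst (w - z) \<bullet> fst h)))) *\<^sub>R fst (w - z),
      2 * C' * snd h)" for w h
  have S: "(S has_derivative (\<lambda>h. 2 * (fst (w - z) \<bullet> fst h))) (at w)" for w
    unfolding S_def by (auto intro!: derivative_eq_intros simp: inner_commute)
  have Spow: "((\<lambda>w. S w ^ j) has_derivative (\<lambda>h. real j * S w ^ (j - 1) * (2 * (fst (w - z) \<bullet> fst h)))) (at w)" for w j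
    using has_derivative_power[OF S, of j w] by (simp add: mult_ac)
  have \<psi>: "(\<psi> has_derivative (\<lambda>h. G w \<bullet> h)) (at w)" for w
  proof -
    have "((\<lambda>w. s * ln (u z) + q * snd (w - z)) has_derivative (\<lambda>h. q * snd h)) (at w)"
      by (auto intro!: derivative_eq_intros)
    moreover have "((\<lambda>w. C' * (snd (w - z))\<^sup>2) has_derivative (\<lambda>h. C' * (2 * snd (w - z) * snd h))) (at w)"
      by (auto intro!: derivative_eq_intros)
    ultimately have "(\<psi> has_derivative (\<lambda>h. q * snd h + C * (real k * S w ^ (k - 1) * (2 * (fst (w - z) \<bullet> fst h)))
        + C' * (2 * snd (w - z) * snd h))) (at w)"
      unfolding \<psi>_def by (intro has_derivative_add has_derivative_mult_right[OF Spow])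
    moreover have "q * snd h + C * (real k * S w ^ (k - 1) * (2 * (fst (w - z) \<bullet> fst h)))
        + C' * (2 * snd (w - z) * snd h) = G w \<bullet> h" for h
      by (simp add: G_def inner_prod_def algebra_simps)
    ultimately show ?thesis by simp
  qed
  have G: "(G has_derivative H w) (at w)" for w
  proof -
    have "((\<lambda>w. 2 * k * C * S w ^ (k - 1)) has_derivative
       (\<lambda>h. 2 * k * C * (real (k - 1) * S w ^ (k - 1 - 1) * (2 * (fst (w - z) \<bullet> fst h))))) (at w)"
      by (rule has_derivative_mult_right[OF Spow])
    moreover have "((\<lambda>w. fst (w - z)) has_derivative fst) (at w)"
      by (auto intro!: derivative_eq_intros)
    ultimately have "((\<lambda>w. (2 * k * C * S w ^ (k - 1)) *\<^sub>R fst (w - z)) has_derivative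
       (\<lambda>h. (2 * k * C * S w ^ (k - 1)) *\<^sub>R fst h +
         (2 * k * C * (real (k - 1) * S w ^ (k - 1 - 1) * (2 * (fst (w - z) \<bullet> fst h)))) *\<^sub>R fst (w - z))) (at w)"
      by (rule has_derivative_scaleR)
    moreover have "((\<lambda>w. q + 2 * C' * snd (w - z)) has_derivative (\<lambda>h. 2 * C' * snd h)) (at w)"
      by (auto intro!: derivative_eq_intros)
    ultimately show ?thesis unfolding G_def H_def by (rule has_derivative_Pair)
  qed
  \<comment> \<open>The test function has a gradient of order \<open>r ^ (2 * k - 1)\<close> and
    second derivatives of order \<open>r ^ (2 * k - 2)\<close>, so its p-Laplacian scales with the
    exponent \<open>(2 * k - 1) * (p - 2) + 2 * k - 2\<close>, which equals
    \<open>e\<close>.\<close>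
  define e where "e = (2 * real k - 1) * (p - 1) - 1"
  have e: "e > 0" using k by (simp add: e_def)
  define c where "c = (2 * k * C) powr (p - 2) * (2 * k * C)
     * (CARD('n) + 2 * real (k - 1) + (p - 2) * (1 + 2 * real (k - 1)))"
  have r: "((\<lambda>w. norm (fst (w - z))) \<longlongrightarrow> 0) (at_off_axis z)"
    using tendsto_at_off_axis[where f="\<lambda>w. norm (fst (w - z))" and z=z] by simp
  have off: "\<forall>\<^sub>F w in at_off_axis z. fst (w - z) \<noteq> 0"
    unfolding at_off_axis_def eventually_at_filter by (auto intro!: always_eventually)
  have V: "Vq p (fst (G w)) (\<lambda>h. h \<bullet> H w h) = c * norm (fst (w - z)) powr e" if x: "fst (w - z) \<noteq> 0" for w
  proof -
    define X where "X = fst (w - z)"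
    define r where "r = norm X"
    have r0: "r > 0" using x by (simp add: r_def X_def)
    have Sr: "S w = r\<^sup>2" by (simp add: S_def r_def X_def power2_norm_eq_inner)
    define m where "m = 2 * k * C * r ^ (2 * (k - 1))"
    have m0: "m > 0" using k(1) C r0 by (simp add: m_def)
    have fG: "fst (G w) = m *\<^sub>R X"
      by (simp add: G_def m_def X_def Sr power_mult)
    have Hq: "(y, 0) \<bullet> H w (y, 0) = m * (y \<bullet> y + 2 * real (k - 1) * (y \<bullet> (X /\<^sub>R r))\<^sup>2)" for y
    proof -
      have "2 * k * C * (real (k - 1) * S w ^ (k - 1 - 1)) * 2 * r\<^sup>2 = m * (2 * real (k - 1))"
      \<comment> \<open>For \<open>k = 1\<close> the exponent \<open>k - 1 - 1\<close> is truncated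
        to 0, which is harmless because of the factor \<open>real (k - 1) = 0\<close>.\<close>
      proof (cases "k = 1")
        case False
        then have "k - 1 = Suc (k - 1 - 1)" using k(1) by simp
        then have "r ^ (2 * (k - 1)) = (r\<^sup>2) ^ (k - 1 - 1) * r\<^sup>2"
          by (metis power_Suc2 power_mult)
        then show ?thesis by (simp add: m_def Sr)
      qed simp
      moreover have "(y \<bullet> X)\<^sup>2 = r\<^sup>2 * (y \<bullet> (X /\<^sub>R r))\<^sup>2"
        using r0 by (simp add: power_mult_distrib power_divide field_simps)
      ultimately have "2 * k * C * (real (k - 1) * S w ^ (k - 1 - 1)) * 2 * (y \<bullet> X)\<^sup>2
         = m * (2 * real (k - 1)) * (y \<bullet> (X /\<^sub>R r))\<^sup>2"
        by (metis mult.assoc)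
      moreover have "(y, 0) \<bullet> H w (y, 0) = m * (y \<bullet> y)
          + 2 * k * C * (real (k - 1) * S w ^ (k - 1 - 1)) * 2 * (y \<bullet> X)\<^sup>2"
        by (simp add: H_def inner_prod_def inner_add_right m_def Sr X_def power_mult inner_commute
            power2_eq_square mult_ac)
      ultimately show ?thesis by (simp add: algebra_simps)
    qed
    let ?h = "X /\<^sub>R r"
    have hat: "fst (G w) /\<^sub>R norm (fst (G w)) = ?h"
      using m0 by (simp add: fG r_def)
    have hh: "?h \<bullet> ?h = 1"
      using r0 by (simp add: r_def power2_norm_eq_inner[symmetric] power2_eq_square field_simps)
    have "(\<Sum>i\<in>UNIV. (axis i 1 \<bullet> ?h)\<^sup>2) = ?h \<bullet> ?h"
    proof -
      have "axis i 1 \<bullet> y = y $ i" for i and y :: "real ^ 'n" by (simp add: inner_axis')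
      then show ?thesis by (simp only:) (simp add: inner_vec_def power2_eq_square)
    qed
    then have tr: "(\<Sum>i\<in>UNIV. (axis i 1, 0) \<bullet> H w (axis i 1, 0)) = m * (CARD('n) + 2 * real (k - 1))"
      by (simp only: Hq hh) (simp add: sum_distrib_left[symmetric] sum.distrib inner_axis_axis)
    have rm: "norm (fst (G w)) = 2 * k * C * r powr (2 * real k - 1)"
    proof -
      have "r ^ (2 * (k - 1)) * r = r powr (2 * real k - 1)"
      proof -
        have "r ^ (2 * (k - 1)) * r = r ^ (2 * (k - 1) + 1)" by simp
        also have "\<dots> = r powr real (2 * (k - 1) + 1)" using r0 by (simp only: powr_realpow)
        also have "real (2 * (k - 1) + 1) = 2 * real k - 1" using k(1) by (simp add: of_nat_diff)
        finally show ?thesis .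
      qed
      then show ?thesis using m0 by (simp add: fG r_def[symmetric] m_def)
    qed
    have mr: "m = 2 * k * C * r powr (2 * real k - 2)"
    proof -
      have "r ^ (2 * (k - 1)) = r powr real (2 * (k - 1))" using r0 by (simp only: powr_realpow)
      also have "real (2 * (k - 1)) = 2 * real k - 2" using k(1) by (simp add: of_nat_diff)
      finally show ?thesis by (simp add: m_def)
    qed
    have nm: "norm (fst (G w)) powr (p - 2) * m = (2 * k * C) powr (p - 2) * (2 * k * C) * r powr e"
    proof -
      have ex: "(2 * real k - 1) * (p - 2) + (2 * real k - 2) = e" by (simp add: e_def algebra_simps)
      have "norm (fst (G w)) powr (p - 2) * m
        = (2 * k * C) powr (p - 2) * (2 * k * C) * (r powr ((2 * real k - 1) * (p - 2)) * r powr (2 * real k - 2))"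
        unfolding rm mr using C r0 by (simp add: powr_mult powr_powr)
      then show ?thesis unfolding powr_add[symmetric] ex .
    qed
    have Qh: "(?h, 0) \<bullet> H w (?h, 0) = m * (1 + 2 * real (k - 1))"
      unfolding Hq hh by simp
    have "Vq p (fst (G w)) (\<lambda>h. h \<bullet> H w h) = norm (fst (G w)) powr (p - 2) *
        (m * (CARD('n) + 2 * real (k - 1)) + (p - 2) * (m * (1 + 2 * real (k - 1))))"
      unfolding Vq_def hat tr Qh ..
    also have "\<dots> = (norm (fst (G w)) powr (p - 2) * m) *
        (CARD('n) + 2 * real (k - 1) + (p - 2) * (1 + 2 * real (k - 1)))"
      by (simp only: distrib_left mult.assoc mult.left_commute)
    finally show ?thesis unfolding nm by (simp add: c_def r_def X_def mult_ac)
  qed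
  have "(p - 1) * q - 0 \<le> 0"
  proof (rule viscosity_test_exp[OF u \<Omega> s \<psi> G])
    show "continuous_on UNIV (\<lambda>w. H w h)" for h
      unfolding H_def S_def by (intro continuous_intros)
    show "\<forall>\<^sub>F w in nhds z. s * ln (u w) \<le> \<psi> w"
      by (rule eventually_nhds_shift) (use touch in \<open>simp add: \<psi>_def S_def\<close>)
    show "\<psi> z = s * ln (u z)" using k(1) by (simp add: \<psi>_def S_def)
    show "\<forall>\<^sub>F w in at_off_axis z. fst (G w) \<noteq> 0"
      using off by eventually_elim (use C k(1) in \<open>auto simp: G_def S_def\<close>)
    have "isCont G z" using G by (rule has_derivative_continuous)
    then have Gt: "(G \<longlongrightarrow> (0, q)) (at_off_axis z)" using tendsto_at_off_axis[where f=G and z=z] by (simp add: G_def)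
    have f1: "((\<lambda>w. norm (fst (G w))) \<longlongrightarrow> 0) (at_off_axis z)"
      and f2: "((\<lambda>w. snd (G w)) \<longlongrightarrow> q) (at_off_axis z)"
      using tendsto_norm[OF tendsto_fst[OF Gt]] tendsto_snd[OF Gt] by simp_all
    have g1: "((\<lambda>w. norm (fst (G w)) powr p) \<longlongrightarrow> 0) (at_off_axis z)"
      using tendsto_zero_powrI[OF f1 tendsto_const, of p] p by simp
    have g2: "((\<lambda>w. Vq p (fst (G w)) (\<lambda>h. h \<bullet> H w h)) \<longlongrightarrow> 0) (at_off_axis z)"
    proof (rule Lim_transform_eventually)
      have "((\<lambda>w. norm (fst (w - z)) powr e) \<longlongrightarrow> 0) (at_off_axis z)"
        using tendsto_zero_powrI[OF r tendsto_const, of e] e by simp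
      then show "((\<lambda>w. c * norm (fst (w - z)) powr e) \<longlongrightarrow> 0) (at_off_axis z)"
        by (rule tendsto_mult_right_zero)
      show "\<forall>\<^sub>F w in at_off_axis z. c * norm (fst (w - z)) powr e = Vq p (fst (G w)) (\<lambda>h. h \<bullet> H w h)"
        using off by eventually_elim (simp add: V)
    qed
    have "((\<lambda>w. (p - 1) * (snd (G w) - s * norm (fst (G w)) powr p)
       - Vq p (fst (G w)) (\<lambda>h. h \<bullet> H w h)) \<longlongrightarrow> (p - 1) * (q - s * 0) - 0) (at_off_axis z)"
      by (intro tendsto_diff tendsto_mult tendsto_const f2 g1 g2)
    then show "((\<lambda>w. (p - 1) * (snd (G w) - s * norm (fst (G w)) powr p)
       - Vq p (fst (G w)) (\<lambda>h. h \<bullet> H w h)) \<longlongrightarrow> (p - 1) * q - 0) (at_off_axis z)"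
      by simp
  qed
  then show ?thesis using p by (simp add: mult_le_0_iff)
qed

section \<open>Sup-convolution\<close>

text \<open>Regularises in space and time together. The supremum over a compact set is attained, at
  the points of \<open>supconv_opt\<close>. Being a supremum of paraboloids of equal curvature, the
  function becomes convex when \<open>(norm z)\<^sup>2 / (2 * \<epsilon>)\<close> is added.\<close>

definition supconv :: "'a::euclidean_space set \<Rightarrow> real \<Rightarrow> ('a \<Rightarrow> real) \<Rightarrow> 'a \<Rightarrow> real" where
  "supconv K \<epsilon> v z = (SUP w\<in>K. v w - (norm (z - w))\<^sup>2 / (2 * \<epsilon>))"

definition supconv_opt :: "'a::euclidean_space set \<Rightarrow> real \<Rightarrow> ('a \<Rightarrow> real) \<Rightarrow> 'a \<Rightarrow> 'a \<Rightarrow> bool" where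
  "supconv_opt K \<epsilon> v z w \<longleftrightarrow> w \<in> K \<and> supconv K \<epsilon> v z = v w - (norm (z - w))\<^sup>2 / (2 * \<epsilon>)"

lemma
  assumes K: "compact K" "K \<noteq> {}" "continuous_on K v"
  shows supconv_opt_ex: "\<exists>w. supconv_opt K \<epsilon> v z w"
    and supconv_ge: "w' \<in> K \<Longrightarrow> v w' - (norm (z - w'))\<^sup>2 / (2 * \<epsilon>) \<le> supconv K \<epsilon> v z"
proof -
  let ?g = "\<lambda>w. v w - (norm (z - w))\<^sup>2 / (2 * \<epsilon>)"
  have "continuous_on K ?g"
    unfolding divide_inverse by (intro continuous_intros K)
  then obtain w where w: "w \<in> K" "\<And>w'. w' \<in> K \<Longrightarrow> ?g w' \<le> ?g w"
    using continuous_attains_sup[OF K(1,2)] by blast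
  have "supconv K \<epsilon> v z = ?g w"
    unfolding supconv_def using w by (intro cSup_eq_maximum) auto
  with w show "\<exists>w. supconv_opt K \<epsilon> v z w" "w' \<in> K \<Longrightarrow> ?g w' \<le> supconv K \<epsilon> v z"
    unfolding supconv_opt_def by auto
qed

lemma norm_sq_diff_le:
  fixes z z' w :: "'a::real_normed_vector"
  assumes "norm w \<le> R"
  shows "\<bar>(norm (z' - w))\<^sup>2 - (norm (z - w))\<^sup>2\<bar> \<le> norm (z' - z) * (norm z + norm z' + 2 * R)"
proof -
  have "(norm (z' - w))\<^sup>2 - (norm (z - w))\<^sup>2 = (norm (z' - w) - norm (z - w)) * (norm (z' - w) + norm (z - w))"
    by (simp add: power2_eq_square algebra_simps)
  moreover have "\<bar>norm (z' - w) - norm (z - w)\<bar> \<le> norm (z' - z)"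
    using norm_triangle_ineq3[of "z' - w" "z - w"] by simp
  moreover have "norm (z' - w) + norm (z - w) \<le> norm z + norm z' + 2 * R"
    using norm_triangle_ineq4[of z' w] norm_triangle_ineq4[of z w] assms by linarith
  ultimately show ?thesis by (simp add: abs_mult mult_mono)
qed

lemma supconv_lipschitz:
  assumes K: "compact K" "K \<noteq> {}" "continuous_on K v" and \<epsilon>: "\<epsilon> > 0" and R: "\<And>w. w \<in> K \<Longrightarrow> norm w \<le> R"
  shows "\<bar>supconv K \<epsilon> v z - supconv K \<epsilon> v z'\<bar> \<le> norm (z' - z) * (norm z + norm z' + 2 * R) / (2 * \<epsilon>)"
proof -
  have *: "supconv K \<epsilon> v z - supconv K \<epsilon> v z' \<le> norm (z' - z) * (norm z + norm z' + 2 * R) / (2 * \<epsilon>)" for z z'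
  proof -
    obtain w where w: "supconv_opt K \<epsilon> v z w" using supconv_opt_ex[OF K] by blast
    then have wK: "w \<in> K" and fz: "supconv K \<epsilon> v z = v w - (norm (z - w))\<^sup>2 / (2 * \<epsilon>)"
      by (auto simp: supconv_opt_def)
    have "supconv K \<epsilon> v z - supconv K \<epsilon> v z' \<le> ((norm (z' - w))\<^sup>2 - (norm (z - w))\<^sup>2) / (2 * \<epsilon>)"
      using supconv_ge[OF K wK, of z' \<epsilon>] fz by (simp add: diff_divide_distrib)
    also have "\<dots> \<le> norm (z' - z) * (norm z + norm z' + 2 * R) / (2 * \<epsilon>)"
      using norm_sq_diff_le[OF R[OF wK], of z' z] \<epsilon> by (intro divide_right_mono) auto
    finally show ?thesis .
  qed
  show ?thesis using *[of z z'] *[of z' z] by (simp add: abs_le_iff norm_minus_commute add.commute)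
qed

lemma supconv_continuous:
  assumes K: "compact K" "K \<noteq> {}" "continuous_on K v" and \<epsilon>: "\<epsilon> > 0"
  shows "continuous_on UNIV (supconv K \<epsilon> v)"
proof (rule continuous_at_imp_continuous_on, rule ballI)
  fix z :: 'a
  obtain R where R: "\<And>w. w \<in> K \<Longrightarrow> norm w \<le> R"
    using compact_imp_bounded[OF K(1)] unfolding bounded_iff by blast
  have "((\<lambda>z'. norm (z - z') * (norm z' + norm z + 2 * R) / (2 * \<epsilon>))
     \<longlongrightarrow> norm (z - z) * (norm z + norm z + 2 * R) / (2 * \<epsilon>)) (at z)"
    using \<epsilon> by (intro tendsto_intros) auto
  then have "((\<lambda>z'. norm (z - z') * (norm z' + norm z + 2 * R) / (2 * \<epsilon>)) \<longlongrightarrow> 0) (at z)" by simp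
  then have "((\<lambda>z'. supconv K \<epsilon> v z' - supconv K \<epsilon> v z) \<longlongrightarrow> 0) (at z)"
    by (rule Lim_null_comparison[rotated])
      (use supconv_lipschitz[OF K \<epsilon> R] in \<open>auto intro!: always_eventually\<close>)
  then show "isCont (supconv K \<epsilon> v) z" unfolding isCont_def by (simp add: LIM_zero_iff)
qed

lemma norm_add_sq: "(norm (a + h :: 'a::real_inner))\<^sup>2 = (norm a)\<^sup>2 + 2 * (a \<bullet> h) + (norm h)\<^sup>2"
  by (simp add: power2_norm_eq_inner algebra_simps inner_commute)

text \<open>A semiconvex function touched from above by a paraboloid is differentiable at the
  contact point, and gradients at nearby points converge to its gradient. At \<open>z\<close> such a
  gradient is \<open>(w - z) /\<^sub>R \<epsilon>\<close> with \<open>w\<close> optimal. The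
  estimate comes from using \<open>w\<close> as a competitor at \<open>z0 + h\<close> and choosing
  \<open>h\<close> opposite to the discrepancy \<open>D\<close>.\<close>

lemma supconv_optimal_near:
  assumes K: "compact K" "K \<noteq> {}" "continuous_on K v" and \<epsilon>: "\<epsilon> > 0"
    and touch: "\<forall>\<^sub>F h in nhds 0. supconv K \<epsilon> v (z0 + h) \<le> supconv K \<epsilon> v z0 + B \<bullet> h + C * (norm h)\<^sup>2"
    and \<eta>: "\<eta> > 0"
  shows "\<exists>\<rho>>0. \<forall>z w. norm (z - z0) < \<rho> \<longrightarrow> supconv_opt K \<epsilon> v z w \<longrightarrow> norm ((w - z) /\<^sub>R \<epsilon> - B) < \<eta>"
proof -
  let ?f = "supconv K \<epsilon> v"
  obtain R where R: "\<And>w. w \<in> K \<Longrightarrow> norm w \<le> R"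
    using compact_imp_bounded[OF K(1)] unfolding bounded_iff by blast
  have R0: "R \<ge> 0" using R K(2) norm_ge_zero order_trans by blast
  obtain d where d: "d > 0" "\<And>h. norm h < d \<Longrightarrow> ?f (z0 + h) \<le> ?f z0 + B \<bullet> h + C * (norm h)\<^sup>2"
    using touch unfolding eventually_nhds_0_norm by blast
  define D0 where "D0 = norm B + (R + norm z0) / \<epsilon>"
  define C' where "C' = \<bar>C\<bar> + 1 / (2 * \<epsilon>)"
  define E where "E = (2 * norm z0 + 1 + 2 * R) / \<epsilon>"
  \<comment> \<open>For \<open>h = - t *\<^sub>R D\<close> the first bound lets half of the linear
    gain absorb the quadratic error; the second keeps \<open>norm h\<close> below
    \<open>d\<close>.\<close>
  define t where "t = min (1 / (2 * C')) (d / (2 * (D0 + 1)))"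
  have D0: "D0 \<ge> 0" using \<epsilon> R0 by (simp add: D0_def)
  have C': "C' > 0" using \<epsilon> by (auto simp: C'_def intro!: add_nonneg_pos)
  have E: "E > 0"
  proof -
    have "2 * norm z0 + 1 + 2 * R > 0" using R0 norm_ge_zero[of z0] by linarith
    then show ?thesis using \<epsilon> by (simp add: E_def)
  qed
  have t: "t > 0" "t \<le> 1 / (2 * C')" "t \<le> d / (2 * (D0 + 1))"
    using C' D0 d(1) by (auto simp: t_def)
  define \<rho> where "\<rho> = min 1 (min (\<eta>\<^sup>2 * t / (16 * E)) (\<eta> * \<epsilon> / 4))"
  have \<rho>: "\<rho> > 0" "\<rho> \<le> 1" "\<rho> \<le> \<eta>\<^sup>2 * t / (16 * E)" "\<rho> \<le> \<eta> * \<epsilon> / 4"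
    using \<eta> t E \<epsilon> by (auto simp: \<rho>_def)
  show ?thesis
  proof (intro exI[of _ \<rho>] conjI allI impI \<rho>(1))
    fix z w assume z: "norm (z - z0) < \<rho>" and opt: "supconv_opt K \<epsilon> v z w"
    have wK: "w \<in> K" and fz: "?f z = v w - (norm (z - w))\<^sup>2 / (2 * \<epsilon>)" using opt by (auto simp: supconv_opt_def)
    define D where "D = B - (w - z0) /\<^sub>R \<epsilon>"
    have nz: "norm z \<le> norm z0 + 1" using norm_triangle_ineq2[of z z0] z \<rho>(2) by linarith
    have key: "- (E * norm (z - z0)) \<le> h \<bullet> D + C' * (norm h)\<^sup>2" if h: "norm h < d" for h
    proof -
      have 1: "\<bar>(norm (z0 - w))\<^sup>2 - (norm (z - w))\<^sup>2\<bar> / (2 * \<epsilon>) \<le> norm (z0 - z) * (norm z + norm z0 + 2 * R) / (2 * \<epsilon>)"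
        using norm_sq_diff_le[OF R[OF wK], of z0 z] \<epsilon> by (intro divide_right_mono) auto
      have 2: "\<bar>?f z - ?f z0\<bar> \<le> norm (z0 - z) * (norm z + norm z0 + 2 * R) / (2 * \<epsilon>)"
        by (rule supconv_lipschitz[OF K \<epsilon> R])
      have 3: "norm (z0 - z) * (norm z + norm z0 + 2 * R) / (2 * \<epsilon>) \<le> E * norm (z - z0) / 2"
      proof -
        have "norm (z0 - z) * (norm z + norm z0 + 2 * R) \<le> norm (z - z0) * (2 * norm z0 + 1 + 2 * R)"
          using nz by (simp add: norm_minus_commute mult_left_mono)
        then have "norm (z0 - z) * (norm z + norm z0 + 2 * R) / (2 * \<epsilon>)
           \<le> norm (z - z0) * (2 * norm z0 + 1 + 2 * R) / (2 * \<epsilon>)"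
          using \<epsilon> by (intro divide_right_mono) auto
        also have "\<dots> = E * norm (z - z0) / 2"
          using \<epsilon> by (simp add: E_def field_simps)
        finally show ?thesis .
      qed
      have lo: "- (E * norm (z - z0)) \<le> ?f z - ?f z0 - ((norm (z0 - w))\<^sup>2 - (norm (z - w))\<^sup>2) / (2 * \<epsilon>)"
      proof -
        have "((norm (z0 - w))\<^sup>2 - (norm (z - w))\<^sup>2) / (2 * \<epsilon>) \<le> \<bar>(norm (z0 - w))\<^sup>2 - (norm (z - w))\<^sup>2\<bar> / (2 * \<epsilon>)"
          using \<epsilon> by (intro divide_right_mono) auto
        with 1 2 3 show ?thesis by linarith
      qed
      have "v w - (norm (z0 + h - w))\<^sup>2 / (2 * \<epsilon>) \<le> ?f z0 + B \<bullet> h + C * (norm h)\<^sup>2"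
        using supconv_ge[OF K wK, of "z0 + h" \<epsilon>] d(2)[OF h] by linarith
      moreover have "(norm (z0 + h - w))\<^sup>2 / (2 * \<epsilon>)
          = (norm (z0 - w))\<^sup>2 / (2 * \<epsilon>) + ((z0 - w) \<bullet> h) / \<epsilon> + 1 / (2 * \<epsilon>) * (norm h)\<^sup>2"
      proof -
        have "(norm (z0 + h - w))\<^sup>2 = (norm (z0 - w))\<^sup>2 + 2 * ((z0 - w) \<bullet> h) + (norm h)\<^sup>2"
          using norm_add_sq[of "z0 - w" h] by (simp add: add_diff_eq add.commute diff_add_eq)
        then show ?thesis by (simp add: add_divide_distrib)
      qed
      ultimately have "?f z - ?f z0 - ((norm (z0 - w))\<^sup>2 - (norm (z - w))\<^sup>2) / (2 * \<epsilon>)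
          \<le> (B \<bullet> h + ((z0 - w) \<bullet> h) / \<epsilon>) + (C + 1 / (2 * \<epsilon>)) * (norm h)\<^sup>2"
        unfolding fz diff_divide_distrib distrib_right by linarith
      also have "B \<bullet> h + ((z0 - w) \<bullet> h) / \<epsilon> = h \<bullet> D"
        by (simp add: D_def inner_diff_right inner_diff_left inner_commute divide_inverse algebra_simps)
      also have "(C + 1 / (2 * \<epsilon>)) * (norm h)\<^sup>2 \<le> C' * (norm h)\<^sup>2"
        unfolding C'_def by (intro mult_right_mono) auto
      finally show ?thesis using lo by linarith
    qed
    have "norm D \<le> norm B + norm ((w - z0) /\<^sub>R \<epsilon>)" unfolding D_def by (rule norm_triangle_ineq4)
    also have "norm ((w - z0) /\<^sub>R \<epsilon>) \<le> (R + norm z0) / \<epsilon>"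
      using norm_triangle_ineq4[of w z0] R[OF wK] \<epsilon> by (simp add: divide_inverse_commute mult_left_mono)
    finally have nD: "norm D \<le> D0" by (simp add: D0_def)
    have "norm (- t *\<^sub>R D) < d"
    proof -
      have "t * norm D \<le> d / (2 * (D0 + 1)) * D0" using t nD D0 d(1) by (intro mult_mono) auto
      also have "\<dots> < d" using D0 d(1) by (simp add: field_simps add_nonneg_pos)
      finally show ?thesis using t by simp
    qed
    from key[OF this] have "- (E * norm (z - z0)) \<le> - t * (norm D)\<^sup>2 + C' * (t\<^sup>2 * (norm D)\<^sup>2)"
      by (simp add: power2_norm_eq_inner power_mult_distrib)
    moreover have "C' * (t\<^sup>2 * (norm D)\<^sup>2) \<le> t * (norm D)\<^sup>2 / 2"
    proof -
      have "C' * t \<le> C' * (1 / (2 * C'))" using t C' by (intro mult_left_mono) auto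
      then have "C' * t \<le> 1/2" using C' by simp
      then have "(C' * t) * (t * (norm D)\<^sup>2) \<le> 1/2 * (t * (norm D)\<^sup>2)" using t by (intro mult_right_mono) auto
      then show ?thesis by (simp add: power2_eq_square mult_ac)
    qed
    ultimately have "t * (norm D)\<^sup>2 \<le> 2 * (E * norm (z - z0))" by linarith
    also have "\<dots> < 2 * (E * (\<eta>\<^sup>2 * t / (16 * E)))"
      using z \<rho>(3) E by (intro mult_strict_left_mono) auto
    also have "\<dots> = t * (\<eta>\<^sup>2 / 8)" using E by simp
    finally have "(norm D)\<^sup>2 < \<eta>\<^sup>2 / 8" using t by simp
    also have "\<dots> \<le> (\<eta> / 2)\<^sup>2" by (simp add: power_divide)
    finally have D1: "norm D < \<eta> / 2" by (rule power_less_imp_less_base) (use \<eta> in simp)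
    have "norm ((z0 - z) /\<^sub>R \<epsilon>) \<le> \<eta> / 4"
    proof -
      have "norm (z0 - z) \<le> \<eta> * \<epsilon> / 4" using z \<rho>(4) by (simp add: norm_minus_commute)
      then have "norm (z0 - z) / \<epsilon> \<le> \<eta> / 4" using \<epsilon> by (simp add: field_simps)
      moreover have "norm ((z0 - z) /\<^sub>R \<epsilon>) = norm (z0 - z) / \<epsilon>" using \<epsilon> by (simp add: divide_inverse_commute)
      ultimately show ?thesis by simp
    qed
    moreover have "(w - z) /\<^sub>R \<epsilon> - B = (z0 - z) /\<^sub>R \<epsilon> - D"
      by (simp add: D_def algebra_simps)
    ultimately show "norm ((w - z) /\<^sub>R \<epsilon> - B) < \<eta>"
      using D1 \<eta> norm_triangle_ineq4[of "(z0 - z) /\<^sub>R \<epsilon>" D] by simp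
  qed
qed

text \<open>Keeping \<open>w\<close> as a competitor while \<open>z\<close> moves puts a paraboloid
  below the sup-convolution; a jet above must share its gradient and cannot be more concave. Moving
  \<open>z\<close> and \<open>w\<close> by the same vector leaves the penalty unchanged, so the jet
  passes to \<open>v\<close> at \<open>w\<close>.\<close>

lemma supconv_jet:
  assumes K: "compact K" "K \<noteq> {}" "continuous_on K v" and \<epsilon>: "\<epsilon> > 0"
    and opt: "supconv_opt K \<epsilon> v z w" and Q: "quadform Q" and jet: "jet_above (supconv K \<epsilon> v) z B Q"
  shows "B = (w - z) /\<^sub>R \<epsilon>" "0 \<le> Q h + 1 / (2 * \<epsilon>) * (norm h)\<^sup>2" "w \<in> interior K \<Longrightarrow> jet_above v w B Q"
proof -
  let ?f = "supconv K \<epsilon> v"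
  have wK: "w \<in> K" and fz: "?f z = v w - (norm (z - w))\<^sup>2 / (2 * \<epsilon>)" using opt by (auto simp: supconv_opt_def)
  have "\<forall>\<^sub>F h in nhds 0. 0 \<le> (B - (w - z) /\<^sub>R \<epsilon>) \<bullet> h + (Q h + 1 / (2 * \<epsilon>) * (norm h)\<^sup>2)"
    using jet unfolding jet_above_def
  proof eventually_elim
    case (elim h)
    have "(norm (z + h - w))\<^sup>2 = (norm (z - w))\<^sup>2 + 2 * ((z - w) \<bullet> h) + (norm h)\<^sup>2"
      using norm_add_sq[of "z - w" h] by (simp add: algebra_simps)
    then have "v w - ((norm (z - w))\<^sup>2 / (2 * \<epsilon>) + ((z - w) \<bullet> h) / \<epsilon> + (norm h)\<^sup>2 / (2 * \<epsilon>)) \<le> ?f z + B \<bullet> h + Q h"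
      using supconv_ge[OF K wK, of "z + h" \<epsilon>] elim by (simp add: add_divide_distrib)
    moreover have "(B - (w - z) /\<^sub>R \<epsilon>) \<bullet> h = B \<bullet> h + ((z - w) \<bullet> h) / \<epsilon>"
      by (simp add: inner_diff_left divide_inverse algebra_simps)
    ultimately show ?case using fz by simp
  qed
  note nn = nonneg_quadratic_imp[OF _ _ this]
  have lin: "linear (\<lambda>h. (B - (w - z) /\<^sub>R \<epsilon>) \<bullet> h)" by (simp add: bounded_linear.linear bounded_linear_inner_right)
  have qf: "quadform (\<lambda>h. Q h + 1 / (2 * \<epsilon>) * (norm h)\<^sup>2)" by (intro quadform_intros Q)
  have "(B - (w - z) /\<^sub>R \<epsilon>) \<bullet> (B - (w - z) /\<^sub>R \<epsilon>) = 0" by (rule nn(1)[OF lin qf])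
  then show "B = (w - z) /\<^sub>R \<epsilon>" by simp
  show "0 \<le> Q h + 1 / (2 * \<epsilon>) * (norm h)\<^sup>2" by (rule nn(2)[OF lin qf])
  assume "w \<in> interior K"
  then have "\<forall>\<^sub>F y in nhds w. y \<in> interior K" by (intro eventually_nhds_in_open) auto
  then obtain d where d: "d > 0" "\<And>y. dist y w < d \<Longrightarrow> y \<in> interior K" unfolding eventually_nhds_metric by blast
  have "\<forall>\<^sub>F h in nhds 0. w + h \<in> K"
    unfolding eventually_nhds_0_norm
  proof (intro exI[of _ d] conjI allI impI d(1))
    fix h :: 'a assume "norm h < d"
    then have "w + h \<in> interior K" by (intro d(2)) (simp add: dist_norm)
    then show "w + h \<in> K" using interior_subset by blast
  qed
  then show "jet_above v w B Q" using jet unfolding jet_above_def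
  proof eventually_elim
    case (elim h)
    have "v (w + h) - (norm (z - w))\<^sup>2 / (2 * \<epsilon>) \<le> ?f (z + h)"
      using supconv_ge[OF K elim(1), of "z + h" \<epsilon>] by simp
    then show ?case using elim(2) fz by simp
  qed
qed

section \<open>Frozen coefficients and their square roots\<close>

lemma quadform_fst: 
  fixes Q :: "(real ^ 'n) \<times> real \<Rightarrow> real"
  assumes "quadform Q" shows "quadform (\<lambda>y. Q (y, 0))"
  by (rule quadform_comp[OF assms]) (auto intro!: linearI)

lemma vec_sum_axis: "(\<Sum>i\<in>UNIV. (e $ i) *\<^sub>R axis i 1) = (e :: real ^ 'n)"
  by (simp add: vec_eq_iff axis_def if_distrib cong: if_cong)

text \<open>Composition with a rank one perturbation of the identity changes the trace only by a
  multiple of the value at \<open>e\<close>. For unit \<open>e\<close> and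
  \<open>\<kappa> = -1\<close> the map is an orthogonal projection, which yields
  \<open>psd_le_trace\<close>; with \<open>(1 + \<kappa>)\<^sup>2 = p - 1\<close> the multiple is
  \<open>p - 2\<close>, as in the p-Laplacian.\<close>

lemma trace_rank_one:
  fixes Q :: "real ^ 'n \<Rightarrow> real"
  assumes Q: "quadform Q"
  shows "(\<Sum>i\<in>UNIV. Q (axis i 1 + (\<kappa> * (e \<bullet> axis i 1)) *\<^sub>R e))
     = (\<Sum>i\<in>UNIV. Q (axis i 1)) + (2 * \<kappa> + \<kappa>\<^sup>2 * (norm e)\<^sup>2) * Q e"
proof -
  obtain A where A: "linear A" "Q = (\<lambda>h. h \<bullet> A h)" using Q by (auto simp: quadform_def)
  have "Q (axis i 1 + (\<kappa> * (e \<bullet> axis i 1)) *\<^sub>R e) = Q (axis i 1)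
      + \<kappa> * (e $ i * (axis i 1 \<bullet> A e)) + \<kappa> * (e $ i * (e \<bullet> A (axis i 1))) + \<kappa>\<^sup>2 * (e $ i * e $ i) * Q e" for i
    by (simp add: A linear_add[OF A(1)] linear_scale[OF A(1)] inner_axis inner_add_left inner_add_right
        power2_eq_square algebra_simps)
  moreover have "(\<Sum>i\<in>UNIV. e $ i * (axis i 1 \<bullet> A e)) = Q e"
  proof -
    have "Q e = (\<Sum>i\<in>UNIV. (e $ i) *\<^sub>R axis i 1) \<bullet> A e" by (simp add: vec_sum_axis A)
    then show ?thesis by (simp add: inner_sum_left)
  qed
  moreover have "(\<Sum>i\<in>UNIV. e $ i * (e \<bullet> A (axis i 1))) = Q e"
  proof -
    have "Q e = e \<bullet> A (\<Sum>i\<in>UNIV. (e $ i) *\<^sub>R axis i 1)" by (simp add: vec_sum_axis A)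
    then show ?thesis by (simp add: linear_sum[OF A(1)] linear_scale[OF A(1)] inner_sum_right)
  qed
  moreover have "(\<Sum>i\<in>UNIV. e $ i * e $ i) = (norm e)\<^sup>2"
    by (simp add: power2_norm_eq_inner inner_vec_def)
  ultimately show ?thesis
    by (simp only: sum.distrib sum_distrib_left[symmetric] sum_distrib_right[symmetric]) (simp add: algebra_simps)
qed

definition pmap :: "real \<Rightarrow> real \<Rightarrow> real ^ 'n \<Rightarrow> real ^ 'n \<Rightarrow> real ^ 'n" where
  "pmap p \<kappa> \<xi> y = norm \<xi> powr ((p - 2) / 2) *\<^sub>R (y + (\<kappa> * ((\<xi> /\<^sub>R norm \<xi>) \<bullet> y)) *\<^sub>R (\<xi> /\<^sub>R norm \<xi>))"

text \<open>Both signs of \<open>1 + \<kappa>\<close> give a square root of the coefficient matrix; the two choices differ by the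
  reflection across the hyperplane orthogonal to \<open>\<xi>\<close>.\<close>

lemma Vq_pmap:
  fixes Q :: "(real ^ 'n) \<times> real \<Rightarrow> real"
  assumes Q: "quadform Q" and \<xi>: "\<xi> \<noteq> 0" and \<kappa>: "(1 + \<kappa>)\<^sup>2 = p - 1"
  shows "(\<Sum>i\<in>UNIV. Q (pmap p \<kappa> \<xi> (axis i 1), 0)) = Vq p \<xi> Q"
proof -
  let ?e = "\<xi> /\<^sub>R norm \<xi>" and ?c = "norm \<xi> powr ((p - 2) / 2)"
  have ne: "norm ?e = 1" using \<xi> by simp
  have c: "?c\<^sup>2 = norm \<xi> powr (p - 2)"
    unfolding power2_eq_square powr_add[symmetric] by simp
  have "Q (pmap p \<kappa> \<xi> y, 0) = ?c\<^sup>2 * Q (y + (\<kappa> * (?e \<bullet> y)) *\<^sub>R ?e, 0)" for y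
    using quadform_scaleR[OF Q, of ?c "(y + (\<kappa> * (?e \<bullet> y)) *\<^sub>R ?e, 0)"] by (simp add: pmap_def)
  then have "(\<Sum>i\<in>UNIV. Q (pmap p \<kappa> \<xi> (axis i 1), 0))
     = ?c\<^sup>2 * (\<Sum>i\<in>UNIV. Q (axis i 1 + (\<kappa> * (?e \<bullet> axis i 1)) *\<^sub>R ?e, 0))"
    by (simp only: sum_distrib_left)
  also have "\<dots> = ?c\<^sup>2 * ((\<Sum>i\<in>UNIV. Q (axis i 1, 0)) + (2 * \<kappa> + \<kappa>\<^sup>2 * (norm ?e)\<^sup>2) * Q (?e, 0))"
    unfolding trace_rank_one[OF quadform_fst[OF Q], of \<kappa> ?e] ..
  also have "2 * \<kappa> + \<kappa>\<^sup>2 * (norm ?e)\<^sup>2 = p - 2"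
    using \<kappa> unfolding ne by (simp add: power2_eq_square algebra_simps)
  finally show ?thesis by (simp add: Vq_def c)
qed

lemma psd_le_trace:
  fixes Q :: "real ^ 'n \<Rightarrow> real"
  assumes Q: "quadform Q" and psd: "\<And>h. 0 \<le> Q h" and e: "norm e = 1"
  shows "Q e \<le> (\<Sum>i\<in>UNIV. Q (axis i 1))"
proof -
  have "0 \<le> (\<Sum>i\<in>UNIV. Q (axis i 1 + (-1 * (e \<bullet> axis i 1)) *\<^sub>R e))" by (intro sum_nonneg psd)
  then show ?thesis unfolding trace_rank_one[OF Q] e by simp
qed

text \<open>Positivity at \<open>axis i 1 + axis j 1\<close> and \<open>axis i 1 - axis j 1\<close>
  bounds every entry of the symmetrised matrix by the trace, so the difference is linear in the
  trace and needs no other information on \<open>Q\<close>.\<close>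

lemma psd_diff_le:
  fixes Q :: "real ^ 'n \<Rightarrow> real"
  assumes Q: "quadform Q" and psd: "\<And>h. 0 \<le> Q h"
  shows "\<bar>Q y - Q y'\<bar> \<le> (\<Sum>i\<in>UNIV. Q (axis i 1)) * (\<Sum>i\<in>UNIV. \<Sum>j\<in>UNIV. \<bar>y $ i * y $ j - y' $ i * y' $ j\<bar>)"
proof -
  let ?T = "\<Sum>i\<in>UNIV. Q (axis i 1)"
  obtain A where A: "linear A" "Q = (\<lambda>h. h \<bullet> A h)" using Q by (auto simp: quadform_def)
  define b where "b i j = (axis i 1 \<bullet> A (axis j 1) + axis j 1 \<bullet> A (axis i 1)) / 2" for i j
  have Qe: "Q (axis i 1) \<le> ?T" for i by (rule member_le_sum) (auto simp: psd)
  have b: "\<bar>b i j\<bar> \<le> ?T" for i j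
  proof -
    have "0 \<le> Q (axis i 1 + axis j 1)" "0 \<le> Q (axis i 1 - axis j 1)" by (rule psd)+
    then have "\<bar>2 * b i j\<bar> \<le> Q (axis i 1) + Q (axis j 1)"
      by (simp add: A b_def linear_add[OF A(1)] linear_diff[OF A(1)] inner_add_left inner_add_right
          inner_diff_left inner_diff_right abs_le_iff)
    then show ?thesis using Qe[of i] Qe[of j] by linarith
  qed
  have expand: "Q y = (\<Sum>i\<in>UNIV. \<Sum>j\<in>UNIV. (y $ i * y $ j) * b i j)" for y
  proof -
    have "Q y = (\<Sum>i\<in>UNIV. (y $ i) *\<^sub>R axis i 1) \<bullet> A (\<Sum>j\<in>UNIV. (y $ j) *\<^sub>R axis j 1)"
      by (simp add: vec_sum_axis A)
    also have "\<dots> = (\<Sum>i\<in>UNIV. \<Sum>j\<in>UNIV. (y $ i * y $ j) * (axis j 1 \<bullet> A (axis i 1)))"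
      by (simp add: linear_sum[OF A(1)] linear_scale[OF A(1)] inner_sum_left inner_sum_right sum_distrib_left mult.assoc)
    finally have 1: "Q y = (\<Sum>i\<in>UNIV. \<Sum>j\<in>UNIV. (y $ i * y $ j) * (axis j 1 \<bullet> A (axis i 1)))" .
    also have "\<dots> = (\<Sum>i\<in>UNIV. \<Sum>j\<in>UNIV. (y $ i * y $ j) * (axis i 1 \<bullet> A (axis j 1)))"
      by (subst sum.swap) (simp add: mult_ac)
    finally have 2: "Q y = (\<Sum>i\<in>UNIV. \<Sum>j\<in>UNIV. (y $ i * y $ j) * (axis i 1 \<bullet> A (axis j 1)))" .
    have "2 * Q y = (\<Sum>i\<in>UNIV. \<Sum>j\<in>UNIV. (y $ i * y $ j) * (2 * b i j))"
    proof -
      have bb: "2 * b i j = axis i 1 \<bullet> A (axis j 1) + axis j 1 \<bullet> A (axis i 1)" for i j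
        by (simp add: b_def)
      show ?thesis by (simp only: bb distrib_left sum.distrib 1[symmetric] 2[symmetric])
    qed
    also have "\<dots> = 2 * (\<Sum>i\<in>UNIV. \<Sum>j\<in>UNIV. (y $ i * y $ j) * b i j)"
      by (simp add: sum_distrib_left mult_ac)
    finally show ?thesis by simp
  qed
  have "\<bar>Q y - Q y'\<bar> = \<bar>\<Sum>i\<in>UNIV. \<Sum>j\<in>UNIV. (y $ i * y $ j - y' $ i * y' $ j) * b i j\<bar>"
    unfolding expand by (simp add: sum_subtractf left_diff_distrib)
  also have "\<dots> \<le> (\<Sum>i\<in>UNIV. \<bar>\<Sum>j\<in>UNIV. (y $ i * y $ j - y' $ i * y' $ j) * b i j\<bar>)" by (rule sum_abs)
  also have "\<dots> \<le> (\<Sum>i\<in>UNIV. \<Sum>j\<in>UNIV. \<bar>(y $ i * y $ j - y' $ i * y' $ j) * b i j\<bar>)"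
    by (intro sum_mono sum_abs)
  also have "\<dots> \<le> (\<Sum>i\<in>UNIV. \<Sum>j\<in>UNIV. \<bar>y $ i * y $ j - y' $ i * y' $ j\<bar> * ?T)"
    unfolding abs_mult by (intro sum_mono mult_left_mono b) auto
  also have "\<dots> = ?T * (\<Sum>i\<in>UNIV. \<Sum>j\<in>UNIV. \<bar>y $ i * y $ j - y' $ i * y' $ j\<bar>)"
  proof -
    have "(\<Sum>i\<in>UNIV. \<Sum>j\<in>UNIV. a i j * c) = c * (\<Sum>i\<in>UNIV. \<Sum>j\<in>UNIV. a i j)"
      for c and a :: "'n \<Rightarrow> 'n \<Rightarrow> real"
      by (simp add: sum_distrib_left mult.commute)
    then show ?thesis .
  qed
  finally show ?thesis .
qed

text \<open>Ellipticity: the coefficient matrix is \<open>norm \<xi> powr (p - 2)\<close> times a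
  matrix whose eigenvalues are \<open>p - 1\<close>, along \<open>\<xi>\<close>, and 1
  otherwise.\<close>

lemma Vq_ge_trace:
  fixes Q :: "(real ^ 'n) \<times> real \<Rightarrow> real"
  assumes Q: "quadform Q" and psd: "\<And>h. 0 \<le> Q h" and \<xi>: "\<xi> \<noteq> 0" and p: "1 < p"
  shows "norm \<xi> powr (p - 2) * min 1 (p - 1) * (\<Sum>i\<in>UNIV. Q (axis i 1, 0)) \<le> Vq p \<xi> Q"
proof -
  let ?T = "\<Sum>i\<in>UNIV. Q (axis i 1, 0)" and ?q = "Q (\<xi> /\<^sub>R norm \<xi>, 0)"
  have q: "0 \<le> ?q" "?q \<le> ?T"
    using psd_le_trace[OF quadform_fst[OF Q], of "\<xi> /\<^sub>R norm \<xi>"] psd \<xi> by auto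
  have "min 1 (p - 1) * ?T \<le> ?T + (p - 2) * ?q"
  proof (cases "p \<ge> 2")
    case True
    then have "0 \<le> (p - 2) * ?q" using q by simp
    then show ?thesis using True by (simp add: min_def)
  next
    case False
    then have "(2 - p) * ?q \<le> (2 - p) * ?T" using q by (intro mult_left_mono) auto
    then show ?thesis using False by (simp add: min_def algebra_simps)
  qed
  then show ?thesis unfolding Vq_def mult.assoc by (intro mult_left_mono) auto
qed

text \<open>On nonnegative forms both the operator and its variation are comparable with the trace,
  so continuity of the coefficients gives a relative error uniform in \<open>Q\<close>. An absolute
  error would be useless, since the second derivatives are not bounded above.\<close>

lemma Vq_near:
  fixes \<xi> :: "real ^ 'n"
  assumes \<xi>: "\<xi> \<noteq> 0" and p: "1 < p" and e: "e > 0"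
  shows "\<forall>\<^sub>F b in nhds \<xi>. \<forall>Q. quadform Q \<longrightarrow> (\<forall>h. 0 \<le> Q h) \<longrightarrow> Vq p b Q \<le> (1 + e) * Vq p \<xi> Q"
proof -
  define c0 where "c0 = norm \<xi> powr (p - 2) * min 1 (p - 1)"
  have c0: "c0 > 0" using \<xi> p by (simp add: c0_def)
  define S where "S b = (\<Sum>i\<in>UNIV. \<Sum>j\<in>UNIV. \<bar>(b /\<^sub>R norm b) $ i * (b /\<^sub>R norm b) $ j
      - (\<xi> /\<^sub>R norm \<xi>) $ i * (\<xi> /\<^sub>R norm \<xi>) $ j\<bar>)" for b :: "real ^ 'n"
  define E where "E b = \<bar>norm b powr (p - 2) - norm \<xi> powr (p - 2)\<bar> * (1 + \<bar>p - 2\<bar>)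
     + norm \<xi> powr (p - 2) * (\<bar>p - 2\<bar> * S b)" for b :: "real ^ 'n"
  have b0: "((\<lambda>b. b) \<longlongrightarrow> \<xi>) (nhds \<xi>)" by (simp add: filterlim_ident)
  have hat: "((\<lambda>b. (b /\<^sub>R norm b) $ i) \<longlongrightarrow> (\<xi> /\<^sub>R norm \<xi>) $ i) (nhds \<xi>)" for i
    using \<xi> b0 by (intro tendsto_intros) auto
  have "(S \<longlongrightarrow> (\<Sum>i\<in>UNIV. \<Sum>j\<in>UNIV. \<bar>(\<xi> /\<^sub>R norm \<xi>) $ i * (\<xi> /\<^sub>R norm \<xi>) $ j
      - (\<xi> /\<^sub>R norm \<xi>) $ i * (\<xi> /\<^sub>R norm \<xi>) $ j\<bar>)) (nhds \<xi>)"
    unfolding S_def by (intro tendsto_sum tendsto_rabs tendsto_diff tendsto_mult hat tendsto_const)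
  then have S: "(S \<longlongrightarrow> 0) (nhds \<xi>)" by simp
  have N: "((\<lambda>b. norm b powr (p - 2)) \<longlongrightarrow> norm \<xi> powr (p - 2)) (nhds \<xi>)"
    using \<xi> b0 by (intro tendsto_powr tendsto_norm tendsto_const) auto
  have "(E \<longlongrightarrow> \<bar>norm \<xi> powr (p - 2) - norm \<xi> powr (p - 2)\<bar> * (1 + \<bar>p - 2\<bar>)
     + norm \<xi> powr (p - 2) * (\<bar>p - 2\<bar> * 0)) (nhds \<xi>)"
    unfolding E_def by (intro tendsto_add tendsto_mult tendsto_rabs tendsto_diff N S tendsto_const)
  then have "(E \<longlongrightarrow> 0) (nhds \<xi>)" by simp
  then have "\<forall>\<^sub>F b in nhds \<xi>. E b < e * c0" using e c0 by (intro order_tendstoD(2)) auto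
  moreover have "\<forall>\<^sub>F b in nhds \<xi>. b \<noteq> 0" using b0 \<xi> by (rule tendsto_imp_eventually_ne)
  ultimately show ?thesis
  proof eventually_elim
    case (elim b)
    show ?case
    proof (intro allI impI)
      fix Q :: "(real ^ 'n) \<times> real \<Rightarrow> real" assume Q: "quadform Q" and psd': "\<forall>h. 0 \<le> Q h"
      then have psd: "0 \<le> Q h" for h by blast
      let ?T = "\<Sum>i\<in>UNIV. Q (axis i 1, 0)"
      let ?qb = "Q (b /\<^sub>R norm b, 0)" and ?q\<xi> = "Q (\<xi> /\<^sub>R norm \<xi>, 0)"
      have T: "?T \<ge> 0" by (intro sum_nonneg psd)
      have qb: "0 \<le> ?qb" "?qb \<le> ?T"
        using psd_le_trace[OF quadform_fst[OF Q], of "b /\<^sub>R norm b"] psd elim(2) by auto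
      have dq: "\<bar>?qb - ?q\<xi>\<bar> \<le> ?T * S b"
        unfolding S_def by (rule psd_diff_le[OF quadform_fst[OF Q]]) (rule psd)
      have eq: "Vq p b Q - Vq p \<xi> Q = (norm b powr (p - 2) - norm \<xi> powr (p - 2)) * (?T + (p - 2) * ?qb)
         + norm \<xi> powr (p - 2) * ((p - 2) * (?qb - ?q\<xi>))"
        by (simp add: Vq_def algebra_simps)
      have "\<bar>?T + (p - 2) * ?qb\<bar> \<le> (1 + \<bar>p - 2\<bar>) * ?T"
      proof -
        have "\<bar>(p - 2) * ?qb\<bar> \<le> \<bar>p - 2\<bar> * ?T" unfolding abs_mult using qb by (intro mult_left_mono) auto
        then show ?thesis using T by (simp add: distrib_right abs_le_iff)
      qed
      then have "\<bar>(norm b powr (p - 2) - norm \<xi> powr (p - 2)) * (?T + (p - 2) * ?qb)\<bar>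
         \<le> \<bar>norm b powr (p - 2) - norm \<xi> powr (p - 2)\<bar> * ((1 + \<bar>p - 2\<bar>) * ?T)"
        unfolding abs_mult by (intro mult_left_mono) auto
      moreover have "\<bar>norm \<xi> powr (p - 2) * ((p - 2) * (?qb - ?q\<xi>))\<bar>
          \<le> norm \<xi> powr (p - 2) * (\<bar>p - 2\<bar> * (?T * S b))"
        unfolding abs_mult using dq by (simp add: mult_left_mono)
      ultimately have "Vq p b Q - Vq p \<xi> Q \<le> E b * ?T"
        unfolding eq E_def by (simp add: algebra_simps) linarith
      also have "\<dots> \<le> e * (c0 * ?T)"
        using elim(1) T mult_right_mono[of "E b" "e * c0" ?T] by (simp add: mult.assoc)
      also have "\<dots> \<le> e * Vq p \<xi> Q"
        using Vq_ge_trace[OF Q psd \<xi> p] e by (intro mult_left_mono) (auto simp: c0_def)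
      finally show "Vq p b Q \<le> (1 + e) * Vq p \<xi> Q" by (simp add: distrib_right)
    qed
  qed
qed

text \<open>Semiconvexity of the sup-convolution makes the freezing of the coefficients at the gradient possible:
  large second derivatives can only be positive, and then they help.\<close>

lemma supconv_frozen_jets:
  fixes v :: "(real ^ 'n) \<times> real \<Rightarrow> real"
  assumes p: "1 < p" and K: "compact K" "K \<noteq> {}" "continuous_on K v" and \<epsilon>: "\<epsilon> > 0"
    and sub: "jet_sub p s (interior K) v"
    and touch: "\<forall>\<^sub>F h in nhds 0. supconv K \<epsilon> v (z0 + h) \<le> supconv K \<epsilon> v z0 + (\<xi>, q) \<bullet> h + C * (norm h)\<^sup>2"
    and \<xi>: "\<xi> \<noteq> 0" and int: "z0 + \<epsilon> *\<^sub>R (\<xi>, q) \<in> interior K" and \<eta>: "\<eta> > 0"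
  shows "\<exists>\<rho>>0. \<forall>z B Q. norm (z - z0) < \<rho> \<longrightarrow> quadform Q \<longrightarrow> jet_above (supconv K \<epsilon> v) z B Q \<longrightarrow>
     (p - 1) / 2 * (q - s * norm \<xi> powr p) - \<eta> \<le> Vq p \<xi> Q"
proof -
  \<comment> \<open>The operator on the paraboloid that makes every \<open>Q\<close> nonnegative;
    this contribution cancels at the end.\<close>
  define n where "n b = Vq p b (\<lambda>h :: (real ^ 'n) \<times> real. (norm h)\<^sup>2) / (2 * \<epsilon>)" for b
  define X where "X B = (p - 1) / 2 * (snd B - s * norm (fst B) powr p) + n (fst B)" for B
  define X0 where "X0 = X (\<xi>, q)"
  \<comment> \<open>Gives \<open>e * X0 \<le> \<eta> / 2\<close>, which suffices for
    \<open>(1 + e) * (X0 - \<eta>) \<le> X0 - \<eta> / 2\<close>.\<close>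
  define e where "e = \<eta> / (2 * (\<bar>X0\<bar> + 1))"
  have e: "e > 0" using \<eta> by (simp add: e_def)
  have B0: "((\<lambda>B. B) \<longlongrightarrow> (\<xi>, q)) (nhds (\<xi>, q))" by (simp add: filterlim_ident)
  have f1: "(fst \<longlongrightarrow> \<xi>) (nhds (\<xi>, q))" and f2: "(snd \<longlongrightarrow> q) (nhds (\<xi>, q))"
    using tendsto_fst[OF B0] tendsto_snd[OF B0] by simp_all
  have "((\<lambda>B. n (fst B)) \<longlongrightarrow> n \<xi>) (nhds (\<xi>, q))"
    unfolding n_def using \<epsilon> \<xi> by (intro tendsto_divide Vq_tendsto quadform_norm f1 tendsto_const) auto
  then have "(X \<longlongrightarrow> X0) (nhds (\<xi>, q))"
    unfolding X_def X0_def fst_conv snd_conv using \<xi>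
    by (intro tendsto_add tendsto_mult tendsto_diff tendsto_powr tendsto_norm f1 f2 tendsto_const) auto
  then have evX: "\<forall>\<^sub>F B in nhds (\<xi>, q). X0 - \<eta> / 2 < X B" using \<eta> by (intro order_tendstoD(1)) auto
  have evV: "\<forall>\<^sub>F B in nhds (\<xi>, q). \<forall>Q. quadform Q \<longrightarrow> (\<forall>h. 0 \<le> Q h) \<longrightarrow>
      Vq p (fst B) Q \<le> (1 + e) * Vq p \<xi> Q"
    using filterlim_iff[THEN iffD1, OF f1, rule_format, OF Vq_near[OF \<xi> p e]] .
  have evn: "\<forall>\<^sub>F B in nhds (\<xi>, q). fst B \<noteq> 0" using f1 \<xi> by (rule tendsto_imp_eventually_ne)
  obtain d where d: "d > 0" "\<And>B. dist B (\<xi>, q) < d \<Longrightarrow> X0 - \<eta> / 2 < X B \<and> fst B \<noteq> 0 \<and>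
     (\<forall>Q. quadform Q \<longrightarrow> (\<forall>h. 0 \<le> Q h) \<longrightarrow> Vq p (fst B) Q \<le> (1 + e) * Vq p \<xi> Q)"
    using eventually_conj[OF evX eventually_conj[OF evn evV]] unfolding eventually_nhds_metric by blast
  obtain r where r: "r > 0" "ball (z0 + \<epsilon> *\<^sub>R (\<xi>, q)) r \<subseteq> interior K"
    using int open_interior open_contains_ball by blast
  \<comment> \<open>Half of the margin \<open>r\<close> is left for the distance from
    \<open>z\<close> to \<open>z0\<close>, the other half for \<open>\<epsilon> * d'\<close>, the
    error of the optimal point.\<close>
  define d' where "d' = min d (r / (2 * \<epsilon>))"
  have d': "d' > 0" "d' \<le> d" "\<epsilon> * d' \<le> r / 2"
  proof -
    show "d' > 0" "d' \<le> d" using d r \<epsilon> by (auto simp: d'_def)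
    have "\<epsilon> * d' \<le> \<epsilon> * (r / (2 * \<epsilon>))" using \<epsilon> by (intro mult_left_mono) (auto simp: d'_def)
    then show "\<epsilon> * d' \<le> r / 2" using \<epsilon> by simp
  qed
  obtain \<rho>0 where \<rho>0: "\<rho>0 > 0" "\<And>z w. norm (z - z0) < \<rho>0 \<Longrightarrow> supconv_opt K \<epsilon> v z w \<Longrightarrow>
      norm ((w - z) /\<^sub>R \<epsilon> - (\<xi>, q)) < d'"
    using supconv_optimal_near[OF K \<epsilon> touch d'(1)] by blast
  show ?thesis
  proof (intro exI[of _ "min \<rho>0 (r/2)"] conjI allI impI)
    show "min \<rho>0 (r/2) > 0" using \<rho>0 r by simp
    fix z B Q assume z: "norm (z - z0) < min \<rho>0 (r/2)" and Q: "quadform Q"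
      and jet: "jet_above (supconv K \<epsilon> v) z B Q"
    obtain w where w: "supconv_opt K \<epsilon> v z w" using supconv_opt_ex[OF K] by blast
    note sj = supconv_jet[OF K \<epsilon> w Q jet]
    have near: "norm (B - (\<xi>, q)) < d'" using \<rho>0(2)[OF _ w] z unfolding sj(1) by simp
    have "w = z + \<epsilon> *\<^sub>R B" using \<epsilon> by (simp add: sj(1))
    then have "z0 + \<epsilon> *\<^sub>R (\<xi>, q) - w = (z0 - z) - \<epsilon> *\<^sub>R (B - (\<xi>, q))" by (simp add: algebra_simps)
    then have "norm (z0 + \<epsilon> *\<^sub>R (\<xi>, q) - w) \<le> norm (z0 - z) + norm (\<epsilon> *\<^sub>R (B - (\<xi>, q)))"
      by (simp only: norm_triangle_ineq4)
    also have "\<dots> = norm (z0 - z) + \<epsilon> * norm (B - (\<xi>, q))" using \<epsilon> by simp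
    also have "\<dots> < r / 2 + \<epsilon> * d'"
      using z near \<epsilon> by (intro add_strict_mono) (auto simp: norm_minus_commute)
    also have "\<dots> \<le> r" using d' by simp
    finally have "w \<in> interior K" using r(2) by (auto simp: dist_norm)
    then have jw: "jet_above v w B Q" and wI: "w \<in> interior K" using sj(3) by auto
    have "dist B (\<xi>, q) < d" using near d' by (simp add: dist_norm)
    note dB = d(2)[OF this]
    obtain b q' where B: "B = (b, q')" by (cases B)
    have "(p - 1) / 2 * (q' - s * norm b powr p) \<le> Vq p b Q"
      using sub wI Q jw dB unfolding jet_sub_def B by auto
    then have XB: "X B \<le> Vq p b (\<lambda>h. Q h + 1 / (2 * \<epsilon>) * (norm h)\<^sup>2)"
      unfolding Vq_add Vq_cmult X_def n_def B by simp
    also have "\<dots> \<le> (1 + e) * Vq p \<xi> (\<lambda>h. Q h + 1 / (2 * \<epsilon>) * (norm h)\<^sup>2)"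
    proof -
      have "quadform (\<lambda>h. Q h + 1 / (2 * \<epsilon>) * (norm h)\<^sup>2)" by (intro quadform_intros Q)
      moreover have "\<forall>h. 0 \<le> Q h + 1 / (2 * \<epsilon>) * (norm h)\<^sup>2" using sj(2) by blast
      moreover have "\<forall>Q. quadform Q \<longrightarrow> (\<forall>h. 0 \<le> Q h) \<longrightarrow> Vq p b Q \<le> (1 + e) * Vq p \<xi> Q"
        using dB unfolding B by simp
      ultimately show ?thesis by simp
    qed
    also have "\<dots> = (1 + e) * (Vq p \<xi> Q + n \<xi>)"
      unfolding Vq_add Vq_cmult n_def by simp
    finally have "X0 - \<eta> / 2 < (1 + e) * (Vq p \<xi> Q + n \<xi>)" using dB by linarith
    moreover have "(1 + e) * (X0 - \<eta>) \<le> X0 - \<eta> / 2"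
    proof -
      have "e * X0 \<le> e * (\<bar>X0\<bar> + 1)" using e by (intro mult_left_mono) auto
      also have "\<dots> = \<eta> / 2"
      proof -
        have "\<eta> / (2 * a) * a = \<eta> / 2" if "a > 0" for a using that by simp
        moreover have "\<bar>X0\<bar> + 1 > 0" by linarith
        ultimately show ?thesis unfolding e_def by blast
      qed
      finally have "e * X0 \<le> \<eta> / 2" .
      moreover have "0 \<le> e * \<eta>" using e \<eta> by simp
      ultimately show ?thesis by (simp add: algebra_simps)
    qed
    ultimately have "(1 + e) * (X0 - \<eta>) < (1 + e) * (Vq p \<xi> Q + n \<xi>)" by linarith
    then have "X0 - \<eta> < Vq p \<xi> Q + n \<xi>" using e by simp
    then show "(p - 1) / 2 * (q - s * norm \<xi> powr p) - \<eta> \<le> Vq p \<xi> Q"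
      by (simp add: X0_def X_def)
  qed
qed

section \<open>The Ishii--Lions estimate\<close>

lemma jet_above_shift: "jet_above (\<lambda>h. f (z + h)) y B Q \<longleftrightarrow> jet_above f (z + y) B Q"
  by (simp add: jet_above_def add.assoc)

lemma Vq_minus: "quadform Q \<Longrightarrow> Vq p (- \<xi>) Q = Vq p \<xi> Q"
  using quadform_minus[of Q "(\<xi> /\<^sub>R norm \<xi>, 0)"] by (simp add: Vq_def)

text \<open>The touching paraboloid forces the optimal point to be
  \<open>z + \<epsilon> *\<^sub>R B\<close>, which is how the freezing lemma refers to it.\<close>

lemma supconv_opt_interior_jet:
  fixes v :: "'a::euclidean_space \<Rightarrow> real"
  assumes K: "compact K" "K \<noteq> {}" "continuous_on K v" and \<epsilon>: "\<epsilon> > 0"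
    and opt: "\<And>w. supconv_opt K \<epsilon> v z w \<Longrightarrow> w \<in> interior K"
    and touch: "\<forall>\<^sub>F h in nhds 0. supconv K \<epsilon> v (z + h) \<le> supconv K \<epsilon> v z + B \<bullet> h + C * (norm h)\<^sup>2"
  shows "z + \<epsilon> *\<^sub>R B \<in> interior K"
proof -
  obtain w where w: "supconv_opt K \<epsilon> v z w" using supconv_opt_ex[OF K] by blast
  have "jet_above (supconv K \<epsilon> v) z B (\<lambda>h. C * (norm h)\<^sup>2)" using touch by (simp add: jet_above_def)
  from supconv_jet(1)[OF K \<epsilon> w quadform_cmult[OF quadform_norm] this]
  have "w = z + \<epsilon> *\<^sub>R B" using \<epsilon> by simp
  with opt[OF w] show ?thesis by simp
qed

lemma eventually_nhds_0_comp:
  fixes T :: "'a::real_normed_vector \<Rightarrow> 'b::real_normed_vector"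
  assumes "\<forall>\<^sub>F H in nhds 0. P H" "\<And>h. norm (T h) = norm h"
  shows "\<forall>\<^sub>F h in nhds 0. P (T h)"
  using assms unfolding eventually_nhds_0_norm by metis

text \<open>After freezing, each operator sums \<open>Q\<close> over the images of the unit vectors
  under a square root, the form required by \<open>jets_of_sum\<close>. The conclusion evaluates
  \<open>Q\<close> on paired images, so it depends on the choice of the roots although the separate
  operators do not; \<open>\<kappa>1\<close> and \<open>\<kappa>2\<close> are left free for this
  reason.\<close>

lemma doubled_maximum:
  fixes v :: "(real ^ 'n) \<times> real \<Rightarrow> real" and \<Phi> :: "((real ^ 'n) \<times> real) \<times> (real ^ 'n) \<times> real \<Rightarrow> real"
  assumes p: "1 < p" and K: "compact K" "K \<noteq> {}" "continuous_on K v" and \<epsilon>: "\<epsilon> > 0"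
    and sub: "jet_sub p 1 (interior K) v" and sup: "jet_sub p (- 1) (interior K) (\<lambda>w. - v w)"
    and so: "second_order \<Phi> (z, z') l Q" and l: "l = (\<lambda>H. (\<xi>1, q1) \<bullet> fst H + (- \<xi>2, - q2) \<bullet> snd H)"
    and max: "\<forall>\<^sub>F H in nhds 0. supconv K \<epsilon> v (z + fst H) + supconv K \<epsilon> (\<lambda>w. - v w) (z' + snd H) - \<Phi> ((z, z') + H)
        \<le> supconv K \<epsilon> v z + supconv K \<epsilon> (\<lambda>w. - v w) z' - \<Phi> (z, z')"
    and opt: "\<And>w. supconv_opt K \<epsilon> v z w \<Longrightarrow> w \<in> interior K"
      "\<And>w. supconv_opt K \<epsilon> (\<lambda>w. - v w) z' w \<Longrightarrow> w \<in> interior K"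
    and \<xi>: "\<xi>1 \<noteq> 0" "\<xi>2 \<noteq> 0" and \<kappa>: "(1 + \<kappa>1)\<^sup>2 = p - 1" "(1 + \<kappa>2)\<^sup>2 = p - 1"
  shows "(p - 1) / 2 * (q1 - q2 - (norm \<xi>1 powr p - norm \<xi>2 powr p))
     \<le> (\<Sum>i\<in>UNIV. Q ((pmap p \<kappa>1 \<xi>1 (axis i 1), 0), (pmap p \<kappa>2 \<xi>2 (axis i 1), 0)))"
proof -
  let ?f = "supconv K \<epsilon> v" and ?g = "supconv K \<epsilon> (\<lambda>w. - v w)"
  have K': "continuous_on K (\<lambda>w. - v w)" using K(3) by (intro continuous_intros)
  note Kg = K(1,2) K'
  let ?\<sigma> = "\<lambda>i. (pmap p \<kappa>1 \<xi>1 (axis i 1), 0 :: real)" and ?\<sigma>' = "\<lambda>i. (pmap p \<kappa>2 \<xi>2 (axis i 1), 0 :: real)"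
  obtain C where C: "\<forall>\<^sub>F H in nhds 0. \<bar>\<Phi> ((z, z') + H) - \<Phi> (z, z') - l H\<bar> \<le> C * (norm H)\<^sup>2"
    using second_order_le_quadratic[OF so] by blast
  have both: "\<forall>\<^sub>F H in nhds 0. ?f (z + fst H) + ?g (z' + snd H) \<le> ?f z + ?g z' + l H + C * (norm H)\<^sup>2"
    using max C by eventually_elim linarith
  \<comment> \<open>Fixing one variable at the maximum leaves a paraboloid above the sup-convolution
    in the other, as freezing requires.\<close>
  have tf: "\<forall>\<^sub>F h in nhds 0. ?f (z + h) \<le> ?f z + (\<xi>1, q1) \<bullet> h + C * (norm h)\<^sup>2"
  proof -
    have "norm (h, 0 :: (real ^ 'n) \<times> real) = norm h" for h :: "(real ^ 'n) \<times> real" by (simp add: norm_Pair)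
    from eventually_nhds_0_comp[where T="\<lambda>h. (h, 0)", OF both this] show ?thesis
      by eventually_elim (simp add: l norm_Pair)
  qed
  have tg: "\<forall>\<^sub>F h in nhds 0. ?g (z' + h) \<le> ?g z' + (- \<xi>2, - q2) \<bullet> h + C * (norm h)\<^sup>2"
  proof -
    have "norm (0 :: (real ^ 'n) \<times> real, h) = norm h" for h :: "(real ^ 'n) \<times> real" by (simp add: norm_Pair)
    from eventually_nhds_0_comp[where T="\<lambda>h. (0, h)", OF both this] show ?thesis
      by eventually_elim (simp add: l norm_Pair)
  qed
  let ?c = "(p - 1) / 2 * (q1 - 1 * norm \<xi>1 powr p)" and ?c' = "(p - 1) / 2 * (- q2 - (- 1) * norm (- \<xi>2) powr p)"
  let ?S = "\<Sum>i\<in>UNIV. Q (?\<sigma> i, ?\<sigma>' i)" and ?N = "\<Sum>i\<in>UNIV. (norm (?\<sigma> i, ?\<sigma>' i))\<^sup>2"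
  \<comment> \<open>Freezing costs \<open>e\<close> twice, and the remainder in the expansion of
    \<open>\<Phi>\<close> costs \<open>e * ?N\<close>.\<close>
  have "?c + ?c' \<le> ?S + e * (?N + 2)" if e: "e > 0" for e
  proof -
    obtain \<rho>1 where \<rho>1: "\<rho>1 > 0" "\<And>y B Q. norm (y - z) < \<rho>1 \<Longrightarrow> quadform Q \<Longrightarrow> jet_above ?f y B Q \<Longrightarrow>
        ?c - e \<le> Vq p \<xi>1 Q"
      using supconv_frozen_jets[OF p K \<epsilon> sub tf \<xi>(1) supconv_opt_interior_jet[OF K \<epsilon> opt(1) tf] e] by blast
    obtain \<rho>2 where \<rho>2: "\<rho>2 > 0" "\<And>y B Q. norm (y - z') < \<rho>2 \<Longrightarrow> quadform Q \<Longrightarrow> jet_above ?g y B Q \<Longrightarrow>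
        ?c' - e \<le> Vq p (- \<xi>2) Q"
      using supconv_frozen_jets[OF p Kg \<epsilon> sup tg _ supconv_opt_interior_jet[OF Kg \<epsilon> opt(2) tg] e] \<xi>(2) by auto
    have linl: "linear l" and Q: "quadform Q" using second_orderD[OF so] by auto
    have "(?c - e) + (?c' - e) \<le> (\<Sum>i\<in>UNIV. Q (?\<sigma> i, ?\<sigma>' i) + e * (norm (?\<sigma> i, ?\<sigma>' i))\<^sup>2)"
    proof (rule jets_of_sum[where f="\<lambda>h. ?f (z + h)" and g="\<lambda>h. ?g (z' + h)" and \<rho>="min \<rho>1 \<rho>2" and l=l
          and Q="\<lambda>H. Q H + e * (norm H)\<^sup>2" and I=UNIV])
      show "continuous_on UNIV (\<lambda>h. ?f (z + h))"
        by (rule continuous_on_compose2[OF supconv_continuous[OF K \<epsilon>]]) (auto intro!: continuous_intros)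
      show "continuous_on UNIV (\<lambda>h. ?g (z' + h))"
        by (rule continuous_on_compose2[OF supconv_continuous[OF Kg \<epsilon>]]) (auto intro!: continuous_intros)
      show "?c - e \<le> (\<Sum>i\<in>UNIV. R (?\<sigma> i))"
        if "norm y < min \<rho>1 \<rho>2" "quadform R" "jet_above (\<lambda>h. ?f (z + h)) y B R" for y B R
        using \<rho>1(2)[of "z + y" R B] that unfolding jet_above_shift Vq_pmap[OF that(2) \<xi>(1) \<kappa>(1)] by simp
      show "?c' - e \<le> (\<Sum>i\<in>UNIV. R (?\<sigma>' i))"
        if "norm y < min \<rho>1 \<rho>2" "quadform R" "jet_above (\<lambda>h. ?g (z' + h)) y B R" for y B R
        using \<rho>2(2)[of "z' + y" R B] that unfolding jet_above_shift Vq_pmap[OF that(2) \<xi>(2) \<kappa>(2)]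
        by (simp add: Vq_minus)
      show "\<forall>\<^sub>F H in nhds 0. ?f (z + fst H) + ?g (z' + snd H) \<le> ?f (z + 0) + ?g (z' + 0) + l H + (Q H + e * (norm H)\<^sup>2)"
        using max second_orderD(3)[OF so e]
      proof eventually_elim
        case (elim H) then show ?case unfolding add_0_right by linarith
      qed
    qed (use \<rho>1 \<rho>2 linl in \<open>auto intro!: quadform_intros Q\<close>)
    also have "\<dots> = ?S + e * ?N" by (simp only: sum.distrib sum_distrib_left)
    finally show ?thesis by (simp add: distrib_left)
  qed
  then have "?c + ?c' \<le> ?S" by (rule le_of_forall_eps_mult)
  moreover have "k * (a - b - (x - y)) = k * (a - 1 * x) + k * (- b - (- 1) * y)" for k a b x y :: real
    by (simp add: algebra_simps)
  ultimately show ?thesis by simp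
qed

section \<open>Perturbation of the gradient\<close>

lemma powr_lipschitz_near_1: "\<exists>C>0. \<forall>s\<in>{1/2..3/2}. \<bar>s powr a - 1\<bar> \<le> C * \<bar>s - 1 :: real\<bar>"
proof -
  have "continuous_on {1/2..3/2} (\<lambda>s::real. a * s powr (a - 1))"
    by (intro continuous_intros) auto
  then have "compact ((\<lambda>s::real. a * s powr (a - 1)) ` {1/2..3/2})"
    by (intro compact_continuous_image) auto
  then have "bounded ((\<lambda>s::real. a * s powr (a - 1)) ` {1/2..3/2})" by (rule compact_imp_bounded)
  then obtain C where C: "C > 0" "\<And>s. s \<in> {1/2..3/2} \<Longrightarrow> \<bar>a * s powr (a - 1)\<bar> \<le> C"
    unfolding bounded_pos by (auto simp: image_iff)
  have "\<bar>s powr a - 1 powr a\<bar> \<le> C * \<bar>s - 1\<bar>" if "s \<in> {1/2..3/2}" for s :: real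
  proof (rule field_differentiable_bound[where S="{1/2..3/2}" and f="\<lambda>s. s powr a", unfolded real_norm_def])
    show "((\<lambda>s. s powr a) has_real_derivative a * y powr (a - 1)) (at y within {1/2..3/2})"
      if "y \<in> {1/2..3/2}" for y
      using that by (intro DERIV_subset[OF has_real_derivative_powr]) auto
  qed (use that C in auto)
  then show ?thesis using C(1) by auto
qed

text \<open>By homogeneity only the ratio of the norms matters; it lies within
  \<open>\<mu> \<le> 1/2\<close> of 1, where every real power is Lipschitz.\<close>

lemma powr_norm_diff_le:
  obtains C where "C > 0" "\<And>(\<xi>1 :: 'a::real_normed_vector) \<xi>2 \<mu>. \<xi>2 \<noteq> 0 \<Longrightarrow> norm (\<xi>1 - \<xi>2) \<le> \<mu> * norm \<xi>2 \<Longrightarrow> \<mu> \<le> 1/2 \<Longrightarrow>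
      \<bar>norm \<xi>1 powr a - norm \<xi>2 powr a\<bar> \<le> C * \<mu> * norm \<xi>2 powr a"
proof -
  obtain C where C: "C > 0" "\<And>s. s \<in> {1/2..3/2} \<Longrightarrow> \<bar>s powr a - 1\<bar> \<le> C * \<bar>s - 1\<bar>"
    using powr_lipschitz_near_1 by blast
  have "\<bar>norm \<xi>1 powr a - norm \<xi>2 powr a\<bar> \<le> C * \<mu> * norm \<xi>2 powr a"
    if \<xi>2: "\<xi>2 \<noteq> 0" and le: "norm (\<xi>1 - \<xi>2) \<le> \<mu> * norm \<xi>2" and \<mu>: "\<mu> \<le> 1/2" for \<xi>1 \<xi>2 :: 'a and \<mu>
  proof -
    define s where "s = norm \<xi>1 / norm \<xi>2"
    have n2: "norm \<xi>2 > 0" using \<xi>2 by simp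
    have "\<bar>norm \<xi>1 - norm \<xi>2\<bar> \<le> \<mu> * norm \<xi>2" using norm_triangle_ineq3[of \<xi>1 \<xi>2] le by linarith
    moreover have "norm \<xi>1 - norm \<xi>2 = (s - 1) * norm \<xi>2" using n2 by (simp add: s_def field_simps)
    ultimately have s: "\<bar>s - 1\<bar> \<le> \<mu>" using n2 by (simp add: abs_mult)
    then have "s \<in> {1/2..3/2}" using \<mu> by (auto simp: abs_le_iff)
    then have "\<bar>s powr a - 1\<bar> \<le> C * \<mu>" using C(2)[of s] s C(1) mult_left_mono[of "\<bar>s - 1\<bar>" \<mu> C] by linarith
    moreover have "norm \<xi>1 powr a - norm \<xi>2 powr a = (s powr a - 1) * norm \<xi>2 powr a"
      using n2 by (simp add: s_def powr_divide field_simps)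
    ultimately show ?thesis by (simp add: abs_mult mult_right_mono)
  qed
  with C(1) that show ?thesis by blast
qed

lemma normalize_diff_le:
  fixes \<xi>1 \<xi>2 :: "'a::real_normed_vector"
  assumes "\<xi>2 \<noteq> 0" "\<xi>1 \<noteq> 0" "norm (\<xi>1 - \<xi>2) \<le> \<mu> * norm \<xi>2"
  shows "norm (\<xi>1 /\<^sub>R norm \<xi>1 - \<xi>2 /\<^sub>R norm \<xi>2) \<le> 2 * \<mu>"
proof -
  have n: "norm \<xi>2 > 0" using assms by simp
  have "norm \<xi>2 *\<^sub>R (\<xi>1 /\<^sub>R norm \<xi>1 - \<xi>2 /\<^sub>R norm \<xi>2) = (norm \<xi>2 - norm \<xi>1) *\<^sub>R (\<xi>1 /\<^sub>R norm \<xi>1) + (\<xi>1 - \<xi>2)"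
    using assms by (simp add: algebra_simps)
  then have "norm \<xi>2 * norm (\<xi>1 /\<^sub>R norm \<xi>1 - \<xi>2 /\<^sub>R norm \<xi>2)
      = norm ((norm \<xi>2 - norm \<xi>1) *\<^sub>R (\<xi>1 /\<^sub>R norm \<xi>1) + (\<xi>1 - \<xi>2))"
    by (metis abs_norm_cancel norm_scaleR)
  also have "\<dots> \<le> \<bar>norm \<xi>2 - norm \<xi>1\<bar> * 1 + norm (\<xi>1 - \<xi>2)"
  proof -
    have "norm (\<xi>1 /\<^sub>R norm \<xi>1) = 1" using assms(2) by simp
    then have "norm ((norm \<xi>2 - norm \<xi>1) *\<^sub>R (\<xi>1 /\<^sub>R norm \<xi>1)) = \<bar>norm \<xi>2 - norm \<xi>1\<bar> * 1"
      by (simp only: norm_scaleR)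
    then show ?thesis by (metis norm_triangle_ineq)
  qed
  also have "\<dots> \<le> 2 * (\<mu> * norm \<xi>2)"
    using assms(3) norm_triangle_ineq3[of \<xi>2 \<xi>1] by (simp add: norm_minus_commute)
  finally have "norm \<xi>2 * norm (\<xi>1 /\<^sub>R norm \<xi>1 - \<xi>2 /\<^sub>R norm \<xi>2) \<le> norm \<xi>2 * (2 * \<mu>)"
    by (simp add: mult_ac)
  then show ?thesis using n by (simp only: mult_le_cancel_left_pos)
qed

lemma pmap_norm_le: "norm (pmap p \<kappa> \<xi> y) \<le> norm \<xi> powr ((p - 2) / 2) * ((1 + \<bar>\<kappa>\<bar>) * norm y)"
proof -
  define h where "h = \<xi> /\<^sub>R norm \<xi>"
  have h: "norm h \<le> 1" by (cases "\<xi> = 0") (auto simp: h_def)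
  have "\<bar>h \<bullet> y\<bar> \<le> 1 * norm y"
    by (rule order_trans[OF Cauchy_Schwarz_ineq2 mult_right_mono[OF h]]) simp
  then have "\<bar>\<kappa>\<bar> * \<bar>h \<bullet> y\<bar> * norm h \<le> (\<bar>\<kappa>\<bar> * norm y) * 1"
    by (intro mult_mono mult_left_mono h) auto
  then have "norm ((\<kappa> * (h \<bullet> y)) *\<^sub>R h) \<le> \<bar>\<kappa>\<bar> * norm y" by (simp add: abs_mult)
  then have "norm (y + (\<kappa> * (h \<bullet> y)) *\<^sub>R h) \<le> (1 + \<bar>\<kappa>\<bar>) * norm y"
    by (intro order_trans[OF norm_triangle_ineq]) (simp add: distrib_right)
  then show ?thesis unfolding pmap_def norm_scaleR h_def[symmetric] by (simp add: mult_left_mono)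
qed

text \<open>The scalar factor is Lipschitz in the relative change by homogeneity, the unit vector by
  \<open>normalize_diff_le\<close>. Measuring in units of the root at \<open>\<xi>2\<close> keeps
  \<open>C\<close> independent of the size of the gradient.\<close>

lemma pmap_diff_le:
  obtains C where "C > 0" "\<And>(\<xi>1 :: real ^ 'n) \<xi>2 y \<mu>. \<xi>2 \<noteq> 0 \<Longrightarrow> norm (\<xi>1 - \<xi>2) \<le> \<mu> * norm \<xi>2 \<Longrightarrow> \<mu> \<le> 1/2 \<Longrightarrow>
      norm (pmap p \<kappa> \<xi>1 y - pmap p \<kappa> \<xi>2 y) \<le> C * \<mu> * norm \<xi>2 powr ((p - 2) / 2) * norm y"
proof -
  obtain C where C: "C > 0" "\<And>(\<xi>1 :: real ^ 'n) \<xi>2 \<mu>. \<xi>2 \<noteq> 0 \<Longrightarrow> norm (\<xi>1 - \<xi>2) \<le> \<mu> * norm \<xi>2 \<Longrightarrow> \<mu> \<le> 1/2 \<Longrightarrow>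
      \<bar>norm \<xi>1 powr ((p - 2) / 2) - norm \<xi>2 powr ((p - 2) / 2)\<bar> \<le> C * \<mu> * norm \<xi>2 powr ((p - 2) / 2)"
    using powr_norm_diff_le[of "(p - 2) / 2", where 'a="real ^ 'n"] by blast
  have "norm (pmap p \<kappa> \<xi>1 y - pmap p \<kappa> \<xi>2 y)
      \<le> (C * (1 + \<bar>\<kappa>\<bar>) + 4 * \<bar>\<kappa>\<bar>) * \<mu> * norm \<xi>2 powr ((p - 2) / 2) * norm y"
    if \<xi>2: "\<xi>2 \<noteq> 0" and le: "norm (\<xi>1 - \<xi>2) \<le> \<mu> * norm \<xi>2" and \<mu>: "\<mu> \<le> 1/2" for \<xi>1 \<xi>2 y :: "real ^ 'n" and \<mu>
  proof -
    have n2: "norm \<xi>2 > 0" using \<xi>2 by simp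
    have \<xi>1: "\<xi>1 \<noteq> 0"
    proof
      assume "\<xi>1 = 0"
      then have "norm \<xi>2 \<le> \<mu> * norm \<xi>2" using le by simp
      also have "\<dots> \<le> 1/2 * norm \<xi>2" using \<mu> by (intro mult_right_mono) auto
      finally show False using n2 by simp
    qed
    have \<mu>0: "\<mu> \<ge> 0" using le n2 order_trans[OF norm_ge_zero le] by (simp add: zero_le_mult_iff)
    let ?c1 = "norm \<xi>1 powr ((p - 2) / 2)" and ?c2 = "norm \<xi>2 powr ((p - 2) / 2)"
    define h1 where "h1 = \<xi>1 /\<^sub>R norm \<xi>1"
    define h2 where "h2 = \<xi>2 /\<^sub>R norm \<xi>2"
    have h: "norm h1 = 1" "norm h2 = 1" "norm (h1 - h2) \<le> 2 * \<mu>"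
      using \<xi>1 \<xi>2 normalize_diff_le[OF \<xi>2 \<xi>1 le] by (auto simp: h1_def h2_def)
    have eq: "pmap p \<kappa> \<xi>1 y - pmap p \<kappa> \<xi>2 y = (?c1 - ?c2) *\<^sub>R (y + (\<kappa> * (h1 \<bullet> y)) *\<^sub>R h1)
       + ?c2 *\<^sub>R (\<kappa> *\<^sub>R (((h1 - h2) \<bullet> y) *\<^sub>R h1 + (h2 \<bullet> y) *\<^sub>R (h1 - h2)))"
      unfolding pmap_def h1_def[symmetric] h2_def[symmetric]
      by (simp add: scaleR_diff_left scaleR_add_right scaleR_diff_right inner_diff_left algebra_simps)
    have 1: "norm ((?c1 - ?c2) *\<^sub>R (y + (\<kappa> * (h1 \<bullet> y)) *\<^sub>R h1)) \<le> (C * \<mu> * ?c2) * ((1 + \<bar>\<kappa>\<bar>) * norm y)"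
    proof -
      have "\<bar>h1 \<bullet> y\<bar> \<le> norm y" using Cauchy_Schwarz_ineq2[of h1 y] h by simp
      then have "norm ((\<kappa> * (h1 \<bullet> y)) *\<^sub>R h1) \<le> \<bar>\<kappa>\<bar> * norm y"
        using h by (simp add: abs_mult mult_left_mono)
      then have "norm (y + (\<kappa> * (h1 \<bullet> y)) *\<^sub>R h1) \<le> (1 + \<bar>\<kappa>\<bar>) * norm y"
        by (intro order_trans[OF norm_triangle_ineq]) (simp add: distrib_right)
      then show ?thesis unfolding norm_scaleR using C(2)[OF \<xi>2 le \<mu>] by (intro mult_mono) auto
    qed
    have 2: "norm (?c2 *\<^sub>R (\<kappa> *\<^sub>R (((h1 - h2) \<bullet> y) *\<^sub>R h1 + (h2 \<bullet> y) *\<^sub>R (h1 - h2))))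
       \<le> ?c2 * (\<bar>\<kappa>\<bar> * (4 * \<mu> * norm y))"
    proof -
      have "norm (((h1 - h2) \<bullet> y) *\<^sub>R h1) \<le> 2 * \<mu> * norm y"
        using order_trans[OF Cauchy_Schwarz_ineq2[of "h1 - h2" y] mult_right_mono[OF h(3)]] h by simp
      moreover have "norm ((h2 \<bullet> y) *\<^sub>R (h1 - h2)) \<le> 2 * \<mu> * norm y"
      proof -
        have "\<bar>h2 \<bullet> y\<bar> \<le> norm y" using Cauchy_Schwarz_ineq2[of h2 y] h by simp
        then have "\<bar>h2 \<bullet> y\<bar> * norm (h1 - h2) \<le> norm y * (2 * \<mu>)" using h by (intro mult_mono) auto
        then show ?thesis by (simp only: norm_scaleR mult.commute)
      qed
      ultimately have "norm (((h1 - h2) \<bullet> y) *\<^sub>R h1 + (h2 \<bullet> y) *\<^sub>R (h1 - h2)) \<le> 4 * \<mu> * norm y"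
        by (intro order_trans[OF norm_triangle_ineq]) linarith
      then show ?thesis unfolding norm_scaleR by (intro mult_mono) auto
    qed
    show ?thesis unfolding eq
      by (rule order_trans[OF norm_triangle_ineq]) (use 1 2 in \<open>simp add: algebra_simps\<close>)
  qed
  moreover have "C * (1 + \<bar>\<kappa>\<bar>) + 4 * \<bar>\<kappa>\<bar> > 0" using C(1) by (intro add_pos_nonneg mult_pos_pos) auto
  ultimately show ?thesis using that by blast
qed

text \<open>The Ishii--Lions estimate at a doubled maximum. Here \<open>D\<close> is the gradient and \<open>1 / \<zeta> ^ 4\<close> the value of
  the weight, \<open>P = \<phi> r\<close> and \<open>c = \<phi>' r\<close> with \<open>\<phi> r = L (2 r - r powr (3/2))\<close>; the term
  \<open>- 3/8 * L / sqrt r\<close> comes from the concavity of \<open>\<phi>\<close> and dominates all others, because the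
  gradients \<open>\<xi>1\<close> and \<open>\<xi>2\<close> differ relatively by at most \<open>16 * r / \<zeta>\<close>.\<close>

lemma ishii_lions_estimate:
  fixes p :: real
  defines "\<kappa>1 \<equiv> sqrt (p - 1) - 1" and "\<kappa>2 \<equiv> - sqrt (p - 1) - 1"
  assumes p: "1 < p"
  obtains C where "C \<ge> 32"
    "\<And>(e :: real ^ 'n) \<xi>1 \<xi>2 D r \<zeta> L P c q O1 \<alpha> \<gamma>. norm e = 1 \<Longrightarrow> 0 < r \<Longrightarrow> r \<le> 1 \<Longrightarrow> 0 < \<zeta> \<Longrightarrow> \<zeta> \<le> 1 \<Longrightarrow>
       1 \<le> O1 \<Longrightarrow> C * O1 ^ 3 \<le> L \<Longrightarrow> L / 2 \<le> c \<Longrightarrow> c \<le> 2 * L \<Longrightarrow> 0 \<le> P \<Longrightarrow> P \<le> 2 * L * r \<Longrightarrow>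
       norm D \<le> 4 / \<zeta> ^ 5 \<Longrightarrow> \<xi>2 = (c / \<zeta> ^ 4) *\<^sub>R e \<Longrightarrow> \<xi>1 = \<xi>2 + P *\<^sub>R D \<Longrightarrow> L * r / \<zeta> ^ 4 \<le> O1 \<Longrightarrow>
       - 2 * P / \<zeta> ^ 5 \<le> q \<Longrightarrow>
       (\<And>i. \<alpha> i = pmap p \<kappa>1 \<xi>1 (axis i 1)) \<Longrightarrow> (\<And>i. \<gamma> i = \<alpha> i - pmap p \<kappa>2 \<xi>2 (axis i 1)) \<Longrightarrow>
       \<xi>1 \<noteq> 0 \<and> \<xi>2 \<noteq> 0 \<and>
       (\<Sum>i\<in>UNIV. 1 / \<zeta> ^ 4 * (c / (2 * r) * ((norm (\<gamma> i))\<^sup>2 - (e \<bullet> \<gamma> i)\<^sup>2) - 3/8 * L / sqrt r * (e \<bullet> \<gamma> i)\<^sup>2)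
          + P * (5 / \<zeta> ^ 6 * (norm (\<alpha> i))\<^sup>2) + c * (e \<bullet> \<gamma> i) * (D \<bullet> \<alpha> i))
       < (p - 1) / 2 * (q - (norm \<xi>1 powr p - norm \<xi>2 powr p))"
proof -
  define sq where "sq = sqrt (p - 1)"
  have sq: "sq > 0" "sq\<^sup>2 = p - 1" using p by (auto simp: sq_def)
  obtain C1 where C1: "C1 > 0" "\<And>(\<xi>1 :: real ^ 'n) \<xi>2 y \<mu>. \<xi>2 \<noteq> 0 \<Longrightarrow> norm (\<xi>1 - \<xi>2) \<le> \<mu> * norm \<xi>2 \<Longrightarrow> \<mu> \<le> 1/2 \<Longrightarrow>
      norm (pmap p \<kappa>1 \<xi>1 y - pmap p \<kappa>1 \<xi>2 y) \<le> C1 * \<mu> * norm \<xi>2 powr ((p - 2) / 2) * norm y"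
    using pmap_diff_le[of p \<kappa>1, where 'n='n] by blast
  obtain Cp where Cp: "Cp > 0" "\<And>(\<xi>1 :: real ^ 'n) \<xi>2 \<mu>. \<xi>2 \<noteq> 0 \<Longrightarrow> norm (\<xi>1 - \<xi>2) \<le> \<mu> * norm \<xi>2 \<Longrightarrow> \<mu> \<le> 1/2 \<Longrightarrow>
      \<bar>norm \<xi>1 powr p - norm \<xi>2 powr p\<bar> \<le> Cp * \<mu> * norm \<xi>2 powr p"
    using powr_norm_diff_le[of p, where 'a="real ^ 'n"] by blast
  define N where "N = real CARD('n)"
  have N: "N > 0" by (simp add: N_def)
  define C2 where "C2 = C1 / 2 + (1 + \<bar>\<kappa>1\<bar>)"
  define C3 where "C3 = C1 / 2 + 2 * sq"
  have C23: "C2 > 0" "C3 > 0" using C1(1) sq by (auto simp: C2_def C3_def add_pos_nonneg)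
  define K1 where "K1 = 256 * (N * C1\<^sup>2) + 10 * (N * C2\<^sup>2) + 8 * (N * (C3 * C2))"
  define K2 where "K2 = (p - 1) / 2 * (8 + 64 * Cp)"
  define K where "K = 8 * (K1 + K2) / (3 * (p - 1))"
  \<comment> \<open>The three summands serve in turn for \<open>\<mu> \<le> 1/2\<close>, for the
    bound \<open>\<mu>sq\<close> that protects the good term, and for the final comparison of the
    good term with all others.\<close>
  define C where "C = 32 + 16 * (N * C1\<^sup>2) / (p - 1) + (K\<^sup>2 + 1)"
  have K1: "K1 > 0" using N C1(1) C23 by (auto simp: K1_def intro!: add_pos_pos)
  have K2: "K2 > 0" using p Cp(1) by (auto simp: K2_def intro!: mult_pos_pos add_pos_pos)
  have K: "K > 0" using K1 K2 p by (simp add: K_def)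
  have Cge: "C \<ge> 32" "C \<ge> 16 * (N * C1\<^sup>2) / (p - 1)" "C > K\<^sup>2"
    using p N by (auto simp: C_def add_nonneg_pos add_pos_nonneg)
  show ?thesis
  proof (rule that[OF Cge(1)])
    fix e \<xi>1 \<xi>2 D :: "real ^ 'n" and r \<zeta> L P c q O1 :: real and \<alpha> \<gamma> :: "'n \<Rightarrow> real ^ 'n"
    assume e: "norm e = 1" and r: "0 < r" "r \<le> 1" and \<zeta>: "0 < \<zeta>" "\<zeta> \<le> 1" and O1: "1 \<le> O1" and L: "C * O1 ^ 3 \<le> L"
      and c: "L / 2 \<le> c" "c \<le> 2 * L" and P: "0 \<le> P" "P \<le> 2 * L * r" and D: "norm D \<le> 4 / \<zeta> ^ 5"
      and \<xi>2: "\<xi>2 = (c / \<zeta> ^ 4) *\<^sub>R e" and \<xi>1: "\<xi>1 = \<xi>2 + P *\<^sub>R D" and LO: "L * r / \<zeta> ^ 4 \<le> O1"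
      and q: "- 2 * P / \<zeta> ^ 5 \<le> q"
      and \<alpha>: "\<And>i. \<alpha> i = pmap p \<kappa>1 \<xi>1 (axis i 1)" and \<gamma>: "\<And>i. \<gamma> i = \<alpha> i - pmap p \<kappa>2 \<xi>2 (axis i 1)"
    have O3: "O1 \<le> O1 ^ 3" "1 \<le> O1 ^ 3" using O1 by (auto simp: self_le_power)
    have LC: "C * O1 \<le> L" using mult_left_mono[OF O3(1), of C] Cge(1) L by linarith
    have L32: "32 * O1 \<le> L" using mult_right_mono[OF Cge(1), of O1] LC O1 by linarith
    have L1: "L \<ge> 32" using L32 O1 by linarith
    define X where "X = L / \<zeta> ^ 4"
    have z4: "0 < \<zeta> ^ 4" "\<zeta> ^ 4 \<le> 1" using \<zeta> by (auto simp: power_le_one)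
    have X: "X \<ge> L" using z4 L1 by (simp add: X_def field_simps mult_left_le)
    have rX: "r * X \<le> O1" using LO by (simp add: X_def mult.commute)
    define n2 where "n2 = norm \<xi>2"
    have n2: "n2 = c / \<zeta> ^ 4" using c L1 z4 e by (simp add: n2_def \<xi>2)
    have n2X: "X / 2 \<le> n2" "n2 \<le> 2 * X"
      using c divide_right_mono[of "L/2" c "\<zeta> ^ 4"] divide_right_mono[of c "2 * L" "\<zeta> ^ 4"] z4
      by (auto simp: n2 X_def)
    have n2_1: "n2 \<ge> 1" using n2X X L1 by linarith
    have \<xi>2_0: "\<xi>2 \<noteq> 0" using n2_1 by (auto simp: n2_def)
    have hat: "\<xi>2 /\<^sub>R norm \<xi>2 = e"
      using n2_1 c L1 z4 e unfolding n2_def[symmetric] n2 \<xi>2 by simp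
    \<comment> \<open>The quotient of \<open>2 * L * r * (4 / \<zeta> ^ 5)\<close>, which bounds
      \<open>P *\<^sub>R D\<close>, by the lower bound \<open>L / (2 * \<zeta> ^ 4)\<close> of
      \<open>norm \<xi>2\<close>.\<close>
    define \<mu> where "\<mu> = 16 * r / \<zeta>"
    have z5: "\<zeta> ^ 5 = \<zeta> ^ 4 * \<zeta>" by (simp add: eval_nat_numeral)
    have z6: "\<zeta> ^ 6 = \<zeta> ^ 4 * \<zeta>\<^sup>2" by (simp add: eval_nat_numeral)
    have diff: "norm (\<xi>1 - \<xi>2) \<le> \<mu> * norm \<xi>2"
    proof -
      have "norm (\<xi>1 - \<xi>2) = P * norm D" using P by (simp add: \<xi>1)
      also have "\<dots> \<le> (2 * L * r) * (4 / \<zeta> ^ 5)" using P D L1 r by (intro mult_mono) auto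
      also have "\<dots> = \<mu> * (X / 2)" by (simp add: \<mu>_def X_def z5)
      also have "\<dots> \<le> \<mu> * norm \<xi>2" using n2X r \<zeta> by (intro mult_left_mono) (auto simp: n2_def \<mu>_def)
      finally show ?thesis .
    qed
    have r\<zeta>: "r / \<zeta> \<le> O1 / L"
    proof -
      have "r * L \<le> O1 * \<zeta> ^ 4" using LO z4 by (simp add: field_simps)
      also have "\<dots> \<le> O1 * \<zeta>"
        using O1 \<zeta> power_decreasing[of 1 4 \<zeta>] by (intro mult_left_mono) auto
      finally show ?thesis using L1 \<zeta> by (simp add: field_simps)
    qed
    have \<mu>0: "\<mu> \<ge> 0" using r \<zeta> by (simp add: \<mu>_def)
    have \<mu>half: "\<mu> \<le> 1/2"
    proof -
      have "O1 / L \<le> 1 / 32" using L32 L1 by (simp add: field_simps)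
      moreover have "\<mu> = 16 * (r / \<zeta>)" by (simp add: \<mu>_def)
      ultimately show ?thesis using r\<zeta> by linarith
    qed
    have \<mu>sq: "N * C1\<^sup>2 * \<mu>\<^sup>2 \<le> p - 1"
    proof -
      have "\<mu>\<^sup>2 \<le> \<mu> * 1" unfolding power2_eq_square using \<mu>0 \<mu>half by (intro mult_left_mono) auto
      moreover have "\<mu> = 16 * (r / \<zeta>)" by (simp add: \<mu>_def)
      ultimately have "\<mu>\<^sup>2 \<le> 16 * (O1 / L)" using r\<zeta> by linarith
      then have "N * C1\<^sup>2 * \<mu>\<^sup>2 \<le> N * C1\<^sup>2 * (16 * (O1 / L))" using N by (intro mult_left_mono) auto
      also have "\<dots> \<le> p - 1"
      proof -
        have "16 * (N * C1\<^sup>2) \<le> C * (p - 1)" using Cge(2) p by (simp add: field_simps)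
        then have "16 * (N * C1\<^sup>2) * O1 \<le> C * (p - 1) * O1" using O1 by (intro mult_right_mono) auto
        also have "\<dots> = (p - 1) * (C * O1)" by simp
        also have "\<dots> \<le> (p - 1) * L" using LC p by (intro mult_left_mono) auto
        finally show ?thesis using L1 by (simp add: field_simps)
      qed
      finally show ?thesis .
    qed
    have \<xi>1_0: "\<xi>1 \<noteq> 0"
    proof
      assume "\<xi>1 = 0"
      then have "n2 \<le> \<mu> * n2" using diff by (simp add: n2_def)
      also have "\<dots> \<le> 1/2 * n2" using \<mu>half n2_1 by (intro mult_right_mono) auto
      finally show False using n2_1 by simp
    qed
    define A where "A = n2 powr ((p - 2) / 2)"
    have A: "A > 0" using n2_1 by (simp add: A_def)
    have A2: "A\<^sup>2 = n2 powr (p - 2)" unfolding A_def power2_eq_square powr_add[symmetric] by simp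
    define \<Delta> where "\<Delta> i = pmap p \<kappa>1 \<xi>1 (axis i 1) - pmap p \<kappa>1 \<xi>2 (axis i 1)" for i
    have \<Delta>: "norm (\<Delta> i) \<le> C1 * \<mu> * A" for i
      using C1(2)[OF \<xi>2_0 diff \<mu>half, of "axis i 1"] by (simp add: \<Delta>_def A_def n2_def norm_axis_1)
    have \<Delta>2: "norm (\<Delta> i) \<le> C1 / 2 * A" for i
    proof -
      have "C1 * \<mu> * A \<le> C1 * (1/2) * A" using \<mu>half C1(1) A by (intro mult_right_mono mult_left_mono) auto
      then show ?thesis using \<Delta>[of i] by simp
    qed
    \<comment> \<open>At equal gradients the two roots differ only along \<open>e\<close>, with
      coefficient \<open>2 * sq * A\<close>; \<open>\<Delta> i\<close> is the error caused by
      \<open>\<xi>1\<close> differing from \<open>\<xi>2\<close>.\<close>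
    have \<gamma>\<Delta>: "\<gamma> i = \<Delta> i + (2 * sq * A * (e $ i)) *\<^sub>R e" for i
    proof -
      have pm: "pmap p \<kappa> \<xi>2 y = A *\<^sub>R (y + (\<kappa> * (e \<bullet> y)) *\<^sub>R e)" for \<kappa> y
        unfolding pmap_def hat A_def n2_def ..
      have "a *\<^sub>R (y + (k * t) *\<^sub>R e) - a *\<^sub>R (y + (j * t) *\<^sub>R e) = ((k - j) * a * t) *\<^sub>R e"
        for a k j t :: real and y
        by (simp add: scaleR_add_right scaleR_diff_left[symmetric] right_diff_distrib mult_ac)
      moreover have "\<kappa>1 - \<kappa>2 = 2 * sq" by (simp add: \<kappa>1_def \<kappa>2_def sq_def)
      moreover have "e \<bullet> axis i 1 = e $ i" by (simp add: inner_axis)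
      ultimately have eq: "pmap p \<kappa>1 \<xi>2 (axis i 1) - pmap p \<kappa>2 \<xi>2 (axis i 1) = (2 * sq * A * (e $ i)) *\<^sub>R e"
        unfolding pm by simp
      show ?thesis unfolding \<gamma> \<alpha> \<Delta>_def eq[symmetric] by simp
    qed
    have \<alpha>b: "norm (\<alpha> i) \<le> C2 * A" for i
    proof -
      have "norm (pmap p \<kappa>1 \<xi>2 (axis i 1)) \<le> A * ((1 + \<bar>\<kappa>1\<bar>) * 1)"
        using pmap_norm_le[of p \<kappa>1 \<xi>2 "axis i 1"] by (simp add: A_def n2_def norm_axis_1)
      moreover have "\<alpha> i = \<Delta> i + pmap p \<kappa>1 \<xi>2 (axis i 1)" by (simp add: \<alpha> \<Delta>_def)
      ultimately show ?thesis using \<Delta>2[of i] norm_triangle_ineq[of "\<Delta> i" "pmap p \<kappa>1 \<xi>2 (axis i 1)"]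
        by (simp add: C2_def algebra_simps)
    qed
    have ei: "\<bar>e $ i\<bar> \<le> 1" for i using component_le_norm_cart[of e i] e by simp
    have \<gamma>b: "norm (\<gamma> i) \<le> C3 * A" for i
    proof -
      have "norm ((2 * sq * A * (e $ i)) *\<^sub>R e) = 2 * sq * A * \<bar>e $ i\<bar>"
        using e sq A by (simp add: abs_mult)
      also have "\<dots> \<le> 2 * sq * A * 1" using ei sq A by (intro mult_left_mono) auto
      finally show ?thesis using \<Delta>2[of i] norm_triangle_ineq[of "\<Delta> i" "(2 * sq * A * (e $ i)) *\<^sub>R e"]
        unfolding \<gamma>\<Delta> C3_def by (simp add: algebra_simps)
    qed
    have ee: "e \<bullet> e = 1" using e by (simp add: power2_norm_eq_inner[symmetric])
    have \<Delta>sq: "(norm (\<Delta> i))\<^sup>2 \<le> C1\<^sup>2 * \<mu>\<^sup>2 * A\<^sup>2" for i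
      using power_mono[OF \<Delta>[of i], of 2] by (simp add: power_mult_distrib)
    \<comment> \<open>The reflected part drops out, so the tangential second derivatives of order
      \<open>1 / r\<close> meet only the square of \<open>\<Delta> i\<close>, which is of order
      \<open>r\<^sup>2\<close>.\<close>
    have perp: "(norm (\<gamma> i))\<^sup>2 - (e \<bullet> \<gamma> i)\<^sup>2 \<le> C1\<^sup>2 * \<mu>\<^sup>2 * A\<^sup>2" for i
    proof -
      have "(norm (\<gamma> i))\<^sup>2 - (e \<bullet> \<gamma> i)\<^sup>2 = (norm (\<Delta> i))\<^sup>2 - (e \<bullet> \<Delta> i)\<^sup>2"
        unfolding \<gamma>\<Delta> power2_norm_eq_inner
        by (simp add: inner_add_left inner_add_right ee inner_commute power2_eq_square algebra_simps)
      also have "\<dots> \<le> (norm (\<Delta> i))\<^sup>2" by simp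
      finally show ?thesis using \<Delta>sq[of i] by linarith
    qed
    \<comment> \<open>The inequality \<open>b\<^sup>2 / 2 - a\<^sup>2 \<le> (a + b)\<^sup>2\<close>
      keeps half of the reflected part, still \<open>p - 1\<close> more than is spent on the errors
      below.\<close>
    have par: "2 * (p - 1) * A\<^sup>2 * (e $ i)\<^sup>2 - C1\<^sup>2 * \<mu>\<^sup>2 * A\<^sup>2 \<le> (e \<bullet> \<gamma> i)\<^sup>2" for i
    proof -
      define a where "a = e \<bullet> \<Delta> i"
      define b where "b = 2 * sq * A * (e $ i)"
      have "(e \<bullet> \<gamma> i)\<^sup>2 = (a + b)\<^sup>2" by (simp add: \<gamma>\<Delta> inner_add_right ee a_def b_def)
      moreover have "b\<^sup>2 / 2 - a\<^sup>2 \<le> (a + b)\<^sup>2"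
        using zero_le_power2[of "2 * a + b"] by (simp add: power2_eq_square algebra_simps)
      moreover have "a\<^sup>2 \<le> (norm (\<Delta> i))\<^sup>2"
        using power_mono[OF Cauchy_Schwarz_ineq2[of e "\<Delta> i"], of 2] e by (simp add: a_def)
      moreover have "b\<^sup>2 / 2 = 2 * (p - 1) * A\<^sup>2 * (e $ i)\<^sup>2"
        by (simp add: b_def power_mult_distrib sq)
      ultimately show ?thesis using \<Delta>sq[of i] by linarith
    qed
    have e2: "(\<Sum>i\<in>UNIV. (e $ i)\<^sup>2) = 1" using ee by (simp add: inner_vec_def power2_eq_square)
    have sumpar: "(p - 1) * A\<^sup>2 \<le> (\<Sum>i\<in>UNIV. (e \<bullet> \<gamma> i)\<^sup>2)"
    proof -
      have "(\<Sum>i\<in>UNIV. 2 * (p - 1) * A\<^sup>2 * (e $ i)\<^sup>2 - C1\<^sup>2 * \<mu>\<^sup>2 * A\<^sup>2) \<le> (\<Sum>i\<in>UNIV. (e \<bullet> \<gamma> i)\<^sup>2)"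
        by (intro sum_mono par)
      moreover have "(\<Sum>i\<in>UNIV. 2 * (p - 1) * A\<^sup>2 * (e $ i)\<^sup>2 - C1\<^sup>2 * \<mu>\<^sup>2 * A\<^sup>2)
         = 2 * (p - 1) * A\<^sup>2 - (N * C1\<^sup>2 * \<mu>\<^sup>2) * A\<^sup>2"
        unfolding sum_subtractf sum_distrib_left[symmetric] e2 by (simp add: N_def)
      moreover have "(N * C1\<^sup>2 * \<mu>\<^sup>2) * A\<^sup>2 \<le> (p - 1) * A\<^sup>2" using \<mu>sq by (intro mult_right_mono) auto
      ultimately show ?thesis by linarith
    qed
    have iz: "1 / \<zeta> \<le> 1 / \<zeta>\<^sup>2" "0 < 1 / \<zeta>\<^sup>2"
      using \<zeta> by (auto simp: power2_eq_square frac_le mult_left_le)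
    let ?T = "\<lambda>i. 1 / \<zeta> ^ 4 * (c / (2 * r) * ((norm (\<gamma> i))\<^sup>2 - (e \<bullet> \<gamma> i)\<^sup>2) - 3/8 * L / sqrt r * (e \<bullet> \<gamma> i)\<^sup>2)
          + P * (5 / \<zeta> ^ 6 * (norm (\<alpha> i))\<^sup>2) + c * (e \<bullet> \<gamma> i) * (D \<bullet> \<alpha> i)"
    have Ti: "?T i \<le> X * A\<^sup>2 * (256 * C1\<^sup>2 + 10 * C2\<^sup>2 + 8 * (C3 * C2)) / \<zeta>\<^sup>2 - 3/8 * X / sqrt r * (e \<bullet> \<gamma> i)\<^sup>2" for i
    proof -
      have t1: "1 / \<zeta> ^ 4 * (c / (2 * r) * ((norm (\<gamma> i))\<^sup>2 - (e \<bullet> \<gamma> i)\<^sup>2)) \<le> X * A\<^sup>2 * (256 * C1\<^sup>2) / \<zeta>\<^sup>2"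
      proof -
        have "1 / \<zeta> ^ 4 * (c / (2 * r) * ((norm (\<gamma> i))\<^sup>2 - (e \<bullet> \<gamma> i)\<^sup>2))
          \<le> 1 / \<zeta> ^ 4 * (c / (2 * r) * (C1\<^sup>2 * \<mu>\<^sup>2 * A\<^sup>2))"
          using z4 c L1 r perp[of i] by (intro mult_left_mono) auto
        also have "\<dots> \<le> 1 / \<zeta> ^ 4 * ((2 * L) / (2 * r) * (C1\<^sup>2 * \<mu>\<^sup>2 * A\<^sup>2))"
          using z4 c r by (intro mult_left_mono mult_right_mono divide_right_mono) auto
        also have "\<dots> = X * A\<^sup>2 * (256 * C1\<^sup>2) / \<zeta>\<^sup>2 * r"
          using r by (simp add: X_def \<mu>_def power_divide power_mult_distrib power2_eq_square)
        also have "\<dots> \<le> X * A\<^sup>2 * (256 * C1\<^sup>2) / \<zeta>\<^sup>2 * 1"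
          using r X L1 by (intro mult_left_mono) auto
        finally show ?thesis by simp
      qed
      have t2: "P * (5 / \<zeta> ^ 6 * (norm (\<alpha> i))\<^sup>2) \<le> X * A\<^sup>2 * (10 * C2\<^sup>2) / \<zeta>\<^sup>2"
      proof -
        have 1: "(norm (\<alpha> i))\<^sup>2 \<le> C2\<^sup>2 * A\<^sup>2" using power_mono[OF \<alpha>b[of i], of 2] by (simp add: power_mult_distrib)
        have "2 * L * r \<le> 2 * L * 1" using r L1 by (intro mult_left_mono) auto
        then have 2: "P \<le> 2 * L" using P by linarith
        have "P * (5 / \<zeta> ^ 6 * (norm (\<alpha> i))\<^sup>2) \<le> 2 * L * (5 / \<zeta> ^ 6 * (C2\<^sup>2 * A\<^sup>2))"
          by (rule mult_mono[OF 2 mult_left_mono[OF 1]]) (use \<zeta> L1 in auto)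
        also have "\<dots> = X * A\<^sup>2 * (10 * C2\<^sup>2) / \<zeta>\<^sup>2"
        proof -
          have "2 * l * (5 / (a * b) * (k * m)) = (l / a) * m * (10 * k) / b" for l a b k m :: real by simp
          then show ?thesis unfolding X_def z6 .
        qed
        finally show ?thesis .
      qed
      have t3: "c * (e \<bullet> \<gamma> i) * (D \<bullet> \<alpha> i) \<le> X * A\<^sup>2 * (8 * (C3 * C2)) / \<zeta>\<^sup>2"
      proof -
        have 1: "\<bar>e \<bullet> \<gamma> i\<bar> \<le> C3 * A" using Cauchy_Schwarz_ineq2[of e "\<gamma> i"] e \<gamma>b[of i] by simp
        have 2: "\<bar>D \<bullet> \<alpha> i\<bar> \<le> (4 / \<zeta> ^ 5) * (C2 * A)"
          by (rule order_trans[OF Cauchy_Schwarz_ineq2 mult_mono[OF D \<alpha>b]]) (use \<zeta> in auto)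
        have "c * (e \<bullet> \<gamma> i) * (D \<bullet> \<alpha> i) \<le> \<bar>c * (e \<bullet> \<gamma> i) * (D \<bullet> \<alpha> i)\<bar>" by (rule abs_ge_self)
        also have "\<dots> = c * \<bar>e \<bullet> \<gamma> i\<bar> * \<bar>D \<bullet> \<alpha> i\<bar>" using c L1 by (simp add: abs_mult)
        also have "\<dots> \<le> (2 * L) * (C3 * A) * ((4 / \<zeta> ^ 5) * (C2 * A))"
          using 1 2 c L1 C23 A by (intro mult_mono) auto
        also have "\<dots> = X * A\<^sup>2 * (8 * (C3 * C2)) * (1 / \<zeta>)"
          by (simp add: X_def z5 power2_eq_square mult_ac)
        also have "\<dots> \<le> X * A\<^sup>2 * (8 * (C3 * C2)) * (1 / \<zeta>\<^sup>2)"
          using X L1 C23 iz by (intro mult_left_mono) auto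
        finally show ?thesis by simp
      qed
      have "1 / \<zeta> ^ 4 * (3/8 * L / sqrt r * (e \<bullet> \<gamma> i)\<^sup>2) = 3/8 * X / sqrt r * (e \<bullet> \<gamma> i)\<^sup>2"
        by (simp add: X_def)
      then show ?thesis using t1 t2 t3
        by (simp only: right_diff_distrib distrib_left add_divide_distrib)
    qed
    have "(\<Sum>i\<in>UNIV. ?T i) \<le> (\<Sum>i\<in>UNIV. X * A\<^sup>2 * (256 * C1\<^sup>2 + 10 * C2\<^sup>2 + 8 * (C3 * C2)) / \<zeta>\<^sup>2
        - 3/8 * X / sqrt r * (e \<bullet> \<gamma> i)\<^sup>2)" by (intro sum_mono Ti)
    also have "\<dots> = N * (X * A\<^sup>2 * (256 * C1\<^sup>2 + 10 * C2\<^sup>2 + 8 * (C3 * C2)) / \<zeta>\<^sup>2)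
        - 3/8 * X / sqrt r * (\<Sum>i\<in>UNIV. (e \<bullet> \<gamma> i)\<^sup>2)"
      unfolding sum_subtractf sum_distrib_left[symmetric] by (simp add: N_def)
    also have "N * (X * A\<^sup>2 * (256 * C1\<^sup>2 + 10 * C2\<^sup>2 + 8 * (C3 * C2)) / \<zeta>\<^sup>2) = X * A\<^sup>2 * (K1 / \<zeta>\<^sup>2)"
      by (simp add: K1_def algebra_simps)
    also have "X * A\<^sup>2 * (K1 / \<zeta>\<^sup>2) - 3/8 * X / sqrt r * (\<Sum>i\<in>UNIV. (e \<bullet> \<gamma> i)\<^sup>2)
      \<le> X * A\<^sup>2 * (K1 / \<zeta>\<^sup>2) - 3/8 * X / sqrt r * ((p - 1) * A\<^sup>2)"
      using sumpar X L1 r by (intro diff_left_mono mult_left_mono) auto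
    also have "\<dots> = X * A\<^sup>2 * (K1 / \<zeta>\<^sup>2 - 3/8 * (p - 1) / sqrt r)"
      by (simp add: algebra_simps)
    finally have upper: "(\<Sum>i\<in>UNIV. ?T i) \<le> X * A\<^sup>2 * (K1 / \<zeta>\<^sup>2 - 3/8 * (p - 1) / sqrt r)" .
    have rX\<zeta>: "r * X / \<zeta> \<le> O1 / \<zeta>\<^sup>2"
    proof -
      have "r * X * (1 / \<zeta>) \<le> O1 * (1 / \<zeta>\<^sup>2)" using rX iz O1 \<zeta> by (intro mult_mono) auto
      then show ?thesis by simp
    qed
    \<comment> \<open>The time derivative of the weight carries no power of the gradient. Since
      \<open>n2 \<ge> 1\<close>, the inequality \<open>1 \<le> n2 powr (p - 1)\<close> supplies the
      factor \<open>A\<^sup>2\<close> that the other terms have.\<close>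
    have low1: "2 * P / \<zeta> ^ 5 \<le> X * A\<^sup>2 * (8 * (O1 / \<zeta>\<^sup>2))"
    proof -
      have "1 \<le> A\<^sup>2 * n2"
      proof -
        have "A\<^sup>2 * n2 = n2 powr (p - 1)"
          using n2_1 powr_add[of n2 "p - 2" 1] by (simp add: A2)
        then show ?thesis using n2_1 p by (simp add: ge_one_powr_ge_zero)
      qed
      also have "A\<^sup>2 * n2 \<le> A\<^sup>2 * (2 * X)" using n2X by (intro mult_left_mono) auto
      finally have 1: "1 \<le> A\<^sup>2 * (2 * X)" .
      have "2 * P / \<zeta> ^ 5 \<le> 2 * (2 * L * r) / \<zeta> ^ 5" using P \<zeta> by (intro divide_right_mono) auto
      also have "\<dots> = 4 * (r * X / \<zeta>) * 1" by (simp add: X_def z5)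
      also have "\<dots> \<le> 4 * (r * X / \<zeta>) * (A\<^sup>2 * (2 * X))"
        using 1 r X L1 \<zeta> by (intro mult_left_mono) auto
      also have "\<dots> = X * A\<^sup>2 * (8 * (r * X / \<zeta>))" by simp
      also have "\<dots> \<le> X * A\<^sup>2 * (8 * (O1 / \<zeta>\<^sup>2))" using rX\<zeta> X L1 by (intro mult_left_mono) auto
      finally show ?thesis .
    qed
    \<comment> \<open>The gradient term has two powers of \<open>X\<close> beyond
      \<open>A\<^sup>2\<close>. One is the common factor, the other is compensated by
      \<open>\<mu>\<close>, because \<open>r * X \<le> O1\<close>.\<close>
    have low2: "\<bar>norm \<xi>1 powr p - norm \<xi>2 powr p\<bar> \<le> X * A\<^sup>2 * (64 * Cp * (O1 / \<zeta>\<^sup>2))"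
    proof -
      have "\<bar>norm \<xi>1 powr p - norm \<xi>2 powr p\<bar> \<le> Cp * \<mu> * n2 powr p"
        using Cp(2)[OF \<xi>2_0 diff \<mu>half] by (simp add: n2_def)
      also have "n2 powr p = A\<^sup>2 * n2\<^sup>2" using n2_1 powr_add[of n2 "p - 2" 2] by (simp add: A2)
      also have "Cp * \<mu> * (A\<^sup>2 * n2\<^sup>2) \<le> Cp * \<mu> * (A\<^sup>2 * (2 * X)\<^sup>2)"
        using n2X n2_1 Cp(1) \<mu>0 by (intro mult_left_mono power_mono) auto
      also have "\<dots> = X * A\<^sup>2 * (64 * Cp * (r * X / \<zeta>))"
        by (simp add: \<mu>_def power2_eq_square)
      also have "\<dots> \<le> X * A\<^sup>2 * (64 * Cp * (O1 / \<zeta>\<^sup>2))"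
        using rX\<zeta> X L1 Cp(1) by (intro mult_left_mono) auto
      finally show ?thesis .
    qed
    have lower: "- (X * A\<^sup>2 * (K2 * O1 / \<zeta>\<^sup>2)) \<le> (p - 1) / 2 * (q - (norm \<xi>1 powr p - norm \<xi>2 powr p))"
    proof -
      have "- (X * A\<^sup>2 * (8 * (O1 / \<zeta>\<^sup>2)) + X * A\<^sup>2 * (64 * Cp * (O1 / \<zeta>\<^sup>2)))
          \<le> q - (norm \<xi>1 powr p - norm \<xi>2 powr p)"
        using q low1 low2 by simp
      then have "(p - 1) / 2 * - (X * A\<^sup>2 * (8 * (O1 / \<zeta>\<^sup>2)) + X * A\<^sup>2 * (64 * Cp * (O1 / \<zeta>\<^sup>2)))
          \<le> (p - 1) / 2 * (q - (norm \<xi>1 powr p - norm \<xi>2 powr p))"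
        using p by (intro mult_left_mono) auto
      moreover have "(p - 1) / 2 * - (X * A\<^sup>2 * (8 * (O1 / \<zeta>\<^sup>2)) + X * A\<^sup>2 * (64 * Cp * (O1 / \<zeta>\<^sup>2)))
          = - (X * A\<^sup>2 * (K2 * O1 / \<zeta>\<^sup>2))"
      proof -
        have "k * - (y * (8 * z) + y * (64 * Cp * z)) = - (y * ((k * (8 + 64 * Cp)) * z))" for k y z :: real
          by (simp add: algebra_simps)
        from this[of "(p - 1) / 2" "X * A\<^sup>2" "O1 / \<zeta>\<^sup>2"] show ?thesis by (simp add: K2_def)
      qed
      ultimately show ?thesis by simp
    qed
    \<comment> \<open>The bad terms are of order \<open>O1 / \<zeta>\<^sup>2\<close>, the good one
      of order \<open>1 / sqrt r\<close>. Since \<open>r * L \<le> O1 * \<zeta> ^ 4\<close>,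
      \<open>sqrt r\<close> is a small multiple of \<open>\<zeta>\<^sup>2\<close> once
      \<open>L\<close> is large: this is what the fourth power in the weight is for, and
      \<open>K\<^sup>2 * O1 ^ 3 < L\<close> accounts for the cube in the condition on
      \<open>L\<close>.\<close>
    have "K1 / \<zeta>\<^sup>2 - 3/8 * (p - 1) / sqrt r < - (K2 * O1 / \<zeta>\<^sup>2)"
    proof -
      have "(K * O1)\<^sup>2 * r < \<zeta> ^ 4"
      proof -
        have "r * L \<le> O1 * \<zeta> ^ 4" using LO z4 by (simp add: field_simps)
        moreover have "K\<^sup>2 * O1 ^ 3 < L"
          using mult_strict_right_mono[OF Cge(3), of "O1 ^ 3"] O3 L by linarith
        then have "r * (K\<^sup>2 * O1 ^ 3) < r * L" using r by simp
        ultimately have "O1 * ((K * O1)\<^sup>2 * r) < O1 * \<zeta> ^ 4"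
          by (simp add: power_mult_distrib power2_eq_square power3_eq_cube mult_ac)
        then show ?thesis using O1 by simp
      qed
      then have "sqrt ((K * O1)\<^sup>2 * r) < sqrt (\<zeta> ^ 4)" by (rule real_sqrt_less_mono)
      moreover have "sqrt ((K * O1)\<^sup>2 * r) = K * O1 * sqrt r" using K O1 by (simp add: real_sqrt_mult)
      moreover have "sqrt (\<zeta> ^ 4) = \<zeta>\<^sup>2"
        using \<zeta> real_sqrt_abs[of "\<zeta>\<^sup>2"] by (simp add: power_mult[symmetric])
      ultimately have "K * O1 * sqrt r < \<zeta>\<^sup>2" by simp
      then have "K * O1 / \<zeta>\<^sup>2 < 1 / sqrt r" using r \<zeta> by (simp add: field_simps)
      then have "3/8 * (p - 1) * (K * O1 / \<zeta>\<^sup>2) < 3/8 * (p - 1) * (1 / sqrt r)"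
        using p by (intro mult_strict_left_mono) auto
      moreover have "3/8 * (p - 1) * (K * O1 / \<zeta>\<^sup>2) = (K1 + K2) * O1 / \<zeta>\<^sup>2"
      proof -
        have "3/8 * d * (8 * k / (3 * d) * o1 / z) = k * o1 / z" if "d \<noteq> 0" for d k o1 z :: real
          using that by simp
        from this[of "p - 1"] show ?thesis using p by (simp only: K_def)
      qed
      moreover have "K1 / \<zeta>\<^sup>2 \<le> K1 * O1 / \<zeta>\<^sup>2"
        using K1 O1 mult_left_mono[of 1 O1 K1] by (intro divide_right_mono) auto
      ultimately show ?thesis by (simp add: distrib_right add_divide_distrib)
    qed
    then have "X * A\<^sup>2 * (K1 / \<zeta>\<^sup>2 - 3/8 * (p - 1) / sqrt r) < X * A\<^sup>2 * - (K2 * O1 / \<zeta>\<^sup>2)"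
      using X L1 A by (intro mult_strict_left_mono) auto
    then have "X * A\<^sup>2 * (K1 / \<zeta>\<^sup>2 - 3/8 * (p - 1) / sqrt r) < - (X * A\<^sup>2 * (K2 * O1 / \<zeta>\<^sup>2))"
      by (simp only: mult_minus_right)
    from le_less_trans[OF upper less_le_trans[OF this lower]]
    show "\<xi>1 \<noteq> 0 \<and> \<xi>2 \<noteq> 0 \<and> (\<Sum>i\<in>UNIV. ?T i) < (p - 1) / 2 * (q - (norm \<xi>1 powr p - norm \<xi>2 powr p))"
      using \<xi>1_0 \<xi>2_0 by blast
  qed
qed

section \<open>The penalised doubling function\<close>

text \<open>Vanishes on the lateral boundary and the bottom of the cylinder of radius and height 3;
  division by 27 normalises its maximum to 1.\<close>

definition zt :: "real ^ 'n \<Rightarrow> real \<Rightarrow> real" where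
  "zt x t = (9 - (norm x)\<^sup>2) * (t + 3) / 27"

text \<open>The concave modulus as a function of the squared distance, so that it is composed with a
  polynomial.\<close>

definition conc :: "real \<Rightarrow> real" where
  "conc S = 2 * S powr (1/2) - S powr (3/4)"

text \<open>The weight depends on the first point only, so the gradient in the second stays parallel
  to the difference of the points. The squared difference couples the two times, and the last two
  terms blow up at the top of the cylinder, where nothing is known about \<open>v\<close>.\<close>

definition dpen :: "real \<Rightarrow> real \<Rightarrow> real \<Rightarrow> ((real ^ 'n) \<times> real) \<times> (real ^ 'n) \<times> real \<Rightarrow> real" where
  "dpen L T \<theta> Z = L * conc ((norm (fst (fst Z) - fst (snd Z)))\<^sup>2) * (1 / zt (fst (fst Z)) (snd (fst Z)) ^ 4)
     + (snd (fst Z) - snd (snd Z))\<^sup>2 / (2 * T) + \<theta> / (- snd (fst Z)) + \<theta> / (- snd (snd Z))"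

lemma conc_square: "0 \<le> r \<Longrightarrow> conc (r\<^sup>2) = 2 * r - r * sqrt r"
proof (cases "r = 0")
  case False
  assume "0 \<le> r"
  then have r: "r > 0" using False by simp
  then have sq: "r\<^sup>2 = r powr 2" by simp
  have "(r powr 2) powr (3/4) = r powr (1 + 1/2)" unfolding powr_powr by simp
  also have "\<dots> = r * sqrt r" using r unfolding powr_add by (simp add: powr_half_sqrt)
  finally have 1: "(r powr 2) powr (3/4) = r * sqrt r" .
  have "(r powr 2) powr (1/2) = r" unfolding powr_powr using r by simp
  then show ?thesis unfolding conc_def sq 1 by simp
qed (simp add: conc_def)

lemma second_order_sqdist:
  fixes Z :: "((real ^ 'n) \<times> real) \<times> (real ^ 'n) \<times> real"
  shows "second_order (\<lambda>Z. (norm (fst (fst Z) - fst (snd Z)))\<^sup>2) Z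
     (\<lambda>H. 2 * ((fst (fst Z) - fst (snd Z)) \<bullet> (fst (fst H) - fst (snd H))))
     (\<lambda>H. (norm (fst (fst H) - fst (snd H)))\<^sup>2)"
proof (rule second_order_exact)
  have lin: "linear (\<lambda>H :: ((real ^ 'n) \<times> real) \<times> (real ^ 'n) \<times> real. fst (fst H) - fst (snd H))"
    by (intro linearI) (auto simp: algebra_simps)
  show "linear (\<lambda>H. 2 * ((fst (fst Z) - fst (snd Z)) \<bullet> (fst (fst H) - fst (snd H))))"
    by (intro linearI) (auto simp: algebra_simps inner_add_right inner_diff_right)
  show "quadform (\<lambda>H :: ((real ^ 'n) \<times> real) \<times> (real ^ 'n) \<times> real. (norm (fst (fst H) - fst (snd H)))\<^sup>2)"
    by (rule quadform_norm_comp[OF lin])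
  fix H :: "((real ^ 'n) \<times> real) \<times> (real ^ 'n) \<times> real"
  have "fst (fst (Z + H)) - fst (snd (Z + H)) = (fst (fst Z) - fst (snd Z)) + (fst (fst H) - fst (snd H))" by simp
  then show "(norm (fst (fst (Z + H)) - fst (snd (Z + H))))\<^sup>2 = (norm (fst (fst Z) - fst (snd Z)))\<^sup>2
     + 2 * ((fst (fst Z) - fst (snd Z)) \<bullet> (fst (fst H) - fst (snd H))) + (norm (fst (fst H) - fst (snd H)))\<^sup>2"
    by (simp only: norm_add_sq)
qed

lemma second_order_conc_dist:
  fixes x y :: "real ^ 'n" and t s :: real
  assumes "x \<noteq> y" and r: "r = norm (x - y)"
  shows "second_order (\<lambda>Z. L * conc ((norm (fst (fst Z) - fst (snd Z)))\<^sup>2)) ((x, t), (y, s))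
     (\<lambda>H. L * (2 - 3/2 * sqrt r) / (2 * r) * (2 * ((x - y) \<bullet> (fst (fst H) - fst (snd H)))))
     (\<lambda>H. L * (2 - 3/2 * sqrt r) / (2 * r) * (norm (fst (fst H) - fst (snd H)))\<^sup>2
        + L * (- 1 / r ^ 3 + 3/8 / (r\<^sup>2 * sqrt r)) / 2 / 2 * (2 * ((x - y) \<bullet> (fst (fst H) - fst (snd H))))\<^sup>2)"
proof -
  have r0: "r > 0" using assms by simp
  let ?F' = "\<lambda>S. L * (2 * (1/2 * S powr (1/2 - 1)) - 3/4 * S powr (3/4 - 1))"
  let ?F'' = "L * (2 * (1/2 * ((1/2 - 1) * (r\<^sup>2) powr (1/2 - 1 - 1))) - 3/4 * ((3/4 - 1) * (r\<^sup>2) powr (3/4 - 1 - 1)))"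
  have d1: "((\<lambda>S. L * conc S) has_real_derivative ?F' S) (at S)" if "S > 0" for S
    unfolding conc_def using that
    by (intro DERIV_cmult DERIV_diff has_real_derivative_powr)
  have d2: "(?F' has_real_derivative ?F'') (at (r\<^sup>2))"
    using r0 by (intro DERIV_cmult DERIV_diff has_real_derivative_powr) simp_all
  have ev: "\<forall>\<^sub>F S in nhds (r\<^sup>2). ((\<lambda>S. L * conc S) has_real_derivative ?F' S) (at S)"
  proof -
    have "\<forall>\<^sub>F S in nhds (r\<^sup>2). S > 0" using r0 eventually_nhds_in_open[of "{0<..}" "r\<^sup>2"] by simp
    then show ?thesis by eventually_elim (rule d1)
  qed
  have sq: "r\<^sup>2 = r powr 2" using r0 by simp
  have e1: "?F' (r\<^sup>2) = L * (2 - 3/2 * sqrt r) / (2 * r)"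
  proof -
    have "(r powr 2) powr (1/2 - 1) = r powr (- 1)" unfolding powr_powr by simp
    also have "\<dots> = 1 / r" using r0 by (simp add: powr_minus_divide)
    finally have 1: "(r powr 2) powr (1/2 - 1) = 1 / r" .
    have "(r powr 2) powr (3/4 - 1) = r powr (- (1/2))" unfolding powr_powr by simp
    also have "\<dots> = 1 / sqrt r" using r0 unfolding powr_minus_divide by (simp add: powr_half_sqrt)
    also have "\<dots> = sqrt r / r" using r0 by (simp add: field_simps)
    finally have 2: "(r powr 2) powr (3/4 - 1) = sqrt r / r" .
    have "L * (2 * (1/2 * (1 / r)) - 3/4 * (m / r)) = L * (2 - 3/2 * m) / (2 * r)" for m
      using r0 by (simp add: field_simps)
    then show ?thesis unfolding sq 1 2 .
  qed
  have e2: "?F'' = L * (- 1 / r ^ 3 + 3/8 / (r\<^sup>2 * sqrt r)) / 2"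
  proof -
    have "(r powr 2) powr (1/2 - 1 - 1) = r powr (- 3)" unfolding powr_powr by simp
    also have "\<dots> = 1 / r ^ 3" using r0 by (simp add: powr_minus_divide)
    finally have 1: "(r powr 2) powr (1/2 - 1 - 1) = 1 / r ^ 3" .
    have "(r powr 2) powr (3/4 - 1 - 1) = r powr (- (2 + 1/2))" unfolding powr_powr by simp
    also have "\<dots> = 1 / (r powr 2 * r powr (1/2))" unfolding powr_minus_divide powr_add ..
    also have "\<dots> = 1 / (r\<^sup>2 * sqrt r)" using r0 by (simp add: powr_half_sqrt)
    finally have 2: "(r powr 2) powr (3/4 - 1 - 1) = 1 / (r\<^sup>2 * sqrt r)" .
    show ?thesis unfolding sq 1 2 unfolding sq[symmetric] by (simp add: algebra_simps)
  qed
  have so: "second_order (\<lambda>Z. (norm (fst (fst Z) - fst (snd Z)))\<^sup>2) ((x, t), (y, s))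
     (\<lambda>H. 2 * ((x - y) \<bullet> (fst (fst H) - fst (snd H)))) (\<lambda>H. (norm (fst (fst H) - fst (snd H)))\<^sup>2)"
    using second_order_sqdist[of "((x, t), (y, s))"] by simp
  have fz: "(norm (fst (fst ((x, t), (y, s))) - fst (snd ((x, t), (y, s)))))\<^sup>2 = r\<^sup>2" by (simp add: r)
  show ?thesis
    using second_order_real_comp[OF so, unfolded fz, OF ev d2] unfolding e1 e2 .
qed

lemma second_order_weight:
  fixes x y :: "real ^ 'n" and t s :: real
  assumes z: "\<zeta> = zt x t" "\<zeta> > 0"
  shows "second_order (\<lambda>Z. 1 / zt (fst (fst Z)) (snd (fst Z)) ^ 4) ((x, t), (y, s))
     (\<lambda>H. - 4 / \<zeta> ^ 5 * ((9 - (norm x)\<^sup>2) * (snd (fst H) / 27) + (t + 3) / 27 * (- 2 * (x \<bullet> fst (fst H)))))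
     (\<lambda>H. - 4 / \<zeta> ^ 5 * ((t + 3) / 27 * (- (norm (fst (fst H)))\<^sup>2) + - 2 * (x \<bullet> fst (fst H)) * (snd (fst H) / 27))
        + 20 / \<zeta> ^ 6 / 2 * ((9 - (norm x)\<^sup>2) * (snd (fst H) / 27) + (t + 3) / 27 * (- 2 * (x \<bullet> fst (fst H))))\<^sup>2)"
proof -
  let ?Z = "((x, t), (y, s))"
  have lin1: "linear (\<lambda>H :: ((real ^ 'n) \<times> real) \<times> (real ^ 'n) \<times> real. fst (fst H))"
    by (intro linearI) auto
  have 1: "second_order (\<lambda>Z :: ((real ^ 'n) \<times> real) \<times> (real ^ 'n) \<times> real. 9 - (norm (fst (fst Z)))\<^sup>2) ?Z
      (\<lambda>H. - 2 * (x \<bullet> fst (fst H))) (\<lambda>H. - (norm (fst (fst H)))\<^sup>2)"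
  proof (rule second_order_exact)
    show "linear (\<lambda>H :: ((real ^ 'n) \<times> real) \<times> (real ^ 'n) \<times> real. - 2 * (x \<bullet> fst (fst H)))"
      by (intro linearI) (auto simp: inner_add_right algebra_simps)
    show "quadform (\<lambda>H :: ((real ^ 'n) \<times> real) \<times> (real ^ 'n) \<times> real. - (norm (fst (fst H)))\<^sup>2)"
      using quadform_cmult[OF quadform_norm_comp[OF lin1], of "-1"] by simp
  qed (simp add: norm_add_sq)
  have 2: "second_order (\<lambda>Z :: ((real ^ 'n) \<times> real) \<times> (real ^ 'n) \<times> real. (snd (fst Z) + 3) / 27) ?Z
      (\<lambda>H. snd (fst H) / 27) (\<lambda>H. 0)"
    by (rule second_order_exact) (auto intro!: linearI quadform_zero simp: add_divide_distrib)
  have 3: "second_order (\<lambda>Z. zt (fst (fst Z)) (snd (fst Z))) ?Z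
      (\<lambda>H. (9 - (norm x)\<^sup>2) * (snd (fst H) / 27) + (t + 3) / 27 * (- 2 * (x \<bullet> fst (fst H))))
      (\<lambda>H. (t + 3) / 27 * (- (norm (fst (fst H)))\<^sup>2) + - 2 * (x \<bullet> fst (fst H)) * (snd (fst H) / 27))"
    using second_order_mult[OF 1 2] unfolding zt_def by simp
  have d1: "((\<lambda>y::real. 1 / y ^ 4) has_real_derivative - 4 / y ^ 5) (at y)" if "y > 0" for y
    using that by (auto intro!: derivative_eq_intros simp: field_simps eval_nat_numeral)
  have ev: "\<forall>\<^sub>F y in nhds \<zeta>. ((\<lambda>y::real. 1 / y ^ 4) has_real_derivative - 4 / y ^ 5) (at y)"
  proof -
    have "\<forall>\<^sub>F y in nhds \<zeta>. y > 0" using z(2) eventually_nhds_in_open[of "{0<..}" \<zeta>] by simp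
    then show ?thesis by eventually_elim (rule d1)
  qed
  have d2: "((\<lambda>y::real. - 4 / y ^ 5) has_real_derivative 20 / \<zeta> ^ 6) (at \<zeta>)"
    using z(2) by (auto intro!: derivative_eq_intros simp: field_simps eval_nat_numeral)
  show ?thesis
    using second_order_real_comp[OF 3, of "\<lambda>y. 1 / y ^ 4" "\<lambda>y. - 4 / y ^ 5" "20 / \<zeta> ^ 6"] ev d2
    by (simp add: z(1)[symmetric])
qed

lemma second_order_reciprocal_time:
  fixes T :: "'a::euclidean_space \<Rightarrow> real"
  assumes T: "linear T" and neg: "T Z < 0"
  shows "second_order (\<lambda>Z. \<theta> / (- T Z)) Z (\<lambda>H. \<theta> / (T Z)\<^sup>2 * T H) (\<lambda>H. - \<theta> / (T Z) ^ 3 * (T H)\<^sup>2)"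
proof -
  have d1: "((\<lambda>y. \<theta> / (- y)) has_real_derivative \<theta> / y\<^sup>2) (at y)" if "y < 0" for y
    using that by (auto intro!: derivative_eq_intros simp: field_simps power2_eq_square)
  have ev: "\<forall>\<^sub>F y in nhds (T Z). ((\<lambda>y. \<theta> / (- y)) has_real_derivative \<theta> / y\<^sup>2) (at y)"
  proof -
    have "\<forall>\<^sub>F y in nhds (T Z). y < 0" using neg eventually_nhds_in_open[of "{..<0}" "T Z"] by simp
    then show ?thesis by eventually_elim (rule d1)
  qed
  have d2: "((\<lambda>y. \<theta> / y\<^sup>2) has_real_derivative - 2 * \<theta> / (T Z) ^ 3) (at (T Z))"
    using neg by (auto intro!: derivative_eq_intros simp: field_simps eval_nat_numeral)
  show ?thesis
    using second_order_real_comp[OF second_order_linear[OF T] ev d2] by simp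
qed

lemma second_order_time_diff:
  fixes Z :: "((real ^ 'n) \<times> real) \<times> (real ^ 'n) \<times> real"
  shows "second_order (\<lambda>Z. (snd (fst Z) - snd (snd Z))\<^sup>2 / (2 * T)) Z
    (\<lambda>H. (snd (fst Z) - snd (snd Z)) / T * (snd (fst H) - snd (snd H)))
    (\<lambda>H. 1 / (2 * T) * (snd (fst H) - snd (snd H))\<^sup>2)"
proof (rule second_order_exact)
  show "linear (\<lambda>H. (snd (fst Z) - snd (snd Z)) / T * (snd (fst H) - snd (snd H)))"
    by (intro linearI) (auto simp: algebra_simps add_divide_distrib diff_divide_distrib)
  show "quadform (\<lambda>H :: ((real ^ 'n) \<times> real) \<times> (real ^ 'n) \<times> real. 1 / (2 * T) * (snd (fst H) - snd (snd H))\<^sup>2)"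
    by (intro quadform_cmult quadform_linear_sq linearI) (auto simp: algebra_simps)
  fix H :: "((real ^ 'n) \<times> real) \<times> (real ^ 'n) \<times> real"
  have "((a + b) - (c + d))\<^sup>2 / (2 * T) = (a - c)\<^sup>2 / (2 * T) + (a - c) / T * (b - d) + 1 / (2 * T) * (b - d)\<^sup>2"
    for a b c d
  proof -
    have "((a + b) - (c + d))\<^sup>2 = (a - c)\<^sup>2 + 2 * ((a - c) * (b - d)) + (b - d)\<^sup>2"
      by (simp add: power2_eq_square algebra_simps)
    moreover have "(u + 2 * w + z) / (2 * T) = u / (2 * T) + w / T + 1 / (2 * T) * z" for u w z
      by (simp add: add_divide_distrib)
    ultimately show ?thesis by (simp only: times_divide_eq_left)
  qed
  then show "(snd (fst (Z + H)) - snd (snd (Z + H)))\<^sup>2 / (2 * T) = (snd (fst Z) - snd (snd Z))\<^sup>2 / (2 * T)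
     + (snd (fst Z) - snd (snd Z)) / T * (snd (fst H) - snd (snd H)) + 1 / (2 * T) * (snd (fst H) - snd (snd H))\<^sup>2"
    by simp
qed

text \<open>The operator sees no second derivatives in time, so \<open>Q\<close> is bounded on
  vectors with zero time components and the time penalties drop out. What remains are the tangential
  and radial curvature of the modulus, the weight with \<open>5 / \<zeta> ^ 6\<close>, and the mixed
  term of the product rule.\<close>

lemma second_order_dpen:
  fixes x y :: "real ^ 'n"
  assumes xy: "x \<noteq> y" and t: "- 3 < t" "t < 0" "s < 0" and x: "norm x < 3" and L: "0 \<le> L"
    and r: "r = norm (x - y)" "r \<le> 1" and \<zeta>: "\<zeta> = zt x t" and e: "e = (x - y) /\<^sub>R r"
    and c: "c = L * (2 - 3/2 * sqrt r)" and P: "P = L * (2 * r - r * sqrt r)"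
    and D: "D = (8 * (t + 3) / (27 * \<zeta> ^ 5)) *\<^sub>R x"
    and \<xi>2: "\<xi>2 = (c / \<zeta> ^ 4) *\<^sub>R e" and \<xi>1: "\<xi>1 = \<xi>2 + P *\<^sub>R D"
    and q1: "q1 = P * (- 4 / \<zeta> ^ 5 * ((9 - (norm x)\<^sup>2) / 27)) + (t - s) / T + \<theta> / t\<^sup>2"
    and q2: "q2 = (t - s) / T - \<theta> / s\<^sup>2"
  obtains Q where "second_order (dpen L T \<theta>) ((x, t), (y, s)) (\<lambda>H. (\<xi>1, q1) \<bullet> fst H + (- \<xi>2, - q2) \<bullet> snd H) Q"
    "\<And>\<alpha> \<beta>. Q ((\<alpha>, 0), (\<beta>, 0)) \<le>
        1 / \<zeta> ^ 4 * (c / (2 * r) * ((norm (\<alpha> - \<beta>))\<^sup>2 - (e \<bullet> (\<alpha> - \<beta>))\<^sup>2) - 3/8 * L / sqrt r * (e \<bullet> (\<alpha> - \<beta>))\<^sup>2)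
        + P * (5 / \<zeta> ^ 6 * (norm \<alpha>)\<^sup>2) + c * (e \<bullet> (\<alpha> - \<beta>)) * (D \<bullet> \<alpha>)"
proof -
  have r0: "r > 0" using xy r by simp
  have x9: "(norm x)\<^sup>2 < 9" using power_strict_mono[OF x, of 2] by simp
  have \<zeta>0: "\<zeta> > 0" using x9 t by (simp add: \<zeta> zt_def)
  have \<zeta>1: "\<zeta> \<le> 1"
  proof -
    have "(9 - (norm x)\<^sup>2) * (t + 3) \<le> 9 * 3" using x9 t by (intro mult_mono) auto
    then show ?thesis by (simp add: \<zeta> zt_def)
  qed
  have P0: "P \<ge> 0"
  proof -
    have "sqrt r \<le> 2" using r real_sqrt_le_1_iff[of r] by linarith
    then have "r * sqrt r \<le> r * 2" using r0 by (intro mult_left_mono) auto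
    then have "0 \<le> 2 * r - r * sqrt r" by linarith
    then show ?thesis unfolding P by (rule mult_nonneg_nonneg[OF L])
  qed
  let ?Z = "((x, t), (y, s))"
  have linT: "linear (\<lambda>H :: ((real ^ 'n) \<times> real) \<times> (real ^ 'n) \<times> real. snd (fst H))"
    "linear (\<lambda>H :: ((real ^ 'n) \<times> real) \<times> (real ^ 'n) \<times> real. snd (snd H))"
    by (auto intro!: linearI)
  let ?lS = "\<lambda>H :: ((real ^ 'n) \<times> real) \<times> (real ^ 'n) \<times> real. c / (2 * r) * (2 * ((x - y) \<bullet> (fst (fst H) - fst (snd H))))"
  let ?lW = "\<lambda>H :: ((real ^ 'n) \<times> real) \<times> (real ^ 'n) \<times> real.
      - 4 / \<zeta> ^ 5 * ((9 - (norm x)\<^sup>2) * (snd (fst H) / 27) + (t + 3) / 27 * (- 2 * (x \<bullet> fst (fst H))))"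
  let ?QS = "\<lambda>H :: ((real ^ 'n) \<times> real) \<times> (real ^ 'n) \<times> real. c / (2 * r) * (norm (fst (fst H) - fst (snd H)))\<^sup>2
        + L * (- 1 / r ^ 3 + 3/8 / (r\<^sup>2 * sqrt r)) / 2 / 2 * (2 * ((x - y) \<bullet> (fst (fst H) - fst (snd H))))\<^sup>2"
  let ?QW = "\<lambda>H :: ((real ^ 'n) \<times> real) \<times> (real ^ 'n) \<times> real.
      - 4 / \<zeta> ^ 5 * ((t + 3) / 27 * (- (norm (fst (fst H)))\<^sup>2) + - 2 * (x \<bullet> fst (fst H)) * (snd (fst H) / 27))
        + 20 / \<zeta> ^ 6 / 2 * ((9 - (norm x)\<^sup>2) * (snd (fst H) / 27) + (t + 3) / 27 * (- 2 * (x \<bullet> fst (fst H))))\<^sup>2"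
  let ?l = "\<lambda>H. P * ?lW H + 1 / \<zeta> ^ 4 * ?lS H + (t - s) / T * (snd (fst H) - snd (snd H)) + \<theta> / t\<^sup>2 * snd (fst H) + \<theta> / s\<^sup>2 * snd (snd H)"
  let ?Q = "\<lambda>H. P * ?QW H + 1 / \<zeta> ^ 4 * ?QS H + ?lS H * ?lW H + 1 / (2 * T) * (snd (fst H) - snd (snd H))\<^sup>2
     + - \<theta> / t ^ 3 * (snd (fst H))\<^sup>2 + - \<theta> / s ^ 3 * (snd (snd H))\<^sup>2"
  have Pv: "L * conc ((norm (x - y))\<^sup>2) = P" using r0 unfolding P r(1)[symmetric] by (simp add: conc_square)
  have prod: "second_order (\<lambda>Z. L * conc ((norm (fst (fst Z) - fst (snd Z)))\<^sup>2) * (1 / zt (fst (fst Z)) (snd (fst Z)) ^ 4)) ?Z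
     (\<lambda>H. P * ?lW H + 1 / \<zeta> ^ 4 * ?lS H) (\<lambda>H. P * ?QW H + 1 / \<zeta> ^ 4 * ?QS H + ?lS H * ?lW H)"
    using second_order_mult[OF second_order_conc_dist[OF xy r(1), of L t s, folded c] second_order_weight[OF \<zeta> \<zeta>0, of y s]]
    unfolding fst_conv snd_conv Pv \<zeta>[symmetric] .
  have time: "second_order (\<lambda>Z. (snd (fst Z) - snd (snd Z))\<^sup>2 / (2 * T)) ?Z
    (\<lambda>H. (t - s) / T * (snd (fst H) - snd (snd H))) (\<lambda>H. 1 / (2 * T) * (snd (fst H) - snd (snd H))\<^sup>2)"
    using second_order_time_diff[of T ?Z] by simp
  have r1: "second_order (\<lambda>Z. \<theta> / (- snd (fst Z))) ?Z (\<lambda>H. \<theta> / t\<^sup>2 * snd (fst H)) (\<lambda>H. - \<theta> / t ^ 3 * (snd (fst H))\<^sup>2)"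
    using second_order_reciprocal_time[OF linT(1), of ?Z \<theta>] t by simp
  have r2: "second_order (\<lambda>Z. \<theta> / (- snd (snd Z))) ?Z (\<lambda>H. \<theta> / s\<^sup>2 * snd (snd H)) (\<lambda>H. - \<theta> / s ^ 3 * (snd (snd H))\<^sup>2)"
    using second_order_reciprocal_time[OF linT(2), of ?Z \<theta>] t by simp
  have so: "second_order (dpen L T \<theta>) ?Z ?l ?Q"
    unfolding dpen_def[abs_def] by (rule second_order_add[OF second_order_add[OF second_order_add[OF prod time] r1] r2])
  have xye: "x - y = r *\<^sub>R e" using r0 by (simp add: e)
  have lS: "?lS H = c * (e \<bullet> (fst (fst H) - fst (snd H)))" for H
    unfolding xye using r0 by simp
  have Dx: "D \<bullet> \<alpha> = - 4 / \<zeta> ^ 5 * ((t + 3) / 27 * (- 2 * (x \<bullet> \<alpha>)))" for \<alpha>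
  proof -
    have "(8 * T / (27 * z)) * k = - 4 / z * (T / 27 * (- 2 * k))" for T z k :: real by simp
    then show ?thesis unfolding D inner_scaleR_left .
  qed
  have "?l = (\<lambda>H. (\<xi>1, q1) \<bullet> fst H + (- \<xi>2, - q2) \<bullet> snd H)"
  proof
    fix H :: "((real ^ 'n) \<times> real) \<times> (real ^ 'n) \<times> real"
    obtain \<alpha> a \<beta> b where H: "H = ((\<alpha>, a), (\<beta>, b))" by (cases H) auto
    have lW: "?lW H = - 4 / \<zeta> ^ 5 * ((9 - (norm x)\<^sup>2) / 27) * a + D \<bullet> \<alpha>"
    proof -
      have "- 4 / z * (u * (a / 27) + w) = - 4 / z * (u / 27) * a + - 4 / z * w" for z u w :: real
        by (simp add: distrib_left)
      then show ?thesis unfolding Dx H fst_conv snd_conv .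
    qed
    have lS': "1 / \<zeta> ^ 4 * ?lS H = \<xi>2 \<bullet> \<alpha> - \<xi>2 \<bullet> \<beta>"
    proof -
      have "1 / z * (k * (u - w)) = k / z * u - k / z * w" for z k u w :: real
        by (simp add: right_diff_distrib diff_divide_distrib)
      then show ?thesis unfolding lS unfolding H fst_conv snd_conv unfolding \<xi>2 inner_diff_right inner_scaleR_left .
    qed
    have gen: "k * (m * a + d) + (u - w) + n * (a - b) + th1 * a + th2 * b
        = (u + k * d + (k * m + n + th1) * a) + (- w + - (n - th2) * b)" for k m d u w n th1 th2
      by (simp add: algebra_simps)
    have rhs: "(\<xi>1, q1) \<bullet> fst H + (- \<xi>2, - q2) \<bullet> snd H
        = (\<xi>2 \<bullet> \<alpha> + P * (D \<bullet> \<alpha>) + q1 * a) + (- (\<xi>2 \<bullet> \<beta>) + - q2 * b)"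
      by (simp add: H \<xi>1 inner_add_left)
    show "?l H = (\<xi>1, q1) \<bullet> fst H + (- \<xi>2, - q2) \<bullet> snd H"
      unfolding lW lS' rhs unfolding H fst_conv snd_conv q1 q2 by (rule gen)
  qed
  with so have so': "second_order (dpen L T \<theta>) ?Z (\<lambda>H. (\<xi>1, q1) \<bullet> fst H + (- \<xi>2, - q2) \<bullet> snd H) ?Q" by simp
  have "?Q ((\<alpha>, 0), (\<beta>, 0)) \<le>
        1 / \<zeta> ^ 4 * (c / (2 * r) * ((norm (\<alpha> - \<beta>))\<^sup>2 - (e \<bullet> (\<alpha> - \<beta>))\<^sup>2) - 3/8 * L / sqrt r * (e \<bullet> (\<alpha> - \<beta>))\<^sup>2)
        + P * (5 / \<zeta> ^ 6 * (norm \<alpha>)\<^sup>2) + c * (e \<bullet> (\<alpha> - \<beta>)) * (D \<bullet> \<alpha>)" for \<alpha> \<beta>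
  proof -
    let ?H = "((\<alpha>, 0), (\<beta>, 0)) :: ((real ^ 'n) \<times> real) \<times> (real ^ 'n) \<times> real" and ?g = "\<alpha> - \<beta>"
    have QS: "?QS ?H = c / (2 * r) * ((norm ?g)\<^sup>2 - (e \<bullet> ?g)\<^sup>2) - 3/8 * L / sqrt r * (e \<bullet> ?g)\<^sup>2"
    proof -
      have m1: "L * (- 1 / r ^ 3 + 3/8 / (r\<^sup>2 * sqrt r)) / 2 / 2 * (2 * (r * m))\<^sup>2
          = (L * (- 1 / r + 3/8 / sqrt r)) * m\<^sup>2" for m
        using r0 by (simp add: field_simps power2_eq_square power3_eq_cube)
      \<comment> \<open>In direction \<open>e\<close> the tangential curvature
        \<open>c / (2 * r)\<close> is cancelled and half the second derivative of the modulus
        remains, \<open>- 3/8 * L / sqrt r\<close>.\<close>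
      have m2: "L * (- 1 / r + 3/8 / sqrt r) = - (c / (2 * r)) - 3/8 * L / sqrt r"
      proof -
        have "sqrt r / r = 1 / sqrt r" using r0 by (simp add: field_simps)
        moreover have "c / (2 * r) = L / r - 3/4 * L * (sqrt r / r)"
          using r0 by (simp add: c field_simps)
        ultimately show ?thesis by (simp add: algebra_simps)
      qed
      have xyg: "(x - y) \<bullet> ?g = r * (e \<bullet> ?g)" by (simp add: xye)
      have QS0: "?QS ?H = c / (2 * r) * (norm ?g)\<^sup>2
          + L * (- 1 / r ^ 3 + 3/8 / (r\<^sup>2 * sqrt r)) / 2 / 2 * (2 * (r * (e \<bullet> ?g)))\<^sup>2"
        unfolding fst_conv snd_conv xyg ..
      have gen: "k * n + (- k - j) * m = k * (n - m) - j * m" for k n j m :: real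
        by (simp add: algebra_simps)
      show ?thesis unfolding QS0 m1 m2 by (rule gen)
    qed
    \<comment> \<open>The Hessian of \<open>zt\<close> contributes 4/9 and the square of its
      gradient 40/9, together less than 5.\<close>
    have QW: "?QW ?H \<le> 5 / \<zeta> ^ 6 * (norm \<alpha>)\<^sup>2"
    proof -
      have t3: "0 \<le> (t + 3) / 27" "(t + 3) / 27 \<le> 1/9" using t by auto
      have a: "4 / \<zeta> ^ 5 * ((t + 3) / 27 * (norm \<alpha>)\<^sup>2) \<le> 4 / \<zeta> ^ 6 * (1/9 * (norm \<alpha>)\<^sup>2)"
      proof (rule mult_mono)
        show "4 / \<zeta> ^ 5 \<le> 4 / \<zeta> ^ 6"
          using \<zeta>0 \<zeta>1 power_decreasing[of 5 6 \<zeta>] by (intro frac_le) auto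
        show "(t + 3) / 27 * (norm \<alpha>)\<^sup>2 \<le> 1/9 * (norm \<alpha>)\<^sup>2" by (rule mult_right_mono[OF t3(2)]) simp
      qed (use t3 \<zeta>0 in auto)
      have "((t + 3) / 27 * (- 2 * (x \<bullet> \<alpha>)))\<^sup>2 \<le> (1/9 * (2 * (3 * norm \<alpha>)))\<^sup>2"
      proof (rule power2_le_iff_abs_le[THEN iffD2])
        have "\<bar>x \<bullet> \<alpha>\<bar> \<le> 3 * norm \<alpha>"
          using order_trans[OF Cauchy_Schwarz_ineq2[of x \<alpha>] mult_right_mono[of "norm x" 3 "norm \<alpha>"]] x by simp
        then have "(t + 3) / 27 * (2 * \<bar>x \<bullet> \<alpha>\<bar>) \<le> 1/9 * (2 * (3 * norm \<alpha>))"
          using t3 by (intro mult_mono) auto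
        then show "\<bar>(t + 3) / 27 * (- 2 * (x \<bullet> \<alpha>))\<bar> \<le> 1/9 * (2 * (3 * norm \<alpha>))"
          using t3 by (simp add: abs_mult)
      qed simp
      then have "20 / \<zeta> ^ 6 / 2 * ((t + 3) / 27 * (- 2 * (x \<bullet> \<alpha>)))\<^sup>2 \<le> 20 / \<zeta> ^ 6 / 2 * (1/9 * (2 * (3 * norm \<alpha>)))\<^sup>2"
        using \<zeta>0 by (intro mult_left_mono) auto
      also have "\<dots> = 40 / 9 / \<zeta> ^ 6 * (norm \<alpha>)\<^sup>2" by (simp add: power2_eq_square)
      finally have b: "20 / \<zeta> ^ 6 / 2 * ((t + 3) / 27 * (- 2 * (x \<bullet> \<alpha>)))\<^sup>2 \<le> 40 / 9 / \<zeta> ^ 6 * (norm \<alpha>)\<^sup>2" .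
      have "4 / \<zeta> ^ 6 * (1/9 * (norm \<alpha>)\<^sup>2) + 40 / 9 / \<zeta> ^ 6 * (norm \<alpha>)\<^sup>2 \<le> 5 / \<zeta> ^ 6 * (norm \<alpha>)\<^sup>2"
      proof -
        have "4 / z * (1/9 * n) + 40 / 9 / z * n = 44 / 9 * (n / z)" for z n :: real by (simp add: add_divide_distrib)
        moreover have "44 / 9 * ((norm \<alpha>)\<^sup>2 / \<zeta> ^ 6) \<le> 5 * ((norm \<alpha>)\<^sup>2 / \<zeta> ^ 6)"
          using \<zeta>0 by (intro mult_right_mono) auto
        ultimately show ?thesis by simp
      qed
      with a b show ?thesis by simp
    qed
    have "?lS ?H * ?lW ?H = c * (e \<bullet> ?g) * (D \<bullet> \<alpha>)"
      unfolding lS unfolding Dx by simp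
    then show ?thesis using mult_left_mono[OF QW P0] QS by simp
  qed
  with so' that show ?thesis by blast
qed

section \<open>Lipschitz regularity in space\<close>

lemma jet_sub_mono: "jet_sub p s \<Omega> v \<Longrightarrow> A \<subseteq> \<Omega> \<Longrightarrow> jet_sub p s A v"
  unfolding jet_sub_def by blast

lemma supconv_le:
  assumes K: "compact K" "K \<noteq> {}" "continuous_on K v" and \<epsilon>: "\<epsilon> > 0" and b: "\<And>w. w \<in> K \<Longrightarrow> v w \<le> b"
  shows "supconv K \<epsilon> v z \<le> b"
proof -
  obtain w where w: "supconv_opt K \<epsilon> v z w" using supconv_opt_ex[OF K] by blast
  moreover have "0 \<le> (norm (z - w))\<^sup>2 / (2 * \<epsilon>)" using \<epsilon> by simp
  ultimately show ?thesis using b[of w] unfolding supconv_opt_def by linarith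
qed

lemma supconv_ge_self:
  assumes K: "compact K" "K \<noteq> {}" "continuous_on K v" and z: "z \<in> K"
  shows "v z \<le> supconv K \<epsilon> v z"
  using supconv_ge[OF K z, of z \<epsilon>] by simp

text \<open>The point \<open>z\<close> competes at no penalty, so the penalty paid by an optimal
  point is at most the oscillation \<open>2 * \<Lambda>\<close>.\<close>

lemma supconv_opt_close:
  assumes K: "compact K" "K \<noteq> {}" "continuous_on K v" and \<epsilon>: "\<epsilon> > 0" and z: "z \<in> K"
    and opt: "supconv_opt K \<epsilon> v z w" and b: "\<And>w. w \<in> K \<Longrightarrow> \<bar>v w\<bar> \<le> \<Lambda>" and m: "4 * \<Lambda> * \<epsilon> \<le> m\<^sup>2" "0 \<le> m"
  shows "norm (z - w) \<le> m"
proof -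
  have "v z \<le> v w - (norm (z - w))\<^sup>2 / (2 * \<epsilon>)" "w \<in> K"
    using supconv_ge_self[OF K z, of \<epsilon>] opt by (auto simp: supconv_opt_def)
  then have "(norm (z - w))\<^sup>2 / (2 * \<epsilon>) \<le> 2 * \<Lambda>" using b[of w] b[OF z] by linarith
  then have "(norm (z - w))\<^sup>2 \<le> 4 * \<Lambda> * \<epsilon>" using \<epsilon> by (simp add: field_simps)
  also have "\<dots> \<le> m\<^sup>2" by (rule m(1))
  finally show ?thesis using m(2) by (rule power2_le_imp_le)
qed

lemma eventually_nhds_unshift:
  fixes z :: "'a::real_normed_vector"
  assumes "\<forall>\<^sub>F w in nhds z. P w" shows "\<forall>\<^sub>F h in nhds 0. P (z + h)"
proof -
  obtain d where "d > 0" "\<And>w. dist w z < d \<Longrightarrow> P w"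
    using assms unfolding eventually_nhds_metric by blast
  then show ?thesis unfolding eventually_nhds_0_norm by (intro exI[of _ d]) (auto simp: dist_norm)
qed

lemma zt_pos:
  assumes "norm x < 3" "- 3 < t" shows "0 < zt x t"
proof -
  have "(norm x)\<^sup>2 < 9" using power_strict_mono[OF assms(1), of 2] by simp
  then show ?thesis using assms by (simp add: zt_def)
qed

lemma zt_le_1:
  assumes "norm x \<le> 3" "- 3 \<le> t" "t \<le> 0" shows "zt x t \<le> 1"
proof -
  have "(norm x)\<^sup>2 \<le> 9" using power_mono[OF assms(1), of 2] by simp
  then have "(9 - (norm x)\<^sup>2) * (t + 3) \<le> 9 * 3" using assms by (intro mult_mono) auto
  then show ?thesis by (simp add: zt_def)
qed

lemma zt_pos_imp:
  assumes "0 < zt x t" "norm x \<le> 3" "- 3 \<le> t" shows "norm x < 3" "- 3 < t"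
proof -
  have "norm x \<noteq> 3" "t \<noteq> - 3" using assms(1) by (auto simp: zt_def)
  then show "norm x < 3" "- 3 < t" using assms by auto
qed

lemma conc_square_bounds:
  assumes "0 \<le> r" "r \<le> 1" shows "r \<le> conc (r\<^sup>2)" "conc (r\<^sup>2) \<le> 2 * r"
proof -
  have "r * sqrt r \<le> r * 1" using assms by (intro mult_left_mono) auto
  then show "r \<le> conc (r\<^sup>2)" "conc (r\<^sup>2) \<le> 2 * r" using assms by (auto simp: conc_square)
qed

lemma norm_Pair_le_add: "norm (a, b) \<le> norm a + norm b"
  unfolding norm_Pair by (rule sqrt_sum_squares_le_sum) auto

text \<open>If the inequality fails at one point, the doubled function built from the regularised
  \<open>v\<close> and \<open>- v\<close> is positive there and has an interior maximum, at which
  \<open>est\<close> contradicts \<open>doubled_maximum\<close>. The condition on \<open>L\<close>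
  involves only \<open>C\<close> and \<open>\<Lambda>\<close>; the parameters of regularisation and
  penalisation are chosen afterwards, from the size of the violation and the uniform
  continuity.\<close>

lemma doubled_inequality:
  fixes v :: "(real ^ 'n) \<times> real \<Rightarrow> real"
  defines "\<Omega> \<equiv> ball 0 4 \<times> {-4<..<0} :: ((real ^ 'n) \<times> real) set"
  assumes p: "1 < p" and \<Lambda>: "\<Lambda> \<ge> 1" and uc: "uniformly_continuous_on \<Omega> v" and bd: "\<And>z. z \<in> \<Omega> \<Longrightarrow> \<bar>v z\<bar> \<le> \<Lambda>"
    and sub: "jet_sub p 1 \<Omega> v" and sup: "jet_sub p (- 1) \<Omega> (\<lambda>w. - v w)"
    and C: "C \<ge> 32"
    and est: "\<And>(e :: real ^ 'n) \<xi>1 \<xi>2 D r \<zeta> L P c q O1 \<alpha> \<gamma>. norm e = 1 \<Longrightarrow> 0 < r \<Longrightarrow> r \<le> 1 \<Longrightarrow> 0 < \<zeta> \<Longrightarrow> \<zeta> \<le> 1 \<Longrightarrow>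
       1 \<le> O1 \<Longrightarrow> C * O1 ^ 3 \<le> L \<Longrightarrow> L / 2 \<le> c \<Longrightarrow> c \<le> 2 * L \<Longrightarrow> 0 \<le> P \<Longrightarrow> P \<le> 2 * L * r \<Longrightarrow>
       norm D \<le> 4 / \<zeta> ^ 5 \<Longrightarrow> \<xi>2 = (c / \<zeta> ^ 4) *\<^sub>R e \<Longrightarrow> \<xi>1 = \<xi>2 + P *\<^sub>R D \<Longrightarrow> L * r / \<zeta> ^ 4 \<le> O1 \<Longrightarrow>
       - 2 * P / \<zeta> ^ 5 \<le> q \<Longrightarrow>
       (\<And>i. \<alpha> i = pmap p (sqrt (p - 1) - 1) \<xi>1 (axis i 1)) \<Longrightarrow>
       (\<And>i. \<gamma> i = \<alpha> i - pmap p (- sqrt (p - 1) - 1) \<xi>2 (axis i 1)) \<Longrightarrow>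
       \<xi>1 \<noteq> 0 \<and> \<xi>2 \<noteq> 0 \<and>
       (\<Sum>i\<in>UNIV. 1 / \<zeta> ^ 4 * (c / (2 * r) * ((norm (\<gamma> i))\<^sup>2 - (e \<bullet> \<gamma> i)\<^sup>2) - 3/8 * L / sqrt r * (e \<bullet> \<gamma> i)\<^sup>2)
          + P * (5 / \<zeta> ^ 6 * (norm (\<alpha> i))\<^sup>2) + c * (e \<bullet> \<gamma> i) * (D \<bullet> \<alpha> i))
       < (p - 1) / 2 * (q - (norm \<xi>1 powr p - norm \<xi>2 powr p))"
    and L: "C * (2 * \<Lambda>) ^ 3 \<le> L"
    and pt: "norm x0 < 3" "- 3 < t0" "t0 < 0" "norm (x0 - y0) \<le> 1/4"
  shows "v (x0, t0) - v (y0, t0) \<le> L * conc ((norm (x0 - y0))\<^sup>2) * (1 / zt x0 t0 ^ 4)"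
proof (rule ccontr)
  assume contra: "\<not> ?thesis"
  define \<kappa>0 where "\<kappa>0 = v (x0, t0) - v (y0, t0) - L * conc ((norm (x0 - y0))\<^sup>2) * (1 / zt x0 t0 ^ 4)"
  have \<kappa>0: "\<kappa>0 > 0" using contra by (simp add: \<kappa>0_def)
  define O1 where "O1 = 2 * \<Lambda>"
  have O1: "O1 \<ge> 2" using \<Lambda> by (simp add: O1_def)
  have L64: "L \<ge> 32 * O1"
  proof -
    have "O1 \<le> O1 ^ 3" using O1 by (intro self_le_power) auto
    then have "32 * O1 \<le> C * O1 ^ 3" using C O1 by (intro mult_mono) auto
    then show ?thesis using L by (simp add: O1_def)
  qed
  then have L1: "L \<ge> 64" using O1 by linarith
  \<comment> \<open>Half of the violation pays for the two terms with \<open>\<theta>\<close> at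
    time \<open>t0\<close>; the other half is the level that the maximum must reach.\<close>
  define \<kappa> where "\<kappa> = \<kappa>0 / 2"
  have \<kappa>: "\<kappa> > 0" using \<kappa>0 by (simp add: \<kappa>_def)
  have x0: "(x0, t0) \<in> \<Omega>" using pt by (simp add: \<Omega>_def)
  have ny0: "norm y0 \<le> norm x0 + 1/4"
    using norm_triangle_ineq4[of x0 "x0 - y0"] pt(4) by simp
  then have y0: "(y0, t0) \<in> \<Omega>" using pt by (simp add: \<Omega>_def)
  have pen0: "0 \<le> L * conc ((norm (x0 - y0))\<^sup>2) * (1 / zt x0 t0 ^ 4)"
    using conc_square_bounds(1)[of "norm (x0 - y0)"] pt(4) L1 zt_pos[OF pt(1,2)]
    by (intro mult_nonneg_nonneg) (auto intro: order_trans[OF norm_ge_zero])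
  have \<kappa>O: "\<kappa> \<le> O1 / 2" using bd[OF x0] bd[OF y0] pen0 by (simp add: \<kappa>_def \<kappa>0_def O1_def)
  define \<theta> where "\<theta> = \<kappa> * (- t0) / 2"
  have \<theta>: "\<theta> > 0" using \<kappa> pt by (simp add: \<theta>_def mult_pos_neg)
  \<comment> \<open>At time \<open>- t1\<close> a term with \<open>\<theta>\<close> equals
    \<open>2 * O1\<close>, more than the oscillation permits, so the maximum stays away from the
    top.\<close>
  define t1 where "t1 = \<theta> / (2 * O1)"
  have t1: "t1 > 0" using \<theta> O1 by (simp add: t1_def)
  have t1t0: "t1 \<le> - t0 / 8" "t1 < 1"
  proof -
    have "t1 = \<kappa> * (- t0) / (4 * O1)" by (simp add: t1_def \<theta>_def)
    also have "\<dots> \<le> (O1 / 2) * (- t0) / (4 * O1)"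
      using \<kappa>O pt O1 by (intro divide_right_mono mult_right_mono) auto
    also have "\<dots> = - t0 / 8" using O1 by simp
    finally show "t1 \<le> - t0 / 8" .
    then show "t1 < 1" using pt by linarith
  qed
  \<comment> \<open>Points where \<open>v\<close> differs by at least \<open>\<kappa>\<close> are at
    least \<open>\<delta>0\<close> apart. This keeps the maximum off the diagonal, where the modulus
    is not differentiable.\<close>
  obtain \<delta>0 where \<delta>0: "\<delta>0 > 0" "\<And>w w'. w \<in> \<Omega> \<Longrightarrow> w' \<in> \<Omega> \<Longrightarrow> dist w' w < \<delta>0 \<Longrightarrow> dist (v w') (v w) < \<kappa>"
    using uc \<kappa> unfolding uniformly_continuous_on_def by metis
  define \<delta> where "\<delta> = min \<delta>0 1"
  have \<delta>: "\<delta> > 0" "\<delta> \<le> 1" "\<delta> \<le> \<delta>0" using \<delta>0 by (auto simp: \<delta>_def)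
  \<comment> \<open>Makes the times differ by at most \<open>\<delta> / 4\<close>. With shifts of at
    most \<open>\<delta> / 8\<close> for each optimal point, \<open>\<delta> / 2\<close> remains for
    \<open>norm (x - y)\<close>.\<close>
  define T where "T = \<delta>\<^sup>2 / (64 * \<Lambda>)"
  have T: "T > 0" "4 * \<Lambda> * T = (\<delta> / 4)\<^sup>2"
    using \<delta> \<Lambda> by (auto simp: T_def power_divide)
  define m where "m = min (\<delta> / 8) (t1 / 4)"
  have m: "m > 0" "m \<le> \<delta> / 8" "m \<le> t1 / 4" using \<delta> t1 by (auto simp: m_def)
  define \<epsilon> where "\<epsilon> = m\<^sup>2 / (4 * \<Lambda>)"
  have \<epsilon>: "\<epsilon> > 0" "4 * \<Lambda> * \<epsilon> \<le> m\<^sup>2" using m \<Lambda> by (auto simp: \<epsilon>_def)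
  \<comment> \<open>Leaves room for the second point, within 1/2 of the ball of radius 3, and for
    the shift of the optimal points, while staying in the domain.\<close>
  define K where "K = cball (0 :: real ^ 'n) (15/4) \<times> {-15/4 .. - t1/2}"
  have K\<Omega>: "K \<subseteq> \<Omega>" using t1 by (auto simp: K_def \<Omega>_def)
  have intK: "interior K = ball 0 (15/4) \<times> {-15/4 <..< - t1/2}" by (simp add: K_def interior_Times)
  have Kc: "compact K" unfolding K_def by (intro compact_Times) auto
  have Kne: "K \<noteq> {}"
  proof -
    have "(0, -1) \<in> K" using t1t0 by (simp add: K_def)
    then show ?thesis by blast
  qed
  have vc: "continuous_on K v"
    using uniformly_continuous_imp_continuous[OF uc] K\<Omega> by (rule continuous_on_subset)
  have vc': "continuous_on K (\<lambda>w. - v w)" using vc by (intro continuous_intros)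
  note Kv = Kc Kne vc and Kv' = Kc Kne vc'
  let ?f = "supconv K \<epsilon> v" and ?g = "supconv K \<epsilon> (\<lambda>w. - v w)"
  have bK: "\<bar>v w\<bar> \<le> \<Lambda>" if "w \<in> K" for w using bd K\<Omega> that by blast
  have bK': "\<bar>- v w\<bar> \<le> \<Lambda>" if "w \<in> K" for w using bK[OF that] by simp
  have fle: "?f z \<le> \<Lambda>" and gle: "?g z \<le> \<Lambda>" for z
    by (rule supconv_le[OF Kv \<epsilon>(1)], use bK in \<open>force simp: abs_le_iff\<close>)
      (rule supconv_le[OF Kv' \<epsilon>(1)], use bK in \<open>force simp: abs_le_iff\<close>)
  let ?\<Phi> = "dpen L T \<theta> :: ((real ^ 'n) \<times> real) \<times> (real ^ 'n) \<times> real \<Rightarrow> real"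
  let ?\<Psi> = "\<lambda>Z. ?f (fst Z) + ?g (snd Z) - ?\<Phi> Z"
  define base where "base x t y s \<longleftrightarrow> norm x \<le> 3 \<and> -3 \<le> t \<and> t \<le> - t1 \<and> norm (x - y) \<le> 1/2 \<and> s \<le> - t1 \<and> \<bar>t - s\<bar> \<le> 1/2"
    for x y :: "real ^ 'n" and t s
  have near: "w \<in> interior K" if "norm z1 \<le> 7/2" "-7/2 \<le> s1" "s1 \<le> - t1" "norm ((z1, s1) - w) \<le> m" for z1 s1 w
  proof -
    obtain a b where w: "w = (a, b)" by (cases w)
    have 1: "norm (z1 - a) \<le> m" "\<bar>s1 - b\<bar> \<le> m"
      using that(4) norm_fst_le[of "z1 - a" "s1 - b"] norm_snd_le[of "s1 - b" "z1 - a"] by (auto simp: w)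
    have "norm a \<le> norm z1 + norm (z1 - a)" using norm_triangle_ineq4[of z1 "z1 - a"] by simp
    then show ?thesis using 1 that m \<delta> t1 unfolding intK w by auto
  qed
  have baseK: "(x, t) \<in> K \<and> (y, s) \<in> K \<and> (\<forall>w. supconv_opt K \<epsilon> v (x, t) w \<longrightarrow> w \<in> interior K \<and> norm ((x, t) - w) \<le> m)
      \<and> (\<forall>w. supconv_opt K \<epsilon> (\<lambda>w. - v w) (y, s) w \<longrightarrow> w \<in> interior K \<and> norm ((y, s) - w) \<le> m)"
    if b: "base x t y s" for x y t s
  proof -
    have ny: "norm y \<le> 7/2" using norm_triangle_ineq4[of x "x - y"] b by (simp add: base_def)
    have s72: "-7/2 \<le> s" using b unfolding base_def by linarith
    have xK: "(x, t) \<in> K" and yK: "(y, s) \<in> K"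
      using b ny t1 s72 unfolding K_def base_def by auto
    have "norm ((x, t) - w) \<le> m" if "supconv_opt K \<epsilon> v (x, t) w" for w
      by (rule supconv_opt_close[OF Kv \<epsilon>(1) xK that bK \<epsilon>(2)]) (use m in auto)
    moreover have "norm ((y, s) - w) \<le> m" if "supconv_opt K \<epsilon> (\<lambda>w. - v w) (y, s) w" for w
      by (rule supconv_opt_close[OF Kv' \<epsilon>(1) yK that bK' \<epsilon>(2)]) (use m in auto)
    moreover have "w \<in> interior K" if "norm ((x, t) - w) \<le> m" for w
      by (rule near[OF _ _ _ that]) (use b in \<open>auto simp: base_def\<close>)
    moreover have "w \<in> interior K" if "norm ((y, s) - w) \<le> m" for w
      by (rule near[OF ny s72 _ that]) (use b in \<open>auto simp: base_def\<close>)
    ultimately show ?thesis using xK yK by blast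
  qed
  \<comment> \<open>Where the doubled function reaches \<open>\<kappa>\<close>, every nonnegative
    part of the penalisation is bounded by the oscillation of \<open>v\<close>. This makes the
    constraints strict, with a factor 2 to spare for the distance and the weight.\<close>
  have level: "\<delta> / 2 \<le> norm (x - y) \<and> L * norm (x - y) / zt x t ^ 4 \<le> O1 \<and> norm (x - y) < 1/2 \<and> t < - t1 \<and> s < - t1
       \<and> \<bar>t - s\<bar> < 1/2 \<and> 2 * (L * \<delta> / (8 * \<Lambda>)) \<le> zt x t"
    if b: "base x t y s" and z: "0 < zt x t" and \<Psi>: "\<kappa> \<le> ?\<Psi> ((x, t), (y, s))" for x y t s
  proof -
    have b': "norm x \<le> 3" "-3 \<le> t" "t \<le> - t1" "norm (x - y) \<le> 1/2" "s \<le> - t1" "\<bar>t - s\<bar> \<le> 1/2"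
      using b by (auto simp: base_def)
    have z1: "zt x t \<le> 1" using b' t1 by (intro zt_le_1) auto
    let ?r = "norm (x - y)" and ?A = "L * conc ((norm (x - y))\<^sup>2) * (1 / zt x t ^ 4)"
    have cr: "?r \<le> conc (?r\<^sup>2)" using b' by (intro conc_square_bounds) auto
    have A: "L * ?r / zt x t ^ 4 \<le> ?A"
    proof -
      have "L * ?r * (1 / zt x t ^ 4) \<le> ?A" using cr z L1 by (intro mult_right_mono mult_left_mono) auto
      then show ?thesis by simp
    qed
    have parts: "0 \<le> L * ?r / zt x t ^ 4" "0 \<le> (t - s)\<^sup>2 / (2 * T)" "0 \<le> \<theta> / (- t)" "0 \<le> \<theta> / (- s)"
    proof -
      show "0 \<le> L * ?r / zt x t ^ 4" "0 \<le> (t - s)\<^sup>2 / (2 * T)" using z L1 T by auto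
      have "0 \<le> - t" "0 \<le> - s" "0 \<le> \<theta>" using b' t1 \<theta> by linarith+
      then show "0 \<le> \<theta> / (- t)" "0 \<le> \<theta> / (- s)" by (blast intro: divide_nonneg_nonneg)+
    qed
    have "?\<Phi> ((x, t), (y, s)) = ?A + (t - s)\<^sup>2 / (2 * T) + \<theta> / (- t) + \<theta> / (- s)" by (simp add: dpen_def)
    then have sum: "\<kappa> + (?A + (t - s)\<^sup>2 / (2 * T) + \<theta> / (- t) + \<theta> / (- s)) \<le> ?f (x, t) + ?g (y, s)"
      using \<Psi> by simp
    have le: "?f (x, t) + ?g (y, s) \<le> 2 * \<Lambda>" using fle[of "(x, t)"] gle[of "(y, s)"] by linarith
    have 1: "L * ?r / zt x t ^ 4 \<le> O1" "(t - s)\<^sup>2 / (2 * T) \<le> 2 * \<Lambda>" "\<theta> / (- t) < O1" "\<theta> / (- s) < O1"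
      using sum le A parts \<kappa> unfolding O1_def by linarith+
    have ts: "\<bar>t - s\<bar> \<le> \<delta> / 4"
    proof -
      have "(t - s)\<^sup>2 \<le> 4 * \<Lambda> * T" using 1(2) T(1) by (simp add: field_simps)
      then have "\<bar>t - s\<bar>\<^sup>2 \<le> (\<delta> / 4)\<^sup>2" using T(2) by simp
      then show ?thesis by (rule power2_le_imp_le) (use \<delta> in simp)
    qed
    have time: "a < - t1" if "\<theta> / (- a) < O1" "a \<le> - t1" for a
    proof -
      have "\<theta> < O1 * (- a)" using that t1 by (simp add: field_simps)
      moreover have "\<theta> = O1 * (2 * t1)" using O1 by (simp add: t1_def)
      ultimately have "O1 * (2 * t1) < O1 * (- a)" by simp
      moreover have "0 < O1" using O1 by simp
      ultimately have "2 * t1 < - a" by (simp only: mult_less_cancel_left_pos)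
      then show ?thesis using t1 by linarith
    qed
    have r: "\<delta> / 2 \<le> ?r"
    proof -
      obtain w where w: "supconv_opt K \<epsilon> v (x, t) w" using supconv_opt_ex[OF Kv] by blast
      obtain w' where w': "supconv_opt K \<epsilon> (\<lambda>w. - v w) (y, s) w'" using supconv_opt_ex[OF Kv'] by blast
      have "norm ((x, t) - w) \<le> m" "norm ((y, s) - w') \<le> m" using baseK[OF b] w w' by blast+
      then have nw: "norm ((x, t) - w) \<le> \<delta> / 8" "norm ((y, s) - w') \<le> \<delta> / 8" using m(2) by linarith+
      have wK: "w \<in> \<Omega>" "w' \<in> \<Omega>" using w w' K\<Omega> by (auto simp: supconv_opt_def)
      have "?f (x, t) \<le> v w" "?g (y, s) \<le> - v w'"
        using w w' \<epsilon>(1) by (auto simp: supconv_opt_def)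
      moreover have "0 \<le> ?A" using A parts(1) by linarith
      ultimately have "\<kappa> \<le> v w - v w'" using sum parts by linarith
      then have "\<not> dist (v w) (v w') < \<kappa>" by (simp add: dist_real_def)
      then have "\<not> dist w w' < \<delta>0" using \<delta>0(2)[OF wK(2,1)] by blast
      then have d: "\<delta> \<le> norm (w - w')" using \<delta> by (simp add: dist_norm)
      have "norm (w - w') \<le> norm ((x, t) - w) + norm ((x, t) - (y, s)) + norm ((y, s) - w')"
      proof -
        have "k - l = - (a - k) + (a - b) + (b - l)" for a b k l :: "(real ^ 'n) \<times> real"
          by (simp add: algebra_simps)
        from this[of w w' "(x, t)" "(y, s)"] show ?thesis
          using norm_triangle_ineq[of "- ((x, t) - w) + ((x, t) - (y, s))" "(y, s) - w'"]
            norm_triangle_ineq[of "- ((x, t) - w)" "(x, t) - (y, s)"] by (simp only: norm_minus_cancel)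
      qed
      moreover have "norm ((x, t) - (y, s)) \<le> ?r + \<bar>t - s\<bar>" using norm_Pair_le_add[of "x - y" "t - s"] by simp
      ultimately show ?thesis using d nw ts by linarith
    qed
    have r2: "?r < 1/2"
    proof -
      have "L * ?r * 1 \<le> L * ?r * (1 / zt x t ^ 4)"
        using L1 z z1 by (intro mult_left_mono) (auto simp: power_le_one)
      then have "L * ?r \<le> O1" using 1(1) by simp
      moreover have "32 * O1 * ?r \<le> L * ?r" using L64 by (intro mult_right_mono) auto
      ultimately have "O1 * (32 * ?r) \<le> O1 * 1" by simp
      then have "32 * ?r \<le> 1" using O1 by (simp only: mult_le_cancel_left_pos)
      then show ?thesis by simp
    qed
    have "2 * (L * \<delta> / (8 * \<Lambda>)) \<le> zt x t"
    proof -
      have "L * (\<delta> / 2) \<le> L * ?r" using r L1 by (intro mult_left_mono) auto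
      also have "\<dots> \<le> O1 * zt x t ^ 4" using 1(1) z by (simp add: field_simps)
      also have "\<dots> \<le> O1 * zt x t ^ 1" using z z1 O1 by (intro mult_left_mono power_decreasing) auto
      finally have "L * \<delta> \<le> 4 * \<Lambda> * zt x t" by (simp add: O1_def)
      then show ?thesis using \<Lambda> by (simp add: field_simps)
    qed
    then show ?thesis using 1 ts time[OF 1(3) b'(3)] time[OF 1(4) b'(5)] r r2 \<delta> by auto
  qed
  define \<zeta>0 where "\<zeta>0 = L * \<delta> / (8 * \<Lambda>)"
  have \<zeta>0: "\<zeta>0 > 0" using L1 \<delta> \<Lambda> by (simp add: \<zeta>0_def)
  \<comment> \<open>The bounds \<open>\<delta> / 4\<close> and \<open>\<zeta>0\<close> keep the
    penalisation continuous on a compact set, so a maximum exists. Points of the level set satisfy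
    the strict version \<open>U\<close> of the constraints, hence this maximum is a local maximum
    without constraints.\<close>
  define S where "S = {Z :: ((real ^ 'n) \<times> real) \<times> (real ^ 'n) \<times> real.
      norm (fst (fst Z)) \<le> 3 \<and> -3 \<le> snd (fst Z) \<and> snd (fst Z) \<le> - t1 \<and> norm (fst (fst Z) - fst (snd Z)) \<le> 1/2 \<and>
      snd (snd Z) \<le> - t1 \<and> \<bar>snd (fst Z) - snd (snd Z)\<bar> \<le> 1/2 \<and>
      \<delta> / 4 \<le> norm (fst (fst Z) - fst (snd Z)) \<and> \<zeta>0 \<le> zt (fst (fst Z)) (snd (fst Z))}"
  define U where "U = {Z :: ((real ^ 'n) \<times> real) \<times> (real ^ 'n) \<times> real.
      norm (fst (fst Z)) < 3 \<and> -3 < snd (fst Z) \<and> snd (fst Z) < - t1 \<and> norm (fst (fst Z) - fst (snd Z)) < 1/2 \<and>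
      snd (snd Z) < - t1 \<and> \<bar>snd (fst Z) - snd (snd Z)\<bar> < 1/2 \<and>
      \<delta> / 4 < norm (fst (fst Z) - fst (snd Z)) \<and> \<zeta>0 < zt (fst (fst Z)) (snd (fst Z))}"
  have US: "U \<subseteq> S" unfolding U_def S_def by auto
  have oU: "open U" unfolding U_def zt_def
    by (intro open_Collect_conj open_Collect_less continuous_intros) auto
  have Sbase: "base x t y s \<and> 0 < zt x t" if "((x, t), (y, s)) \<in> S" for x y t s
    using that \<zeta>0 by (auto simp: S_def base_def)
  have Sc: "compact S"
  proof -
    have "closed S" unfolding S_def zt_def
      by (intro closed_Collect_conj closed_Collect_le continuous_intros) auto
    moreover have "S \<subseteq> K \<times> K"
    proof
      fix Z assume ZS: "Z \<in> S"
      obtain x t y s where Z: "Z = ((x, t), (y, s))" by (metis prod.collapse)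
      have "base x t y s" using Sbase ZS unfolding Z by blast
      from baseK[OF this] show "Z \<in> K \<times> K" unfolding Z by blast
    qed
    then have "S = (K \<times> K) \<inter> S" by blast
    ultimately show ?thesis using compact_Int_closed[OF compact_Times[OF Kc Kc]] by metis
  qed
  have start: "\<kappa> \<le> ?\<Psi> ((x0, t0), (y0, t0))"
  proof -
    have "2 * (\<theta> / (- t0)) = \<kappa>" using pt by (simp add: \<theta>_def)
    moreover have "(x0, t0) \<in> K" "(y0, t0) \<in> K" using pt ny0 t1t0 t1 by (auto simp: K_def)
    then have "v (x0, t0) \<le> ?f (x0, t0)" "- v (y0, t0) \<le> ?g (y0, t0)"
      using supconv_ge_self[OF Kv] supconv_ge_self[OF Kv'] by blast+
    ultimately show ?thesis unfolding dpen_def \<kappa>_def fst_conv snd_conv using \<kappa>0_def by simp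
  qed
  have SU: "Z \<in> U" if "Z \<in> S \<or> Z = ((x0, t0), (y0, t0))" "\<kappa> \<le> ?\<Psi> Z" for Z
  proof -
    obtain x t y s where Z: "Z = ((x, t), (y, s))" by (metis prod.collapse)
    have bz: "base x t y s" "0 < zt x t"
      using that(1) Sbase pt t1t0 t1 zt_pos[OF pt(1,2)] unfolding Z by (auto simp: base_def)
    note lv = level[OF bz that(2)[unfolded Z], folded \<zeta>0_def]
    have "norm x < 3" "-3 < t" using zt_pos_imp[OF bz(2)] bz(1) by (auto simp: base_def)
    then show ?thesis using lv \<delta> \<zeta>0 unfolding Z U_def by auto
  qed
  have startS: "((x0, t0), (y0, t0)) \<in> S" using SU[OF disjI2[OF refl] start] US by blast
  have "continuous_on S ?\<Psi>"
  proof -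
    have "continuous_on S (\<lambda>Z. ?f (fst Z))"
      by (rule continuous_on_compose2[OF supconv_continuous[OF Kv \<epsilon>(1)] continuous_on_fst[OF continuous_on_id]]) simp
    moreover have "continuous_on S (\<lambda>Z. ?g (snd Z))"
      by (rule continuous_on_compose2[OF supconv_continuous[OF Kv' \<epsilon>(1)] continuous_on_snd[OF continuous_on_id]]) simp
    moreover have "continuous_on S ?\<Phi>"
      unfolding dpen_def conc_def zt_def using T \<delta> \<zeta>0 t1
      by (intro continuous_intros) (auto simp: S_def zt_def)
    ultimately show ?thesis by (intro continuous_on_diff continuous_on_add)
  qed
  moreover have "S \<noteq> {}" using startS by blast
  ultimately obtain Z where Z: "Z \<in> S" "\<And>Y. Y \<in> S \<Longrightarrow> ?\<Psi> Y \<le> ?\<Psi> Z"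
    using continuous_attains_sup[OF Sc, of ?\<Psi>] by blast
  have \<Psi>Z: "\<kappa> \<le> ?\<Psi> Z" using start Z(2)[OF startS] by linarith
  have ZU: "Z \<in> U" using SU[OF disjI1[OF Z(1)] \<Psi>Z] .
  obtain x t y s where Zeq: "Z = ((x, t), (y, s))" by (metis prod.collapse)
  have bz: "base x t y s" "0 < zt x t" using Sbase Z(1) unfolding Zeq by auto
  have lv: "\<delta> / 2 \<le> norm (x - y)" "L * norm (x - y) / zt x t ^ 4 \<le> O1" "norm (x - y) < 1/2" "t < - t1" "s < - t1"
    using level[OF bz \<Psi>Z[unfolded Zeq]] by auto
  have b': "norm x < 3" "-3 < t" using ZU by (auto simp: Zeq U_def)
  define r where "r = norm (x - y)"
  define \<zeta> where "\<zeta> = zt x t"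
  define e where "e = (x - y) /\<^sub>R r"
  define c where "c = L * (2 - 3/2 * sqrt r)"
  define P where "P = L * (2 * r - r * sqrt r)"
  define D where "D = (8 * (t + 3) / (27 * \<zeta> ^ 5)) *\<^sub>R x"
  define \<xi>2 where "\<xi>2 = (c / \<zeta> ^ 4) *\<^sub>R e"
  define \<xi>1 where "\<xi>1 = \<xi>2 + P *\<^sub>R D"
  define q1 where "q1 = P * (- 4 / \<zeta> ^ 5 * ((9 - (norm x)\<^sup>2) / 27)) + (t - s) / T + \<theta> / t\<^sup>2"
  define q2 where "q2 = (t - s) / T - \<theta> / s\<^sup>2"
  have r: "0 < r" "r < 1/2" "L * r / \<zeta> ^ 4 \<le> O1" using lv \<delta> by (auto simp: r_def \<zeta>_def)
  have \<zeta>: "0 < \<zeta>" "\<zeta> \<le> 1" using bz b' lv t1 zt_le_1[of x t] by (auto simp: \<zeta>_def)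
  have xy: "x \<noteq> y" using r by (auto simp: r_def)
  have Preq: "P = L * conc (r\<^sup>2)" using r by (simp add: P_def conc_square)
  have P: "0 \<le> P" "P \<le> 2 * L * r"
  proof -
    have "r \<le> conc (r\<^sup>2)" "conc (r\<^sup>2) \<le> 2 * r" using r by (auto intro!: conc_square_bounds)
    then show "0 \<le> P" "P \<le> 2 * L * r"
      unfolding Preq using r L1 mult_left_mono[of "conc (r\<^sup>2)" "2 * r" L] by auto
  qed
  obtain Q where Q: "second_order (dpen L T \<theta>) ((x, t), (y, s)) (\<lambda>H. (\<xi>1, q1) \<bullet> fst H + (- \<xi>2, - q2) \<bullet> snd H) Q"
    "\<And>\<alpha> \<beta>. Q ((\<alpha>, 0), (\<beta>, 0)) \<le>
        1 / \<zeta> ^ 4 * (c / (2 * r) * ((norm (\<alpha> - \<beta>))\<^sup>2 - (e \<bullet> (\<alpha> - \<beta>))\<^sup>2) - 3/8 * L / sqrt r * (e \<bullet> (\<alpha> - \<beta>))\<^sup>2)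
        + P * (5 / \<zeta> ^ 6 * (norm \<alpha>)\<^sup>2) + c * (e \<bullet> (\<alpha> - \<beta>)) * (D \<bullet> \<alpha>)"
    by (rule second_order_dpen[OF xy b'(2) _ _ b'(1) _ r_def _ \<zeta>_def e_def c_def P_def D_def \<xi>2_def \<xi>1_def q1_def q2_def])
      (use lv t1 L1 r in auto)
  let ?\<alpha> = "\<lambda>i. pmap p (sqrt (p - 1) - 1) \<xi>1 (axis i 1)" and ?\<beta> = "\<lambda>i. pmap p (- sqrt (p - 1) - 1) \<xi>2 (axis i 1)"
  have ne: "norm e = 1" using r by (simp add: e_def r_def)
  have cb: "L / 2 \<le> c" "c \<le> 2 * L"
  proof -
    have "0 \<le> sqrt r" "sqrt r \<le> 1" using r by auto
    then have "L * (1/2) \<le> c" "c \<le> L * 2" unfolding c_def using L1 by (intro mult_left_mono; simp)+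
    then show "L / 2 \<le> c" "c \<le> 2 * L" by auto
  qed
  have Db: "norm D \<le> 4 / \<zeta> ^ 5"
  proof -
    have "norm D = 8 * (t + 3) / (27 * \<zeta> ^ 5) * norm x" using b' \<zeta> by (simp add: D_def)
    also have "\<dots> \<le> 8 * 3 / (27 * \<zeta> ^ 5) * 3"
      using b' lv t1 \<zeta> by (intro mult_mono divide_right_mono) auto
    also have "\<dots> = (8/3) / \<zeta> ^ 5" by simp
    also have "\<dots> \<le> 4 / \<zeta> ^ 5" using \<zeta> by (intro divide_right_mono) auto
    finally show ?thesis .
  qed
  \<comment> \<open>The quotient \<open>(t - s) / T\<close> is common to both time derivatives and
    cancels, the terms with \<open>\<theta>\<close> have the favourable sign, and only the time
    derivative of the weight is left.\<close>
  have qb: "- 2 * P / \<zeta> ^ 5 \<le> q1 - q2"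
  proof -
    have "(9 - (norm x)\<^sup>2) / 27 \<le> 1/2" by (simp add: field_simps)
    then have 1: "4 * P / \<zeta> ^ 5 * ((9 - (norm x)\<^sup>2) / 27) \<le> 4 * P / \<zeta> ^ 5 * (1/2)"
      using P \<zeta> by (intro mult_left_mono) auto
    have 2: "0 \<le> \<theta> / t\<^sup>2" "0 \<le> \<theta> / s\<^sup>2" using \<theta> by auto
    have 3: "P * (- 4 / \<zeta> ^ 5 * ((9 - (norm x)\<^sup>2) / 27)) = - (4 * P / \<zeta> ^ 5 * ((9 - (norm x)\<^sup>2) / 27))" by simp
    have 4: "4 * P / \<zeta> ^ 5 * (1/2) = - (- 2 * P / \<zeta> ^ 5)" by simp
    have "a \<le> b \<Longrightarrow> 0 \<le> u \<Longrightarrow> 0 \<le> w \<Longrightarrow> b = - y \<Longrightarrow> y \<le> - a + k + u - (k - w)" for a b u w y k :: real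
      by linarith
    from this[OF 1 2 4] show ?thesis unfolding q1_def q2_def 3 .
  qed
  have LO: "C * O1 ^ 3 \<le> L" using L by (simp add: O1_def)
  note E = est[OF ne r(1) _ \<zeta> _ LO cb P Db \<xi>2_def \<xi>1_def r(3) qb refl refl]
  have \<xi>: "\<xi>1 \<noteq> 0" "\<xi>2 \<noteq> 0" using E r O1 by auto
  have "(p - 1) / 2 * (q1 - q2 - (norm \<xi>1 powr p - norm \<xi>2 powr p)) \<le> (\<Sum>i\<in>UNIV. Q ((?\<alpha> i, 0), (?\<beta> i, 0)))"
  proof (rule doubled_maximum[OF p Kv \<epsilon>(1) _ _ Q(1) refl _ _ _ \<xi>])
    show "jet_sub p 1 (interior K) v" "jet_sub p (- 1) (interior K) (\<lambda>w. - v w)"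
      using jet_sub_mono[OF sub] jet_sub_mono[OF sup] K\<Omega> interior_subset by blast+
    show "(1 + (sqrt (p - 1) - 1))\<^sup>2 = p - 1" "(1 + (- sqrt (p - 1) - 1))\<^sup>2 = p - 1" using p by auto
    show "w \<in> interior K" if "supconv_opt K \<epsilon> v (x, t) w" for w using baseK[OF bz(1)] that by blast
    show "w \<in> interior K" if "supconv_opt K \<epsilon> (\<lambda>w. - v w) (y, s) w" for w using baseK[OF bz(1)] that by blast
    have "\<forall>\<^sub>F Y in nhds Z. Y \<in> U" using oU ZU by (rule eventually_nhds_in_open)
    then have "\<forall>\<^sub>F Y in nhds Z. ?\<Psi> Y \<le> ?\<Psi> Z" by eventually_elim (use US Z(2) in blast)
    from eventually_nhds_unshift[OF this]
    show "\<forall>\<^sub>F H in nhds 0. ?f ((x, t) + fst H) + ?g ((y, s) + snd H) - ?\<Phi> (((x, t), (y, s)) + H)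
        \<le> ?f (x, t) + ?g (y, s) - ?\<Phi> ((x, t), (y, s))"
      by (simp add: Zeq)
  qed
  also have "\<dots> \<le> (\<Sum>i\<in>UNIV. 1 / \<zeta> ^ 4 * (c / (2 * r) * ((norm (?\<alpha> i - ?\<beta> i))\<^sup>2 - (e \<bullet> (?\<alpha> i - ?\<beta> i))\<^sup>2)
      - 3/8 * L / sqrt r * (e \<bullet> (?\<alpha> i - ?\<beta> i))\<^sup>2)
      + P * (5 / \<zeta> ^ 6 * (norm (?\<alpha> i))\<^sup>2) + c * (e \<bullet> (?\<alpha> i - ?\<beta> i)) * (D \<bullet> ?\<alpha> i))"
    by (intro sum_mono Q(2))
  also have "\<dots> < (p - 1) / 2 * (q1 - q2 - (norm \<xi>1 powr p - norm \<xi>2 powr p))"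
    using E r O1 by auto
  finally show False by simp
qed

lemma log_solution_lipschitz:
  assumes p: "1 < p" and \<Lambda>: "\<Lambda> \<ge> 1"
  obtains L where "L > 0" "\<And>(v :: (real ^ 'n) \<times> real \<Rightarrow> real) x y t. uniformly_continuous_on (ball 0 4 \<times> {-4<..<0}) v \<Longrightarrow>
     (\<And>z. z \<in> ball 0 4 \<times> {-4<..<0} \<Longrightarrow> \<bar>v z\<bar> \<le> \<Lambda>) \<Longrightarrow> jet_sub p 1 (ball 0 4 \<times> {-4<..<0}) v \<Longrightarrow>
     jet_sub p (- 1) (ball 0 4 \<times> {-4<..<0}) (\<lambda>w. - v w) \<Longrightarrow> norm x < 2 \<Longrightarrow> norm y < 2 \<Longrightarrow> -2 < t \<Longrightarrow> t < 0 \<Longrightarrow>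
     \<bar>v (x, t) - v (y, t)\<bar> \<le> L * norm (x - y)"
proof (rule ishii_lions_estimate[OF p, where 'n='n])
  fix C :: real
  assume C: "C \<ge> 32"
    and est: "\<And>(e :: real ^ 'n) \<xi>1 \<xi>2 D r \<zeta> L P c q O1 \<alpha> \<gamma>. norm e = 1 \<Longrightarrow> 0 < r \<Longrightarrow> r \<le> 1 \<Longrightarrow> 0 < \<zeta> \<Longrightarrow> \<zeta> \<le> 1 \<Longrightarrow>
       1 \<le> O1 \<Longrightarrow> C * O1 ^ 3 \<le> L \<Longrightarrow> L / 2 \<le> c \<Longrightarrow> c \<le> 2 * L \<Longrightarrow> 0 \<le> P \<Longrightarrow> P \<le> 2 * L * r \<Longrightarrow>
       norm D \<le> 4 / \<zeta> ^ 5 \<Longrightarrow> \<xi>2 = (c / \<zeta> ^ 4) *\<^sub>R e \<Longrightarrow> \<xi>1 = \<xi>2 + P *\<^sub>R D \<Longrightarrow> L * r / \<zeta> ^ 4 \<le> O1 \<Longrightarrow>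
       - 2 * P / \<zeta> ^ 5 \<le> q \<Longrightarrow>
       (\<And>i. \<alpha> i = pmap p (sqrt (p - 1) - 1) \<xi>1 (axis i 1)) \<Longrightarrow>
       (\<And>i. \<gamma> i = \<alpha> i - pmap p (- sqrt (p - 1) - 1) \<xi>2 (axis i 1)) \<Longrightarrow>
       \<xi>1 \<noteq> 0 \<and> \<xi>2 \<noteq> 0 \<and>
       (\<Sum>i\<in>UNIV. 1 / \<zeta> ^ 4 * (c / (2 * r) * ((norm (\<gamma> i))\<^sup>2 - (e \<bullet> \<gamma> i)\<^sup>2) - 3/8 * L / sqrt r * (e \<bullet> \<gamma> i)\<^sup>2)
          + P * (5 / \<zeta> ^ 6 * (norm (\<alpha> i))\<^sup>2) + c * (e \<bullet> \<gamma> i) * (D \<bullet> \<alpha> i))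
       < (p - 1) / 2 * (q - (norm \<xi>1 powr p - norm \<xi>2 powr p))"
  define L0 where "L0 = C * (2 * \<Lambda>) ^ 3"
  have L0: "L0 > 0" using C \<Lambda> by (simp add: L0_def)
  \<comment> \<open>In the smaller cylinder \<open>zt\<close> is at least 5/27, and
    \<open>conc\<close> is at most twice the distance; \<open>8 * \<Lambda>\<close> takes care of
    points more than 1/4 apart.\<close>
  define L where "L = L0 * 2 * (27/5) ^ 4 + 8 * \<Lambda>"
  show thesis
  proof (rule that[of L])
    show "L > 0" using L0 \<Lambda> by (auto simp: L_def intro!: add_pos_pos)
    fix v :: "(real ^ 'n) \<times> real \<Rightarrow> real" and x y :: "real ^ 'n" and t :: real
    assume uc: "uniformly_continuous_on (ball 0 4 \<times> {-4<..<0}) v"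
      and bd: "\<And>z. z \<in> ball 0 4 \<times> {-4<..<0} \<Longrightarrow> \<bar>v z\<bar> \<le> \<Lambda>"
      and jets: "jet_sub p 1 (ball 0 4 \<times> {-4<..<0}) v" "jet_sub p (- 1) (ball 0 4 \<times> {-4<..<0}) (\<lambda>w. - v w)"
      and pt: "norm x < 2" "norm y < 2" "-2 < t" "t < 0"
    have one: "v (x, t) - v (y, t) \<le> L * norm (x - y)" if pt: "norm x < 2" "norm y < 2" for x y :: "real ^ 'n"
    proof (cases "norm (x - y) \<le> 1/4")
      case True
      have c0: "0 \<le> conc ((norm (x - y))\<^sup>2)"
        using conc_square_bounds(1)[of "norm (x - y)"] True norm_ge_zero[of "x - y"] by linarith
      have "v (x, t) - v (y, t) \<le> L0 * conc ((norm (x - y))\<^sup>2) * (1 / zt x t ^ 4)"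
        by (rule doubled_inequality[OF p \<Lambda> uc bd jets C est])
          (use that True \<open>-2 < t\<close> \<open>t < 0\<close> in \<open>auto simp: L0_def\<close>)
      also have "\<dots> \<le> L0 * (2 * norm (x - y)) * (27/5) ^ 4"
      proof (intro mult_mono mult_left_mono)
        show "conc ((norm (x - y))\<^sup>2) \<le> 2 * norm (x - y)" using True by (intro conc_square_bounds) auto
        have "(norm x)\<^sup>2 \<le> 4" using power_mono[of "norm x" 2 2] pt by simp
        then have "5 * 1 \<le> (9 - (norm x)\<^sup>2) * (t + 3)" using \<open>-2 < t\<close> by (intro mult_mono) auto
        then have "5/27 \<le> zt x t" by (simp add: zt_def)
        then have "(5/27) ^ 4 \<le> zt x t ^ 4" by (intro power_mono) auto
        then have "1 / zt x t ^ 4 \<le> 1 / (5/27) ^ 4" by (intro frac_le) auto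
        then show "1 / zt x t ^ 4 \<le> (27/5) ^ 4" by (simp add: power_divide)
      qed (use L0 c0 in auto)
      also have "\<dots> = (L0 * 2 * (27/5) ^ 4) * norm (x - y)" by simp
      also have "\<dots> \<le> L * norm (x - y)" unfolding L_def using \<Lambda> by (intro mult_right_mono) auto
      finally show ?thesis .
    next
      case False
      have "\<bar>v (x, t)\<bar> \<le> \<Lambda>" "\<bar>v (y, t)\<bar> \<le> \<Lambda>" using that \<open>-2 < t\<close> \<open>t < 0\<close> by (auto intro!: bd)
      then have "v (x, t) - v (y, t) \<le> 8 * \<Lambda> * (1/4)" by (simp add: abs_le_iff)
      also have "\<dots> \<le> L * norm (x - y)"
        using False L0 \<Lambda> unfolding L_def by (intro mult_mono) auto
      finally show ?thesis .
    qed
    show "\<bar>v (x, t) - v (y, t)\<bar> \<le> L * norm (x - y)"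
      using one[OF pt(1,2)] one[OF pt(2,1)] by (simp add: abs_le_iff norm_minus_commute)
  qed
qed

section \<open>The time barrier\<close>

text \<open>A smooth substitute for the maximum of \<open>\<eta>\<close> and \<open>L\<close> times
  the distance, namely the norm of order \<open>2 * k\<close> of the two numbers, with
  \<open>S\<close> the squared distance.\<close>

definition root_barrier :: "nat \<Rightarrow> real \<Rightarrow> real \<Rightarrow> real \<Rightarrow> real" where
  "root_barrier k \<eta> L S = (\<eta> ^ (2 * k) + L ^ (2 * k) * S ^ k) powr (1 / (2 * k))"

lemma powr_root_power: "0 < a \<Longrightarrow> 1 \<le> k \<Longrightarrow> (a ^ (2 * k)) powr (1 / (2 * real k)) = (a :: real)"
proof -
  assume a: "0 < a" "1 \<le> k"
  then have "(a ^ (2 * k)) powr (1 / (2 * real k)) = (a powr real (2 * k)) powr (1 / (2 * real k))"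
    by (simp only: powr_realpow)
  also have "\<dots> = a powr 1" unfolding powr_powr using a by simp
  finally show ?thesis using a by simp
qed

lemma root_barrier_0: "0 < \<eta> \<Longrightarrow> 1 \<le> k \<Longrightarrow> root_barrier k \<eta> L 0 = \<eta>"
  using powr_root_power[of \<eta> k] by (simp add: root_barrier_def zero_power)

lemma root_barrier_ge:
  assumes "0 < \<eta>" "0 < L" "1 \<le> k" "0 \<le> r"
  shows "L * r \<le> root_barrier k \<eta> L (r\<^sup>2)"
proof (cases "r = 0")
  case False
  then have r: "L * r > 0" using assms by simp
  have "L * r = ((L * r) ^ (2 * k)) powr (1 / (2 * real k))" using powr_root_power[OF r assms(3)] by simp
  also have "\<dots> \<le> root_barrier k \<eta> L (r\<^sup>2)"
    unfolding root_barrier_def using assms by (intro powr_mono2) (auto simp: power_mult_distrib power_mult)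
  finally show ?thesis .
qed (simp add: root_barrier_def)

text \<open>The barrier is flat enough at its centre for the test with vanishing gradient.\<close>

lemma root_barrier_le:
  assumes "0 < \<eta>" "0 < L" "1 \<le> k" "0 \<le> S"
  shows "root_barrier k \<eta> L S \<le> \<eta> + L ^ (2 * k) / (2 * k * \<eta> ^ (2 * k - 1)) * S ^ k"
proof -
  define y where "y = L ^ (2 * k) * S ^ k"
  define x where "x = y / (2 * k * \<eta> ^ (2 * k))"
  have y: "0 \<le> y" using assms by (simp add: y_def)
  then have x: "0 \<le> x" using assms by (simp add: x_def)
  have pw: "\<eta> ^ (2 * k) = \<eta> ^ (2 * k - 1) * \<eta>" using assms(3) by (metis One_nat_def Suc_le_eq mult_pos_pos pos2 power_minus_mult)
  have "\<eta> ^ (2 * k) + y = \<eta> ^ (2 * k) * (1 + real (2 * k) * x)"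
    using assms by (simp add: x_def distrib_left)
  also have "\<dots> \<le> \<eta> ^ (2 * k) * (1 + x) ^ (2 * k)"
    using Bernoulli_inequality[of x "2 * k"] x assms by (intro mult_left_mono) auto
  also have "\<dots> = (\<eta> * (1 + x)) ^ (2 * k)" by (simp add: power_mult_distrib)
  finally have le: "\<eta> ^ (2 * k) + y \<le> (\<eta> * (1 + x)) ^ (2 * k)" .
  have "root_barrier k \<eta> L S \<le> ((\<eta> * (1 + x)) ^ (2 * k)) powr (1 / (2 * real k))"
    unfolding root_barrier_def using le y assms by (intro powr_mono2) (auto simp: y_def)
  also have "\<dots> = \<eta> * (1 + x)" using x assms by (intro powr_root_power) (auto intro!: mult_pos_pos add_pos_nonneg)
  also have "\<dots> = \<eta> + y / (2 * k * \<eta> ^ (2 * k - 1))" using assms unfolding x_def pw by (simp add: distrib_left)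
  finally show ?thesis by (simp add: y_def)
qed

text \<open>The gradient of the barrier has norm \<open>2 * r * F1\<close>. It never exceeds
  \<open>L\<close>, and near the centre it decays so fast that its power \<open>p - 1\<close> is at
  most linear in \<open>r\<close>, with a factor \<open>1 / \<eta>\<close> that later determines the
  rate in time. For \<open>F2\<close> only an upper bound is kept, since concavity helps a
  supersolution.\<close>

lemma root_barrier_derivatives:
  fixes \<eta> L r :: real and k :: nat
  assumes \<eta>: "0 < \<eta>" and L: "0 < L" and k: "1 \<le> k" and r: "0 < r"
  obtains F1 F2 where "F1 > 0" "2 * r * F1 \<le> L" "F1 + 2 * r\<^sup>2 * F2 \<le> (2 * real k - 1) * F1"
    "\<And>p. 1 < p \<Longrightarrow> 1 \<le> (2 * real k - 1) * (p - 1) \<Longrightarrow> (2 * r * F1) powr (p - 1) \<le> L powr p / \<eta> * r"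
    "\<And>(f :: 'a::euclidean_space \<Rightarrow> real) z l Q. second_order f z l Q \<Longrightarrow> f z = r\<^sup>2 \<Longrightarrow>
       second_order (\<lambda>w. root_barrier k \<eta> L (f w)) z (\<lambda>h. F1 * l h) (\<lambda>h. F1 * Q h + F2 / 2 * (l h)\<^sup>2)"
proof -
  define e where "e = 1 / (2 * real k) - 1"
  have e0: "e \<le> 0" using k by (simp add: e_def field_simps)
  have ke: "2 * real k * e = 1 - 2 * real k" using k by (simp add: e_def field_simps)
  define b where "b = L ^ (2 * k)"
  have b: "b > 0" using L by (simp add: b_def)
  define T where "T S = \<eta> ^ (2 * k) + b * S ^ k" for S
  have T: "T S > 0" if "S \<ge> 0" for S using \<eta> b that by (auto simp: T_def intro!: add_pos_nonneg)
  define F' where "F' S = 1/2 * b * (S ^ (k - 1) * T S powr e)" for S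
  define F2 where "F2 = 1/2 * b * (real (k - 1) * (r\<^sup>2) ^ (k - 1 - 1) * T (r\<^sup>2) powr e
     + (r\<^sup>2) ^ (k - 1) * (e * T (r\<^sup>2) powr (e - 1) * (b * (real k * (r\<^sup>2) ^ (k - 1)))))"
  define F1 where "F1 = F' (r\<^sup>2)"
  have dT: "(T has_real_derivative b * (real k * S ^ (k - 1))) (at S)" for S
    unfolding T_def by (auto intro!: derivative_eq_intros)
  have dTe: "((\<lambda>S. T S powr a) has_real_derivative a * T S powr (a - 1) * (b * (real k * S ^ (k - 1)))) (at S)"
    if "S > 0" for S a
    using DERIV_fun_powr[OF dT T, of S a] that by simp
  have d1: "(root_barrier k \<eta> L has_real_derivative F' S) (at S)" if "S > 0" for S
  proof -
    have "root_barrier k \<eta> L = (\<lambda>S. T S powr (1 / (2 * real k)))"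
      by (auto simp: root_barrier_def T_def b_def)
    moreover have "1 / (2 * real k) * T S powr e * (b * (real k * S ^ (k - 1))) = F' S"
      using k by (simp add: F'_def)
    ultimately show ?thesis using dTe[OF that, of "1 / (2 * real k)"] unfolding e_def by simp
  qed
  have d2: "(F' has_real_derivative F2) (at (r\<^sup>2))"
  proof -
    have "((\<lambda>S. S ^ (k - 1)) has_real_derivative real (k - 1) * (r\<^sup>2) ^ (k - 1 - 1)) (at (r\<^sup>2))"
      by (auto intro!: derivative_eq_intros)
    from DERIV_cmult[OF DERIV_mult[OF this dTe[of "r\<^sup>2" e]], of "1/2 * b"] show ?thesis
      unfolding F'_def F2_def using r by (simp add: algebra_simps)
  qed
  have rk: "(r\<^sup>2) ^ (k - 1) * r = r powr (2 * real k - 1)"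
  proof -
    have "(r\<^sup>2) ^ (k - 1) * r = r ^ (2 * (k - 1) + 1)" by (simp add: power_mult)
    also have "\<dots> = r powr real (2 * (k - 1) + 1)" using r by (simp only: powr_realpow)
    also have "real (2 * (k - 1) + 1) = 2 * real k - 1" using k by (simp add: of_nat_diff)
    finally show ?thesis .
  qed
  have bL: "b = L * L powr (2 * real k - 1)"
  proof -
    have "b = L powr real (2 * k)" using L by (simp add: b_def powr_realpow[symmetric])
    also have "\<dots> = L powr (1 + (2 * real k - 1))" by simp
    finally show ?thesis using L by (simp only: powr_add) simp
  qed
  have G: "2 * r * F1 = L * ((L * r) powr (2 * real k - 1) * T (r\<^sup>2) powr e)"
  proof -
    have "2 * r * F1 = b * ((r\<^sup>2) ^ (k - 1) * r) * T (r\<^sup>2) powr e" by (simp add: F1_def F'_def)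
    then show ?thesis unfolding rk bL using L r by (simp add: powr_mult)
  qed
  have F1: "F1 > 0" using b r T[of "r\<^sup>2"] by (simp add: F1_def F'_def)
  have Tge: "T (r\<^sup>2) powr e \<le> a powr (1 - 2 * real k)" if "0 < a" "a ^ (2 * k) \<le> T (r\<^sup>2)" for a
  proof -
    have "T (r\<^sup>2) powr e \<le> (a ^ (2 * k)) powr e" using that e0 by (intro powr_mono2') auto
    also have "a ^ (2 * k) = a powr (2 * real k)" using that(1) powr_realpow[of a "2 * k"] by simp
    also have "(a powr (2 * real k)) powr e = a powr (1 - 2 * real k)" by (simp only: powr_powr ke)
    finally show ?thesis .
  qed
  have GL: "2 * r * F1 \<le> L"
  proof -
    have "(L * r) ^ (2 * k) \<le> T (r\<^sup>2)" using \<eta> by (simp add: T_def b_def power_mult_distrib power_mult)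
    then have "(L * r) powr (2 * real k - 1) * T (r\<^sup>2) powr e \<le> (L * r) powr (2 * real k - 1) * (L * r) powr (1 - 2 * real k)"
      using L r by (intro mult_left_mono Tge) auto
    also have "\<dots> = 1" using L r by (simp add: powr_add[symmetric])
    finally show ?thesis unfolding G using L by simp
  qed
  have G\<eta>: "2 * r * F1 \<le> L * (L * r / \<eta>) powr (2 * real k - 1)"
  proof -
    have "\<eta> ^ (2 * k) \<le> T (r\<^sup>2)" using b by (simp add: T_def)
    then have "(L * r) powr (2 * real k - 1) * T (r\<^sup>2) powr e \<le> (L * r) powr (2 * real k - 1) * \<eta> powr (1 - 2 * real k)"
      using \<eta> by (intro mult_left_mono Tge) auto
    also have "\<dots> = (L * r / \<eta>) powr (2 * real k - 1)"
    proof -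
      have "\<eta> powr (1 - 2 * real k) = 1 / \<eta> powr (2 * real k - 1)" using powr_minus_divide[of \<eta> "2 * real k - 1"] by simp
      then show ?thesis using \<eta> L r by (simp add: powr_divide)
    qed
    finally show ?thesis unfolding G using L by simp
  qed
  have third: "(2 * r * F1) powr (p - 1) \<le> L powr p / \<eta> * r" if p: "1 < p" "1 \<le> (2 * real k - 1) * (p - 1)" for p
  proof -
    have Lp: "L powr p = L powr (p - 1) * L" using L powr_add[of L "p - 1" 1] by simp
    show ?thesis
    \<comment> \<open>Far from the centre the bound \<open>L\<close> on the gradient suffices. Near
      it the gradient supplies the power \<open>(2 * real k - 1) * (p - 1)\<close> of the number
      \<open>L * r / \<eta>\<close>, and both the exponent being at least 1 and the number at most 1
      are used.\<close>
    proof (cases "\<eta> \<le> L * r")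
      case True
      have "(2 * r * F1) powr (p - 1) \<le> L powr (p - 1) * 1" using GL F1 r p by (simp add: powr_mono2)
      also have "\<dots> \<le> L powr (p - 1) * (L * r / \<eta>)" using True \<eta> by (intro mult_left_mono) auto
      finally show ?thesis by (simp add: Lp)
    next
      case False
      define x where "x = L * r / \<eta>"
      have x: "0 < x" "x \<le> 1" using False L r \<eta> by (auto simp: x_def)
      have "(2 * r * F1) powr (p - 1) \<le> (L * x powr (2 * real k - 1)) powr (p - 1)"
        using G\<eta> F1 r p by (intro powr_mono2) (auto simp: x_def)
      also have "\<dots> = L powr (p - 1) * x powr ((2 * real k - 1) * (p - 1))"
        using L x by (simp add: powr_mult powr_powr)
      also have "\<dots> \<le> L powr (p - 1) * x powr 1"
        using x p by (intro mult_left_mono powr_mono') auto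
      finally show ?thesis using L r \<eta> by (simp add: Lp x_def)
    qed
  qed
  have second: "F1 + 2 * r\<^sup>2 * F2 \<le> (2 * real k - 1) * F1"
  proof -
    have a: "r\<^sup>2 * (real (k - 1) * (r\<^sup>2) ^ (k - 1 - 1)) = real (k - 1) * (r\<^sup>2) ^ (k - 1)"
    proof (cases "k = 1")
      case False
      then have "k - 1 = Suc (k - 1 - 1)" using k by simp
      then show ?thesis by (metis mult.left_commute power_Suc)
    qed simp
    define X where "X = 1/2 * b * ((r\<^sup>2) ^ (k - 1) * (e * T (r\<^sup>2) powr (e - 1) * (b * (real k * (r\<^sup>2) ^ (k - 1)))))"
    have X: "X \<le> 0" unfolding X_def using b e0 T[of "r\<^sup>2"]
      by (intro mult_nonneg_nonpos mult_nonpos_nonneg) auto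
    have "r\<^sup>2 * F2 = 1/2 * b * (r\<^sup>2 * (real (k - 1) * (r\<^sup>2) ^ (k - 1 - 1))) * T (r\<^sup>2) powr e + r\<^sup>2 * X"
      by (simp add: F2_def X_def distrib_left mult_ac)
    also have "\<dots> = real (k - 1) * F1 + r\<^sup>2 * X" unfolding a by (simp add: F1_def F'_def)
    also have "\<dots> \<le> real (k - 1) * F1" using X by (simp add: mult_nonneg_nonpos)
    finally show ?thesis using k by (simp add: of_nat_diff algebra_simps)
  qed
  have so: "second_order (\<lambda>w. root_barrier k \<eta> L (f w)) z (\<lambda>h. F1 * l h) (\<lambda>h. F1 * Q h + F2 / 2 * (l h)\<^sup>2)"
    if f: "second_order f z l Q" and fz: "f z = r\<^sup>2" for f :: "'a \<Rightarrow> real" and z l Q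
  proof -
    have "\<forall>\<^sub>F y in nhds (f z). y > 0" using r eventually_nhds_in_open[of "{0<..}" "f z"] by (simp add: fz)
    then have ev: "\<forall>\<^sub>F y in nhds (f z). (root_barrier k \<eta> L has_real_derivative F' y) (at y)"
      by eventually_elim (rule d1)
    from second_order_real_comp[OF f ev, of F2] d2 show ?thesis unfolding fz F1_def by simp
  qed
  show ?thesis by (rule that[OF F1 GL second third so])
qed

text \<open>The second derivatives, tangential and radial, are at most multiples of
  \<open>F1\<close>, and \<open>F1\<close> times the power \<open>p - 2\<close> of the gradient is
  its power \<open>p - 1\<close> divided by \<open>2 * norm X\<close>. The hypothesis linear in
  \<open>norm X\<close> cancels this division, so the bound is uniform up to the centre.\<close>

lemma barrier_operator_bound:
  fixes X :: "real ^ 'n"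
  assumes X: "X \<noteq> 0" and p: "1 < p" and F1: "F1 > 0" and F2: "F1 + 2 * (norm X)\<^sup>2 * F2 \<le> (2 * real k - 1) * F1"
    and G: "(2 * norm X * F1) powr (p - 1) \<le> A * norm X" and k: "1 \<le> k"
  shows "Vq p ((2 * F1) *\<^sub>R X) (\<lambda>h. F1 * (norm (fst h))\<^sup>2 + F2 / 2 * (2 * (X \<bullet> fst h))\<^sup>2 + c * (snd h)\<^sup>2)
    \<le> ((real CARD('n) - 1) + (p - 1) * (2 * real k - 1)) * A / 2"
proof -
  let ?r = "norm X" and ?N = "real CARD('n)"
  let ?C = "(?N - 1) + (p - 1) * (2 * real k - 1)"
  have r: "?r > 0" using X by simp
  have N: "?N \<ge> 1" using one_le_card_finite[where 'a='n] by simp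
  have C: "?C \<ge> 0" using N p k by (intro add_nonneg_nonneg mult_nonneg_nonneg) auto
  have nb: "norm ((2 * F1) *\<^sub>R X) = 2 * ?r * F1" using F1 by simp
  have dir: "((2 * F1) *\<^sub>R X) /\<^sub>R norm ((2 * F1) *\<^sub>R X) = X /\<^sub>R ?r" using F1 X by simp
  note dir = dir[unfolded nb]
  have XX: "X \<bullet> (X /\<^sub>R ?r) = ?r"
    using r by (simp add: power2_norm_eq_inner[symmetric] power2_eq_square)
  have tr: "(\<Sum>i\<in>UNIV. (2 * (X \<bullet> axis i 1))\<^sup>2) = 4 * ?r\<^sup>2"
  proof -
    have "?r\<^sup>2 = (\<Sum>i\<in>UNIV. X $ i * X $ i)" by (simp add: power2_norm_eq_inner inner_vec_def)
    then show ?thesis by (simp add: inner_axis power2_eq_square sum_distrib_left mult_ac)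
  qed
  have s1: "(\<Sum>i\<in>UNIV. F1 * (norm (axis i (1::real) :: real ^ 'n))\<^sup>2 + F2 / 2 * (2 * (X \<bullet> axis i 1))\<^sup>2 + c * 0\<^sup>2)
      = ?N * F1 + 2 * ?r\<^sup>2 * F2"
    unfolding sum.distrib sum_distrib_left[symmetric] tr by simp
  have s2: "F1 * (norm (X /\<^sub>R ?r))\<^sup>2 + F2 / 2 * (2 * (X \<bullet> (X /\<^sub>R ?r)))\<^sup>2 + c * 0\<^sup>2 = F1 + 2 * ?r\<^sup>2 * F2"
    unfolding XX using r by (simp add: power_mult_distrib)
  have "Vq p ((2 * F1) *\<^sub>R X) (\<lambda>h. F1 * (norm (fst h))\<^sup>2 + F2 / 2 * (2 * (X \<bullet> fst h))\<^sup>2 + c * (snd h)\<^sup>2)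
      = (2 * ?r * F1) powr (p - 2) * ((?N * F1 + 2 * ?r\<^sup>2 * F2) + (p - 2) * (F1 + 2 * ?r\<^sup>2 * F2))"
    unfolding Vq_def nb dir fst_conv snd_conv by (simp only: s1 s2)
  also have "(?N * F1 + 2 * ?r\<^sup>2 * F2) + (p - 2) * (F1 + 2 * ?r\<^sup>2 * F2) = (?N - 1) * F1 + (p - 1) * (F1 + 2 * ?r\<^sup>2 * F2)"
    by (simp add: algebra_simps)
  also have "(2 * ?r * F1) powr (p - 2) * \<dots>
      \<le> (2 * ?r * F1) powr (p - 2) * ((?N - 1) * F1 + (p - 1) * ((2 * real k - 1) * F1))"
    using p F2 by (intro mult_left_mono add_left_mono) auto
  also have "\<dots> = ?C * ((2 * ?r * F1) powr (p - 2) * F1)" by (simp add: algebra_simps)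
  also have "(2 * ?r * F1) powr (p - 2) * F1 = (2 * ?r * F1) powr (p - 1) / (2 * ?r)"
  proof -
    have "(2 * ?r * F1) powr (p - 1) = (2 * ?r * F1) powr (p - 2) * (2 * ?r * F1)"
      using powr_add[of "2 * ?r * F1" "p - 2" 1] r F1 by simp
    then show ?thesis using r by simp
  qed
  also have "?C * ((2 * ?r * F1) powr (p - 1) / (2 * ?r)) \<le> ?C * (A * ?r / (2 * ?r))"
    using G r C by (intro mult_left_mono divide_right_mono) auto
  also have "\<dots> = ?C * A / 2" using r by simp
  finally show ?thesis .
qed

text \<open>The barrier starts above the solution by the Lipschitz bound and stays above on the
  sphere of radius 1 because \<open>L \<ge> 2 * \<Lambda>\<close>. A violation therefore leads to an
  interior contact with a strict supersolution: away from \<open>x0\<close> the jets contradict the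
  size of \<open>B\<close>, and at \<open>x0\<close> the test with vanishing gradient contradicts
  \<open>B > 0\<close>.\<close>

lemma time_barrier:
  fixes u :: "(real ^ 'n) \<times> real \<Rightarrow> real"
  defines "\<Omega> \<equiv> ball (0 :: real ^ 'n) 4 \<times> {-4<..<0 :: real}"
  assumes u: "viscosity_solution p \<Omega> u" and s: "s = 1 \<or> s = -1" and p: "1 < p"
    and k: "1 \<le> k" "(2 * real k - 1) * (p - 1) > 1"
    and bd: "\<And>z. z \<in> \<Omega> \<Longrightarrow> \<bar>s * ln (u z)\<bar> \<le> \<Lambda>" and \<Lambda>: "\<Lambda> \<ge> 0" and L: "L > 0" "L \<ge> 2 * \<Lambda>"
    and lip: "\<And>x y t. norm x < 2 \<Longrightarrow> norm y < 2 \<Longrightarrow> -2 < t \<Longrightarrow> t < 0 \<Longrightarrow> s * ln (u (x, t)) - s * ln (u (y, t)) \<le> L * norm (x - y)"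
    and pt: "norm x0 < 1" "-1 < s0" "s0 < t'" "t' < 0" and \<eta>: "\<eta> > 0"
    and B: "B > L powr p + ((real CARD('n) - 1) + (p - 1) * (2 * real k - 1)) * (L powr p / \<eta>) / (p - 1)"
  shows "s * ln (u (x0, t')) - s * ln (u (x0, s0)) \<le> \<eta> + B * (t' - s0)"
proof (rule ccontr)
  define w where "w z = s * ln (u z)" for z
  let ?C1 = "(real CARD('n) - 1) + (p - 1) * (2 * real k - 1)"
  assume "\<not> ?thesis"
  then have neg: "w (x0, t') - w (x0, s0) - \<eta> - B * (t' - s0) > 0" by (simp add: w_def)
  define \<delta> where "\<delta> = w (x0, t') - w (x0, s0) - \<eta> - B * (t' - s0)"
  \<comment> \<open>Small enough that the violation at \<open>t'\<close> survives, and such that the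
    term with \<open>\<theta>\<close> exceeds the oscillation at the time \<open>\<tau>\<close>,
    which is negative but not earlier than \<open>t'\<close>.\<close>
  define \<theta> where "\<theta> = (- t') * min (\<delta> / 2) (2 * \<Lambda> + 1)"
  define \<tau> where "\<tau> = - \<theta> / (2 * \<Lambda> + 1)"
  have m: "min (\<delta> / 2) (2 * \<Lambda> + 1) > 0" using neg \<Lambda> by (simp add: \<delta>_def)
  have \<theta>: "\<theta> > 0" using pt mult_pos_pos[OF _ m, of "- t'"] by (simp add: \<theta>_def)
  have \<theta>1: "\<theta> / (- t') < \<delta>" using pt neg by (simp add: \<theta>_def \<delta>_def[symmetric] min_def)
  have "\<theta> \<le> (- t') * (2 * \<Lambda> + 1)" unfolding \<theta>_def using pt by (intro mult_left_mono) auto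
  then have \<tau>: "t' \<le> \<tau>" "\<tau> < 0" using \<theta> \<Lambda> by (auto simp: \<tau>_def field_simps)
  have C1: "?C1 \<ge> 0" using one_le_card_finite[where 'a='n] p k by (intro add_nonneg_nonneg mult_nonneg_nonneg) auto
  have "?C1 * (L powr p / \<eta>) / (p - 1) \<ge> 0" using C1 p \<eta> by simp
  then have B0: "B > 0" using B powr_ge_zero[of L p] by linarith
  define H where "H z = root_barrier k \<eta> L ((norm (fst z - x0))\<^sup>2) + B * snd z + \<theta> / (- snd z)"
    for z :: "(real ^ 'n) \<times> real"
  define K where "K = cball x0 1 \<times> {s0..\<tau>}"
  have inK: "norm (fst z) < 2 \<and> -2 < snd z \<and> snd z < 0 \<and> z \<in> \<Omega>" if "z \<in> K" for z
  proof -
    have "norm (fst z) \<le> norm x0 + norm (fst z - x0)" using norm_triangle_sub[of "fst z" x0] by simp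
    then show ?thesis using that pt \<tau> by (auto simp: K_def \<Omega>_def mem_Times_iff dist_norm norm_minus_commute)
  qed
  have \<Omega>o: "open \<Omega>" unfolding \<Omega>_def by (intro open_Times) auto
  have uc: "continuous_on \<Omega> u" and up: "\<And>z. z \<in> \<Omega> \<Longrightarrow> 0 < u z"
    using u by (auto simp: viscosity_solution_def viscosity_subsolution_def)
  have wc: "continuous_on K w"
  proof -
    have "continuous_on K u" using inK by (intro continuous_on_subset[OF uc]) auto
    moreover have "u z \<noteq> 0" if "z \<in> K" for z using up[of z] inK[OF that] by auto
    ultimately show ?thesis unfolding w_def by (intro continuous_intros) auto
  qed
  have rbc: "continuous_on {0..} (root_barrier k \<eta> L)"
  proof -
    have "\<eta> ^ (2 * k) + L ^ (2 * k) * S ^ k \<noteq> 0" if "S \<ge> 0" for S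
      using \<eta> L that by (simp add: add_pos_nonneg less_imp_neq[symmetric])
    then show ?thesis unfolding root_barrier_def by (intro continuous_intros) auto
  qed
  have Hc: "continuous_on K H"
  proof -
    have "continuous_on K (\<lambda>z. root_barrier k \<eta> L ((norm (fst z - x0))\<^sup>2))"
      by (rule continuous_on_compose2[OF rbc]) (auto intro!: continuous_intros)
    then show ?thesis unfolding H_def using inK by (intro continuous_intros) force+
  qed
  have K: "compact K" unfolding K_def by (intro compact_Times) auto
  have x0K: "(x0, t') \<in> K" using pt \<tau> by (simp add: K_def)
  then have "K \<noteq> {}" by blast
  then obtain z where z: "z \<in> K" and max: "\<And>y. y \<in> K \<Longrightarrow> w y - H y \<le> w z - H z"
    using continuous_attains_sup[OF K _ continuous_on_diff[OF wc Hc]] by blast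
  have rb0: "root_barrier k \<eta> L 0 = \<eta>" using root_barrier_0 \<eta> k(1) .
  have "w (x0, t') - H (x0, t') > w (x0, s0) - B * s0"
    using \<theta>1 by (simp add: H_def rb0 \<delta>_def right_diff_distrib)
  then have zpos: "w z - H z > w (x0, s0) - B * s0" using max[OF x0K] by simp
  obtain x1 t1 where z1: "z = (x1, t1)" by (cases z)
  have t1: "t1 < 0" "s0 \<le> t1" "t1 \<le> \<tau>" "norm (x1 - x0) \<le> 1" "norm x1 < 2" "-2 < t1"
    using inK[OF z] z by (auto simp: z1 K_def dist_norm norm_minus_commute)
  have rbL: "L * norm (x1 - x0) \<le> root_barrier k \<eta> L ((norm (x1 - x0))\<^sup>2)"
    using root_barrier_ge \<eta> L k by simp
  have \<theta>t: "\<theta> / (- t1) > 0" using \<theta> t1 by (intro divide_pos_pos) auto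
  have osc: "w z - w (x0, s0) \<le> 2 * \<Lambda>"
    using bd[of z] bd[of "(x0, s0)"] inK[OF z] pt by (auto simp: w_def \<Omega>_def abs_le_iff)
  have Bt: "B * (t1 - s0) \<ge> 0" using B0 t1 by simp
  have Hz: "w z - w (x0, s0) > root_barrier k \<eta> L ((norm (x1 - x0))\<^sup>2) + B * (t1 - s0) + \<theta> / (- t1)"
    using zpos by (simp add: H_def z1 right_diff_distrib)
  have rbpos: "root_barrier k \<eta> L ((norm (x1 - x0))\<^sup>2) \<ge> 0" using rbL L norm_ge_zero[of "x1 - x0"]
    by (meson mult_nonneg_nonneg less_imp_le order_trans)
  have "norm (x1 - x0) \<noteq> 1"
  proof
    assume "norm (x1 - x0) = 1"
    then have "root_barrier k \<eta> L ((norm (x1 - x0))\<^sup>2) \<ge> 2 * \<Lambda>" using rbL L by simp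
    then show False using Hz osc \<theta>t Bt by linarith
  qed
  moreover have "t1 \<noteq> \<tau>"
  proof
    assume "t1 = \<tau>"
    then have "\<theta> / (- t1) = 2 * \<Lambda> + 1" using \<theta> \<Lambda> by (simp add: \<tau>_def)
    then show False using Hz osc rbpos Bt by linarith
  qed
  moreover have "t1 \<noteq> s0"
  proof
    assume "t1 = s0"
    then have "w z - w (x0, s0) \<le> L * norm (x1 - x0)"
      using lip[of x1 x0 s0] t1 pt by (simp add: w_def z1)
    then show False using Hz rbL \<theta>t Bt by linarith
  qed
  ultimately have "z \<in> ball x0 1 \<times> {s0<..<\<tau>}" using t1 by (auto simp: z1 dist_norm norm_minus_commute)
  moreover have "open (ball x0 1 \<times> {s0<..<\<tau>})" by (intro open_Times) auto
  moreover have "ball x0 1 \<times> {s0<..<\<tau>} \<subseteq> K" by (auto simp: K_def)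
  ultimately obtain d where d: "d > 0" "\<And>y. dist y z < d \<Longrightarrow> y \<in> K"
    unfolding open_dist by (metis subset_iff)
  have near: "\<forall>\<^sub>F h in nhds 0. w (z + h) - w z \<le> H (z + h) - H z"
    unfolding eventually_nhds_0_norm
  proof (intro exI conjI allI impI)
    fix h :: "(real ^ 'n) \<times> real" assume "norm h < d"
    then have "z + h \<in> K" by (intro d) (simp add: dist_norm)
    from max[OF this] show "w (z + h) - w z \<le> H (z + h) - H z" by simp
  qed (rule d)
  define q where "q = B + \<theta> / t1\<^sup>2"
  have qB: "q \<ge> B" using \<theta> by (simp add: q_def)
  show False
  proof (cases "x1 = x0")
    case True
    have lin: "linear (\<lambda>y::real. y)" by (rule linear_ident)
    obtain C' where C': "\<forall>\<^sub>F h in nhds 0. \<bar>\<theta> / (- (t1 + h)) - \<theta> / (- t1) - \<theta> / t1\<^sup>2 * h\<bar> \<le> C' * (norm h)\<^sup>2"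
      using second_order_le_quadratic[OF second_order_reciprocal_time[OF lin t1(1), of \<theta>]] by blast
    have C'2: "\<forall>\<^sub>F h in nhds (0 :: (real ^ 'n) \<times> real).
        \<bar>\<theta> / (- (t1 + snd h)) - \<theta> / (- t1) - \<theta> / t1\<^sup>2 * snd h\<bar> \<le> C' * (snd h)\<^sup>2"
    proof -
      obtain d where "d > 0" and d: "\<And>h. norm h < d \<Longrightarrow> \<bar>\<theta> / (- (t1 + h)) - \<theta> / (- t1) - \<theta> / t1\<^sup>2 * h\<bar> \<le> C' * (norm h)\<^sup>2"
        using C' unfolding eventually_nhds_0_norm by blast
      then show ?thesis unfolding eventually_nhds_0_norm
      proof (intro exI conjI allI impI)
        show "d > 0" by fact
        fix h :: "(real ^ 'n) \<times> real" assume "norm h < d"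
        then have "norm (snd h) < d" using norm_snd_le[of "snd h" "fst h"] by simp
        from d[OF this]
        show "\<bar>\<theta> / (- (t1 + snd h)) - \<theta> / (- t1) - \<theta> / t1\<^sup>2 * snd h\<bar> \<le> C' * (snd h)\<^sup>2"
          by (simp only: real_norm_def power2_abs)
      qed
    qed
    define C where "C = L ^ (2 * k) / (2 * k * \<eta> ^ (2 * k - 1))"
    have C: "C > 0" using L \<eta> k by (simp add: C_def)
    have "q \<le> 0"
    proof (rule viscosity_zero_gradient[OF u \<Omega>o _ s p k C])
      show "z \<in> \<Omega>" using inK z by blast
      show "\<forall>\<^sub>F h in nhds 0. s * ln (u (z + h)) \<le> s * ln (u z) + q * snd h + C * (fst h \<bullet> fst h) ^ k + C' * (snd h)\<^sup>2"
        using near C'2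
      proof eventually_elim
        case (elim h)
        have "root_barrier k \<eta> L ((norm (fst h))\<^sup>2) \<le> \<eta> + C * ((norm (fst h))\<^sup>2) ^ k"
          unfolding C_def using root_barrier_le \<eta> L k by simp
        moreover have "w (z + h) - w z \<le> root_barrier k \<eta> L ((norm (fst h))\<^sup>2) - \<eta> + B * snd h + (\<theta> / (- (t1 + snd h)) - \<theta> / (- t1))"
          using elim(1) by (simp add: H_def z1 True rb0 distrib_left)
        ultimately show ?case using elim(2)
          unfolding w_def[symmetric] q_def distrib_right power2_norm_eq_inner by linarith
      qed
    qed
    then show False using qB B0 by simp
  next
    case False
    define X where "X = x1 - x0"
    have X: "X \<noteq> 0" "norm X > 0" using False by (auto simp: X_def)
    obtain F1 F2 where F1: "F1 > 0" and GL: "2 * norm X * F1 \<le> L"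
      and F2: "F1 + 2 * (norm X)\<^sup>2 * F2 \<le> (2 * real k - 1) * F1"
      and Gp: "\<And>p. 1 < p \<Longrightarrow> 1 \<le> (2 * real k - 1) * (p - 1) \<Longrightarrow> (2 * norm X * F1) powr (p - 1) \<le> L powr p / \<eta> * norm X"
      and so: "\<And>(f :: (real ^ 'n) \<times> real \<Rightarrow> real) z l Q. second_order f z l Q \<Longrightarrow> f z = (norm X)\<^sup>2 \<Longrightarrow>
       second_order (\<lambda>w. root_barrier k \<eta> L (f w)) z (\<lambda>h. F1 * l h) (\<lambda>h. F1 * Q h + F2 / 2 * (l h)\<^sup>2)"
    proof (rule root_barrier_derivatives[OF \<eta> L(1) k(1) X(2), where 'a="(real ^ 'n) \<times> real"], goal_cases)
      case (1 F1 F2)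
      show ?case by (rule that[of F1 F2]) (fact 1)+
    qed
    have lsnd: "linear (snd :: (real ^ 'n) \<times> real \<Rightarrow> real)" and lfst: "linear (fst :: (real ^ 'n) \<times> real \<Rightarrow> real ^ 'n)"
      by (auto intro!: linearI)
    have lX: "linear (\<lambda>h :: (real ^ 'n) \<times> real. 2 * (X \<bullet> fst h))"
      by (auto intro!: linearI simp: inner_add_right distrib_left)
    have "second_order (\<lambda>w. (norm (fst w - x0))\<^sup>2) z (\<lambda>h. 2 * (X \<bullet> fst h)) (\<lambda>h. (norm (fst h))\<^sup>2)"
    proof (rule second_order_exact[OF lX quadform_norm_comp[OF lfst]])
      fix h :: "(real ^ 'n) \<times> real"
      have "fst (z + h) - x0 = X + fst h" by (simp add: z1 X_def)
      moreover have "fst z - x0 = X" by (simp add: z1 X_def)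
      ultimately show "(norm (fst (z + h) - x0))\<^sup>2 = (norm (fst z - x0))\<^sup>2 + 2 * (X \<bullet> fst h) + (norm (fst h))\<^sup>2"
        by (simp only: norm_add_sq)
    qed
    note sb = so[OF this]
    define Q where "Q h = F1 * (norm (fst h))\<^sup>2 + F2 / 2 * (2 * (X \<bullet> fst h))\<^sup>2 + (- \<theta> / t1 ^ 3) * (snd h)\<^sup>2"
      for h :: "(real ^ 'n) \<times> real"
    have sH: "second_order H z (\<lambda>h. ((2 * F1) *\<^sub>R X, q) \<bullet> h) Q"
    proof -
      have "(\<lambda>h. ((2 * F1) *\<^sub>R X, q) \<bullet> h) = (\<lambda>h. F1 * (2 * (X \<bullet> fst h)) + B * snd h + \<theta> / (snd z)\<^sup>2 * snd h)"
        by (auto simp: q_def z1 inner_prod_def algebra_simps)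
      moreover have "Q = (\<lambda>h. F1 * (norm (fst h))\<^sup>2 + F2 / 2 * (2 * (X \<bullet> fst h))\<^sup>2 + B * 0 + (- \<theta> / (snd z) ^ 3) * (snd h)\<^sup>2)"
        by (auto simp: Q_def z1)
      moreover have "second_order (\<lambda>z. root_barrier k \<eta> L ((norm (fst z - x0))\<^sup>2) + B * snd z + \<theta> / (- snd z)) z
          (\<lambda>h. F1 * (2 * (X \<bullet> fst h)) + B * snd h + \<theta> / (snd z)\<^sup>2 * snd h)
          (\<lambda>h. F1 * (norm (fst h))\<^sup>2 + F2 / 2 * (2 * (X \<bullet> fst h))\<^sup>2 + B * 0 + (- \<theta> / (snd z) ^ 3) * (snd h)\<^sup>2)"
        by (intro second_order_add sb second_order_cmult second_order_linear lsnd second_order_reciprocal_time)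
          (use t1 in \<open>auto simp: z1 X_def\<close>)
      ultimately show ?thesis unfolding H_def[abs_def] by simp
    qed
    have Qq: "quadform Q" using sH by (simp add: second_order_def)
    have VQ: "Vq p ((2 * F1) *\<^sub>R X) Q \<le> ?C1 * (L powr p / \<eta>) / 2"
      unfolding Q_def by (rule barrier_operator_bound[OF X(1) p F1 F2 Gp[OF p] k(1)]) (use k in simp)
    have js: "jet_sub p s \<Omega> w" unfolding w_def by (rule viscosity_imp_jet_sub[OF u \<Omega>o s])
    have "(p - 1) / 2 * (q - s * norm ((2 * F1) *\<^sub>R X) powr p) \<le> Vq p ((2 * F1) *\<^sub>R X) Q"
    proof (rule le_of_forall_eps_mult)
      fix e :: real assume e: "e > 0"
      have j: "jet_above w z ((2 * F1) *\<^sub>R X, q) (\<lambda>h. Q h + e * (norm h)\<^sup>2)"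
        by (rule jet_above_second_order[OF sH near e refl])
      have qf: "quadform (\<lambda>h. Q h + e * (norm h)\<^sup>2)" by (intro quadform_intros Qq)
      have nz: "(2 * F1) *\<^sub>R X \<noteq> 0" using F1 X by simp
      have "z \<in> \<Omega>" using inK z by blast
      then show "(p - 1) / 2 * (q - s * norm ((2 * F1) *\<^sub>R X) powr p)
          \<le> Vq p ((2 * F1) *\<^sub>R X) Q + e * Vq p ((2 * F1) *\<^sub>R X) (\<lambda>h. (norm h)\<^sup>2)"
        using js qf nz j unfolding jet_sub_def Vq_add[symmetric] Vq_cmult[symmetric] by blast
    qed
    note Vle = order_trans[OF this VQ]
    have half: "(p - 1) / 2 * y \<le> D / 2 \<Longrightarrow> (p - 1) * y \<le> D" for y D :: real by simp
    have "(p - 1) * (q - s * norm ((2 * F1) *\<^sub>R X) powr p) \<le> ?C1 * (L powr p / \<eta>)"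
      by (rule half[OF Vle])
    moreover have "s * norm ((2 * F1) *\<^sub>R X) powr p \<le> L powr p"
    proof -
      have nb: "norm ((2 * F1) *\<^sub>R X) = 2 * norm X * F1" using F1 by simp
      have "norm ((2 * F1) *\<^sub>R X) powr p \<le> L powr p" unfolding nb using GL F1 p by (intro powr_mono2) auto
      moreover have "s * norm ((2 * F1) *\<^sub>R X) powr p \<le> norm ((2 * F1) *\<^sub>R X) powr p" using s by auto
      ultimately show ?thesis by simp
    qed
    moreover have "(p - 1) * (q - L powr p) > ?C1 * (L powr p / \<eta>)"
    proof -
      have "?C1 * (L powr p / \<eta>) / (p - 1) < q - L powr p" using B qB by linarith
      then show ?thesis using p by (simp only: pos_divide_less_eq mult.commute diff_gt_0_iff_gt)
    qed
    moreover have "(p - 1) * (q - L powr p) \<le> (p - 1) * (q - s * norm ((2 * F1) *\<^sub>R X) powr p)"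
      using p calculation(2) by (intro mult_left_mono) auto
    ultimately show False by linarith
  qed
qed

section \<open>Regularity in time\<close>

lemma log_solution_time_regularity:
  assumes p: "1 < p" and \<Lambda>: "\<Lambda> \<ge> 1"
  obtains C where "C > 0" "\<And>(u :: (real ^ 'n) \<times> real \<Rightarrow> real) x t s. viscosity_solution p (ball 0 4 \<times> {-4<..<0}) u \<Longrightarrow>
     uniformly_continuous_on (ball 0 4 \<times> {-4<..<0}) (\<lambda>z. ln (u z)) \<Longrightarrow>
     (\<And>z. z \<in> ball 0 4 \<times> {-4<..<0} \<Longrightarrow> \<bar>ln (u z)\<bar> \<le> \<Lambda>) \<Longrightarrow> norm x < 1 \<Longrightarrow>
     -1 < t \<Longrightarrow> t < 0 \<Longrightarrow> -1 < s \<Longrightarrow> s < 0 \<Longrightarrow> \<bar>ln (u (x, t)) - ln (u (x, s))\<bar> \<le> C * sqrt \<bar>t - s\<bar>"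
proof (rule log_solution_lipschitz[OF p \<Lambda>, where 'n='n])
  fix L0 :: real
  assume L0: "L0 > 0"
    and lip0: "\<And>(v :: (real ^ 'n) \<times> real \<Rightarrow> real) x y t. uniformly_continuous_on (ball 0 4 \<times> {-4<..<0}) v \<Longrightarrow>
     (\<And>z. z \<in> ball 0 4 \<times> {-4<..<0} \<Longrightarrow> \<bar>v z\<bar> \<le> \<Lambda>) \<Longrightarrow> jet_sub p 1 (ball 0 4 \<times> {-4<..<0}) v \<Longrightarrow>
     jet_sub p (- 1) (ball 0 4 \<times> {-4<..<0}) (\<lambda>w. - v w) \<Longrightarrow> norm x < 2 \<Longrightarrow> norm y < 2 \<Longrightarrow> -2 < t \<Longrightarrow> t < 0 \<Longrightarrow>
     \<bar>v (x, t) - v (y, t)\<bar> \<le> L0 * norm (x - y)"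
  \<comment> \<open>The summand \<open>2 * \<Lambda>\<close> lets the barrier exceed the oscillation
    on its lateral boundary, at distance 1 from the centre.\<close>
  define L where "L = L0 + 2 * \<Lambda>"
  have L: "L > 0" "L \<ge> 2 * \<Lambda>" "L0 \<le> L" using L0 \<Lambda> by (auto simp: L_def)
  \<comment> \<open>For \<open>p\<close> close to 1 a high order of flatness is necessary;
    \<open>k\<close> depends on \<open>p\<close> only.\<close>
  obtain k :: nat where "1 / (p - 1) + 1 < real k" using reals_Archimedean2 by blast
  moreover have "1 / (p - 1) > 0" using p by simp
  ultimately have "1 < real k" "1 / (p - 1) < 2 * real k - 1" by linarith+
  then have k: "1 \<le> k" "(2 * real k - 1) * (p - 1) > 1" using p by (auto simp: pos_divide_less_eq)
  define A where "A = ((real CARD('n) - 1) + (p - 1) * (2 * real k - 1)) * L powr p / (p - 1)"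
  have A: "A \<ge> 0" using one_le_card_finite[where 'a='n] p k unfolding A_def
    by (intro divide_nonneg_pos mult_nonneg_nonneg add_nonneg_nonneg) auto
  define C where "C = L powr p + 2 + A"
  show thesis
  proof (rule that[of C])
    show "C > 0" unfolding C_def using A by (intro add_pos_nonneg add_nonneg_pos) auto
    fix u :: "(real ^ 'n) \<times> real \<Rightarrow> real" and x :: "real ^ 'n" and t s :: real
    assume u: "viscosity_solution p (ball 0 4 \<times> {-4<..<0}) u"
      and uc: "uniformly_continuous_on (ball 0 4 \<times> {-4<..<0}) (\<lambda>z. ln (u z))"
      and bd: "\<And>z. z \<in> ball 0 4 \<times> {-4<..<0} \<Longrightarrow> \<bar>ln (u z)\<bar> \<le> \<Lambda>"
      and x: "norm x < 1" and ts: "-1 < t" "t < 0" "-1 < s" "s < 0"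
    have o: "open (ball (0 :: real ^ 'n) 4 \<times> {-4<..<0::real})" by (intro open_Times) auto
    have lip: "\<bar>ln (u (x, t)) - ln (u (y, t))\<bar> \<le> L * norm (x - y)"
      if "norm x < 2" "norm y < 2" "-2 < t" "t < 0" for x y t
    proof -
      have "\<bar>ln (u (x, t)) - ln (u (y, t))\<bar> \<le> L0 * norm (x - y)"
        using viscosity_imp_jet_sub[OF u o, of 1] viscosity_imp_jet_sub[OF u o, of "-1"]
        by (intro lip0[OF uc bd] that) auto
      also have "\<dots> \<le> L * norm (x - y)" using L by (intro mult_right_mono) auto
      finally show ?thesis .
    qed
    \<comment> \<open>The barrier bounds increments forward in time from above; the two signs
      together give the absolute value.\<close>
    have one: "\<sigma> * ln (u (x, t)) - \<sigma> * ln (u (x, s)) \<le> C * sqrt (t - s)"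
      if \<sigma>: "\<sigma> = 1 \<or> \<sigma> = -1" and ts: "-1 < s" "s < t" "t < 0" for \<sigma> s t :: real
    proof -
      \<comment> \<open>Balances the height \<open>\<eta>\<close> of the barrier against its growth
        at rate \<open>A / \<eta>\<close> over the time \<open>t - s\<close>. The summand 1 in the
        rate below makes the condition on \<open>B\<close> strict.\<close>
      define \<eta> where "\<eta> = sqrt (t - s)"
      have \<eta>: "\<eta> > 0" "t - s = \<eta> * \<eta>" "\<eta> \<le> 1" using ts by (auto simp: \<eta>_def)
      have "\<sigma> * ln (u (x, t)) - \<sigma> * ln (u (x, s)) \<le> \<eta> + (L powr p + A / \<eta> + 1) * (t - s)"
      proof (rule time_barrier[OF u \<sigma> p k _ _ L(1,2) _ x ts \<eta>(1)])
        show "\<bar>\<sigma> * ln (u z)\<bar> \<le> \<Lambda>" if "z \<in> ball 0 4 \<times> {-4<..<0}" for z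
          using bd[OF that] \<sigma> by auto
        show "\<sigma> * ln (u (x, t)) - \<sigma> * ln (u (y, t)) \<le> L * norm (x - y)"
          if "norm x < 2" "norm y < 2" "-2 < t" "t < 0" for x y t
          using lip[OF that] \<sigma> by (auto simp: abs_le_iff)
      qed (use \<Lambda> in \<open>auto simp: A_def mult.commute\<close>)
      also have "\<dots> = \<eta> + (L powr p + 1) * (\<eta> * \<eta>) + A * \<eta>"
        unfolding \<eta>(2) using \<eta>(1) by (simp add: field_simps)
      also have "\<dots> \<le> \<eta> + (L powr p + 1) * (\<eta> * 1) + A * \<eta>"
        using \<eta> by (intro add_mono mult_left_mono order_refl) auto
      also have "\<dots> = C * \<eta>" by (simp add: C_def algebra_simps)
      finally show ?thesis by (simp add: \<eta>_def)
    qed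
    have two: "\<bar>ln (u (x, t)) - ln (u (x, s))\<bar> \<le> C * sqrt (t - s)" if "-1 < s" "s < t" "t < 0" for s t
      using one[of 1, OF _ that] one[of "-1", OF _ that] by (simp add: abs_le_iff)
    show "\<bar>ln (u (x, t)) - ln (u (x, s))\<bar> \<le> C * sqrt \<bar>t - s\<bar>"
      using two[of s t] two[of t s] ts by (cases s t rule: linorder_cases) (auto simp: abs_minus_commute)
  qed
qed

theorem theorem4p1:
  fixes p m M :: real and \<omega> :: "real \<Rightarrow> real"
  assumes "1 < p" and "0 < m"
  shows "\<exists>C_H>0. \<forall>u :: (real ^ 'n) \<times> real \<Rightarrow> real.
    uniformly_continuous_on (ball 0 4 \<times> {-4<..<0}) u \<longrightarrow>
    continuous_on (ball 0 4 \<times> {-4<..0}) u \<longrightarrow>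
    viscosity_solution p (ball 0 4 \<times> {-4<..<0}) u \<longrightarrow>
    (\<forall>z \<in> ball 0 4 \<times> {-4<..<0}. m \<le> u z \<and> u z \<le> M) \<longrightarrow>
    (\<forall>s\<ge>0. optimal_space_modulus (ball 0 4 \<times> {-4<..<0}) u s = \<omega> s) \<longrightarrow>
    (\<forall>x\<^sub>0 t\<^sub>0 s\<^sub>0. (x\<^sub>0, t\<^sub>0) \<in> Q_cyl 1 \<longrightarrow> (x\<^sub>0, s\<^sub>0) \<in> Q_cyl 1 \<longrightarrow>
       \<bar>u (x\<^sub>0, t\<^sub>0) - u (x\<^sub>0, s\<^sub>0)\<bar> \<le> C_H * \<bar>t\<^sub>0 - s\<^sub>0\<bar> powr (1/2))"
proof -
  let ?\<Omega> = "ball (0 :: real ^ 'n) 4 \<times> {-4<..<0::real}"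
  define \<Lambda> where "\<Lambda> = \<bar>ln m\<bar> + \<bar>ln M\<bar> + 1"
  have "\<Lambda> \<ge> 1" by (simp add: \<Lambda>_def)
  then obtain C where C: "C > 0" and
    reg: "\<And>(u :: (real ^ 'n) \<times> real \<Rightarrow> real) x t s. viscosity_solution p ?\<Omega> u \<Longrightarrow>
     uniformly_continuous_on ?\<Omega> (\<lambda>z. ln (u z)) \<Longrightarrow> (\<And>z. z \<in> ?\<Omega> \<Longrightarrow> \<bar>ln (u z)\<bar> \<le> \<Lambda>) \<Longrightarrow> norm x < 1 \<Longrightarrow>
     -1 < t \<Longrightarrow> t < 0 \<Longrightarrow> -1 < s \<Longrightarrow> s < 0 \<Longrightarrow> \<bar>ln (u (x, t)) - ln (u (x, s))\<bar> \<le> C * sqrt \<bar>t - s\<bar>"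
    by (rule log_solution_time_regularity[OF assms(1), where 'n='n]) blast
  show ?thesis
  \<comment> \<open>Passing from \<open>ln u\<close> back to \<open>u\<close> costs the Lipschitz
    constant of the exponential below \<open>ln M\<close>; the summand 1 makes the factor positive
    for every \<open>M\<close>.\<close>
  proof (intro exI[of _ "(\<bar>M\<bar> + 1) * C"] conjI allI impI)
    show "0 < (\<bar>M\<bar> + 1) * C" using C by (simp add: add_nonneg_pos)
    fix u :: "(real ^ 'n) \<times> real \<Rightarrow> real" and x\<^sub>0 :: "real ^ 'n" and t\<^sub>0 s\<^sub>0 :: real
    assume uc: "uniformly_continuous_on ?\<Omega> u" and top: "continuous_on (ball 0 4 \<times> {-4<..0}) u"
      and u: "viscosity_solution p ?\<Omega> u" and "\<forall>z \<in> ?\<Omega>. m \<le> u z \<and> u z \<le> M"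
      and "(x\<^sub>0, t\<^sub>0) \<in> Q_cyl 1" "(x\<^sub>0, s\<^sub>0) \<in> Q_cyl 1"
    then have bd: "\<And>z. z \<in> ?\<Omega> \<Longrightarrow> m \<le> u z \<and> u z \<le> M"
      and x0: "norm x\<^sub>0 < 1" and t0: "-1 < t\<^sub>0" "t\<^sub>0 \<le> 0" and s0: "-1 < s\<^sub>0" "s\<^sub>0 \<le> 0"
      by (auto simp: Q_cyl_def)
    have ln_lip: "\<bar>ln a - ln b\<bar> \<le> \<bar>a - b\<bar> / m" if "m \<le> a" "m \<le> b" for a b
    proof -
      have "ln a - ln b \<le> \<bar>a - b\<bar> / m" if "m \<le> a" "m \<le> b" for a b
      proof -
        have "ln a - ln b \<le> (a - b) / b" using that assms by (intro ln_diff_le) auto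
        also have "\<dots> \<le> \<bar>a - b\<bar> / b" using that assms by (intro divide_right_mono) auto
        also have "\<dots> \<le> \<bar>a - b\<bar> / m" using that assms by (intro divide_left_mono) auto
        finally show ?thesis .
      qed
      from this[of a b] this[of b a] that show ?thesis by (simp add: abs_minus_commute abs_le_iff)
    qed
    have exp_lip: "\<bar>a - b\<bar> \<le> (\<bar>M\<bar> + 1) * \<bar>ln a - ln b\<bar>" if "m \<le> a" "a \<le> M" "m \<le> b" "b \<le> M" for a b
    proof -
      have "a - b \<le> (\<bar>M\<bar> + 1) * \<bar>ln a - ln b\<bar>" if "m \<le> a" "a \<le> M" "m \<le> b" "b \<le> M" for a b
      proof -
        have "ln b - ln a \<le> (b - a) / a" using that assms by (intro ln_diff_le) auto
        then have "(a - b) / a \<le> \<bar>ln a - ln b\<bar>" by (simp add: diff_divide_distrib)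
        then have "a - b \<le> a * \<bar>ln a - ln b\<bar>" using that assms by (simp add: pos_divide_le_eq mult.commute)
        also have "\<dots> \<le> (\<bar>M\<bar> + 1) * \<bar>ln a - ln b\<bar>" using that by (intro mult_right_mono) auto
        finally show ?thesis .
      qed
      from this[of a b] this[of b a] that show ?thesis by (simp add: abs_minus_commute abs_le_iff)
    qed
    have lnb: "\<bar>ln (u z)\<bar> \<le> \<Lambda>" if "z \<in> ?\<Omega>" for z
    proof -
      have "ln m \<le> ln (u z)" "ln (u z) \<le> ln M" using bd[OF that] assms by (simp_all add: ln_mono)
      then show ?thesis unfolding \<Lambda>_def by linarith
    qed
    have lnuc: "uniformly_continuous_on ?\<Omega> (\<lambda>z. ln (u z))"
      unfolding uniformly_continuous_on_def
    proof (intro allI impI)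
      fix e :: real assume "e > 0"
      then have "e * m > 0" using assms by simp
      then obtain d where d: "d > 0" "\<And>z z'. z \<in> ?\<Omega> \<Longrightarrow> z' \<in> ?\<Omega> \<Longrightarrow> dist z' z < d \<Longrightarrow> dist (u z') (u z) < e * m"
        using uc unfolding uniformly_continuous_on_def by metis
      have "dist (ln (u z')) (ln (u z)) < e" if "z \<in> ?\<Omega>" "z' \<in> ?\<Omega>" "dist z' z < d" for z z'
      proof -
        have "\<bar>ln (u z') - ln (u z)\<bar> \<le> \<bar>u z' - u z\<bar> / m" using that bd by (intro ln_lip) auto
        also have "\<dots> < e" using d(2)[OF that] assms by (simp add: dist_real_def pos_divide_less_eq)
        finally show ?thesis by (simp add: dist_real_def)
      qed
      then show "\<exists>d>0. \<forall>z\<in>?\<Omega>. \<forall>z'\<in>?\<Omega>. dist z' z < d \<longrightarrow> dist (ln (u z')) (ln (u z)) < e"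
        using d(1) by blast
    qed
    have inner: "\<bar>u (x\<^sub>0, t) - u (x\<^sub>0, s)\<bar> \<le> (\<bar>M\<bar> + 1) * C * sqrt \<bar>t - s\<bar>"
      if "-1 < t" "t < 0" "-1 < s" "s < 0" for t s
    proof -
      have "\<bar>u (x\<^sub>0, t) - u (x\<^sub>0, s)\<bar> \<le> (\<bar>M\<bar> + 1) * \<bar>ln (u (x\<^sub>0, t)) - ln (u (x\<^sub>0, s))\<bar>"
        using bd[of "(x\<^sub>0, t)"] bd[of "(x\<^sub>0, s)"] x0 that by (intro exp_lip) auto
      also have "\<dots> \<le> (\<bar>M\<bar> + 1) * (C * sqrt \<bar>t - s\<bar>)"
        using x0 that by (intro mult_left_mono reg[OF u lnuc lnb]) auto
      finally show ?thesis by (simp add: mult.assoc)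
    qed
    \<comment> \<open>An affine contraction of the times towards -1. For small positive
      \<open>e\<close> it moves the top into the open interval and does not increase differences of
      times, so the interior estimate extends by continuity.\<close>
    define \<sigma> where "\<sigma> e t = t - e * (1 + t)" for e t :: real
    have lim: "((\<lambda>e. u (x\<^sub>0, \<sigma> e t)) \<longlongrightarrow> u (x\<^sub>0, t)) (at_right 0)" if "-1 < t" "t \<le> 0" for t
    proof (rule continuous_on_tendsto_compose[OF top])
      show "((\<lambda>e. (x\<^sub>0, \<sigma> e t)) \<longlongrightarrow> (x\<^sub>0, t)) (at_right 0)"
        unfolding \<sigma>_def by (auto intro!: tendsto_eq_intros)
      show "(x\<^sub>0, t) \<in> ball 0 4 \<times> {-4<..0}" using x0 that by auto
      show "\<forall>\<^sub>F e in at_right 0. (x\<^sub>0, \<sigma> e t) \<in> ball 0 4 \<times> {-4<..0}"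
        using eventually_at_right_real[of 0 1, simplified]
      proof eventually_elim
        case (elim e)
        then have "0 \<le> e * (1 + t)" "e * (1 + t) \<le> 1 * (1 + t)" using that by (intro mult_nonneg_nonneg mult_right_mono; simp)+
        moreover have "\<sigma> e t = t - y \<Longrightarrow> 0 \<le> y \<Longrightarrow> y \<le> 1 * (1 + t) \<Longrightarrow> -4 < \<sigma> e t \<and> \<sigma> e t \<le> 0" for y
          using that by auto
        ultimately have "-4 < \<sigma> e t \<and> \<sigma> e t \<le> 0" using \<sigma>_def by blast
        then show ?case using x0 by auto
      qed
    qed
    have "\<bar>u (x\<^sub>0, t\<^sub>0) - u (x\<^sub>0, s\<^sub>0)\<bar> \<le> (\<bar>M\<bar> + 1) * C * sqrt \<bar>t\<^sub>0 - s\<^sub>0\<bar>"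
    proof (rule tendsto_upperbound)
      show "((\<lambda>e. \<bar>u (x\<^sub>0, \<sigma> e t\<^sub>0) - u (x\<^sub>0, \<sigma> e s\<^sub>0)\<bar>) \<longlongrightarrow> \<bar>u (x\<^sub>0, t\<^sub>0) - u (x\<^sub>0, s\<^sub>0)\<bar>) (at_right 0)"
        by (intro tendsto_intros lim t0 s0)
      show "\<forall>\<^sub>F e in at_right 0. \<bar>u (x\<^sub>0, \<sigma> e t\<^sub>0) - u (x\<^sub>0, \<sigma> e s\<^sub>0)\<bar> \<le> (\<bar>M\<bar> + 1) * C * sqrt \<bar>t\<^sub>0 - s\<^sub>0\<bar>"
        using eventually_at_right_real[of 0 1, simplified]
      proof eventually_elim
        case (elim e)
        have in01: "-1 < \<sigma> e t \<and> \<sigma> e t < 0" if "-1 < t" "t \<le> 0" for t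
        proof -
          have "0 < e * (1 + t)" "e * (1 + t) < 1 * (1 + t)"
            using that elim by (intro mult_pos_pos mult_strict_right_mono; simp)+
          moreover have "\<sigma> e t = t - y \<Longrightarrow> 0 < y \<Longrightarrow> y < 1 * (1 + t) \<Longrightarrow> -1 < \<sigma> e t \<and> \<sigma> e t < 0" for y
            using that by auto
          ultimately show ?thesis using \<sigma>_def by blast
        qed
        have "\<sigma> e t\<^sub>0 - \<sigma> e s\<^sub>0 = (1 - e) * (t\<^sub>0 - s\<^sub>0)" by (simp add: \<sigma>_def algebra_simps)
        then have "\<bar>\<sigma> e t\<^sub>0 - \<sigma> e s\<^sub>0\<bar> = (1 - e) * \<bar>t\<^sub>0 - s\<^sub>0\<bar>" using elim by (simp add: abs_mult)
        also have "\<dots> \<le> 1 * \<bar>t\<^sub>0 - s\<^sub>0\<bar>" using elim by (intro mult_right_mono) auto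
        finally have "\<bar>\<sigma> e t\<^sub>0 - \<sigma> e s\<^sub>0\<bar> \<le> \<bar>t\<^sub>0 - s\<^sub>0\<bar>" by simp
        then have "(\<bar>M\<bar> + 1) * C * sqrt \<bar>\<sigma> e t\<^sub>0 - \<sigma> e s\<^sub>0\<bar> \<le> (\<bar>M\<bar> + 1) * C * sqrt \<bar>t\<^sub>0 - s\<^sub>0\<bar>"
          using C by (intro mult_left_mono) auto
        with inner[of "\<sigma> e t\<^sub>0" "\<sigma> e s\<^sub>0"] in01[OF t0] in01[OF s0] show ?case by linarith
      qed
    qed simp
    then show "\<bar>u (x\<^sub>0, t\<^sub>0) - u (x\<^sub>0, s\<^sub>0)\<bar> \<le> (\<bar>M\<bar> + 1) * C * \<bar>t\<^sub>0 - s\<^sub>0\<bar> powr (1/2)"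
      by (simp add: powr_half_sqrt)
  qed
qed
end
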